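(* Let $\bar g$ be a $D$-dimensional metric solving the Einstein equations $G_{\mu\nu}+\Lambda g_{\mu\nu}=0$ which in coordinates $(t,\rho,\psi,\theta^{A})$, $A=3,\dots,D-1$, has the near-horizon form, as $\rho\to0$, $$(\bar g_{\mu\nu})=\begin{pmatrix}-\kappa^{2}\rho^{2}+\mathcal O(\rho^{4})&\mathcal O(\rho^{4})&f_{t\psi}\rho^{2}+\mathcal O(\rho^{4})&f_{tA}\rho^{2}+\mathcal O(\rho^{4})\\ \mathcal O(\rho^{4})&1+\mathcal O(\rho^{2})&\mathcal O(\rho^{4})&\mathcal O(\rho^{3})\\ f_{t\psi}\rho^{2}+\mathcal O(\rho^{4})&\mathcal O(\rho^{4})&f_{\psi\psi}+\mathcal O(\rho^{2})&\mathcal O(\rho^{2})\\ f_{tA}\rho^{2}+\mathcal O(\rho^{4})&\mathcal O(\rho^{3})&\mathcal O(\rho^{2})&\Omega_{AB}+\mathcal O(\rho^{2})\end{pmatrix},$$ where $\kappa\neq0$ is a constant and $f_{t\psi},f_{tA},f_{\psi\psi},\Omega_{AB}$ depend only on the $\theta^{A}$. Write $x^{M}=(\psi,\theta^{A})$, $M=2,\dots,D-1$, and let $D_M$ be the covariant derivative of the metric $f_{\psi\psi}\,d\psi^{2}+\Omega_{AB}\,d\theta^{A}d\theta^{B}$ induced on the horizon cross-section $\partial\Sigma=\{t=\mathrm{const},\rho=0\}$. Let $\mathcal A$ be the set of vector fields $V$ of the form $$V^{t}=F(x)+tG(x)+\mathcal O(\rho^{2}),\qquad V^{\rho}=\rho\,\big(H(x)+tJ(x)\big)+\mathcal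 O(\rho^{2}),\qquad V^{M}=K^{M}(x)+\mathcal O(\rho^{2}),$$ with $F,G,H,J$ arbitrary functions and $K^{M}$ an arbitrary vector field of the variables $x^{M}$ subject to $D_MK^{M}=0$. Then: (a) $\mathcal A$ is closed under commutators. (b) For all $\xi,\eta\in\mathcal A$, as $\rho\to0$, $$\omega^{t}(\bar g,\pounds_\eta\bar g,\pounds_\xi\bar g)=\mathcal O(1),\qquad\omega^{\rho}(\bar g,\pounds_\eta\bar g,\pounds_\xi\bar g)=\mathcal O(\rho),\qquad\omega^{M}(\bar g,\pounds_\eta\bar g,\pounds_\xi\bar g)=\mathcal O(1).$$ (c) The charges associated with $\mathcal A$ are integrable: for every $g=\phi^{*}\bar g$ with $\phi$ a diffeomorphism generated by $\mathcal A$ and all $\xi,\eta,\chi\in\mathcal A$, $$\int_{\partial\Sigma}(\mathrm d^{D-2}x)_{\mu\nu}\,\xi^{[\mu}\omega^{\nu]}(g,\pounds_\eta g,\pounds_\chi g)=0 .$$ (d) The algebra of charges is non-trivial: there exist $\xi,\eta\in\mathcal A$ with $$\int_{\partial\Sigma}(\mathrm d^{D-2}x)_{\mu\nu}\,S^{\mu\nu}(\bar g,\pounds_\eta\bar g,\pounds_\xi\bar g)\neq0 .$$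
   Context: Conventions. $\pounds_\xi$ is the Lie derivative; all functions are smooth. $\mathcal O(\rho^{k})$ denotes a function equal to $\rho^{k}$ times a function smooth up to $\rho=0$ (possibly depending on all coordinates). Square brackets on indices denote antisymmetrization with weight one ($A^{[\mu}B^{\nu]}=\frac12(A^\mu B^\nu-A^\nu B^\mu)$). The measure is $(\mathrm d^{D-2}x)_{\mu\nu}=\frac{1}{2!(D-2)!}\epsilon_{\mu\nu\mu_3\dots\mu_D}\mathrm dx^{\mu_3}\wedge\dots\wedge\mathrm dx^{\mu_D}$, with $\epsilon$ the Levi-Civita symbol. An integral over $\partial\Sigma$ means: pull back the integrand to the surfaces $\{t,\rho=\mathrm{const}\}$, take the limit $\rho\to0$ of the resulting density, and integrate over $x^{M}$. The matrix $(f_{\psi\psi})\oplus(\Omega_{AB})$ is positive definite. A diffeomorphism generated by $\mathcal A$ is a finite composition of time-one flow maps of elements of $\mathcal A$ (for which these flows exist). Pre-symplectic potential: $\Theta^{\mu}(g,\delta g)=\frac{\sqrt{-g}}{16\pi G}\left(g^{\mu\alpha}\nabla^{\beta}\delta g_{\alpha\beta}-g^{\alpha\beta}\nabla^{\mu}\delta g_{\alpha\beta}\right)$. Pre-symplectic current: $\omega^{\mu}(g,\delta_1g,\delta_2g)=\delta_1\Theta^{\mu}(g,\delta_2g)-\delta_2\Theta^{\mu}(g,\delta_1g)$, with $\delta_1g,\delta_2g$ treated as fixed tensor fields under the variations. Finally, with indices moved by $g$, $$S^{\mu\nu}(g,\delta g,\pounds_\xi g)=\frac{\sqrt{-g}}{8\pi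 G}\Big(-\tfrac12\delta g^{\alpha}{}_{\alpha}\nabla^{[\mu}\xi^{\nu]}+\delta g^{\alpha[\mu}\nabla_{\alpha}\xi^{\nu]}-\nabla^{[\mu}\delta g^{\nu]\alpha}\xi_{\alpha}+\xi^{[\mu}\nabla_{\alpha}\delta g^{\nu]\alpha}-\xi^{[\mu}\nabla^{\nu]}\delta g^{\alpha}{}_{\alpha}\Big);$$ its integral over $\partial\Sigma$ is the variation $\delta H[\xi]$ of the charge generating $g\mapsto g+\pounds_\xi g$, and with $\delta g=\pounds_\eta g$ it is the Poisson bracket $\{H[\xi],H[\eta]\}$ at $g$. *)

theory Defs
  imports "HOL-Analysis.Analysis"
begin

section \<open>Coordinates\<close>

text \<open>
  The index type \<open>'m\<close> numbers the coordinates \<open>x\<^sup>M = (\<psi>, \<theta>\<^sup>A)\<close> of the horizon cross-section, so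
  \<open>D = CARD('m) + 2\<close>. One element of \<open>'m\<close> is singled out in \<open>near_horizon_form\<close> as the \<open>\<psi>\<close> direction;
  the others are the \<open>\<theta>\<^sup>A\<close>.
\<close>

datatype 'm coord = Time | Radial | Cross 'm

instance coord :: (finite) finite
proof
  have "UNIV \<subseteq> {Time, Radial} \<union> range (Cross :: 'a \<Rightarrow> 'a coord)"
    by (auto intro: coord.exhaust)
  then show "finite (UNIV :: 'a coord set)"
    by (rule finite_subset) simp
qed

definition cross :: "real ^ ('m::finite) coord \<Rightarrow> real ^ 'm" where
  "cross p = (\<chi> i. p $ Cross i)"

definition point :: "real \<Rightarrow> real \<Rightarrow> real ^ 'm \<Rightarrow> real ^ ('m::finite) coord" where
  "point t \<rho> x = (\<chi> a. case a of Time \<Rightarrow> t | Radial \<Rightarrow> \<rho> | Cross i \<Rightarrow> x $ i)"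

text \<open>
  \<open>U\<close> is the range of the coordinates \<open>x\<^sup>M\<close> on the cross-section. A collar is a neighbourhood of
  the horizon \<open>{\<rho> = 0}\<close> in \<open>{\<rho> \<ge> 0}\<close>, of possibly non-uniform width. It contains the points
  \<open>\<rho> = 0\<close>, where functions are required to be smooth but the metric is degenerate.
\<close>

definition collar :: "(real ^ 'm) set \<Rightarrow> (real ^ ('m::finite) coord) set \<Rightarrow> bool" where
  "collar U N \<longleftrightarrow>
     (\<exists>W. open W \<and> N = W \<inter> {p. 0 \<le> p $ Radial \<and> cross p \<in> U}) \<and>
     {p. p $ Radial = 0 \<and> cross p \<in> U} \<subseteq> N"


section \<open>Smoothness\<close>

text \<open>\<open>Ck_on k S f\<close> is meant for open \<open>S\<close> only.\<close>

primrec Ck_on :: "nat \<Rightarrow> 'a::euclidean_space set \<Rightarrow> ('a \<Rightarrow> 'b::real_normed_vector) \<Rightarrow> bool" where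
  "Ck_on 0 S f \<longleftrightarrow> continuous_on S f"
| "Ck_on (Suc k) S f \<longleftrightarrow>
     (\<forall>x\<in>S. f differentiable (at x)) \<and>
     (\<forall>v. Ck_on k S (\<lambda>x. frechet_derivative f (at x) v))"

text \<open>On an arbitrary set, smooth means: locally the restriction of a smooth function on an open set.\<close>

definition smooth_on :: "'a::euclidean_space set \<Rightarrow> ('a \<Rightarrow> 'b::real_normed_vector) \<Rightarrow> bool" where
  "smooth_on S f \<longleftrightarrow>
     (\<forall>x\<in>S. \<exists>T F. open T \<and> x \<in> T \<and> (\<forall>k. Ck_on k T F) \<and> (\<forall>y\<in>S \<inter> T. F y = f y))"

text \<open>
  \<open>f = \<O>(\<rho>\<^sup>k)\<close>. The equation is imposed for \<open>\<rho> > 0\<close> only, because quantities built from the inverse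
  metric have no meaning at \<open>\<rho> = 0\<close>; the cofactor \<open>h\<close> is smooth up to \<open>\<rho> = 0\<close>.
\<close>

definition rho_order ::
  "(real ^ ('m::finite) coord) set \<Rightarrow> nat \<Rightarrow> (real ^ 'm coord \<Rightarrow> real) \<Rightarrow> bool" where
  "rho_order N k f \<longleftrightarrow>
     (\<exists>h. smooth_on N h \<and> (\<forall>p\<in>N. 0 < p $ Radial \<longrightarrow> f p = (p $ Radial) ^ k * h p))"


section \<open>Tensor calculus in coordinates\<close>

text \<open>
  In this section \<open>S\<close> is the domain of the fields. Derivatives are taken within \<open>S\<close>, so that they are
  one-sided at the boundary \<open>\<rho> = 0\<close> of a collar and ordinary at interior points. Metrics and
  symmetric tensors \<open>h\<^sub>a\<^sub>b\<close> are given by their covariant components \<open>h p $ a $ b\<close>, vector fields by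
  their contravariant components.
\<close>

definition pd :: "(real ^ 'n) set \<Rightarrow> 'n \<Rightarrow> (real ^ ('n::finite) \<Rightarrow> real) \<Rightarrow> real ^ 'n \<Rightarrow> real" where
  "pd S i f p = frechet_derivative f (at p within S) (axis i 1)"

abbreviation ginv :: "(real ^ 'n \<Rightarrow> real ^ 'n ^ 'n) \<Rightarrow> real ^ ('n::finite) \<Rightarrow> real ^ 'n ^ 'n" where
  "ginv g p \<equiv> matrix_inv (g p)"

text \<open>\<open>christoffel S g a b c\<close> is \<open>\<Gamma>\<^sup>a\<^sub>b\<^sub>c\<close>.\<close>

definition christoffel ::
  "(real ^ 'n) set \<Rightarrow> (real ^ 'n \<Rightarrow> real ^ 'n ^ 'n) \<Rightarrow> 'n \<Rightarrow> 'n \<Rightarrow> 'n \<Rightarrow> real ^ ('n::finite) \<Rightarrow> real" where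
  "christoffel S g a b c p =
     (1 / 2) * (\<Sum>e\<in>UNIV. ginv g p $ a $ e *
        (pd S b (\<lambda>q. g q $ e $ c) p + pd S c (\<lambda>q. g q $ e $ b) p - pd S e (\<lambda>q. g q $ b $ c) p))"

definition ricci ::
  "(real ^ 'n) set \<Rightarrow> (real ^ 'n \<Rightarrow> real ^ 'n ^ 'n) \<Rightarrow> real ^ ('n::finite) \<Rightarrow> real ^ 'n ^ 'n" where
  "ricci S g p = (\<chi> a b.
     (\<Sum>c\<in>UNIV. pd S c (christoffel S g c a b) p) - (\<Sum>c\<in>UNIV. pd S b (christoffel S g c a c) p)
     + (\<Sum>c\<in>UNIV. \<Sum>d\<in>UNIV. christoffel S g c c d p * christoffel S g d a b p
                         - christoffel S g c b d p * christoffel S g d a c p))"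

definition trace_with ::
  "(real ^ 'n \<Rightarrow> real ^ 'n ^ 'n) \<Rightarrow> (real ^ 'n \<Rightarrow> real ^ 'n ^ 'n) \<Rightarrow> real ^ ('n::finite) \<Rightarrow> real" where
  "trace_with g h p = (\<Sum>a\<in>UNIV. \<Sum>b\<in>UNIV. ginv g p $ a $ b * h p $ a $ b)"

definition einstein_tensor ::
  "(real ^ 'n) set \<Rightarrow> (real ^ 'n \<Rightarrow> real ^ 'n ^ 'n) \<Rightarrow> real ^ ('n::finite) \<Rightarrow> real ^ 'n ^ 'n" where
  "einstein_tensor S g p = ricci S g p - (1 / 2 * trace_with g (ricci S g) p) *\<^sub>R g p"

text \<open>\<open>nabla_vec S g a V b\<close> is \<open>\<nabla>\<^sub>a V\<^sup>b\<close>.\<close>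

definition nabla_vec ::
  "(real ^ 'n) set \<Rightarrow> (real ^ 'n \<Rightarrow> real ^ 'n ^ 'n) \<Rightarrow> 'n \<Rightarrow> (real ^ 'n \<Rightarrow> real ^ 'n) \<Rightarrow> 'n
     \<Rightarrow> real ^ ('n::finite) \<Rightarrow> real" where
  "nabla_vec S g a V b p =
     pd S a (\<lambda>q. V q $ b) p + (\<Sum>c\<in>UNIV. christoffel S g b a c p * V p $ c)"

text \<open>\<open>nabla_cov S g c h a b\<close> is \<open>\<nabla>\<^sub>c h\<^sub>a\<^sub>b\<close>, and \<open>nabla_con S g c h a b\<close> is \<open>\<nabla>\<^sub>c h\<^sup>a\<^sup>b\<close>.\<close>

definition nabla_cov ::
  "(real ^ 'n) set \<Rightarrow> (real ^ 'n \<Rightarrow> real ^ 'n ^ 'n) \<Rightarrow> 'n \<Rightarrow> (real ^ 'n \<Rightarrow> real ^ 'n ^ 'n) \<Rightarrow> 'n \<Rightarrow> 'n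
     \<Rightarrow> real ^ ('n::finite) \<Rightarrow> real" where
  "nabla_cov S g c h a b p =
     pd S c (\<lambda>q. h q $ a $ b) p
     - (\<Sum>d\<in>UNIV. christoffel S g d c a p * h p $ d $ b + christoffel S g d c b p * h p $ a $ d)"

definition nabla_con ::
  "(real ^ 'n) set \<Rightarrow> (real ^ 'n \<Rightarrow> real ^ 'n ^ 'n) \<Rightarrow> 'n \<Rightarrow> (real ^ 'n \<Rightarrow> real ^ 'n ^ 'n) \<Rightarrow> 'n \<Rightarrow> 'n
     \<Rightarrow> real ^ ('n::finite) \<Rightarrow> real" where
  "nabla_con S g c h a b p =
     (\<Sum>d\<in>UNIV. \<Sum>e\<in>UNIV. ginv g p $ a $ d * ginv g p $ b $ e * nabla_cov S g c h d e p)"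

definition lie_derivative ::
  "(real ^ 'n) set \<Rightarrow> (real ^ 'n \<Rightarrow> real ^ 'n) \<Rightarrow> (real ^ 'n \<Rightarrow> real ^ 'n ^ 'n)
     \<Rightarrow> real ^ ('n::finite) \<Rightarrow> real ^ 'n ^ 'n" where
  "lie_derivative S V g p = (\<chi> a b. \<Sum>c\<in>UNIV.
     V p $ c * pd S c (\<lambda>q. g q $ a $ b) p
     + g p $ c $ b * pd S a (\<lambda>q. V q $ c) p + g p $ a $ c * pd S b (\<lambda>q. V q $ c) p)"

definition commutator ::
  "(real ^ 'n) set \<Rightarrow> (real ^ 'n \<Rightarrow> real ^ 'n) \<Rightarrow> (real ^ 'n \<Rightarrow> real ^ 'n)
     \<Rightarrow> real ^ ('n::finite) \<Rightarrow> real ^ 'n" where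
  "commutator S V W p = (\<chi> a. \<Sum>b\<in>UNIV.
     V p $ b * pd S b (\<lambda>q. W q $ a) p - W p $ b * pd S b (\<lambda>q. V q $ a) p)"

definition pullback ::
  "(real ^ 'n) set \<Rightarrow> (real ^ 'n \<Rightarrow> real ^ 'n) \<Rightarrow> (real ^ 'n \<Rightarrow> real ^ 'n ^ 'n)
     \<Rightarrow> real ^ ('n::finite) \<Rightarrow> real ^ 'n ^ 'n" where
  "pullback S \<phi> g p = (\<chi> a b. \<Sum>c\<in>UNIV. \<Sum>d\<in>UNIV.
     pd S a (\<lambda>q. \<phi> q $ c) p * pd S b (\<lambda>q. \<phi> q $ d) p * g (\<phi> p) $ c $ d)"

definition antisym_part :: "real ^ 'n ^ 'n \<Rightarrow> real ^ ('n::finite) ^ 'n" where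
  "antisym_part B = (\<chi> a b. (B $ a $ b - B $ b $ a) / 2)"


section \<open>Covariant phase space of general relativity\<close>

text \<open>\<open>Gn\<close> is Newton's constant. The variations \<open>h\<close>, \<open>h\<^sub>1\<close>, \<open>h\<^sub>2\<close> stand for \<open>\<delta>g\<^sub>a\<^sub>b\<close> (lower indices).\<close>

definition Theta ::
  "real \<Rightarrow> (real ^ 'n) set \<Rightarrow> (real ^ 'n \<Rightarrow> real ^ 'n ^ 'n) \<Rightarrow> (real ^ 'n \<Rightarrow> real ^ 'n ^ 'n)
     \<Rightarrow> real ^ ('n::finite) \<Rightarrow> real ^ 'n" where
  "Theta Gn S g h p = (\<chi> m. sqrt (- det (g p)) / (16 * pi * Gn) *
     ((\<Sum>a\<in>UNIV. \<Sum>b\<in>UNIV. \<Sum>c\<in>UNIV. ginv g p $ m $ a * ginv g p $ b $ c * nabla_cov S g c h a b p)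
      - (\<Sum>a\<in>UNIV. \<Sum>b\<in>UNIV. \<Sum>c\<in>UNIV. ginv g p $ a $ b * ginv g p $ m $ c * nabla_cov S g c h a b p)))"

definition omega ::
  "real \<Rightarrow> (real ^ 'n) set \<Rightarrow> (real ^ 'n \<Rightarrow> real ^ 'n ^ 'n) \<Rightarrow> (real ^ 'n \<Rightarrow> real ^ 'n ^ 'n)
     \<Rightarrow> (real ^ 'n \<Rightarrow> real ^ 'n ^ 'n) \<Rightarrow> real ^ ('n::finite) \<Rightarrow> real ^ 'n" where
  "omega Gn S g h1 h2 p =
     vector_derivative (\<lambda>\<epsilon>. Theta Gn S (\<lambda>q. g q + \<epsilon> *\<^sub>R h1 q) h2 p) (at 0)
     - vector_derivative (\<lambda>\<epsilon>. Theta Gn S (\<lambda>q. g q + \<epsilon> *\<^sub>R h2 q) h1 p) (at 0)"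

text \<open>
  \<open>charge_density Gn S g h \<xi>\<close> is \<open>S\<^sup>\<mu>\<^sup>\<nu>(g, \<delta>g, \<pounds>\<^sub>\<xi> g)\<close> with \<open>\<delta>g = h\<close>. The five summands are, before
  antisymmetrization, in this order, those of the defining formula.
\<close>

definition charge_density ::
  "real \<Rightarrow> (real ^ 'n) set \<Rightarrow> (real ^ 'n \<Rightarrow> real ^ 'n ^ 'n) \<Rightarrow> (real ^ 'n \<Rightarrow> real ^ 'n ^ 'n)
     \<Rightarrow> (real ^ 'n \<Rightarrow> real ^ 'n) \<Rightarrow> real ^ ('n::finite) \<Rightarrow> real ^ 'n ^ 'n" where
  "charge_density Gn S g h \<xi> p = (sqrt (- det (g p)) / (8 * pi * Gn)) *\<^sub>R antisym_part (\<chi> m n.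
     - (1 / 2) * trace_with g h p * (\<Sum>c\<in>UNIV. ginv g p $ m $ c * nabla_vec S g c \<xi> n p)
     + (\<Sum>a\<in>UNIV. (\<Sum>c\<in>UNIV. \<Sum>d\<in>UNIV. ginv g p $ a $ c * ginv g p $ m $ d * h p $ c $ d)
                 * nabla_vec S g a \<xi> n p)
     - (\<Sum>a\<in>UNIV. (\<Sum>c\<in>UNIV. ginv g p $ m $ c * nabla_con S g c h n a p)
                 * (\<Sum>b\<in>UNIV. g p $ a $ b * \<xi> p $ b))
     + \<xi> p $ m * (\<Sum>a\<in>UNIV. nabla_con S g a h n a p)
     - \<xi> p $ m * (\<Sum>c\<in>UNIV. ginv g p $ n $ c * pd S c (trace_with g h) p))"

text \<open>
  \<open>\<integral>\<^sub>\<partial>\<^sub>\<Sigma> (d\<^sup>D\<^sup>-\<^sup>2x)\<^sub>\<mu>\<^sub>\<nu> B\<^sup>\<mu>\<^sup>\<nu> = I\<close> on the slice of time \<open>t\<close>. Pulled back to \<open>t, \<rho> = const\<close>, the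
  only surviving components of the measure are \<open>(d\<^sup>D\<^sup>-\<^sup>2x)\<^sub>t\<^sub>\<rho> = - (d\<^sup>D\<^sup>-\<^sup>2x)\<^sub>\<rho>\<^sub>t = (1/2) d\<psi> \<and> d\<theta>\<^sup>3 \<and> \<dots>\<close>:
  the sum over the \<open>(D-2)!\<close> permutations cancels the factorial. Existence of the limit and convergence
  of the integral are part of the claim.
\<close>

definition has_boundary_integral ::
  "(real ^ 'm) set \<Rightarrow> real \<Rightarrow> (real ^ ('m::finite) coord \<Rightarrow> real ^ 'm coord ^ 'm coord) \<Rightarrow> real \<Rightarrow> bool" where
  "has_boundary_integral U t B I \<longleftrightarrow> (\<exists>L.
     (\<forall>x\<in>U. ((\<lambda>\<rho>. (1 / 2) * (B (point t \<rho> x) $ Time $ Radial - B (point t \<rho> x) $ Radial $ Time))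
                \<longlongrightarrow> L x) (at_right 0)) \<and>
     L absolutely_integrable_on U \<and> integral U L = I)"


section \<open>The near-horizon metric\<close>

text \<open>Lorentzian signature \<open>(-, +, \<dots>, +)\<close>; in particular the matrix is symmetric and invertible.\<close>

definition lorentzian :: "real ^ ('m::finite) coord ^ 'm coord \<Rightarrow> bool" where
  "lorentzian A \<longleftrightarrow> (\<exists>P :: real ^ 'm coord ^ 'm coord. invertible P \<and>
     transpose P ** A ** P = (\<chi> a b. if a = b then (if a = Time then -1 else 1) else 0))"

definition positive_definite :: "real ^ 'm ^ ('m::finite) \<Rightarrow> bool" where
  "positive_definite A \<longleftrightarrow> transpose A = A \<and> (\<forall>v. v \<noteq> 0 \<longrightarrow> 0 < v \<bullet> (A *v v))"

text \<open>
  \<open>f\<^sub>\<psi>\<^sub>\<psi> d\<psi>\<^sup>2 + \<Omega>\<^sub>A\<^sub>B d\<theta>\<^sup>A d\<theta>\<^sup>B\<close>. Only the entries of \<open>\<Omega>\<close> with both indices different from \<open>\<psi>\<close> are used.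
\<close>

definition cross_metric ::
  "'m \<Rightarrow> (real ^ 'm \<Rightarrow> real) \<Rightarrow> (real ^ 'm \<Rightarrow> real ^ 'm ^ 'm) \<Rightarrow> real ^ ('m::finite) \<Rightarrow> real ^ 'm ^ 'm" where
  "cross_metric \<psi> fpp \<Omega> x = (\<chi> i j.
     if i = \<psi> \<and> j = \<psi> then fpp x else if i = \<psi> \<or> j = \<psi> then 0 else \<Omega> x $ i $ j)"

definition theta_only :: "'m \<Rightarrow> (real ^ 'm) set \<Rightarrow> (real ^ ('m::finite) \<Rightarrow> real) \<Rightarrow> bool" where
  "theta_only \<psi> U f \<longleftrightarrow> (\<forall>x\<in>U. \<forall>y\<in>U. (\<forall>i. i \<noteq> \<psi> \<longrightarrow> x $ i = y $ i) \<longrightarrow> f x = f y)"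

text \<open>\<open>ft x $ \<psi>\<close> is \<open>f\<^sub>t\<^sub>\<psi>\<close>, and \<open>ft x $ A\<close> is \<open>f\<^sub>t\<^sub>A\<close> for \<open>A \<noteq> \<psi>\<close>.\<close>

definition near_horizon_form ::
  "'m \<Rightarrow> (real ^ 'm) set \<Rightarrow> (real ^ 'm coord) set \<Rightarrow> real \<Rightarrow> (real ^ 'm \<Rightarrow> real ^ 'm)
     \<Rightarrow> (real ^ 'm \<Rightarrow> real) \<Rightarrow> (real ^ 'm \<Rightarrow> real ^ 'm ^ 'm)
     \<Rightarrow> (real ^ 'm coord \<Rightarrow> real ^ ('m::finite) coord ^ 'm coord) \<Rightarrow> bool" where
  "near_horizon_form \<psi> U N \<kappa> ft fpp \<Omega> g \<longleftrightarrow>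
     (\<forall>i. smooth_on U (\<lambda>x. ft x $ i) \<and> theta_only \<psi> U (\<lambda>x. ft x $ i)) \<and>
     smooth_on U fpp \<and> theta_only \<psi> U fpp \<and>
     (\<forall>A B. A \<noteq> \<psi> \<longrightarrow> B \<noteq> \<psi> \<longrightarrow>
        smooth_on U (\<lambda>x. \<Omega> x $ A $ B) \<and> theta_only \<psi> U (\<lambda>x. \<Omega> x $ A $ B)) \<and>
     (\<forall>x\<in>U. positive_definite (cross_metric \<psi> fpp \<Omega> x)) \<and>
     rho_order N 4 (\<lambda>p. g p $ Time $ Time - (- \<kappa>\<^sup>2 * (p $ Radial)\<^sup>2)) \<and>
     rho_order N 4 (\<lambda>p. g p $ Time $ Radial) \<and>
     (\<forall>i. rho_order N 4 (\<lambda>p. g p $ Time $ Cross i - ft (cross p) $ i * (p $ Radial)\<^sup>2)) \<and>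
     rho_order N 2 (\<lambda>p. g p $ Radial $ Radial - 1) \<and>
     rho_order N 4 (\<lambda>p. g p $ Radial $ Cross \<psi>) \<and>
     (\<forall>A. A \<noteq> \<psi> \<longrightarrow> rho_order N 3 (\<lambda>p. g p $ Radial $ Cross A)) \<and>
     rho_order N 2 (\<lambda>p. g p $ Cross \<psi> $ Cross \<psi> - fpp (cross p)) \<and>
     (\<forall>A. A \<noteq> \<psi> \<longrightarrow> rho_order N 2 (\<lambda>p. g p $ Cross \<psi> $ Cross A)) \<and>
     (\<forall>A B. A \<noteq> \<psi> \<longrightarrow> B \<noteq> \<psi> \<longrightarrow>
        rho_order N 2 (\<lambda>p. g p $ Cross A $ Cross B - \<Omega> (cross p) $ A $ B))"


section \<open>The symmetry algebra and the diffeomorphisms it generates\<close>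

text \<open>
  \<open>\<gamma>\<close> is the metric on the cross-section. Smoothness of \<open>V\<close> on \<open>N\<close> fixes its values at \<open>\<rho> = 0\<close>,
  about which \<open>rho_order\<close> says nothing.
\<close>

definition near_horizon_fields ::
  "(real ^ 'm) set \<Rightarrow> (real ^ 'm coord) set \<Rightarrow> (real ^ 'm \<Rightarrow> real ^ 'm ^ 'm)
     \<Rightarrow> (real ^ 'm coord \<Rightarrow> real ^ ('m::finite) coord) set" where
  "near_horizon_fields U N \<gamma> = {V. smooth_on N V \<and> (\<exists>F G H J K.
     smooth_on U F \<and> smooth_on U G \<and> smooth_on U H \<and> smooth_on U J \<and> smooth_on U K \<and>
     (\<forall>x\<in>U. (\<Sum>i\<in>UNIV. nabla_vec U \<gamma> i K i x) = 0) \<and>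
     rho_order N 2 (\<lambda>p. V p $ Time - (F (cross p) + p $ Time * G (cross p))) \<and>
     rho_order N 2 (\<lambda>p. V p $ Radial - p $ Radial * (H (cross p) + p $ Time * J (cross p))) \<and>
     (\<forall>i. rho_order N 2 (\<lambda>p. V p $ Cross i - K (cross p) $ i)))}"

text \<open>
  \<open>\<phi>\<close> is the time-one map of the flow \<open>\<Phi>\<close> of \<open>V\<close>, as a diffeomorphism of collars \<open>W\<close> and \<open>W'\<close>: a
  vector field given near the horizon has only a local flow. Smoothness of \<open>\<Phi>\<close> and of the inverse, and
  injectivity, are automatic for integral curves of a smooth field and restrict nothing.
\<close>

definition time_one_flow ::
  "(real ^ 'm) set \<Rightarrow> (real ^ 'm coord) set \<Rightarrow> (real ^ 'm coord \<Rightarrow> real ^ 'm coord)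
     \<Rightarrow> (real ^ 'm coord) set \<Rightarrow> (real ^ 'm coord) set
     \<Rightarrow> (real ^ 'm coord \<Rightarrow> real ^ ('m::finite) coord) \<Rightarrow> bool" where
  "time_one_flow U N V W W' \<phi> \<longleftrightarrow>
     collar U W \<and> collar U W' \<and> W \<subseteq> N \<and> W' \<subseteq> N \<and>
     bij_betw \<phi> W W' \<and> smooth_on W' (inv_into W \<phi>) \<and>
     (\<exists>\<Phi>. smooth_on ({0..1} \<times> W) (\<lambda>(s, p). \<Phi> s p) \<and>
       (\<forall>p\<in>W. \<Phi> 0 p = p \<and> \<Phi> 1 p = \<phi> p \<and>
         (\<forall>s\<in>{0..1}. \<Phi> s p \<in> N \<and>
            ((\<lambda>r. \<Phi> r p) has_vector_derivative V (\<Phi> s p)) (at s within {0..1}))))"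

inductive generated ::
  "(real ^ 'm) set \<Rightarrow> (real ^ 'm coord) set \<Rightarrow> (real ^ 'm coord \<Rightarrow> real ^ 'm coord) set
     \<Rightarrow> (real ^ 'm coord) set \<Rightarrow> (real ^ 'm coord) set
     \<Rightarrow> (real ^ 'm coord \<Rightarrow> real ^ ('m::finite) coord) \<Rightarrow> bool"
  for U N \<A> where
  "collar U W \<Longrightarrow> W \<subseteq> N \<Longrightarrow> generated U N \<A> W W id"
| "V \<in> \<A> \<Longrightarrow> time_one_flow U N V W W' \<phi> \<Longrightarrow> generated U N \<A> W' W'' \<phi>'
     \<Longrightarrow> generated U N \<A> W W'' (\<phi>' \<circ> \<phi>)"

end

theory Submission
  imports Defs
begin

text \<open>
  In the frame \<open>\<rho>\<^sup>-\<^sup>1 \<partial>\<^sub>t, \<partial>\<^sub>\<rho>, \<partial>\<^sub>M\<close> the metric is smooth and nondegenerate up to \<open>\<rho> = 0\<close>, by Hadamard's lemma,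
  and so are its Lie derivatives along elements of the algebra; the components of \<open>\<omega>\<close> in this frame are
  therefore smooth as well, which gives (b).

  On the horizon the \<open>t, \<rho>\<close> block decouples: the cross part of a variation is traceless because \<open>K\<close> is
  divergence free, so \<open>\<omega>\<^sup>t\<close> and \<open>\<omega>\<^sup>\<rho>\<close> reduce to an expression in two dimensions. There the variation
  \<open>\<delta>\<^sub>1 \<Theta>(\<delta>\<^sub>2 g)\<close> has vanishing \<open>t\<close> component and a \<open>\<rho>\<close> component symmetric in the two variations, so its
  antisymmetrization vanishes in the limit. The flows preserve the class of metrics for which this
  argument works (the \<open>t, \<rho>\<close> block acquires a factor of the form \<open>exp (2 (e(x) + t c(x)))\<close>), whence (c).

  For (d) take \<open>\<xi> = t \<beta>(x) \<partial>\<^sub>t\<close> and \<open>\<eta> = t \<rho> \<partial>\<^sub>\<rho>\<close>, whose charge density is proportional to \<open>\<beta>\<close> times the volume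
  density of the cross-section; \<open>\<beta>\<close> is chosen such that the density is a multiple of \<open>\<Prod>\<^sub>i 1 / (1 + x\<^sub>i\<^sup>2)\<close>.
\<close>

section \<open>Smooth functions\<close>

text \<open>Smoothness in the rescaled frame alone bounds \<omega>^t by 1/\<rho> and \<omega>^\<rho>
  by a constant. The missing power of \<rho> in (b) comes from the vanishing of these frame
  components on the horizon, the same cancellation that gives (c). It is a fact about a planar
  model. The map \<rho> -> \<rho> exp (e + t c) turns d\<rho> into exp (e + t c) (d\<rho> + c \<rho>
  dt), so a pulled-back metric has normal part E ((d\<rho> + c \<rho> dt)^2 - q \<rho>^2 dt^2) with
  E = exp (2 (e + t c)). Lie derivatives along the algebra merely vary e, c and q, and the radial
  component of \<delta>_1 \<Theta>(\<delta>_2 g) is a symmetric bilinear form in these variations.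
  Two facts keep pullbacks in this class. The exponent stays affine in t, since flows act affinely
  on t and the radial rate is affine in t. And the trace of a variation is taken with the
  pulled-back cross metric while K is divergence free for the original one; Liouville's theorem
  gives both metrics the same determinant.\<close>

lemma Ck_on_cong:
  assumes "open S" "\<And>x. x \<in> S \<Longrightarrow> f x = g x" "Ck_on k S f"
  shows "Ck_on k S g"
  using assms(2,3)
proof (induction k arbitrary: f g)
  case 0
  then show ?case using continuous_on_cong by fastforce
next
  case (Suc k)
  have d: "(g has_derivative frechet_derivative f (at x)) (at x)" if "x \<in> S" for x
    using has_derivative_transform_within_open[OF _ \<open>open S\<close> that, of f _ UNIV g] Suc.prems that
    by (auto simp: frechet_derivative_works)
  then have "frechet_derivative g (at x) = frechet_derivative f (at x)" if "x \<in> S" for x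
    using frechet_derivative_at that by metis
  then show ?case
    using d Suc.prems(2) Suc.IH[of "\<lambda>x. frechet_derivative f (at x) v" "\<lambda>x. frechet_derivative g (at x) v" for v]
    by (auto simp: differentiable_def)
qed

lemma Ck_on_SucI:
  assumes "open S" "\<And>x. x \<in> S \<Longrightarrow> (f has_derivative f' x) (at x)" "\<And>v. Ck_on k S (\<lambda>x. f' x v)"
  shows "Ck_on (Suc k) S f"
proof -
  have "f' x = frechet_derivative f (at x)" if "x \<in> S" for x
    using assms(2)[OF that] frechet_derivative_at by blast
  then have "Ck_on k S (\<lambda>x. frechet_derivative f (at x) v)" for v
    using Ck_on_cong[OF \<open>open S\<close> _ assms(3)[of v]] by auto
  then show ?thesis using assms(2) by (auto simp: differentiable_def)
qed

lemma Ck_on_SucD: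
  assumes "Ck_on (Suc k) S f" "x \<in> S"
  shows "(f has_derivative frechet_derivative f (at x)) (at x)"
  using assms by (auto simp: frechet_derivative_works)

lemma Ck_on_decrease: "Ck_on (Suc k) S f \<Longrightarrow> Ck_on k S f"
proof (induction k arbitrary: f)
  case 0
  then show ?case
    by (auto intro!: continuous_at_imp_continuous_on differentiable_imp_continuous_within)
next
  case (Suc k)
  have "Ck_on k S (\<lambda>x. frechet_derivative f (at x) v)" for v
    using Suc.prems by (intro Suc.IH) simp
  then show ?case using Suc.prems by auto
qed

lemma Ck_on_subset: "Ck_on k S f \<Longrightarrow> T \<subseteq> S \<Longrightarrow> Ck_on k T f"
  by (induction k arbitrary: f) (auto intro: continuous_on_subset)

lemma Ck_on_const: "open S \<Longrightarrow> Ck_on k S (\<lambda>x. c)"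
proof (induction k arbitrary: c)
  case (Suc k)
  then show ?case by (intro Ck_on_SucI[where f'="\<lambda>x v. 0"]) auto
qed simp

lemma Ck_on_linear:
  assumes "open S" "bounded_linear f"
  shows "Ck_on k S f"
proof (cases k)
  case 0
  then show ?thesis using assms by (simp add: linear_continuous_on)
next
  case (Suc j)
  have "Ck_on (Suc j) S f"
    by (rule Ck_on_SucI[where f'="\<lambda>x. f"])
      (use assms in \<open>auto intro: bounded_linear_imp_has_derivative Ck_on_const\<close>)
  then show ?thesis using Suc by simp
qed

lemma Ck_on_add:
  assumes "open S" "Ck_on k S f" "Ck_on k S g"
  shows "Ck_on k S (\<lambda>x. f x + g x)"
  using assms(2,3)
proof (induction k arbitrary: f g)
  case 0
  then show ?case by (auto intro: continuous_intros)
next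
  case (Suc k)
  show ?case
  proof (rule Ck_on_SucI[OF \<open>open S\<close>])
    show "((\<lambda>x. f x + g x) has_derivative
      (\<lambda>v. frechet_derivative f (at x) v + frechet_derivative g (at x) v)) (at x)" if "x \<in> S" for x
      using Suc.prems that by (intro has_derivative_add Ck_on_SucD)
    show "Ck_on k S (\<lambda>x. frechet_derivative f (at x) v + frechet_derivative g (at x) v)" for v
      using Suc.prems by (intro Suc.IH) auto
  qed
qed

lemma Ck_on_bilinear:
  assumes "open S" "bounded_bilinear B" "Ck_on k S f" "Ck_on k S g"
  shows "Ck_on k S (\<lambda>x. B (f x) (g x))"
  using assms(3,4)
proof (induction k arbitrary: f g)
  case 0
  then show ?case using bounded_bilinear.continuous_on[OF assms(2)] by auto
next
  case (Suc k)
  show ?case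
  proof (rule Ck_on_SucI[OF \<open>open S\<close>])
    show "((\<lambda>x. B (f x) (g x)) has_derivative
      (\<lambda>v. B (f x) (frechet_derivative g (at x) v) + B (frechet_derivative f (at x) v) (g x))) (at x)"
      if "x \<in> S" for x
      using Suc.prems that by (intro bounded_bilinear.FDERIV[OF assms(2)] Ck_on_SucD)
    show "Ck_on k S (\<lambda>x. B (f x) (frechet_derivative g (at x) v) + B (frechet_derivative f (at x) v) (g x))" for v
      using Suc.prems Suc.prems[THEN Ck_on_decrease]
      by (intro Ck_on_add Suc.IH) (auto simp: \<open>open S\<close>)
  qed
qed

lemma Ck_on_sum:
  assumes "open S" "\<And>i. i \<in> I \<Longrightarrow> Ck_on k S (f i)"
  shows "Ck_on k S (\<lambda>x. \<Sum>i\<in>I. f i x)"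
  using assms(2)
  by (induction I rule: infinite_finite_induct) (auto intro!: Ck_on_const Ck_on_add simp: assms(1))

text \<open>The derivative of the composite is a derivative of g in a direction that varies with x,
  which the inductive hypothesis does not cover. Expanding this direction in \<open>Basis\<close>
  leaves derivatives of g in fixed directions, multiplied by coefficients of class k.\<close>

lemma Ck_on_compose:
  assumes "open S" "open T" "f ` S \<subseteq> T" "Ck_on k S f" "Ck_on k T g"
  shows "Ck_on k S (\<lambda>x. g (f x))"
  using assms(4,5)
proof (induction k arbitrary: g)
  case 0
  then show ?case using continuous_on_compose2 assms(3) by auto
next
  case (Suc k)
  show ?case
  proof (rule Ck_on_SucI[OF \<open>open S\<close>])
    fix x assume x: "x \<in> S"
    have g: "(g has_derivative frechet_derivative g (at (f x))) (at (f x))"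
      using Suc.prems assms(3) x by (intro Ck_on_SucD) auto
    have d: "((\<lambda>x. g (f x)) has_derivative
        (\<lambda>v. frechet_derivative g (at (f x)) (frechet_derivative f (at x) v))) (at x)"
      using has_derivative_compose[OF Ck_on_SucD[OF Suc.prems(1) x] g] by simp
    have eq: "frechet_derivative g (at (f x)) w
        = (\<Sum>b\<in>Basis. (w \<bullet> b) *\<^sub>R frechet_derivative g (at (f x)) b)" for w
    proof -
      have l: "linear (frechet_derivative g (at (f x)))" using g by (rule has_derivative_linear)
      have "frechet_derivative g (at (f x)) w = frechet_derivative g (at (f x)) (\<Sum>b\<in>Basis. (w \<bullet> b) *\<^sub>R b)"
        by (simp add: euclidean_representation)
      also have "\<dots> = (\<Sum>b\<in>Basis. (w \<bullet> b) *\<^sub>R frechet_derivative g (at (f x)) b)"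
        by (simp add: linear_sum[OF l] linear_scale[OF l])
      finally show ?thesis .
    qed
    show "((\<lambda>x. g (f x)) has_derivative
        (\<lambda>v. \<Sum>b\<in>Basis. (frechet_derivative f (at x) v \<bullet> b) *\<^sub>R frechet_derivative g (at (f x)) b)) (at x)"
      by (rule has_derivative_eq_rhs[OF d]) (rule ext, rule eq)
  next
    fix v
    show "Ck_on k S (\<lambda>x. \<Sum>b\<in>Basis. (frechet_derivative f (at x) v \<bullet> b) *\<^sub>R frechet_derivative g (at (f x)) b)"
    proof (intro Ck_on_sum \<open>open S\<close> Ck_on_bilinear[OF \<open>open S\<close> bounded_bilinear_scaleR])
      fix b :: 'b assume b: "b \<in> Basis"
      show "Ck_on k S (\<lambda>x. frechet_derivative f (at x) v \<bullet> b)"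
        using Suc.prems(1)
        by (intro Ck_on_bilinear[OF \<open>open S\<close> bounded_bilinear_inner]) (auto intro: Ck_on_const \<open>open S\<close>)
      show "Ck_on k S (\<lambda>x. frechet_derivative g (at (f x)) b)"
        using Suc.prems Ck_on_decrease[OF Suc.prems(1)] by (intro Suc.IH) auto
    qed
  qed
qed

lemma Ck_on_inverse: "Ck_on k {x::real. x \<noteq> 0} inverse"
proof (induction k)
  case 0
  show ?case by (auto intro!: continuous_intros)
next
  case (Suc k)
  have o: "open {x::real. x \<noteq> 0}" by (simp add: open_Collect_neq)
  show ?case
  proof (rule Ck_on_SucI[OF o])
    show "(inverse has_derivative (\<lambda>v. - (inverse x * v * inverse x))) (at x)" if "x \<in> {x::real. x \<noteq> 0}" for x
      using that by (auto intro!: derivative_eq_intros)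
    have "Ck_on k {x::real. x \<noteq> 0} (\<lambda>x. (-v) * (inverse x * inverse x))" for v
      by (intro Ck_on_bilinear[OF o bounded_bilinear_mult] Ck_on_const o Suc)
    then show "Ck_on k {x::real. x \<noteq> 0} (\<lambda>x. - (inverse x * v * inverse x))" for v
      by (simp add: mult_ac)
  qed
qed

lemma Ck_on_sqrt: "Ck_on k {x::real. 0 < x} sqrt"
proof (induction k)
  case 0
  show ?case by (auto intro!: continuous_intros)
next
  case (Suc k)
  have o: "open {x::real. 0 < x}" by (simp add: open_Collect_less)
  have o': "open {x::real. x \<noteq> 0}" by (simp add: open_Collect_neq)
  show ?case
  proof (rule Ck_on_SucI[OF o])
    show "(sqrt has_derivative (\<lambda>v. (v / 2) * inverse (sqrt x))) (at x)" if "x \<in> {x::real. 0 < x}" for x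
      using that by (auto intro!: derivative_eq_intros ext simp: field_simps)
    show "Ck_on k {x::real. 0 < x} (\<lambda>x. (v / 2) * inverse (sqrt x))" for v
      by (intro Ck_on_bilinear[OF o bounded_bilinear_mult] Ck_on_const o
          Ck_on_compose[OF o o' _ Suc Ck_on_inverse]) auto
  qed
qed

lemma Ck_on_ln: "Ck_on k {x::real. 0 < x} ln"
proof (cases k)
  case 0
  then show ?thesis by (auto intro!: continuous_intros)
next
  case (Suc j)
  have o: "open {x::real. 0 < x}" by (simp add: open_Collect_less)
  have "Ck_on (Suc j) {x::real. 0 < x} ln"
  proof (rule Ck_on_SucI[OF o])
    show "(ln has_derivative (\<lambda>v. v * inverse x)) (at x)" if "x \<in> {x::real. 0 < x}" for x
      using that by (auto intro!: derivative_eq_intros ext simp: field_simps)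
    show "Ck_on j {x::real. 0 < x} (\<lambda>x. v * inverse x)" for v
      by (intro Ck_on_bilinear[OF o bounded_bilinear_mult] Ck_on_const o
          Ck_on_subset[OF Ck_on_inverse]) auto
  qed
  then show ?thesis using Suc by simp
qed

section \<open>Calculus of functions that are smooth on an arbitrary set\<close>

lemma smooth_onE:
  assumes "smooth_on S f" "x \<in> S"
  obtains T F where "open T" "x \<in> T" "\<And>k. Ck_on k T F" "\<And>y. y \<in> S \<inter> T \<Longrightarrow> F y = f y"
  using assms unfolding smooth_on_def by meson

lemma smooth_on_cong: "(\<And>x. x \<in> S \<Longrightarrow> f x = g x) \<Longrightarrow> smooth_on S f \<Longrightarrow> smooth_on S g"
  unfolding smooth_on_def by (metis IntD1)

lemma smooth_on_subset: "smooth_on S f \<Longrightarrow> T \<subseteq> S \<Longrightarrow> smooth_on T f"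
  unfolding smooth_on_def[of T]
proof
  fix x assume S: "smooth_on S f" "T \<subseteq> S" and x: "x \<in> T"
  obtain A F where "open A" "x \<in> A" "\<And>k. Ck_on k A F" "\<And>y. y \<in> S \<inter> A \<Longrightarrow> F y = f y"
    using smooth_onE[OF S(1)] S(2) x by (metis subsetD)
  then show "\<exists>A F. open A \<and> x \<in> A \<and> (\<forall>k. Ck_on k A F) \<and> (\<forall>y\<in>T \<inter> A. F y = f y)"
    using S(2) by (intro exI[of _ A] exI[of _ F]) auto
qed

lemma smooth_on_local:
  assumes "\<And>x. x \<in> S \<Longrightarrow> \<exists>T. open T \<and> x \<in> T \<and> smooth_on (S \<inter> T) f"
  shows "smooth_on S f"
  unfolding smooth_on_def
proof
  fix x assume x: "x \<in> S"
  then obtain T where T: "open T" "x \<in> T" "smooth_on (S \<inter> T) f" using assms by blast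
  obtain T' F where T': "open T'" "x \<in> T'" "\<And>k. Ck_on k T' F" "\<And>y. y \<in> S \<inter> T \<inter> T' \<Longrightarrow> F y = f y"
    using smooth_onE[OF T(3)] x T(2) by blast
  show "\<exists>T F. open T \<and> x \<in> T \<and> (\<forall>k. Ck_on k T F) \<and> (\<forall>y\<in>S \<inter> T. F y = f y)"
    using T T' by (intro exI[of _ "T \<inter> T'"] exI[of _ F]) (auto intro: Ck_on_subset)
qed

lemma smooth_on_Ck: "(\<And>k. Ck_on k S f) \<Longrightarrow> open S \<Longrightarrow> smooth_on S f"
  unfolding smooth_on_def by blast

lemma smooth_on_const: "smooth_on S (\<lambda>x. c)"
  using smooth_on_subset[OF smooth_on_Ck[OF Ck_on_const[OF open_UNIV]]] by blast

lemma smooth_on_linear: "bounded_linear f \<Longrightarrow> smooth_on S f"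
  using smooth_on_subset[OF smooth_on_Ck[OF Ck_on_linear[OF open_UNIV]]] by blast

lemma smooth_on_component: "smooth_on S (\<lambda>x. x $ i)"
  by (rule smooth_on_linear) (rule bounded_linear_vec_nth)

lemma smooth_on_compose:
  assumes "smooth_on S f" "smooth_on T g" "\<And>x. x \<in> S \<Longrightarrow> f x \<in> T"
  shows "smooth_on S (\<lambda>x. g (f x))"
  unfolding smooth_on_def
proof
  fix x assume x: "x \<in> S"
  obtain A F where A: "open A" "x \<in> A" "\<And>k. Ck_on k A F" "\<And>y. y \<in> S \<inter> A \<Longrightarrow> F y = f y"
    using smooth_onE[OF assms(1) x] by blast
  obtain B G where B: "open B" "f x \<in> B" "\<And>k. Ck_on k B G" "\<And>y. y \<in> T \<inter> B \<Longrightarrow> G y = g y"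
    using smooth_onE[OF assms(2) assms(3)[OF x]] by blast
  define C where "C = A \<inter> F -` B"
  have "continuous_on A F" using A(3)[of 0] by simp
  then have C: "open C" unfolding C_def
    using A(1) B(1) continuous_on_open_vimage by (metis inf_commute)
  have "x \<in> C" using A B x C_def by auto
  moreover have "Ck_on k C (\<lambda>y. G (F y))" for k
    by (rule Ck_on_compose[OF C B(1) _ Ck_on_subset[OF A(3)] B(3)]) (auto simp: C_def)
  moreover have "\<forall>y\<in>S \<inter> C. G (F y) = g (f y)"
    using A(4) B(4) assms(3) C_def by fastforce
  ultimately show "\<exists>T F. open T \<and> x \<in> T \<and> (\<forall>k. Ck_on k T F) \<and> (\<forall>y\<in>S \<inter> T. F y = g (f y))"
    using C by (intro exI[of _ C] exI[of _ "\<lambda>y. G (F y)"]) auto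
qed

lemma smooth_on_compose_linear:
  "bounded_linear L \<Longrightarrow> smooth_on S (f :: _ \<Rightarrow> 'b::euclidean_space) \<Longrightarrow> smooth_on S (\<lambda>x. L (f x))"
  using smooth_on_compose[of S f UNIV L] smooth_on_linear by auto

lemma smooth_on_bilinear:
  assumes "bounded_bilinear B" "smooth_on S f" "smooth_on S g"
  shows "smooth_on S (\<lambda>x. B (f x) (g x))"
  unfolding smooth_on_def
proof
  fix x assume x: "x \<in> S"
  obtain A F where A: "open A" "x \<in> A" "\<And>k. Ck_on k A F" "\<And>y. y \<in> S \<inter> A \<Longrightarrow> F y = f y"
    using smooth_onE[OF assms(2) x] by blast
  obtain C G where C: "open C" "x \<in> C" "\<And>k. Ck_on k C G" "\<And>y. y \<in> S \<inter> C \<Longrightarrow> G y = g y"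
    using smooth_onE[OF assms(3) x] by blast
  show "\<exists>T F. open T \<and> x \<in> T \<and> (\<forall>k. Ck_on k T F) \<and> (\<forall>y\<in>S \<inter> T. F y = B (f y) (g y))"
    using A C
    by (intro exI[of _ "A \<inter> C"] exI[of _ "\<lambda>y. B (F y) (G y)"])
      (auto intro!: Ck_on_bilinear[OF _ assms(1)] intro: Ck_on_subset)
qed

lemmas smooth_on_mult = smooth_on_bilinear[OF bounded_bilinear_mult]
lemmas smooth_on_scaleR = smooth_on_bilinear[OF bounded_bilinear_scaleR]

lemma smooth_on_add:
  assumes "smooth_on S f" "smooth_on S g"
  shows "smooth_on S (\<lambda>x. f x + g x)"
  unfolding smooth_on_def
proof
  fix x assume x: "x \<in> S"
  obtain A F where A: "open A" "x \<in> A" "\<And>k. Ck_on k A F" "\<And>y. y \<in> S \<inter> A \<Longrightarrow> F y = f y"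
    using smooth_onE[OF assms(1) x] by blast
  obtain C G where C: "open C" "x \<in> C" "\<And>k. Ck_on k C G" "\<And>y. y \<in> S \<inter> C \<Longrightarrow> G y = g y"
    using smooth_onE[OF assms(2) x] by blast
  show "\<exists>T F. open T \<and> x \<in> T \<and> (\<forall>k. Ck_on k T F) \<and> (\<forall>y\<in>S \<inter> T. F y = f y + g y)"
    using A C
    by (intro exI[of _ "A \<inter> C"] exI[of _ "\<lambda>y. F y + G y"])
      (auto intro!: Ck_on_add intro: Ck_on_subset)
qed

lemma smooth_on_minus: "smooth_on S f \<Longrightarrow> smooth_on S (\<lambda>x. - f x)"
  using smooth_on_scaleR[OF smooth_on_const[of S "- 1"]] by simp

lemma smooth_on_diff: "smooth_on S f \<Longrightarrow> smooth_on S g \<Longrightarrow> smooth_on S (\<lambda>x. f x - g x)"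
  using smooth_on_add[OF _ smooth_on_minus] by fastforce

lemma smooth_on_sum: "(\<And>i. i \<in> I \<Longrightarrow> smooth_on S (f i)) \<Longrightarrow> smooth_on S (\<lambda>x. \<Sum>i\<in>I. f i x)"
  by (induction I rule: infinite_finite_induct) (auto intro!: smooth_on_const smooth_on_add)

lemma smooth_on_prod:
  fixes f :: "'i \<Rightarrow> _ \<Rightarrow> real"
  shows "(\<And>i. i \<in> I \<Longrightarrow> smooth_on S (f i)) \<Longrightarrow> smooth_on S (\<lambda>x. \<Prod>i\<in>I. f i x)"
  by (induction I rule: infinite_finite_induct) (auto intro!: smooth_on_const smooth_on_mult)

lemma smooth_on_power:
  fixes f :: "_ \<Rightarrow> real"
  shows "smooth_on S f \<Longrightarrow> smooth_on S (\<lambda>x. f x ^ n)"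
  by (induction n) (auto intro!: smooth_on_const smooth_on_mult)

lemma smooth_on_inverse:
  fixes f :: "_ \<Rightarrow> real"
  assumes "smooth_on S f" "\<And>x. x \<in> S \<Longrightarrow> f x \<noteq> 0"
  shows "smooth_on S (\<lambda>x. inverse (f x))"
  by (rule smooth_on_compose[OF assms(1), of "{x. x \<noteq> 0}"])
    (auto intro!: smooth_on_Ck Ck_on_inverse simp: assms(2) open_Collect_neq)

lemma smooth_on_divide:
  fixes f :: "_ \<Rightarrow> real"
  assumes "smooth_on S g" "smooth_on S f" "\<And>x. x \<in> S \<Longrightarrow> f x \<noteq> 0"
  shows "smooth_on S (\<lambda>x. g x / f x)"
  unfolding divide_inverse by (intro smooth_on_mult smooth_on_inverse assms)

lemma smooth_on_sqrt:
  assumes "smooth_on S f" "\<And>x. x \<in> S \<Longrightarrow> 0 < f x"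
  shows "smooth_on S (\<lambda>x. sqrt (f x))"
  by (rule smooth_on_compose[OF assms(1), of "{x. 0 < x}"])
    (auto intro!: smooth_on_Ck Ck_on_sqrt simp: assms(2) open_Collect_less)

lemma smooth_on_ln:
  fixes f :: "_ \<Rightarrow> real"
  assumes "smooth_on S f" "\<And>x. x \<in> S \<Longrightarrow> 0 < f x"
  shows "smooth_on S (\<lambda>x. ln (f x))"
  by (rule smooth_on_compose[OF assms(1), of "{x. 0 < x}"])
    (auto intro!: smooth_on_Ck Ck_on_ln simp: assms(2) open_Collect_less)

lemma smooth_on_vec_nth:
  "smooth_on S (f :: _ \<Rightarrow> ('b::euclidean_space) ^ 'n) \<Longrightarrow> smooth_on S (\<lambda>x. f x $ i)"
  by (rule smooth_on_compose_linear) (rule bounded_linear_vec_nth)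

lemma smooth_on_vec:
  fixes f :: "_ \<Rightarrow> ('b::euclidean_space) ^ ('n::finite)"
  assumes "\<And>i. smooth_on S (\<lambda>x. f x $ i)"
  shows "smooth_on S f"
proof -
  have bl: "bounded_linear (axis i :: 'b \<Rightarrow> 'b ^ 'n)" for i :: 'n
    unfolding linear_conv_bounded_linear[symmetric]
    by (rule linearI) (auto simp: axis_def vec_eq_iff)
  have "f = (\<lambda>x. \<Sum>i\<in>UNIV. axis i (f x $ i))"
    by (auto simp: axis_def vec_eq_iff fun_eq_iff if_distrib cong: if_cong)
  then show ?thesis
    using smooth_on_sum[of UNIV S "\<lambda>i x. axis i (f x $ i)"] smooth_on_compose_linear[OF bl assms]
    by metis
qed

subsection \<open>Derivatives within a set\<close>

text \<open>On a fat set the derivative within the set is unique, also at boundary points.\<close>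

definition fat :: "'a::euclidean_space set \<Rightarrow> bool" where
  "fat S \<longleftrightarrow> (\<forall>x\<in>S. \<forall>i\<in>Basis. \<forall>e>0. \<exists>d. 0 < \<bar>d\<bar> \<and> \<bar>d\<bar> < e \<and> x + d *\<^sub>R i \<in> S)"

lemma fat_frechet:
  assumes "fat S" "x \<in> S" "(f has_derivative D) (at x within S)"
  shows "frechet_derivative f (at x within S) = D"
proof (rule frechet_derivative_unique_within[OF _ assms(3)])
  show "(f has_derivative frechet_derivative f (at x within S)) (at x within S)"
    using assms(3) frechet_derivative_works differentiable_def by blast
qed (use assms(1,2) in \<open>auto simp: fat_def\<close>)

lemma open_fat: assumes "open S" shows "fat S"
  unfolding fat_def
proof (intro ballI allI impI)
  fix x i :: 'a and e :: real assume x: "x \<in> S" and i: "i \<in> Basis" and e: "0 < e"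
  obtain r where r: "r > 0" "ball x r \<subseteq> S" using assms x openE by blast
  have "x + (min e r / 2) *\<^sub>R i \<in> ball x r"
    using r e i by (auto simp: dist_norm)
  then show "\<exists>d. 0 < \<bar>d\<bar> \<and> \<bar>d\<bar> < e \<and> x + d *\<^sub>R i \<in> S"
    using r e by (intro exI[of _ "min e r / 2"]) auto
qed

lemma fat_Times:
  assumes "fat S" "fat T" shows "fat (S \<times> T)"
  unfolding fat_def
proof (intro ballI allI impI)
  fix x and i :: "'a \<times> 'b" and e :: real assume x: "x \<in> S \<times> T" and i: "i \<in> Basis" and e: "0 < e"
  consider u where "i = (u, 0)" "u \<in> Basis" | v where "i = (0, v)" "v \<in> Basis"
    using i by (auto simp: Basis_prod_def)
  then show "\<exists>d. 0 < \<bar>d\<bar> \<and> \<bar>d\<bar> < e \<and> x + d *\<^sub>R i \<in> S \<times> T"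
  proof cases
    case 1
    then obtain d where "0 < \<bar>d\<bar>" "\<bar>d\<bar> < e" "fst x + d *\<^sub>R u \<in> S"
      using assms(1) x e unfolding fat_def by (metis mem_Times_iff)
    then show ?thesis using 1 x by (intro exI[of _ d]) (auto simp: mem_Times_iff)
  next
    case 2
    then obtain d where "0 < \<bar>d\<bar>" "\<bar>d\<bar> < e" "snd x + d *\<^sub>R v \<in> T"
      using assms(2) x e unfolding fat_def by (metis mem_Times_iff)
    then show ?thesis using 2 x by (intro exI[of _ d]) (auto simp: mem_Times_iff)
  qed
qed

lemma fat_unit_interval: "fat {0..1::real}"
  unfolding fat_def
proof (intro ballI allI impI)
  fix x i e :: real assume x: "x \<in> {0..1}" and i: "i \<in> Basis" and e: "0 < e"
  show "\<exists>d. 0 < \<bar>d\<bar> \<and> \<bar>d\<bar> < e \<and> x + d *\<^sub>R i \<in> {0..1}"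
  proof (cases "x < 1/2")
    case True
    then show ?thesis using x i e by (intro exI[of _ "min e (1/2) / 2"]) auto
  next
    case False
    then show ?thesis using x i e by (intro exI[of _ "- (min e (1/2) / 2)"]) auto
  qed
qed

lemma has_derivative_extension:
  assumes "open T" "\<And>k. Ck_on k T F" "\<And>y. y \<in> S \<inter> T \<Longrightarrow> F y = f y" "x \<in> S \<inter> T"
  shows "(f has_derivative frechet_derivative F (at x)) (at x within S)"
proof -
  have "(F has_derivative frechet_derivative F (at x)) (at x within S)"
    using Ck_on_SucD[OF assms(2)[of "Suc 0"], of x] assms(4) by (auto intro: has_derivative_at_withinI)
  moreover obtain d where "d > 0" "ball x d \<subseteq> T" using assms(1,4) by (meson IntD2 openE)
  ultimately show ?thesis
    using assms(3,4) by (elim has_derivative_transform_within[of _ _ _ _ d]) (auto simp: dist_commute subset_iff)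
qed

lemma smooth_on_has_derivative:
  assumes "smooth_on S f" "x \<in> S"
  shows "(f has_derivative frechet_derivative f (at x within S)) (at x within S)"
proof -
  obtain A F where "open A" "x \<in> A" "\<And>k. Ck_on k A F" "\<And>y. y \<in> S \<inter> A \<Longrightarrow> F y = f y"
    using smooth_onE[OF assms] by blast
  from has_derivative_extension[OF this(1,3,4)] this(2) assms(2) show ?thesis
    by (auto simp: frechet_derivative_works[symmetric] differentiable_def)
qed

lemma smooth_on_continuous: "smooth_on S f \<Longrightarrow> continuous_on S f"
  using smooth_on_has_derivative has_derivative_continuous
  by (metis continuous_on_eq_continuous_within)

text \<open>Fatness makes the derivative within S unique, so on S it agrees with the derivative of
  any local smooth extension, and the latter is again of class \<open>Ck_on\<close> for every
  k.\<close>

lemma smooth_on_frechet: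
  assumes "fat S" "smooth_on S f"
  shows "smooth_on S (\<lambda>x. frechet_derivative f (at x within S) v)"
  unfolding smooth_on_def
proof
  fix x assume x: "x \<in> S"
  obtain A F where A: "open A" "x \<in> A" "\<And>k. Ck_on k A F" "\<And>y. y \<in> S \<inter> A \<Longrightarrow> F y = f y"
    using smooth_onE[OF assms(2) x] by blast
  have "\<forall>y\<in>S \<inter> A. frechet_derivative F (at y) v = frechet_derivative f (at y within S) v"
    using fat_frechet[OF assms(1) _ has_derivative_extension[OF A(1,3,4)]] by auto
  moreover have "Ck_on k A (\<lambda>y. frechet_derivative F (at y) v)" for k
    using A(3)[of "Suc k"] by simp
  ultimately show "\<exists>T F. open T \<and> x \<in> T \<and> (\<forall>k. Ck_on k T F) \<and>
      (\<forall>y\<in>S \<inter> T. F y = frechet_derivative f (at y within S) v)"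
    using A(1,2) by (intro exI[of _ A] exI[of _ "\<lambda>y. frechet_derivative F (at y) v"]) auto
qed

text \<open>The mean value theorem in direction u for the difference in direction v, then once more
  in direction v. The left-hand side is symmetric in u and v, which is what
  \<open>frechet_symmetric\<close> exploits; of the point y only its closeness to x matters.\<close>

lemma second_difference:
  fixes F :: "'a::euclidean_space \<Rightarrow> real"
  assumes F: "Ck_on (Suc (Suc 0)) (ball x r) F" and h: "h > 0" "h * (norm u + norm v) < r"
  shows "\<exists>y\<in>cball x (h * (norm u + norm v)).
    F (x + h *\<^sub>R u + h *\<^sub>R v) - F (x + h *\<^sub>R u) - F (x + h *\<^sub>R v) + F x
     = h\<^sup>2 * frechet_derivative (\<lambda>y. frechet_derivative F (at y) u) (at y) v"
proof -
  have n: "norm (a *\<^sub>R u + b *\<^sub>R v) \<le> h * (norm u + norm v)" if "0 \<le> a" "a \<le> h" "0 \<le> b" "b \<le> h" for a b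
    using norm_triangle_ineq[of "a *\<^sub>R u" "b *\<^sub>R v"] mult_right_mono[OF that(2), of "norm u"]
      mult_right_mono[OF that(4), of "norm v"] that by (auto simp: algebra_simps)
  have inb: "x + a *\<^sub>R u + b *\<^sub>R v \<in> ball x r" if "0 \<le> a" "a \<le> h" "0 \<le> b" "b \<le> h" for a b
  proof -
    have "dist x (x + a *\<^sub>R u + b *\<^sub>R v) = norm (a *\<^sub>R u + b *\<^sub>R v)"
      by (subst dist_commute) (simp add: dist_norm add.assoc)
    then show ?thesis using n[OF that] h by simp
  qed
  have D1: "((\<lambda>a. F (x + a *\<^sub>R u + b *\<^sub>R v)) has_real_derivative
      frechet_derivative F (at (x + a *\<^sub>R u + b *\<^sub>R v)) u) (at a)"
    if "0 \<le> a" "a \<le> h" "0 \<le> b" "b \<le> h" for a b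
  proof -
    note d = Ck_on_SucD[OF F inb[OF that]]
    have l: "linear (frechet_derivative F (at (x + a *\<^sub>R u + b *\<^sub>R v)))"
      using d by (rule has_derivative_linear)
    have "((\<lambda>a. x + a *\<^sub>R u + b *\<^sub>R v) has_derivative (\<lambda>t. t *\<^sub>R u)) (at a)"
      by (auto intro!: derivative_eq_intros)
    from has_derivative_compose[OF this d]
    have "((\<lambda>a. F (x + a *\<^sub>R u + b *\<^sub>R v)) has_derivative
      (\<lambda>t. frechet_derivative F (at (x + a *\<^sub>R u + b *\<^sub>R v)) (t *\<^sub>R u))) (at a)" .
    moreover have "(\<lambda>t. frechet_derivative F (at (x + a *\<^sub>R u + b *\<^sub>R v)) (t *\<^sub>R u)) = (*) (frechet_derivative F (at (x + a *\<^sub>R u + b *\<^sub>R v)) u)"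
      by (rule ext) (simp add: linear_scale[OF l])
    ultimately show ?thesis
      unfolding has_field_derivative_def by (simp only:)
  qed
  have F': "Ck_on (Suc 0) (ball x r) (\<lambda>y. frechet_derivative F (at y) u)" using F by simp
  have D2: "((\<lambda>b. frechet_derivative F (at (x + a *\<^sub>R u + b *\<^sub>R v)) u) has_real_derivative
      frechet_derivative (\<lambda>y. frechet_derivative F (at y) u) (at (x + a *\<^sub>R u + b *\<^sub>R v)) v) (at b)"
    if "0 \<le> a" "a \<le> h" "0 \<le> b" "b \<le> h" for a b
  proof -
    note d = Ck_on_SucD[OF F' inb[OF that]]
    have l: "linear (frechet_derivative (\<lambda>y. frechet_derivative F (at y) u) (at (x + a *\<^sub>R u + b *\<^sub>R v)))"
      using d by (rule has_derivative_linear)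
    have "((\<lambda>b. x + a *\<^sub>R u + b *\<^sub>R v) has_derivative (\<lambda>t. t *\<^sub>R v)) (at b)"
      by (auto intro!: derivative_eq_intros)
    from has_derivative_compose[OF this d]
    have "((\<lambda>b. frechet_derivative F (at (x + a *\<^sub>R u + b *\<^sub>R v)) u) has_derivative
      (\<lambda>t. frechet_derivative (\<lambda>y. frechet_derivative F (at y) u) (at (x + a *\<^sub>R u + b *\<^sub>R v)) (t *\<^sub>R v))) (at b)" .
    moreover have "(\<lambda>t. frechet_derivative (\<lambda>y. frechet_derivative F (at y) u) (at (x + a *\<^sub>R u + b *\<^sub>R v)) (t *\<^sub>R v)) = (*) (frechet_derivative (\<lambda>y. frechet_derivative F (at y) u) (at (x + a *\<^sub>R u + b *\<^sub>R v)) v)"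
      by (rule ext) (simp add: linear_scale[OF l])
    ultimately show ?thesis
      unfolding has_field_derivative_def by (simp only:)
  qed
  have "\<exists>z>0. z < h \<and>
      (F (x + h *\<^sub>R u + h *\<^sub>R v) - F (x + h *\<^sub>R u + 0 *\<^sub>R v)) - (F (x + 0 *\<^sub>R u + h *\<^sub>R v) - F (x + 0 *\<^sub>R u + 0 *\<^sub>R v))
      = (h - 0) * (frechet_derivative F (at (x + z *\<^sub>R u + h *\<^sub>R v)) u
                   - frechet_derivative F (at (x + z *\<^sub>R u + 0 *\<^sub>R v)) u)"
    by (rule MVT2[OF h(1)]) (use h in \<open>intro DERIV_diff D1; simp\<close>)
  then obtain z where z: "0 < z" "z < h" "F (x + h *\<^sub>R u + h *\<^sub>R v) - F (x + h *\<^sub>R u) - F (x + h *\<^sub>R v) + F x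
      = h * (frechet_derivative F (at (x + z *\<^sub>R u + h *\<^sub>R v)) u
                   - frechet_derivative F (at (x + z *\<^sub>R u + 0 *\<^sub>R v)) u)"
    by auto
  have "\<exists>w>0. w < h \<and> frechet_derivative F (at (x + z *\<^sub>R u + h *\<^sub>R v)) u
                   - frechet_derivative F (at (x + z *\<^sub>R u + 0 *\<^sub>R v)) u
      = (h - 0) * frechet_derivative (\<lambda>y. frechet_derivative F (at y) u) (at (x + z *\<^sub>R u + w *\<^sub>R v)) v"
    by (rule MVT2[OF h(1)]) (use z in \<open>intro D2; simp\<close>)
  then obtain w where w: "0 < w" "w < h" "frechet_derivative F (at (x + z *\<^sub>R u + h *\<^sub>R v)) u
                   - frechet_derivative F (at (x + z *\<^sub>R u + 0 *\<^sub>R v)) u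
      = h * frechet_derivative (\<lambda>y. frechet_derivative F (at y) u) (at (x + z *\<^sub>R u + w *\<^sub>R v)) v"
    by auto
  have "dist x (x + z *\<^sub>R u + w *\<^sub>R v) \<le> h * (norm u + norm v)"
    using n[of z w] z w by (subst dist_commute) (simp add: dist_norm add.assoc)
  then show ?thesis using z(3) w(3)
    by (intro bexI[of _ "x + z *\<^sub>R u + w *\<^sub>R v"]) (auto simp: power2_eq_square)
qed

lemma frechet_symmetric:
  fixes F :: "'a::euclidean_space \<Rightarrow> real"
  assumes T: "open T" "x \<in> T" and F: "Ck_on (Suc (Suc 0)) T F"
  shows "frechet_derivative (\<lambda>y. frechet_derivative F (at y) u) (at x) v
       = frechet_derivative (\<lambda>y. frechet_derivative F (at y) v) (at x) u"
    (is "?D u v x = ?D v u x")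
proof (rule ccontr)
  assume ne: "?D u v x \<noteq> ?D v u x"
  define e where "e = \<bar>?D u v x - ?D v u x\<bar> / 2"
  have e: "e > 0" using ne e_def by auto
  have "continuous (at x) (?D u v)" "continuous (at x) (?D v u)"
    using F T by (auto simp: continuous_on_eq_continuous_at)
  then obtain d1 d2 where d: "d1 > 0" "d2 > 0" "\<And>y. dist y x < d1 \<Longrightarrow> dist (?D u v y) (?D u v x) < e"
    "\<And>y. dist y x < d2 \<Longrightarrow> dist (?D v u y) (?D v u x) < e"
    unfolding continuous_at_eps_delta using e by (metis dist_commute)
  obtain r where r: "r > 0" "ball x r \<subseteq> T" using T openE by blast
  define s where "s = min r (min d1 d2)"
  have s: "s > 0" using r d by (auto simp: s_def)
  \<comment> \<open>The added 1 keeps c positive when u = v = 0, so that h is well defined.\<close>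
  define c where "c = norm u + norm v + 1"
  have c: "c > 0" by (simp add: c_def add_nonneg_pos)
  define h where "h = s / (2 * c)"
  have h: "h > 0" using s c by (auto simp: h_def)
  have "h * c = s / 2" unfolding h_def using c by (simp add: field_simps)
  then have hs: "h * (norm u + norm v) < s" using h s by (simp add: algebra_simps c_def)
  have F': "Ck_on (Suc (Suc 0)) (ball x r) F" using F r(2) Ck_on_subset by blast
  obtain y where y: "y \<in> cball x (h * (norm u + norm v))"
    "F (x + h *\<^sub>R u + h *\<^sub>R v) - F (x + h *\<^sub>R u) - F (x + h *\<^sub>R v) + F x = h\<^sup>2 * ?D u v y"
    using second_difference[OF F' h, of u v] hs s_def by auto
  obtain z where z: "z \<in> cball x (h * (norm v + norm u))"
    "F (x + h *\<^sub>R v + h *\<^sub>R u) - F (x + h *\<^sub>R v) - F (x + h *\<^sub>R u) + F x = h\<^sup>2 * ?D v u z"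
    using second_difference[OF F' h, of v u] hs s_def by (auto simp: add.commute)
  have "h\<^sup>2 * ?D u v y = h\<^sup>2 * ?D v u z" using y(2) z(2) by (simp add: algebra_simps)
  then have "?D u v y = ?D v u z" using h by simp
  moreover have "dist y x < d1" "dist z x < d2"
    using y(1) z(1) hs unfolding s_def by (auto simp: dist_commute add.commute)
  from d(3)[OF this(1)] d(4)[OF this(2)]
  have "dist (?D u v y) (?D u v x) < e" "dist (?D v u z) (?D v u x) < e" .
  ultimately show False unfolding e_def dist_real_def by (auto simp: abs_if field_simps split: if_splits)
qed

text \<open>Local extensions reduce boundary points to the open case. Boundary points are where it
  counts: exchanging \<partial>_t and \<partial>_\<rho> on the horizon evaluates quotients by
  \<rho>, and the variational equation of a flow exchanges flow time and space up to the ends of the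
  time interval.\<close>

lemma smooth_on_symmetric:
  fixes f :: "'a::euclidean_space \<Rightarrow> real"
  assumes "fat S" "smooth_on S f" "x \<in> S"
  shows "frechet_derivative (\<lambda>y. frechet_derivative f (at y within S) u) (at x within S) v
       = frechet_derivative (\<lambda>y. frechet_derivative f (at y within S) v) (at x within S) u"
proof -
  obtain A F where A: "open A" "x \<in> A" "\<And>k. Ck_on k A F" "\<And>y. y \<in> S \<inter> A \<Longrightarrow> F y = f y"
    using smooth_onE[OF assms(2,3)] by blast
  have 1: "frechet_derivative F (at y) w = frechet_derivative f (at y within S) w" if "y \<in> S \<inter> A" for y w
    using fat_frechet[OF assms(1) _ has_derivative_extension[OF A(1,3,4)]] that by auto
  have "Ck_on k A (\<lambda>y. frechet_derivative F (at y) w)" for k w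
    using A(3)[of "Suc k"] by simp
  from fat_frechet[OF assms(1,3) has_derivative_extension[OF A(1) this 1]]
  show ?thesis using A(1,2,3) assms(3) frechet_symmetric[OF A(1,2,3)] by auto
qed

subsection \<open>Partial derivatives\<close>

lemma vec_expansion: "v = (\<Sum>i\<in>UNIV. (v $ i) *\<^sub>R axis i (1::real))"
  by (simp add: vec_eq_iff axis_def if_distrib cong: if_cong)

lemma linear_expansion:
  assumes "linear (D :: real ^ 'n \<Rightarrow> 'b::real_vector)"
  shows "D v = (\<Sum>i\<in>UNIV. (v $ i) *\<^sub>R D (axis i 1))"
  by (subst vec_expansion) (simp only: linear_sum[OF assms] linear_scale[OF assms])

lemma pd_has_derivative:
  assumes "smooth_on S f" "x \<in> S"
  shows "(f has_derivative (\<lambda>v. \<Sum>i\<in>UNIV. v $ i * pd S i f x)) (at x within S)"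
proof -
  note d = smooth_on_has_derivative[OF assms]
  have l: "linear (frechet_derivative f (at x within S))" using d by (rule has_derivative_linear)
  show ?thesis
    by (rule has_derivative_eq_rhs[OF d], rule ext, subst linear_expansion[OF l]) (simp add: pd_def)
qed

lemma pdI:
  assumes "fat S" "x \<in> S" "(f has_derivative D) (at x within S)"
  shows "pd S i f x = D (axis i 1)"
  using fat_frechet[OF assms] by (simp add: pd_def)

lemma pd_smooth: "fat S \<Longrightarrow> smooth_on S f \<Longrightarrow> smooth_on S (pd S i f)"
  unfolding pd_def by (rule smooth_on_frechet)

lemma pd_cong_local:
  assumes "fat S" "open T" "x \<in> S \<inter> T" "smooth_on S f" "\<And>y. y \<in> S \<inter> T \<Longrightarrow> g y = f y"
  shows "pd S i g x = pd S i f x"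
proof -
  obtain d where d: "d > 0" "ball x d \<subseteq> T" using assms(2,3) by (meson IntD2 openE)
  have "(g has_derivative (\<lambda>v. \<Sum>i\<in>UNIV. v $ i * pd S i f x)) (at x within S)"
    using pd_has_derivative[OF assms(4), of x]
    by (rule has_derivative_transform_within[of _ _ _ _ d]) (use assms d in \<open>auto simp: dist_commute subset_iff\<close>)
  from pdI[OF assms(1) _ this] assms(3) show ?thesis
    by (simp add: axis_def if_distrib if_distribR cong: if_cong)
qed

lemma pd_cong: "fat S \<Longrightarrow> x \<in> S \<Longrightarrow> smooth_on S f \<Longrightarrow> (\<And>y. y \<in> S \<Longrightarrow> g y = f y) \<Longrightarrow> pd S i g x = pd S i f x"
  by (rule pd_cong_local[of S UNIV]) auto

lemma pd_const: "fat S \<Longrightarrow> x \<in> S \<Longrightarrow> pd S i (\<lambda>_. c) x = 0"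
  using pdI[OF _ _ has_derivative_const] by metis

lemma pd_coord: "fat S \<Longrightarrow> x \<in> S \<Longrightarrow> pd S i (\<lambda>q. q $ j) x = (if i = j then 1 else 0)"
  by (subst pdI[where D="\<lambda>v. v $ j"])
    (auto intro!: bounded_linear_imp_has_derivative bounded_linear_vec_nth simp: axis_def)

lemma pd_add:
  assumes "fat S" "x \<in> S" "smooth_on S f" "smooth_on S g"
  shows "pd S i (\<lambda>q. f q + g q) x = pd S i f x + pd S i g x"
  by (subst pdI[OF assms(1,2) has_derivative_add[OF assms(3,4)[THEN pd_has_derivative, OF assms(2)]]])
    (simp add: axis_def if_distrib if_distribR cong: if_cong)

lemma pd_diff:
  assumes "fat S" "x \<in> S" "smooth_on S f" "smooth_on S g"
  shows "pd S i (\<lambda>q. f q - g q) x = pd S i f x - pd S i g x"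
  by (subst pdI[OF assms(1,2) has_derivative_diff[OF assms(3,4)[THEN pd_has_derivative, OF assms(2)]]])
    (simp add: axis_def if_distrib if_distribR cong: if_cong)

lemma pd_mult:
  assumes "fat S" "x \<in> S" "smooth_on S f" "smooth_on S g"
  shows "pd S i (\<lambda>q. f q * g q) x = f x * pd S i g x + pd S i f x * g x"
  by (subst pdI[OF assms(1,2) has_derivative_mult[OF assms(3,4)[THEN pd_has_derivative, OF assms(2)]]])
    (simp add: axis_def if_distrib if_distribR cong: if_cong)

lemma pd_sum:
  assumes "fat S" "x \<in> S" "\<And>j. j \<in> J \<Longrightarrow> smooth_on S (f j)"
  shows "pd S i (\<lambda>q. \<Sum>j\<in>J. f j q) x = (\<Sum>j\<in>J. pd S i (f j) x)"
  using assms(3)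
  by (induction J rule: infinite_finite_induct)
    (auto simp: pd_const[OF assms(1,2)] pd_add[OF assms(1,2)] smooth_on_sum)

lemma pd_symmetric:
  assumes "fat S" "x \<in> S" "smooth_on S f"
  shows "pd S i (pd S j f) x = pd S j (pd S i f) x"
  unfolding pd_def by (rule smooth_on_symmetric[OF assms(1,3,2)])

lemma pd_chain_gen:
  fixes \<phi> :: "real ^ 'n \<Rightarrow> real ^ ('k::finite)"
  assumes "fat S" "x \<in> S" "smooth_on T f" "\<And>y. y \<in> S \<Longrightarrow> \<phi> y \<in> T" "smooth_on S \<phi>"
  shows "pd S i (\<lambda>q. f (\<phi> q)) x = (\<Sum>c\<in>UNIV. pd T c f (\<phi> x) * pd S i (\<lambda>q. \<phi> q $ c) x)"
proof -
  let ?D = "frechet_derivative \<phi> (at x within S)"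
  note d = smooth_on_has_derivative[OF assms(5,2)]
  have "((\<lambda>q. \<phi> q $ c) has_derivative (\<lambda>v. ?D v $ c)) (at x within S)" for c
    by (rule bounded_linear.has_derivative[OF bounded_linear_vec_nth d])
  from pdI[OF assms(1,2) this] have 1: "pd S i (\<lambda>q. \<phi> q $ c) x = ?D (axis i 1) $ c" for c .
  have "(f has_derivative (\<lambda>v. \<Sum>i\<in>UNIV. v $ i * pd T i f (\<phi> x))) (at (\<phi> x) within \<phi> ` S)"
    using pd_has_derivative[OF assms(3) assms(4)[OF assms(2)]] assms(4)
    by (elim has_derivative_subset) auto
  from has_derivative_in_compose[OF d this]
  have "((\<lambda>q. f (\<phi> q)) has_derivative (\<lambda>v. \<Sum>c\<in>UNIV. ?D v $ c * pd T c f (\<phi> x))) (at x within S)" .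
  from pdI[OF assms(1,2) this, of i] show ?thesis unfolding 1
    by (simp add: mult.commute)
qed

lemma pd_line:
  assumes "smooth_on S f" "x \<in> S" "open I" "0 \<in> I" "\<And>s. s \<in> I \<Longrightarrow> x + s *\<^sub>R axis i 1 \<in> S"
  shows "((\<lambda>s. f (x + s *\<^sub>R axis i 1)) has_real_derivative pd S i f x) (at 0)"
proof -
  have "((\<lambda>s. x + s *\<^sub>R axis i (1::real)) has_derivative (\<lambda>s. s *\<^sub>R axis i 1)) (at 0 within I)"
    by (auto intro!: derivative_eq_intros)
  moreover have "(f has_derivative (\<lambda>v. \<Sum>i\<in>UNIV. v $ i * pd S i f x))
     (at (x + 0 *\<^sub>R axis i 1) within (\<lambda>s. x + s *\<^sub>R axis i 1) ` I)"
    using pd_has_derivative[OF assms(1,2)] assms(5) by (auto elim!: has_derivative_subset)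
  ultimately have "((\<lambda>s. f (x + s *\<^sub>R axis i 1)) has_derivative
      (\<lambda>s. \<Sum>j\<in>UNIV. (s *\<^sub>R axis i 1) $ j * pd S j f x)) (at 0 within I)"
    by (rule has_derivative_in_compose)
  moreover have "(\<lambda>s. \<Sum>j\<in>UNIV. (s *\<^sub>R axis i 1) $ j * pd S j f x) = (*) (pd S i f x)"
    by (rule ext) (simp add: axis_def if_distrib if_distribR mult.commute cong: if_cong)
  ultimately have "((\<lambda>s. f (x + s *\<^sub>R axis i 1)) has_real_derivative pd S i f x) (at 0 within I)"
    by (simp only: has_field_derivative_def)
  then show ?thesis unfolding at_within_open[OF assms(4,3)] .
qed

section \<open>Collars\<close>

lemma sum_coord: "(\<Sum>c\<in>UNIV. f c) = f Time + f Radial + (\<Sum>i\<in>UNIV. f (Cross (i::'m::finite)))"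
proof -
  have "(UNIV :: 'm coord set) = insert Time (insert Radial (range Cross))"
    using coord.exhaust by blast
  then have "sum f UNIV = sum f (insert Time (insert Radial (range Cross)))" by simp
  also have "\<dots> = f Time + f Radial + sum f (range Cross)"
    by (subst sum.insert, auto)+ (simp add: add.assoc)
  also have "sum f (range Cross) = (\<Sum>i\<in>UNIV. f (Cross i))"
    by (subst sum.reindex) (auto simp: inj_on_def)
  finally show ?thesis .
qed

lemma all_coord: "(\<forall>c. P c) \<longleftrightarrow> P Time \<and> P Radial \<and> (\<forall>i. P (Cross i))"
  by (metis coord.exhaust)

lemma point_simps [simp]:
  "point t r x $ Time = t" "point t r x $ Radial = r" "point t r x $ Cross i = x $ i"
  "cross (point t r x) = x" "cross p $ i = p $ Cross i"
  by (auto simp: point_def cross_def)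

lemma point_eq: "point (p $ Time) (p $ Radial) (cross p) = p"
  by (simp add: vec_eq_iff all_coord)

lemma point_Time: "point t r x + s *\<^sub>R axis Time 1 = point (t + s) r x"
  by (simp add: vec_eq_iff all_coord axis_def)

lemma bounded_linear_cross: "bounded_linear cross"
  by (intro linear_conv_bounded_linear[THEN iffD1] linearI) (auto simp: vec_eq_iff)

lemma smooth_on_point: "smooth_on S (\<lambda>x. point t r x)"
proof (rule smooth_on_vec)
  fix c show "smooth_on S (\<lambda>x. point t r x $ c)"
    by (cases c) (auto intro!: smooth_on_const smooth_on_component)
qed

lemma smooth_on_cross:
  assumes "smooth_on U f" "\<And>p. p \<in> N \<Longrightarrow> cross p \<in> U"
  shows "smooth_on N (\<lambda>p. f (cross p))"
  by (rule smooth_on_compose[OF smooth_on_linear[OF bounded_linear_cross] assms])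

locale collar_domain =
  fixes U :: "(real ^ ('m::finite)) set" and N :: "(real ^ 'm coord) set"
  assumes open_U: "open U" and collar: "collar U N"
begin

lemma N_D: assumes "p \<in> N" shows "0 \<le> p $ Radial" "cross p \<in> U"
  using assms collar unfolding collar_def by auto

lemma boundary_in: "x \<in> U \<Longrightarrow> point t 0 x \<in> N"
  using collar subsetD[of "{p. p $ Radial = 0 \<and> cross p \<in> U}" N "point t 0 x"]
  unfolding collar_def by simp

lemma N_ball:
  assumes "p \<in> N"
  obtains e where "e > 0" "\<And>q. dist q p < e \<Longrightarrow> 0 \<le> q $ Radial \<Longrightarrow> q \<in> N"
proof -
  obtain W where W: "open W" "N = W \<inter> {p. 0 \<le> p $ Radial \<and> cross p \<in> U}"
    using collar unfolding collar_def by auto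
  have "open (cross -` U)"
    by (rule open_vimage[OF open_U linear_continuous_on[OF bounded_linear_cross]])
  then have "open (W \<inter> cross -` U)" using W by auto
  then obtain e where "e > 0" "\<And>q. dist q p < e \<Longrightarrow> q \<in> W \<inter> cross -` U"
    using assms W unfolding open_dist by blast
  then show ?thesis using W(2) by (intro that[of e]) auto
qed

text \<open>The chosen step is positive, so it never lowers \<rho> and stays in the collar even when
  it starts on the horizon.\<close>

lemma fat_N: "fat N"
  unfolding fat_def
proof (intro ballI allI impI)
  fix p i :: "real ^ 'm coord" and e :: real assume p: "p \<in> N" and i: "i \<in> Basis" and e: "0 < e"
  obtain a where a: "i = axis a 1" using i by (auto simp: Basis_vec_def)
  obtain r where r: "r > 0" "\<And>q. dist q p < r \<Longrightarrow> 0 \<le> q $ Radial \<Longrightarrow> q \<in> N"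
    using N_ball[OF p] by blast
  show "\<exists>d. 0 < \<bar>d\<bar> \<and> \<bar>d\<bar> < e \<and> p + d *\<^sub>R i \<in> N"
    using r e N_D(1)[OF p]
  proof (intro exI[of _ "min e r / 2"] conjI r(2))
    show "dist (p + (min e r / 2) *\<^sub>R i) p < r" using r e by (simp add: a dist_norm)
    show "0 \<le> (p + (min e r / 2) *\<^sub>R i) $ Radial" using r e N_D(1)[OF p] by (simp add: a axis_def)
  qed (use r e in auto)
qed

lemma interior_ball:
  assumes "p \<in> N" "0 < p $ Radial"
  obtains T where "open T" "p \<in> T" "T \<subseteq> N" "\<And>q. q \<in> T \<Longrightarrow> 0 < q $ Radial"
proof -
  obtain r where r: "r > 0" "\<And>q. dist q p < r \<Longrightarrow> 0 \<le> q $ Radial \<Longrightarrow> q \<in> N"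
    using N_ball[OF assms(1)] by blast
  have "open {q :: real ^ 'm coord. 0 < q $ Radial}"
    by (intro open_Collect_less continuous_intros)
  then show ?thesis
    using r assms by (intro that[of "ball p r \<inter> {q. 0 < q $ Radial}"]) (auto simp: dist_commute)
qed

lemma eventually_in:
  assumes "x \<in> U" shows "\<forall>\<^sub>F r in at_right 0. point t r x \<in> N \<and> 0 < r"
proof -
  obtain e where e: "e > 0" "\<And>q. dist q (point t 0 x) < e \<Longrightarrow> 0 \<le> q $ Radial \<Longrightarrow> q \<in> N"
    using N_ball[OF boundary_in[OF assms]] by blast
  have "point t r x - point t 0 x = r *\<^sub>R axis Radial 1" for r
    by (simp add: vec_eq_iff all_coord axis_def)
  then have "dist (point t r x) (point t 0 x) = \<bar>r\<bar>" for r by (simp add: dist_norm)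
  then show ?thesis unfolding eventually_at_right_field
    using e by (intro exI[of _ e]) auto
qed

lemma tendsto_boundary:
  assumes "smooth_on N f" "x \<in> U"
  shows "((\<lambda>r. f (point t r x)) \<longlongrightarrow> f (point t 0 x)) (at_right 0)"
proof -
  have "continuous_on N f" using assms(1) by (rule smooth_on_continuous)
  then have "(f \<longlongrightarrow> f (point t 0 x)) (at (point t 0 x) within N)"
    using boundary_in[OF assms(2)] by (simp add: continuous_on_def)
  moreover have "filterlim (\<lambda>r. point t r x) (at (point t 0 x) within N) (at_right 0)"
  proof (unfold filterlim_at, intro conjI)
    show "\<forall>\<^sub>F r in at_right 0. point t r x \<in> N \<and> point t r x \<noteq> point t 0 x"
      using eventually_in[OF assms(2), of t] by eventually_elim (metis less_irrefl point_simps(2))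
    show "((\<lambda>r. point t r x) \<longlongrightarrow> point t 0 x) (at_right 0)"
      by (rule vec_tendstoI) (auto simp: point_def split: coord.split)
  qed
  ultimately show ?thesis by (rule filterlim_compose)
qed

text \<open>Continuity carries identities known for \<rho> > 0 to the horizon, where
  \<open>rho_order\<close>, \<open>rescales\<close> and the Lorentzian signature say
  nothing.\<close>

lemma zero_boundary:
  assumes "smooth_on N f" "\<And>p. p \<in> N \<Longrightarrow> 0 < p $ Radial \<Longrightarrow> f p = 0" "p \<in> N"
  shows "f p = (0 :: real)"
proof (cases "p $ Radial = 0")
  case True
  have x: "cross p \<in> U" using N_D assms(3) by auto
  have "((\<lambda>r. f (point (p $ Time) r (cross p))) \<longlongrightarrow> f p) (at_right 0)"
    using tendsto_boundary[OF assms(1) x, of "p $ Time"] True point_eq[of p] by simp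
  moreover have "((\<lambda>r. f (point (p $ Time) r (cross p))) \<longlongrightarrow> 0) (at_right 0)"
    using eventually_in[OF x, of "p $ Time"]
    by (intro tendsto_eventually) (auto elim!: eventually_mono simp: assms(2))
  ultimately show ?thesis by (rule tendsto_unique[rotated]) simp
next
  case False
  then show ?thesis using assms N_D(1)[OF assms(3)] by auto
qed

text \<open>A collar contains every point with \<rho> = 0 over U, hence full t-lines and
  cross-sections of the horizon. Tangential derivatives there are therefore ordinary derivatives of
  the boundary values; this also underlies the next two lemmas.\<close>

lemma pd_Time_boundary:
  assumes "smooth_on N f" "x \<in> U"
  shows "((\<lambda>s. f (point s 0 x)) has_real_derivative pd N Time f (point t 0 x)) (at t)"
proof -
  have "((\<lambda>s. f (point t 0 x + s *\<^sub>R axis Time 1)) has_real_derivative pd N Time f (point t 0 x)) (at 0)"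
    by (rule pd_line[OF assms(1) boundary_in[OF assms(2)] open_UNIV])
      (auto simp: point_Time boundary_in assms(2))
  then show ?thesis
    using DERIV_shift[of "\<lambda>s. f (point s 0 x)" "pd N Time f (point t 0 x)" 0 t]
    by (simp add: point_Time add.commute)
qed

lemma pd_Cross_boundary:
  assumes "smooth_on N f" "x \<in> U"
  shows "pd N (Cross i) f (point t 0 x) = pd U i (\<lambda>y. f (point t 0 y)) x"
proof -
  note fU = open_fat[OF open_U]
  have "pd U i (\<lambda>y. f (point t 0 y)) x
    = (\<Sum>c\<in>UNIV. pd N c f (point t 0 x) * pd U i (\<lambda>y. point t 0 y $ c) x)"
    by (rule pd_chain_gen[OF fU assms(2,1) boundary_in smooth_on_point])
  then show ?thesis
    by (simp add: sum_coord pd_const[OF fU assms(2)] pd_coord[OF fU assms(2)]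
        if_distrib cong: if_cong)
qed

lemma pd_tangent_zero:
  assumes "smooth_on N f" "\<And>t x. x \<in> U \<Longrightarrow> f (point t 0 x) = 0" "a \<noteq> Radial" "x \<in> U"
  shows "pd N a f (point t 0 x) = 0"
proof (cases a)
  case Time
  have "((\<lambda>s. f (point s 0 x)) has_real_derivative 0) (at t)"
    using assms by simp
  then show ?thesis using pd_Time_boundary[OF assms(1,4)] Time DERIV_unique by blast
next
  case (Cross i)
  note fU = open_fat[OF open_U]
  have "pd U i (\<lambda>y. f (point t 0 y)) x = 0"
    by (subst pd_cong[OF fU assms(4) smooth_on_const[of _ 0]]) (auto simp: assms pd_const[OF fU])
  then show ?thesis using pd_Cross_boundary[OF assms(1,4)] Cross by simp
qed (use assms(3) in simp)

lemma pd_cong_interior: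
  assumes "smooth_on N f" "\<And>q. q \<in> N \<Longrightarrow> 0 < q $ Radial \<Longrightarrow> g q = f q" "p \<in> N" "0 < p $ Radial"
  shows "pd N i g p = pd N i f p"
proof -
  obtain T where "open T" "p \<in> T" "T \<subseteq> N" "\<And>q. q \<in> T \<Longrightarrow> 0 < q $ Radial"
    using interior_ball[OF assms(3,4)] by blast
  then show ?thesis using assms by (intro pd_cong_local[OF fat_N, of T]) auto
qed

end

subsection \<open>Division by the defining function of the horizon\<close>

text \<open>The homotopy \<rho> -> s \<rho> of Hadamard's lemma, written as a subtraction along the
  radial axis so that linearity in q and affine dependence on s are visible.\<close>

definition squeeze :: "real \<Rightarrow> real ^ ('m::finite) coord \<Rightarrow> real ^ 'm coord" where
  "squeeze s q = q - ((1 - s) * q $ Radial) *\<^sub>R axis Radial 1"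

lemma squeeze_simps: "squeeze 1 q = q" "squeeze s q $ Radial = s * q $ Radial"
  "c \<noteq> Radial \<Longrightarrow> squeeze s q $ c = q $ c"
  by (auto simp: squeeze_def axis_def algebra_simps)

lemma squeeze_ball:
  assumes "q \<in> ball p e" "p $ Radial = 0" "s \<in> {0..1}"
  shows "squeeze s q \<in> ball p e"
proof -
  have "norm (squeeze s q - p) \<le> norm (q - p)"
  proof (rule norm_le_componentwise_cart)
    fix c
    show "norm ((squeeze s q - p) $ c) \<le> norm ((q - p) $ c)"
      using assms(2,3) by (cases "c = Radial") (auto simp: squeeze_simps abs_mult mult_left_le_one_le)
  qed
  then show ?thesis using assms(1) by (simp add: dist_norm norm_minus_commute)
qed

lemma has_derivative_squeeze: "(squeeze s has_derivative squeeze s) (at q)"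
  unfolding squeeze_def[abs_def]
  by (auto intro!: derivative_eq_intros bounded_linear.has_derivative[OF bounded_linear_vec_nth])

lemma squeeze_continuous: "continuous_on (A \<times> S) (\<lambda>(q, s). squeeze s q)"
  unfolding squeeze_def split_def by (intro continuous_intros)

text \<open>The weight w is there for the induction: \<open>squeeze s v\<close> is v minus (1 - s)
  times its radial part, so differentiating under the integral produces integrals of the same kind
  with weights w and w (1 - s).\<close>

lemma Ck_on_squeeze_integral:
  fixes G :: "real ^ ('m::finite) coord \<Rightarrow> real"
  assumes p: "p $ Radial = 0" and "\<And>j. Ck_on j (ball p e) G" and w: "continuous_on {0..1} w"
  shows "Ck_on k (ball p e) (\<lambda>q. integral (cbox 0 1) (\<lambda>s. w s * G (squeeze s q)))"
  using assms(2,3)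
proof (induction k arbitrary: w G)
  have w2: "continuous_on (ball p e \<times> cbox 0 1) (\<lambda>(q, s). w s)" if "continuous_on {0..1} w" for w :: "real \<Rightarrow> real"
    unfolding split_def by (rule continuous_on_compose2[OF that]) (auto intro!: continuous_intros)
  have cont: "continuous_on (ball p e \<times> cbox 0 1) (\<lambda>(q, s). w s * G (squeeze s q))"
    if "continuous_on (ball p e) G" "continuous_on {0..1} w" for w and G :: "real ^ 'm coord \<Rightarrow> real"
  proof -
    have "continuous_on (ball p e \<times> cbox 0 1) (\<lambda>z. G ((\<lambda>(q, s). squeeze s q) z))"
      using squeeze_ball[OF _ p]
      by (intro continuous_on_compose2[OF that(1) squeeze_continuous]) (auto simp del: mem_ball)
    then show ?thesis using w2[OF that(2)] by (auto simp: split_def intro!: continuous_intros)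
  qed
  have o: "open (ball p e)" by simp
  {
    case 0
    have "continuous_on (ball p e) G" using 0(1)[of 0] by simp
    from integral_continuous_on_param[OF cont[OF this 0(2)]] show ?case by simp
  next
    case (Suc k)
    let ?D = "\<lambda>y. frechet_derivative G (at y)"
    have D: "(G has_derivative ?D y) (at y)" if "y \<in> ball p e" for y
      using Ck_on_SucD[OF Suc.prems(1)[of "Suc 0"] that] .
    have CD: "Ck_on j (ball p e) (\<lambda>y. ?D y v)" for j v using Suc.prems(1)[of "Suc j"] by simp
    have cD: "continuous_on (ball p e) (\<lambda>y. ?D y v)" for v using CD[of 0] by simp
    have lin: "linear (?D y)" if "y \<in> ball p e" for y using has_derivative_linear[OF D[OF that]] .
    \<comment> \<open>\<open>leibniz_rule\<close> takes the derivative of the integrand as a bounded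
      linear function that is jointly continuous in q and s.\<close>
    define L where "L q s = Blinfun (\<lambda>v. w s * ?D (squeeze s q) (squeeze s v))" for q s
    have bl: "bounded_linear (\<lambda>v. w s * ?D (squeeze s q) (squeeze s v))" if "q \<in> ball p e" "s \<in> cbox 0 1" for q s
      using bounded_linear_const_mult[OF bounded_linear_compose[OF has_derivative_bounded_linear[OF D[OF squeeze_ball[OF that(1) p]]]
         has_derivative_bounded_linear[OF has_derivative_squeeze]]] that by auto
    have L: "blinfun_apply (L q s) v = w s * ?D (squeeze s q) v
         - v $ Radial * (w s * (1 - s) * ?D (squeeze s q) (axis Radial 1))"
      if "q \<in> ball p e" "s \<in> cbox 0 1" for q s v
    proof -
      note l = lin[OF squeeze_ball[OF that(1) p, of s]]
      have "?D (squeeze s q) (squeeze s v)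
         = ?D (squeeze s q) v - ((1 - s) * v $ Radial) * ?D (squeeze s q) (axis Radial 1)"
        unfolding squeeze_def[of s v] using l that by (simp add: linear_diff linear_scale)
      then show ?thesis unfolding L_def bounded_linear_Blinfun_apply[OF bl[OF that]]
        by (simp only:) (simp add: right_diff_distrib mult_ac)
    qed
    have ccL: "continuous_on (ball p e \<times> cbox 0 1) (\<lambda>(q, s). L q s)"
    proof (rule continuous_on_blinfun_componentwise)
      fix v :: "real ^ 'm coord"
      have "continuous_on (ball p e \<times> cbox 0 1) (\<lambda>z. (\<lambda>(q, s). w s * ?D (squeeze s q) v) z
         - v $ Radial * (\<lambda>(q, s). (w s * (1 - s)) * ?D (squeeze s q) (axis Radial 1)) z)"
        by (intro continuous_intros cont cD Suc.prems(2))
      then show "continuous_on (ball p e \<times> cbox 0 1) (\<lambda>z. blinfun_apply ((\<lambda>(q, s). L q s) z) v)"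
        by (rule continuous_on_eq) (auto simp: L simp del: mem_ball)
    qed
    have cs: "continuous_on (cbox 0 1) (\<lambda>s. u s * H (squeeze s q))"
      if "continuous_on (ball p e) H" "continuous_on {0..1} u" "q \<in> ball p e"
      for u and H :: "real ^ 'm coord \<Rightarrow> real" and q
    proof -
      have "continuous_on (cbox 0 (1::real)) (Pair q)" by (intro continuous_intros)
      moreover have "Pair q ` cbox 0 (1::real) \<subseteq> ball p e \<times> cbox 0 1" using that(3) by auto
      ultimately show ?thesis using continuous_on_compose2[OF cont[OF that(1,2)]] by fastforce
    qed
    have G: "continuous_on (ball p e) G" using Suc.prems(1)[of 0] by simp
    have der: "((\<lambda>q. integral (cbox 0 1) (\<lambda>s. w s * G (squeeze s q))) has_derivative
        blinfun_apply (integral (cbox 0 1) (L q))) (at q)" if q: "q \<in> ball p e" for q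
    proof -
      have "((\<lambda>q. integral (cbox 0 1) (\<lambda>s. w s * G (squeeze s q))) has_derivative
        blinfun_apply (integral (cbox 0 1) (L q))) (at q within ball p e)"
      proof (rule leibniz_rule[OF _ _ ccL q convex_ball])
        fix q and s :: real assume a: "q \<in> ball p e" "s \<in> cbox 0 1"
        have "((\<lambda>q. w s * G (squeeze s q)) has_derivative
            (\<lambda>v. w s * ?D (squeeze s q) (squeeze s v))) (at q within ball p e)"
          using has_derivative_mult_right[OF has_derivative_compose[OF has_derivative_squeeze D[OF squeeze_ball[OF a(1) p]]]] a
          by (auto intro: has_derivative_at_withinI)
        then show "((\<lambda>q. w s * G (squeeze s q)) has_derivative blinfun_apply (L q s)) (at q within ball p e)"
          unfolding L_def bounded_linear_Blinfun_apply[OF bl[OF a]] .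
      next
        fix q assume "q \<in> ball p e"
        then show "(\<lambda>s. w s * G (squeeze s q)) integrable_on cbox 0 1"
          by (intro integrable_continuous cs G Suc.prems(2))
      qed
      then show ?thesis using q by (simp add: at_within_open[OF _ o] del: mem_ball)
    qed
    have eq: "blinfun_apply (integral (cbox 0 1) (L q)) v
       = integral (cbox 0 1) (\<lambda>s. w s * ?D (squeeze s q) v)
         - v $ Radial * integral (cbox 0 1) (\<lambda>s. w s * (1 - s) * ?D (squeeze s q) (axis Radial 1))"
      if q: "q \<in> ball p e" for q v
    proof -
      have "continuous_on (cbox 0 1) (L q)"
      proof -
        have "continuous_on (cbox 0 (1::real)) (Pair q)" by (intro continuous_intros)
        moreover have "Pair q ` cbox 0 (1::real) \<subseteq> ball p e \<times> cbox 0 1" using q by auto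
        ultimately show ?thesis using continuous_on_compose2[OF ccL] by fastforce
      qed
      then have "L q integrable_on cbox 0 1" by (rule integrable_continuous)
      then have "blinfun_apply (integral (cbox 0 1) (L q)) v = integral (cbox 0 1) (\<lambda>s. blinfun_apply (L q s) v)"
        by (rule blinfun_apply_integral)
      also have "\<dots> = integral (cbox 0 1) (\<lambda>s. w s * ?D (squeeze s q) v
         - v $ Radial * (w s * (1 - s) * ?D (squeeze s q) (axis Radial 1)))"
        by (intro integral_cong) (simp add: L[OF q])
      also have "\<dots> = integral (cbox 0 1) (\<lambda>s. w s * ?D (squeeze s q) v)
         - v $ Radial * integral (cbox 0 1) (\<lambda>s. w s * (1 - s) * ?D (squeeze s q) (axis Radial 1))"
      proof (subst integral_diff)
        show "(\<lambda>s. w s * ?D (squeeze s q) v) integrable_on cbox 0 1"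
          by (intro integrable_continuous cs cD Suc.prems(2) q)
        have "(\<lambda>s. (w s * (1 - s)) * ?D (squeeze s q) (axis Radial 1)) integrable_on cbox 0 1"
          by (intro integrable_continuous cs[OF cD _ q] continuous_intros Suc.prems(2))
        then show "(\<lambda>s. v $ Radial * (w s * (1 - s) * ?D (squeeze s q) (axis Radial 1))) integrable_on cbox 0 1"
          by (rule integrable_on_mult_right)
      qed simp
      finally show ?thesis .
    qed
    show ?case
    proof (rule Ck_on_SucI[OF o der])
      fix v
      have "Ck_on k (ball p e) (\<lambda>q. integral (cbox 0 1) (\<lambda>s. w s * ?D (squeeze s q) v)
         + (- (v $ Radial)) * integral (cbox 0 1) (\<lambda>s. (w s * (1 - s)) * ?D (squeeze s q) (axis Radial 1)))"
        by (intro Ck_on_add[OF o] Ck_on_bilinear[OF o bounded_bilinear_mult] Ck_on_const[OF o] Suc.IH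
            continuous_intros CD Suc.prems(2))
      then show "Ck_on k (ball p e) (\<lambda>q. blinfun_apply (integral (cbox 0 1) (L q)) v)"
        by (rule Ck_on_cong[OF o, rotated]) (subst eq, assumption, simp)
    qed
  }
qed

text \<open>At \<rho> = 0 the value is the limit of f / \<rho> for a function f that vanishes on the
  horizon, which makes the quotient smooth up to there.\<close>

definition rho_quot :: "(real ^ ('m::finite) coord) set \<Rightarrow> (real ^ 'm coord \<Rightarrow> real) \<Rightarrow> real ^ 'm coord \<Rightarrow> real" where
  "rho_quot N f p = (if p $ Radial = 0 then pd N Radial f p else f p / p $ Radial)"

context collar_domain
begin

lemma rho_quot_boundary: "rho_quot N f (point t 0 x) = pd N Radial f (point t 0 x)"
  by (simp add: rho_quot_def)

lemma rho_quot_mult: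
  assumes "\<And>t x. x \<in> U \<Longrightarrow> f (point t 0 x) = 0" "p \<in> N"
  shows "f p = p $ Radial * rho_quot N f p"
  using assms(1)[OF N_D(2)[OF assms(2)], of "p $ Time"] point_eq[of p] by (auto simp: rho_quot_def)

text \<open>Hadamard's lemma: \<open>f = \<rho> \<integral>\<^sub>0\<^sup>1 \<partial>\<^sub>\<rho> f(t, s \<rho>, x) ds\<close>.\<close>

lemma smooth_on_rho_quot:
  assumes f: "smooth_on N f" and f0: "\<And>t x. x \<in> U \<Longrightarrow> f (point t 0 x) = 0"
  shows "smooth_on N (rho_quot N f)"
proof (rule smooth_on_local)
  fix p assume p: "p \<in> N"
  show "\<exists>T. open T \<and> p \<in> T \<and> smooth_on (N \<inter> T) (rho_quot N f)"
  proof (cases "p $ Radial = 0")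
    case False
    then have "0 < p $ Radial" using N_D(1)[OF p] by simp
    then obtain T where T: "open T" "p \<in> T" "T \<subseteq> N" "\<And>q. q \<in> T \<Longrightarrow> 0 < q $ Radial"
      using interior_ball[OF p] by blast
    have "smooth_on (N \<inter> T) (\<lambda>q. f q / q $ Radial)"
      using T(4) by (intro smooth_on_divide smooth_on_component smooth_on_subset[OF f]) force+
    then have "smooth_on (N \<inter> T) (rho_quot N f)"
      using T(4) by (elim smooth_on_cong[rotated]) (force simp: rho_quot_def)
    then show ?thesis using T by blast
  next
    case True
    obtain A F where A: "open A" "p \<in> A" "\<And>k. Ck_on k A F" "\<And>y. y \<in> N \<inter> A \<Longrightarrow> F y = f y"
      using smooth_onE[OF f p] by blast
    obtain e1 where e1: "e1 > 0" "ball p e1 \<subseteq> A" using A openE by blast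
    obtain e2 where e2: "e2 > 0" "\<And>q. dist q p < e2 \<Longrightarrow> 0 \<le> q $ Radial \<Longrightarrow> q \<in> N"
      using N_ball[OF p] by blast
    define e where "e = min e1 e2"
    have e: "e > 0" "ball p e \<subseteq> A" "\<And>q. q \<in> ball p e \<Longrightarrow> 0 \<le> q $ Radial \<Longrightarrow> q \<in> N"
      using e1 e2 by (auto simp: e_def dist_commute)
    let ?D = "\<lambda>y. frechet_derivative F (at y)"
    \<comment> \<open>The integral uses the extension F on a full ball, so H is smooth across \<rho>
      = 0. The segment from a point of the ball to the horizon stays in the ball.\<close>
    define H where "H q = integral (cbox 0 1) (\<lambda>s. 1 * ?D (squeeze s q) (axis Radial 1))" for q
    have CD: "Ck_on j (ball p e) (\<lambda>y. ?D y (axis Radial 1))" for j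
      using Ck_on_subset[OF A(3)[of "Suc j"] e(2)] by simp
    have H: "smooth_on (N \<inter> ball p e) H"
      unfolding H_def using Ck_on_squeeze_integral[OF True CD, of "\<lambda>_. 1"]
      by (intro smooth_on_subset[OF smooth_on_Ck]) auto
    have "rho_quot N f q = H q" if q: "q \<in> N \<inter> ball p e" for q
    proof (cases "q $ Radial = 0")
      case True
      then have "squeeze s q = q" for s by (simp add: squeeze_def)
      moreover have "pd N Radial f q = ?D q (axis Radial 1)"
        using has_derivative_extension[OF A(1,3,4), where x=q] q e(2)
        by (intro pdI[OF fat_N]) (auto simp del: mem_ball)
      ultimately show ?thesis using True by (simp add: rho_quot_def H_def)
    next
      case False
      have d: "((\<lambda>s. F (squeeze s q)) has_vector_derivative q $ Radial * ?D (squeeze s q) (axis Radial 1))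
        (at s within {0..1})" if s: "s \<in> {0..1}" for s
      proof -
        have "squeeze s q \<in> A" using squeeze_ball[OF _ \<open>p $ Radial = 0\<close> s, of q e] q e(2) by blast
        from Ck_on_SucD[OF A(3)[of "Suc 0"] this]
        have D: "(F has_derivative ?D (squeeze s q)) (at (squeeze s q))" .
        have l: "linear (?D (squeeze s q))" using D by (rule has_derivative_linear)
        have "((\<lambda>s. squeeze s q) has_derivative (\<lambda>h. (h * q $ Radial) *\<^sub>R axis Radial 1)) (at s)"
          unfolding squeeze_def[abs_def] by (auto intro!: derivative_eq_intros ext simp: algebra_simps)
        from has_derivative_compose[OF this D]
        have "((\<lambda>s. F (squeeze s q)) has_derivative
           (\<lambda>h. ?D (squeeze s q) ((h * q $ Radial) *\<^sub>R axis Radial 1))) (at s within {0..1})"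
          by (rule has_derivative_at_withinI)
        then show ?thesis unfolding has_vector_derivative_def
          by (rule has_derivative_eq_rhs) (rule ext, simp add: linear_scale[OF l])
      qed
      have i: "((\<lambda>s. q $ Radial * ?D (squeeze s q) (axis Radial 1)) has_integral
          F (squeeze 1 q) - F (squeeze 0 q)) {0..1}"
        by (rule fundamental_theorem_of_calculus[OF _ d]) simp_all
      have b: "squeeze 0 q \<in> ball p e" by (rule squeeze_ball) (use q True \<open>p $ Radial = 0\<close> in auto)
      then have s0: "squeeze 0 q \<in> N" using e(3) by (simp add: squeeze_simps)
      have "f (squeeze 0 q) = 0"
        using f0[OF N_D(2)[OF s0], of "squeeze 0 q $ Time"] point_eq[of "squeeze 0 q"]
        by (simp add: squeeze_simps)
      then have "F (squeeze 1 q) - F (squeeze 0 q) = f q"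
        using A(4)[of "squeeze 0 q"] A(4)[of q] s0 subsetD[OF e(2) b] subsetD[OF e(2), of q] q
        by (auto simp: squeeze_simps)
      then have "((\<lambda>s. ?D (squeeze s q) (axis Radial 1)) has_integral f q / q $ Radial) {0..1}"
        using has_integral_mult_right[OF i, of "inverse (q $ Radial)"] False
        by (simp add: field_simps)
      then show ?thesis using False by (simp add: rho_quot_def H_def integral_unique)
    qed
    then have "smooth_on (N \<inter> ball p e) (rho_quot N f)"
      by (intro smooth_on_cong[OF _ H]) simp
    then show ?thesis using e(1) by (intro exI[of _ "ball p e"]) auto
  qed
qed

lemma pd_Radial_product_boundary:
  assumes "smooth_on N h" "x \<in> U"
  shows "pd N Radial (\<lambda>p. p $ Radial * h p) (point t 0 x) = h (point t 0 x)"
  using boundary_in[OF assms(2)]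
  by (simp add: pd_mult[OF fat_N _ smooth_on_component assms(1)] pd_coord[OF fat_N])

section \<open>Orders in \<rho> and radial 1-jets on the horizon\<close>

lemma rho_order_cong:
  "rho_order N k f \<Longrightarrow> (\<And>p. p \<in> N \<Longrightarrow> 0 < p $ Radial \<Longrightarrow> g p = f p) \<Longrightarrow> rho_order N k g"
  unfolding rho_order_def by metis

lemma rho_order_1I:
  assumes "smooth_on N f" "\<And>t x. x \<in> U \<Longrightarrow> f (point t 0 x) = 0"
  shows "rho_order N 1 f"
  unfolding rho_order_def
  by (intro exI[of _ "rho_quot N f"] conjI smooth_on_rho_quot assms)
    (auto intro!: rho_quot_mult[where f=f, OF assms(2)])

lemma rho_order_2I:
  assumes "smooth_on N f" "\<And>t x. x \<in> U \<Longrightarrow> f (point t 0 x) = 0"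
    "\<And>t x. x \<in> U \<Longrightarrow> pd N Radial f (point t 0 x) = 0"
  shows "rho_order N 2 f"
proof -
  have 1: "smooth_on N (rho_quot N f)" by (rule smooth_on_rho_quot[OF assms(1,2)])
  have 0: "rho_quot N f (point t 0 x) = 0" if "x \<in> U" for t x
    using assms(3)[OF that] by (simp add: rho_quot_boundary)
  have "rho_order N 2 (\<lambda>p. p $ Radial * (p $ Radial * rho_quot N (rho_quot N f) p))"
    unfolding rho_order_def
    by (intro exI[of _ "rho_quot N (rho_quot N f)"] conjI smooth_on_rho_quot 1 0) (auto simp: power2_eq_square)
  then show ?thesis
    by (rule rho_order_cong) (simp add: rho_quot_mult[where f=f, OF assms(2)] rho_quot_mult[where f="rho_quot N f", OF 0])
qed

lemma rho_order_eq:
  assumes "rho_order N k (\<lambda>p. f p - g p)" "smooth_on N f" "smooth_on N g"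
  obtains h where "smooth_on N h" "\<And>p. p \<in> N \<Longrightarrow> f p = g p + p $ Radial ^ k * h p"
proof -
  obtain h where h: "smooth_on N h" "\<And>p. p \<in> N \<Longrightarrow> 0 < p $ Radial \<Longrightarrow> f p - g p = p $ Radial ^ k * h p"
    using assms(1) unfolding rho_order_def by blast
  have "f p - g p - p $ Radial ^ k * h p = 0" if "p \<in> N" for p
  proof (rule zero_boundary[OF _ _ that])
    show "smooth_on N (\<lambda>p. f p - g p - p $ Radial ^ k * h p)"
      by (intro smooth_on_diff smooth_on_mult smooth_on_power smooth_on_component assms(2,3) h(1))
  qed (simp add: h(2))
  then show ?thesis using that[OF h(1)] by (simp add: algebra_simps)
qed

text \<open>With its converse \<open>rho_order_2I\<close>: for smooth functions, agreement to order
  \<rho>^2 means equal values and equal radial derivatives on the horizon. Order conditions thereby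
  become boundary conditions, which can be differentiated along the horizon.\<close>

lemma rho_order_2D:
  assumes "rho_order N 2 (\<lambda>p. f p - g p)" "smooth_on N f" "smooth_on N g" "x \<in> U"
  shows "f (point t 0 x) = g (point t 0 x)" "pd N Radial f (point t 0 x) = pd N Radial g (point t 0 x)"
proof -
  obtain h where h: "smooth_on N h" "\<And>p. p \<in> N \<Longrightarrow> f p = g p + p $ Radial ^ 2 * h p"
    using rho_order_eq[OF assms(1-3)] by blast
  note p = boundary_in[OF assms(4)]
  show "f (point t 0 x) = g (point t 0 x)" using h(2)[OF p] by simp
  have s: "smooth_on N (\<lambda>p. p $ Radial * h p)" by (intro smooth_on_mult smooth_on_component h)
  have "pd N Radial f (point t 0 x) = pd N Radial (\<lambda>p. g p + p $ Radial * (p $ Radial * h p)) (point t 0 x)"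
    by (intro pd_cong fat_N p smooth_on_add smooth_on_mult assms smooth_on_component h(1))
      (simp add: h(2) power2_eq_square)
  also have "\<dots> = pd N Radial g (point t 0 x)"
    by (subst pd_add[OF fat_N p assms(3)])
      (auto intro!: s smooth_on_mult smooth_on_component simp: pd_Radial_product_boundary[OF s assms(4)])
  finally show "pd N Radial f (point t 0 x) = pd N Radial g (point t 0 x)" .
qed

end

section \<open>Determinants and inverse matrices\<close>

lemma matrix_mult_entry: "(A ** B) $ i $ j = (\<Sum>k\<in>UNIV. A $ i $ k * B $ k $ j)"
  by (simp add: matrix_matrix_mult_def)

definition det_deriv :: "real ^ 'n ^ 'n \<Rightarrow> real ^ 'n ^ ('n::finite) \<Rightarrow> real" where
  "det_deriv M B = (\<Sum>p\<in>{p. p permutes UNIV}. of_int (sign p) *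
     (\<Sum>i\<in>UNIV. B $ i $ p i * (\<Prod>j\<in>UNIV - {i}. M $ j $ p j)))"

lemma det_has_derivative:
  fixes A :: "'a::real_normed_vector \<Rightarrow> real ^ 'n ^ ('n::finite)"
  assumes "\<And>i j. ((\<lambda>x. A x $ i $ j) has_derivative (\<lambda>v. A' v $ i $ j)) (at x within S)"
  shows "((\<lambda>x. det (A x)) has_derivative (\<lambda>v. det_deriv (A x) (A' v))) (at x within S)"
  unfolding det_def det_deriv_def
  by (intro has_derivative_sum has_derivative_mult_right has_derivative_prod assms)

text \<open>A permutation other than the identity moves at least two points, so whichever single
  factor is replaced by an entry of B, an off-diagonal zero survives in the product.\<close>

lemma det_deriv_mat_1: "det_deriv (mat 1) B = trace B"
proof -
  have "(\<Sum>i\<in>UNIV. B $ i $ p i * (\<Prod>j\<in>UNIV - {i}. mat 1 $ j $ p j)) = 0"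
    if p: "p permutes UNIV" "p \<noteq> id" for p :: "'a \<Rightarrow> 'a"
  proof (rule sum.neutral, rule ballI)
    fix i
    obtain j where j: "p j \<noteq> j" using p(2) by fastforce
    have "p (p j) \<noteq> p j" using j permutes_inj[OF p(1)] by (metis injD)
    then obtain k where "k \<noteq> i" "p k \<noteq> k" using j by (cases "j = i") auto
    then have "(\<Prod>j\<in>UNIV - {i}. (mat 1 :: real ^ 'a ^ 'a) $ j $ p j) = 0"
      by (intro prod_zero) (auto simp: mat_def intro!: bexI[of _ k])
    then show "B $ i $ p i * (\<Prod>j\<in>UNIV - {i}. mat 1 $ j $ p j) = 0" by simp
  qed
  then have "det_deriv (mat 1) B = (\<Sum>p\<in>{id}. of_int (sign p) *
      (\<Sum>i\<in>UNIV. B $ i $ p i * (\<Prod>j\<in>UNIV - {i}. mat 1 $ j $ p j)))"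
    unfolding det_deriv_def
    by (intro sum.mono_neutral_right) (auto simp: permutes_id finite_permutations)
  then show ?thesis by (simp add: trace_def mat_def)
qed

text \<open>Jacobi's formula, by differentiating det (M + s C M) = det (1 + s C) det M at s = 0. It
  covers singular M too, so Liouville's theorem can use it before anything is known about the
  Jacobian of the flow.\<close>

lemma det_deriv_mult: "det_deriv M (C ** M) = trace C * det M"
proof -
  have "((\<lambda>s. det (M + s *\<^sub>R (C ** M))) has_derivative
      (\<lambda>v. det_deriv (M + 0 *\<^sub>R (C ** M)) (v *\<^sub>R (C ** M)))) (at (0::real))"
    by (rule det_has_derivative) (auto intro!: derivative_eq_intros)
  moreover have "((\<lambda>s. det (mat 1 + s *\<^sub>R C)) has_derivative
      (\<lambda>v. det_deriv (mat 1 + 0 *\<^sub>R C) (v *\<^sub>R C))) (at (0::real))"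
    by (rule det_has_derivative) (auto intro!: derivative_eq_intros)
  then have "((\<lambda>s. det (mat 1 + s *\<^sub>R C) * det M) has_derivative
      (\<lambda>v. det_deriv (mat 1 + 0 *\<^sub>R C) (v *\<^sub>R C) * det M)) (at (0::real))"
    by (rule has_derivative_mult_left)
  moreover have "det (M + s *\<^sub>R (C ** M)) = det (mat 1 + s *\<^sub>R C) * det M" for s
  proof -
    have "(mat 1 + s *\<^sub>R C) ** M = mat 1 ** M + s *\<^sub>R (C ** M)"
      by (simp add: vec_eq_iff matrix_mult_entry distrib_right sum.distrib sum_distrib_left mult.assoc
          del: matrix_mul_lid)
    then have "M + s *\<^sub>R (C ** M) = (mat 1 + s *\<^sub>R C) ** M" by simp
    then show ?thesis by (simp add: det_mul)
  qed
  ultimately have "(\<lambda>v. det_deriv (M + 0 *\<^sub>R (C ** M)) (v *\<^sub>R (C ** M)))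
      = (\<lambda>v. det_deriv (mat 1 + 0 *\<^sub>R C) (v *\<^sub>R C) * det M)"
    using has_derivative_unique by simp
  from fun_cong[OF this, of 1] show ?thesis by (simp add: det_deriv_mat_1)
qed

lemma matrix_inv_inverse:
  fixes A :: "real ^ 'n ^ 'n"
  assumes "det A \<noteq> 0"
  shows "A ** matrix_inv A = mat 1" "matrix_inv A ** A = mat 1"
  using someI_ex[OF assms[unfolded invertible_det_nz[symmetric] invertible_def]]
  unfolding matrix_inv_def by auto

lemma matrix_inv_unique:
  fixes A :: "real ^ 'n ^ 'n"
  assumes "A ** B = mat 1"
  shows "matrix_inv A = B" "det A \<noteq> 0"
proof -
  show d: "det A \<noteq> 0" using det_mul[of A B] assms by auto
  have "matrix_inv A ** (A ** B) = B"
    by (simp add: matrix_mul_assoc matrix_inv_inverse[OF d])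
  then show "matrix_inv A = B" by (simp add: assms)
qed

lemma det_deriv_inv:
  assumes "det M \<noteq> 0"
  shows "det_deriv M B = det M * (\<Sum>a\<in>UNIV. \<Sum>b\<in>UNIV. matrix_inv M $ a $ b * B $ b $ a)"
proof -
  have "B = (B ** matrix_inv M) ** M"
    by (simp add: matrix_mul_assoc[symmetric] matrix_inv_inverse[OF assms])
  then have "det_deriv M B = trace (B ** matrix_inv M) * det M"
    using det_deriv_mult by metis
  also have "trace (B ** matrix_inv M) = trace (matrix_inv M ** B)" by (rule trace_mul_sym)
  finally show ?thesis by (simp add: trace_def matrix_mult_entry mult.commute)
qed

lemma pd_det:
  fixes g :: "real ^ 'n \<Rightarrow> real ^ 'k ^ ('k::finite)"
  assumes "fat S" "x \<in> S" "\<And>a b. smooth_on S (\<lambda>q. g q $ a $ b)" "det (g x) \<noteq> 0"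
  shows "pd S i (\<lambda>q. det (g q)) x
     = det (g x) * (\<Sum>a\<in>UNIV. \<Sum>b\<in>UNIV. matrix_inv (g x) $ a $ b * pd S i (\<lambda>q. g q $ b $ a) x)"
proof -
  have "((\<lambda>q. det (g q)) has_derivative
     (\<lambda>v. det_deriv (g x) (\<chi> a b. \<Sum>i\<in>UNIV. v $ i * pd S i (\<lambda>q. g q $ a $ b) x))) (at x within S)"
    using pd_has_derivative[OF assms(3,2)] by (intro det_has_derivative) simp
  from pdI[OF assms(1,2) this] show ?thesis
    by (simp add: det_deriv_inv[OF assms(4)] axis_def if_distrib if_distribR cong: if_cong)
qed

text \<open>Exhibits the entries of the inverse as quotients of determinants; this is where their
  smoothness, and their differentiability under perturbation, come from.\<close>

lemma matrix_inv_cramer: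
  fixes A :: "real ^ 'n ^ 'n"
  assumes "det A \<noteq> 0"
  shows "matrix_inv A $ a $ b
     = det (\<chi> i j. if j = a then (if i = b then 1 else 0) else A $ i $ j) / det A"
proof -
  have "A *v (matrix_inv A *v axis b 1) = axis b 1"
    by (simp add: matrix_vector_mul_assoc matrix_inv_inverse[OF assms])
  then have "matrix_inv A *v axis b 1
      = (\<chi> k. det (\<chi> i j. if j = k then axis b 1 $ i else A $ i $ j) / det A)"
    using cramer[OF assms] by blast
  then have "(matrix_inv A *v axis b 1) $ a
      = det (\<chi> i j. if j = a then axis b 1 $ i else A $ i $ j) / det A" by simp
  moreover have "(matrix_inv A *v axis b 1) $ a = matrix_inv A $ a $ b"
    by (simp add: matrix_vector_mult_def axis_def if_distrib cong: if_cong)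
  ultimately show ?thesis by (simp add: axis_def cong: if_cong)
qed

lemma smooth_on_det:
  fixes g :: "_ \<Rightarrow> real ^ 'n ^ ('n::finite)"
  assumes "\<And>a b. smooth_on S (\<lambda>q. g q $ a $ b)"
  shows "smooth_on S (\<lambda>q. det (g q))"
  unfolding det_def
  by (intro smooth_on_sum smooth_on_mult smooth_on_const smooth_on_prod assms)

lemma smooth_on_matrix_inv:
  fixes g :: "_ \<Rightarrow> real ^ 'n ^ ('n::finite)"
  assumes "\<And>a b. smooth_on S (\<lambda>q. g q $ a $ b)" "\<And>q. q \<in> S \<Longrightarrow> det (g q) \<noteq> 0"
  shows "smooth_on S (\<lambda>q. matrix_inv (g q) $ a $ b)"
proof -
  have "smooth_on S (\<lambda>q. det (\<chi> i j. if j = a then (if i = b then 1 else 0) else g q $ i $ j) / det (g q))"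
  proof (intro smooth_on_divide smooth_on_det assms)
    fix i j
    show "smooth_on S (\<lambda>q. (\<chi> i j. if j = a then (if i = b then 1 else 0) else g q $ i $ j) $ i $ j)"
      by (cases "j = a") (auto intro: smooth_on_const assms)
  qed
  then show ?thesis by (rule smooth_on_cong[rotated]) (simp add: matrix_inv_cramer assms(2))
qed

section \<open>First variations of the determinant and of the inverse matrix\<close>

lemma det_perturb_derivative:
  fixes A h :: "real ^ 'n ^ 'n"
  assumes "det A \<noteq> 0"
  shows "((\<lambda>\<epsilon>. det (A + \<epsilon> *\<^sub>R h)) has_real_derivative
     det A * (\<Sum>a\<in>UNIV. \<Sum>b\<in>UNIV. matrix_inv A $ a $ b * h $ b $ a)) (at 0)"
proof -
  have "((\<lambda>\<epsilon>. det (A + \<epsilon> *\<^sub>R h)) has_derivative (\<lambda>v. det_deriv (A + 0 *\<^sub>R h) (v *\<^sub>R h))) (at (0::real))"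
    by (rule det_has_derivative) (auto intro!: derivative_eq_intros)
  then show ?thesis unfolding has_field_derivative_def
    by (rule has_derivative_eq_rhs)
      (auto simp: det_deriv_inv[OF assms] sum_distrib_left mult_ac intro!: ext sum.cong)
qed

text \<open>Cramer's rule shows that the entries are differentiable at all; differentiating M^-1 M =
  1 then yields the value.\<close>

lemma matrix_inv_perturb_derivative:
  fixes A h :: "real ^ 'n ^ 'n"
  assumes "det A \<noteq> 0"
  shows "((\<lambda>\<epsilon>. matrix_inv (A + \<epsilon> *\<^sub>R h) $ a $ b) has_real_derivative
     - (\<Sum>c\<in>UNIV. \<Sum>d\<in>UNIV. matrix_inv A $ a $ c * h $ c $ d * matrix_inv A $ d $ b)) (at 0)"
proof -
  let ?M = "\<lambda>\<epsilon>::real. A + \<epsilon> *\<^sub>R h"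
  have "isCont (\<lambda>\<epsilon>. det (?M \<epsilon>)) 0" using det_perturb_derivative[OF assms] DERIV_isCont by blast
  then have ev: "\<forall>\<^sub>F \<epsilon> in nhds 0. det (?M \<epsilon>) \<noteq> 0"
    using assms continuous_within_tendsto_compose tendsto_imp_eventually_ne[of "\<lambda>\<epsilon>. det (?M \<epsilon>)" "det A" "at 0" 0]
    by (auto simp: isCont_def eventually_at_filter elim: eventually_mono)
  have ex: "\<exists>d. ((\<lambda>\<epsilon>. matrix_inv (?M \<epsilon>) $ i $ j) has_real_derivative d) (at 0)" for i j
  proof -
    let ?C = "\<lambda>\<epsilon>. \<chi> k l. if l = i then (if k = j then 1 else 0) else ?M \<epsilon> $ k $ l"
    have "((\<lambda>\<epsilon>. det (?C \<epsilon>)) has_derivative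
        (\<lambda>v. det_deriv (?C 0) (\<chi> k l. if l = i then 0 else v * h $ k $ l))) (at 0)"
    proof (rule det_has_derivative)
      fix k l
      show "((\<lambda>\<epsilon>. ?C \<epsilon> $ k $ l) has_derivative (\<lambda>v. (\<chi> k l. if l = i then 0 else v * h $ k $ l) $ k $ l)) (at 0)"
        by (cases "l = i") (auto intro!: derivative_eq_intros)
    qed
    then have "(\<lambda>\<epsilon>. det (?C \<epsilon>)) differentiable (at 0)" by (auto simp: differentiable_def)
    moreover have "(\<lambda>\<epsilon>. det (?M \<epsilon>)) differentiable (at 0)"
      using det_perturb_derivative[OF assms, of h] real_differentiable_def by blast
    ultimately have "(\<lambda>\<epsilon>. det (?C \<epsilon>) / det (?M \<epsilon>)) differentiable (at 0)"
      using assms by (intro differentiable_divide) auto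
    then obtain d where "((\<lambda>\<epsilon>. det (?C \<epsilon>) / det (?M \<epsilon>)) has_real_derivative d) (at 0)"
      by (auto simp: real_differentiable_def)
    moreover have "\<forall>\<^sub>F \<epsilon> in nhds 0. matrix_inv (?M \<epsilon>) $ i $ j = det (?C \<epsilon>) / det (?M \<epsilon>)"
      using ev by eventually_elim (rule matrix_inv_cramer)
    ultimately have "((\<lambda>\<epsilon>. matrix_inv (?M \<epsilon>) $ i $ j) has_real_derivative d) (at 0)"
      by (subst DERIV_cong_ev[OF refl _ refl]) auto
    then show ?thesis by blast
  qed
  then obtain J where J: "\<And>i j. ((\<lambda>\<epsilon>. matrix_inv (?M \<epsilon>) $ i $ j) has_real_derivative J i j) (at 0)"
    by metis
  have eq: "(\<Sum>k\<in>UNIV. J i k * A $ k $ j) = - (\<Sum>k\<in>UNIV. matrix_inv A $ i $ k * h $ k $ j)" for i j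
  proof -
    have "((\<lambda>\<epsilon>. \<Sum>k\<in>UNIV. matrix_inv (?M \<epsilon>) $ i $ k * ?M \<epsilon> $ k $ j) has_real_derivative
       (\<Sum>k\<in>UNIV. J i k * A $ k $ j + matrix_inv A $ i $ k * h $ k $ j)) (at 0)"
      by (intro DERIV_sum) (auto intro!: derivative_eq_intros J)
    moreover have "\<forall>\<^sub>F \<epsilon> in nhds 0. (\<Sum>k\<in>UNIV. matrix_inv (?M \<epsilon>) $ i $ k * ?M \<epsilon> $ k $ j) = mat 1 $ i $ j"
      using ev
    proof eventually_elim
      case (elim \<epsilon>)
      have "(matrix_inv (?M \<epsilon>) ** ?M \<epsilon>) $ i $ j = mat 1 $ i $ j"
        by (simp only: matrix_inv_inverse(2)[OF elim])
      then show ?case unfolding matrix_mult_entry .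
    qed
    then have "((\<lambda>\<epsilon>. \<Sum>k\<in>UNIV. matrix_inv (?M \<epsilon>) $ i $ k * ?M \<epsilon> $ k $ j) has_real_derivative 0) (at 0)"
      by (subst DERIV_cong_ev[OF refl _ refl]) auto
    ultimately have "(\<Sum>k\<in>UNIV. J i k * A $ k $ j + matrix_inv A $ i $ k * h $ k $ j) = 0"
      by (rule DERIV_unique)
    then show ?thesis by (simp add: sum.distrib)
  qed
  define JM :: "real ^ 'n ^ 'n" where "JM = (\<chi> i j. J i j)"
  have "JM ** A = - (matrix_inv A ** h)"
    by (simp add: vec_eq_iff matrix_mult_entry JM_def eq)
  moreover have "JM = JM ** A ** matrix_inv A"
    by (simp add: matrix_mul_assoc[symmetric] matrix_inv_inverse[OF assms])
  moreover have "(- X) ** Y = - (X ** Y)" for X Y :: "real ^ 'n ^ 'n"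
    by (simp add: vec_eq_iff matrix_mult_entry sum_negf)
  ultimately have "JM = - (matrix_inv A ** h ** matrix_inv A)" by metis
  then have "J a b = - (matrix_inv A ** h ** matrix_inv A) $ a $ b"
    by (simp add: JM_def vec_eq_iff)
  also have "\<dots> = - (\<Sum>c\<in>UNIV. \<Sum>d\<in>UNIV. matrix_inv A $ a $ c * h $ c $ d * matrix_inv A $ d $ b)"
    by (simp add: matrix_mult_entry sum_distrib_right) (rule sum.swap)
  finally show ?thesis using J[of a b] by (simp only:)
qed

section \<open>The symplectic current as an algebraic function of first jets\<close>

text \<open>
  \<open>I\<close> stands for the inverse metric, \<open>B c a b\<close> for \<open>\<partial>\<^sub>c g\<^sub>a\<^sub>b\<close>, and \<open>k c a b\<close> for \<open>\<partial>\<^sub>c h\<^sub>a\<^sub>b\<close>.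
  The functions \<open>var_\<dots>\<close> are first variations along \<open>\<delta>g = h\<^sub>1\<close>, \<open>\<delta>B = k\<^sub>1\<close>.
\<close>

definition chr_alg :: "('n::finite \<Rightarrow> 'n \<Rightarrow> real) \<Rightarrow> ('n \<Rightarrow> 'n \<Rightarrow> 'n \<Rightarrow> real) \<Rightarrow> 'n \<Rightarrow> 'n \<Rightarrow> 'n \<Rightarrow> real" where
  "chr_alg I B a b c = (1 / 2) * (\<Sum>e\<in>UNIV. I a e * (B b e c + B c e b - B e b c))"

definition nab_alg where
  "nab_alg \<Gamma> h k c a b = k c a b - (\<Sum>d\<in>UNIV. \<Gamma> d c a * h d b + \<Gamma> d c b * h a d)"
  for \<Gamma> :: "'n::finite \<Rightarrow> 'n \<Rightarrow> 'n \<Rightarrow> real"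

definition theta_alg where
  "theta_alg I \<nu> m = (\<Sum>a\<in>UNIV. \<Sum>b\<in>UNIV. \<Sum>c\<in>UNIV. (I m a * I b c - I a b * I m c) * \<nu> c a b)"
  for I :: "'n::finite \<Rightarrow> 'n \<Rightarrow> real" and \<nu> :: "'n \<Rightarrow> 'n \<Rightarrow> 'n \<Rightarrow> real"

definition tr_alg where
  "tr_alg I h = (\<Sum>a\<in>UNIV. \<Sum>b\<in>UNIV. I a b * h a b)" for I h :: "'n::finite \<Rightarrow> 'n \<Rightarrow> real"

definition var_inv where
  "var_inv I h a b = - (\<Sum>c\<in>UNIV. \<Sum>d\<in>UNIV. I a c * h c d * I d b)" for I h :: "'n::finite \<Rightarrow> 'n \<Rightarrow> real"

definition var_chr where
  "var_chr I B h k a b c = chr_alg (var_inv I h) B a b c + chr_alg I k a b c"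

definition var_nab where
  "var_nab \<Gamma>' h c a b = - (\<Sum>d\<in>UNIV. \<Gamma>' d c a * h d b + \<Gamma>' d c b * h a d)"
  for \<Gamma>' :: "'n::finite \<Rightarrow> 'n \<Rightarrow> 'n \<Rightarrow> real"

definition var_theta where
  "var_theta I I' \<nu> \<nu>' m = (\<Sum>a\<in>UNIV. \<Sum>b\<in>UNIV. \<Sum>c\<in>UNIV.
     (I' m a * I b c + I m a * I' b c - I' a b * I m c - I a b * I' m c) * \<nu> c a b
     + (I m a * I b c - I a b * I m c) * \<nu>' c a b)"
  for I :: "'n::finite \<Rightarrow> 'n \<Rightarrow> real" and \<nu> \<nu>' :: "'n \<Rightarrow> 'n \<Rightarrow> 'n \<Rightarrow> real"

text \<open>This is \<delta>_1 \<Theta>(\<delta>_2 g) with the factor sqrt (- det g) / (16 pi G)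
  taken out; the trace term is the variation of that factor. The tensor h2 is held fixed, so
  \<open>var_nab\<close> varies only the connection.\<close>

definition omega_half where
  "omega_half I B h1 k1 h2 k2 m =
     1 / 2 * tr_alg I h1 * theta_alg I (nab_alg (chr_alg I B) h2 k2) m
     + var_theta I (var_inv I h1) (nab_alg (chr_alg I B) h2 k2) (var_nab (var_chr I B h1 k1) h2) m"

definition omega_alg where
  "omega_alg I B h1 k1 h2 k2 m = omega_half I B h1 k1 h2 k2 m - omega_half I B h2 k2 h1 k1 m"

section \<open>First variation of the symplectic potential\<close>

lemma chr_alg_derivative:
  assumes "\<And>a b. ((\<lambda>\<epsilon>. I \<epsilon> a b) has_real_derivative I' a b) (at 0)"
    and "\<And>c a b. ((\<lambda>\<epsilon>. B \<epsilon> c a b) has_real_derivative k c a b) (at 0)"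
  shows "((\<lambda>\<epsilon>. chr_alg (I \<epsilon>) (B \<epsilon>) a b c) has_real_derivative
     chr_alg I' (B 0) a b c + chr_alg (I 0) k a b c) (at 0)"
  unfolding chr_alg_def
  by (rule DERIV_cong[OF DERIV_cmult[OF DERIV_sum[OF DERIV_mult[OF assms(1) DERIV_diff[OF DERIV_add[OF assms(2) assms(2)] assms(2)]]]]])
    (simp add: distrib_left[symmetric] sum.distrib[symmetric], intro sum.cong refl, simp add: algebra_simps)

lemma nab_alg_derivative:
  assumes "\<And>a b c. ((\<lambda>\<epsilon>. \<Gamma> \<epsilon> a b c) has_real_derivative \<Gamma>' a b c) (at 0)"
  shows "((\<lambda>\<epsilon>. nab_alg (\<Gamma> \<epsilon>) h k c a b) has_real_derivative var_nab \<Gamma>' h c a b) (at 0)"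
  unfolding nab_alg_def var_nab_def
  by (rule DERIV_cong[OF DERIV_diff[OF DERIV_const DERIV_sum[OF DERIV_add[OF
      DERIV_cmult_right[OF assms] DERIV_cmult_right[OF assms]]]]]) simp

lemma theta_alg_derivative:
  assumes I: "\<And>a b. ((\<lambda>\<epsilon>. I \<epsilon> a b) has_real_derivative I' a b) (at 0)"
    and \<nu>: "\<And>c a b. ((\<lambda>\<epsilon>. \<nu> \<epsilon> c a b) has_real_derivative \<nu>' c a b) (at 0)"
  shows "((\<lambda>\<epsilon>. theta_alg (I \<epsilon>) (\<nu> \<epsilon>) m) has_real_derivative var_theta (I 0) I' (\<nu> 0) \<nu>' m) (at 0)"
  unfolding theta_alg_def var_theta_def
  by (intro DERIV_sum) (auto intro!: derivative_eq_intros I \<nu> simp: algebra_simps)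

lemma has_vector_derivative_vec:
  fixes f :: "real \<Rightarrow> real ^ ('n::finite)"
  assumes "\<And>i. ((\<lambda>x. f x $ i) has_real_derivative f' $ i) (at x within S)"
  shows "(f has_vector_derivative f') (at x within S)"
  unfolding has_vector_derivative_def
proof (subst has_derivative_componentwise_within, rule ballI)
  fix b :: "real ^ 'n" assume "b \<in> Basis"
  then obtain i where b: "b = axis i 1" by (auto simp: Basis_vec_def)
  have "((\<lambda>x. f x $ i) has_derivative (\<lambda>h. h * f' $ i)) (at x within S)"
    using assms[of i] unfolding has_field_derivative_def
    by (rule has_derivative_eq_rhs) (simp add: fun_eq_iff)
  then show "((\<lambda>x. f x \<bullet> b) has_derivative (\<lambda>h. (h *\<^sub>R f') \<bullet> b)) (at x within S)"
    by (simp add: b inner_axis)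
qed

definition jet where "jet S g p c a b = pd S c (\<lambda>q. g q $ a $ b) p"

lemma christoffel_alg: "christoffel S g a b c p = chr_alg (\<lambda>a b. ginv g p $ a $ b) (jet S g p) a b c"
  by (simp add: christoffel_def chr_alg_def jet_def)

lemma nabla_cov_alg:
  "nabla_cov S g c h a b p
    = nab_alg (chr_alg (\<lambda>a b. ginv g p $ a $ b) (jet S g p)) (\<lambda>a b. h p $ a $ b) (jet S h p) c a b"
  by (simp add: nabla_cov_def nab_alg_def christoffel_alg jet_def)

lemma Theta_alg:
  "Theta Gn S g h p $ m = sqrt (- det (g p)) / (16 * pi * Gn) *
     theta_alg (\<lambda>a b. ginv g p $ a $ b)
       (nab_alg (chr_alg (\<lambda>a b. ginv g p $ a $ b) (jet S g p)) (\<lambda>a b. h p $ a $ b) (jet S h p)) m"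
  by (simp add: Theta_def theta_alg_def nabla_cov_alg left_diff_distrib sum_subtractf)

definition smooth_tensor where
  "smooth_tensor S h \<longleftrightarrow> (\<forall>a b. smooth_on S (\<lambda>q. h q $ a $ b))"

lemma smooth_tensorD: "smooth_tensor S h \<Longrightarrow> smooth_on S (\<lambda>q. h q $ a $ b)"
  by (simp add: smooth_tensor_def)

lemma jet_perturb:
  assumes "fat S" "p \<in> S" "smooth_tensor S g" "smooth_tensor S h"
  shows "jet S (\<lambda>q. g q + \<epsilon> *\<^sub>R h q) p c a b = jet S g p c a b + \<epsilon> * jet S h p c a b"
  unfolding jet_def
  by (simp add: pd_add[OF assms(1,2) smooth_tensorD[OF assms(3)] smooth_on_mult[OF smooth_on_const smooth_tensorD[OF assms(4)]]]
      pd_mult[OF assms(1,2) smooth_on_const smooth_tensorD[OF assms(4)]] pd_const[OF assms(1,2)])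

lemma Theta_derivative:
  assumes "fat S" "p \<in> S" "smooth_tensor S g" "smooth_tensor S h1" "smooth_tensor S h2"
    and det: "det (g p) < 0" and sym: "\<And>a b. h1 p $ a $ b = h1 p $ b $ a"
  shows "((\<lambda>\<epsilon>. Theta Gn S (\<lambda>q. g q + \<epsilon> *\<^sub>R h1 q) h2 p) has_vector_derivative
     (\<chi> m. sqrt (- det (g p)) / (16 * pi * Gn) *
       omega_half (\<lambda>a b. ginv g p $ a $ b) (jet S g p) (\<lambda>a b. h1 p $ a $ b) (jet S h1 p)
         (\<lambda>a b. h2 p $ a $ b) (jet S h2 p) m)) (at 0)"
proof (rule has_vector_derivative_vec)
  fix m
  have d0: "det (g p) \<noteq> 0" using det by simp
  let ?M = "\<lambda>\<epsilon>::real. g p + \<epsilon> *\<^sub>R h1 p"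
  let ?I = "\<lambda>\<epsilon> a b. matrix_inv (?M \<epsilon>) $ a $ b"
  let ?B = "\<lambda>\<epsilon> c a b. jet S g p c a b + \<epsilon> * jet S h1 p c a b"
  let ?\<nu> = "\<lambda>\<epsilon>. nab_alg (chr_alg (?I \<epsilon>) (?B \<epsilon>)) (\<lambda>a b. h2 p $ a $ b) (jet S h2 p)"
  have I: "((\<lambda>\<epsilon>. ?I \<epsilon> a b) has_real_derivative var_inv (?I 0) (\<lambda>a b. h1 p $ a $ b) a b) (at 0)" for a b
    using matrix_inv_perturb_derivative[OF d0, of "h1 p" a b] by (simp add: var_inv_def)
  have B: "((\<lambda>\<epsilon>. ?B \<epsilon> c a b) has_real_derivative jet S h1 p c a b) (at 0)" for c a b
    by (auto intro!: derivative_eq_intros)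
  have \<theta>: "((\<lambda>\<epsilon>. theta_alg (?I \<epsilon>) (?\<nu> \<epsilon>) m) has_real_derivative
      var_theta (?I 0) (var_inv (?I 0) (\<lambda>a b. h1 p $ a $ b)) (?\<nu> 0)
        (var_nab (var_chr (?I 0) (?B 0) (\<lambda>a b. h1 p $ a $ b) (jet S h1 p)) (\<lambda>a b. h2 p $ a $ b)) m) (at 0)"
    unfolding var_chr_def
    by (intro theta_alg_derivative[OF I nab_alg_derivative[OF chr_alg_derivative[OF I B]]])
  have "((\<lambda>\<epsilon>. - det (?M \<epsilon>)) has_real_derivative - (det (g p) * (\<Sum>a\<in>UNIV. \<Sum>b\<in>UNIV. ?I 0 a b * h1 p $ b $ a))) (at 0)"
    using DERIV_minus[OF det_perturb_derivative[OF d0]] by simp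
  moreover have "(\<Sum>a\<in>UNIV. \<Sum>b\<in>UNIV. ?I 0 a b * h1 p $ b $ a) = tr_alg (?I 0) (\<lambda>a b. h1 p $ a $ b)"
    unfolding tr_alg_def by (intro sum.cong refl) (metis sym)
  ultimately have d: "((\<lambda>\<epsilon>. - det (?M \<epsilon>)) has_real_derivative - det (g p) * tr_alg (?I 0) (\<lambda>a b. h1 p $ a $ b)) (at 0)"
    by simp
  have "0 < - det (?M 0)" using det by simp
  from DERIV_chain2[OF DERIV_real_sqrt[OF this] d]
  have "((\<lambda>\<epsilon>. sqrt (- det (?M \<epsilon>))) has_real_derivative
      inverse (sqrt (- det (g p))) / 2 * (- det (g p) * tr_alg (?I 0) (\<lambda>a b. h1 p $ a $ b))) (at 0)"
    by (simp only: scaleR_zero_left add_0_right)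
  moreover have "inverse (sqrt (- det (g p))) / 2 * (- det (g p) * tr_alg (?I 0) (\<lambda>a b. h1 p $ a $ b))
     = sqrt (- det (g p)) * (1 / 2 * tr_alg (?I 0) (\<lambda>a b. h1 p $ a $ b))"
  proof -
    define s where "s = sqrt (- det (g p))"
    have "s > 0" "- det (g p) = s * s" using det by (auto simp: s_def)
    then show ?thesis unfolding s_def[symmetric] by (simp add: field_simps)
  qed
  ultimately have s: "((\<lambda>\<epsilon>. sqrt (- det (?M \<epsilon>))) has_real_derivative
      sqrt (- det (g p)) * (1 / 2 * tr_alg (?I 0) (\<lambda>a b. h1 p $ a $ b))) (at 0)" by (rule DERIV_cong)
  have eq: "Theta Gn S (\<lambda>q. g q + \<epsilon> *\<^sub>R h1 q) h2 p $ m
     = sqrt (- det (?M \<epsilon>)) / (16 * pi * Gn) * theta_alg (?I \<epsilon>) (?\<nu> \<epsilon>) m" for \<epsilon>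
    unfolding Theta_alg jet_perturb[OF assms(1-4), abs_def] by (simp add: jet_perturb[OF assms(1-4), abs_def])
  show "((\<lambda>\<epsilon>. Theta Gn S (\<lambda>q. g q + \<epsilon> *\<^sub>R h1 q) h2 p $ m) has_real_derivative
     (\<chi> m. sqrt (- det (g p)) / (16 * pi * Gn) *
       omega_half (\<lambda>a b. ginv g p $ a $ b) (jet S g p) (\<lambda>a b. h1 p $ a $ b) (jet S h1 p)
         (\<lambda>a b. h2 p $ a $ b) (jet S h2 p) m) $ m) (at 0)"
    unfolding eq
    by (rule DERIV_cong[OF DERIV_mult[OF DERIV_cdivide[OF s] \<theta>]])
      (simp add: omega_half_def algebra_simps)
qed

lemma omega_eq_alg:
  assumes "fat S" "p \<in> S" "smooth_tensor S g" "smooth_tensor S h1" "smooth_tensor S h2"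
    and "det (g p) < 0" "\<And>a b. h1 p $ a $ b = h1 p $ b $ a" "\<And>a b. h2 p $ a $ b = h2 p $ b $ a"
  shows "omega Gn S g h1 h2 p $ m = sqrt (- det (g p)) / (16 * pi * Gn) *
       omega_alg (\<lambda>a b. ginv g p $ a $ b) (jet S g p) (\<lambda>a b. h1 p $ a $ b) (jet S h1 p)
         (\<lambda>a b. h2 p $ a $ b) (jet S h2 p) m"
  unfolding omega_def
    vector_derivative_at[OF Theta_derivative[OF assms(1-5,6,7)]]
    vector_derivative_at[OF Theta_derivative[OF assms(1-3,5,4,6,8)]]
  by (simp add: omega_alg_def right_diff_distrib)

subsection \<open>Behaviour under diagonal rescaling\<close>

text \<open>A lower index a carries the weight \<open>l a\<close>, an upper one its inverse, and
  each derivative an extra 1 / r. Contractions respect the weights, so the current, with one upper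
  index and one derivative, scales by 1 / (l m r). In the application l is \<open>lam\<close> at
  \<rho>, and r = \<rho>.\<close>

locale diagonal_rescaling =
  fixes l :: "'n::finite \<Rightarrow> real" and r :: real
  assumes l0: "\<And>a. l a \<noteq> 0" and r0: "r \<noteq> 0"
begin

lemma chr_scale:
  assumes "\<And>a b. I a b = I' a b / (l a * l b)" "\<And>c a b. B c a b = l a * l b * l c / r * B' c a b"
  shows "chr_alg I B a b c = l b * l c / (l a * r) * chr_alg I' B' a b c"
  unfolding chr_alg_def sum_distrib_left
  by (intro sum.cong refl) (use l0 r0 in \<open>simp add: assms field_simps\<close>)

lemma nab_scale:
  assumes "\<And>a b c. \<Gamma> a b c = l b * l c / (l a * r) * \<Gamma>' a b c"
    "\<And>a b. h a b = l a * l b * h' a b" "\<And>c a b. k c a b = l a * l b * l c / r * k' c a b"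
  shows "nab_alg \<Gamma> h k c a b = l a * l b * l c / r * nab_alg \<Gamma>' h' k' c a b"
  unfolding nab_alg_def right_diff_distrib sum_distrib_left
  by (intro arg_cong2[where f=minus] sum.cong refl) (use l0 r0 in \<open>simp_all add: assms field_simps\<close>)

lemma var_nab_scale:
  assumes "\<And>a b c. \<Gamma> a b c = l b * l c / (l a * r) * \<Gamma>' a b c"
    "\<And>a b. h a b = l a * l b * h' a b"
  shows "var_nab \<Gamma> h c a b = l a * l b * l c / r * var_nab \<Gamma>' h' c a b"
  unfolding var_nab_def mult_minus_right sum_distrib_left
  by (intro arg_cong[where f=uminus] sum.cong refl) (use l0 r0 in \<open>simp_all add: assms field_simps\<close>)

lemma theta_scale:
  assumes "\<And>a b. I a b = I' a b / (l a * l b)" "\<And>c a b. \<nu> c a b = l a * l b * l c / r * \<nu>' c a b"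
  shows "theta_alg I \<nu> m = theta_alg I' \<nu>' m / (l m * r)"
  unfolding theta_alg_def sum_divide_distrib
  by (intro sum.cong refl) (use l0 r0 in \<open>simp add: assms field_simps\<close>)

lemma var_theta_scale:
  assumes "\<And>a b. I a b = I' a b / (l a * l b)" "\<And>a b. J a b = J' a b / (l a * l b)"
    "\<And>c a b. \<nu> c a b = l a * l b * l c / r * \<nu>' c a b" "\<And>c a b. \<mu> c a b = l a * l b * l c / r * \<mu>' c a b"
  shows "var_theta I J \<nu> \<mu> m = var_theta I' J' \<nu>' \<mu>' m / (l m * r)"
  unfolding var_theta_def sum_divide_distrib
  by (intro sum.cong refl) (use l0 r0 in \<open>simp add: assms field_simps\<close>)

lemma tr_scale:
  assumes "\<And>a b. I a b = I' a b / (l a * l b)" "\<And>a b. h a b = l a * l b * h' a b"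
  shows "tr_alg I h = tr_alg I' h'"
  unfolding tr_alg_def
  by (intro sum.cong refl) (use l0 r0 in \<open>simp add: assms field_simps\<close>)

lemma var_inv_scale:
  assumes "\<And>a b. I a b = I' a b / (l a * l b)" "\<And>a b. h a b = l a * l b * h' a b"
  shows "var_inv I h a b = var_inv I' h' a b / (l a * l b)"
  unfolding var_inv_def minus_divide_left[symmetric] sum_divide_distrib
  by (intro arg_cong[where f=uminus] sum.cong refl) (use l0 r0 in \<open>simp add: assms field_simps\<close>)

lemma omega_half_scale:
  assumes I: "\<And>a b. I a b = I' a b / (l a * l b)" and B: "\<And>c a b. B c a b = l a * l b * l c / r * B' c a b"
    and h: "\<And>a b. h a b = l a * l b * h' a b" and k: "\<And>c a b. k c a b = l a * l b * l c / r * k' c a b"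
    and H: "\<And>a b. H a b = l a * l b * H' a b" and K: "\<And>c a b. K c a b = l a * l b * l c / r * K' c a b"
  shows "omega_half I B h k H K m = omega_half I' B' h' k' H' K' m / (l m * r)"
proof -
  note \<Gamma> = chr_scale[OF I B]
  note \<nu> = nab_scale[OF \<Gamma> H K]
  have \<Gamma>': "var_chr I B h k a b c = l b * l c / (l a * r) * var_chr I' B' h' k' a b c" for a b c
    unfolding var_chr_def chr_scale[OF var_inv_scale[OF I h] B] chr_scale[OF I k] by (simp add: distrib_left)
  show ?thesis
    unfolding omega_half_def tr_scale[OF I h] theta_scale[OF I \<nu>]
      var_theta_scale[OF I var_inv_scale[OF I h] \<nu> var_nab_scale[OF \<Gamma>' H]]
    by (simp add: add_divide_distrib)
qed

lemma omega_alg_scale: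
  assumes "\<And>a b. I a b = I' a b / (l a * l b)" "\<And>c a b. B c a b = l a * l b * l c / r * B' c a b"
    "\<And>a b. h a b = l a * l b * h' a b" "\<And>c a b. k c a b = l a * l b * l c / r * k' c a b"
    "\<And>a b. H a b = l a * l b * H' a b" "\<And>c a b. K c a b = l a * l b * l c / r * K' c a b"
  shows "omega_alg I B h k H K m = omega_alg I' B' h' k' H' K' m / (l m * r)"
  unfolding omega_alg_def omega_half_scale[OF assms] omega_half_scale[OF assms(1,2,5,6,3,4)]
  by (simp add: diff_divide_distrib)

end

lemma smooth_on_chr_alg:
  assumes "\<And>a b. smooth_on S (\<lambda>p. I p a b)" "\<And>a b c. smooth_on S (\<lambda>p. B p a b c)"
  shows "smooth_on S (\<lambda>p. chr_alg (I p) (B p) a b c)"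
  unfolding chr_alg_def
  by (intro smooth_on_mult smooth_on_const smooth_on_sum smooth_on_diff smooth_on_add assms)

lemma smooth_on_nab_alg:
  assumes "\<And>a b c. smooth_on S (\<lambda>p. \<Gamma> p a b c)" "\<And>a b. smooth_on S (\<lambda>p. h p a b)"
    "\<And>a b c. smooth_on S (\<lambda>p. k p a b c)"
  shows "smooth_on S (\<lambda>p. nab_alg (\<Gamma> p) (h p) (k p) c a b)"
  unfolding nab_alg_def
  by (intro smooth_on_mult smooth_on_sum smooth_on_diff smooth_on_add assms)

lemma smooth_on_omega_half:
  assumes "\<And>a b. smooth_on S (\<lambda>p. I p a b)" "\<And>a b c. smooth_on S (\<lambda>p. B p a b c)"
    "\<And>a b. smooth_on S (\<lambda>p. h p a b)" "\<And>a b c. smooth_on S (\<lambda>p. k p a b c)"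
    "\<And>a b. smooth_on S (\<lambda>p. H p a b)" "\<And>a b c. smooth_on S (\<lambda>p. K p a b c)"
  shows "smooth_on S (\<lambda>p. omega_half (I p) (B p) (h p) (k p) (H p) (K p) m)"
proof -
  note \<nu> = smooth_on_nab_alg[OF smooth_on_chr_alg[OF assms(1,2)] assms(5,6)]
  have J: "smooth_on S (\<lambda>p. var_inv (I p) (h p) a b)" for a b
    unfolding var_inv_def by (intro smooth_on_minus smooth_on_mult smooth_on_sum assms)
  have "smooth_on S (\<lambda>p. var_nab (var_chr (I p) (B p) (h p) (k p)) (H p) c a b)" for c a b
    unfolding var_nab_def var_chr_def
    by (intro smooth_on_minus smooth_on_mult smooth_on_sum smooth_on_add smooth_on_chr_alg[OF J assms(2)]
        smooth_on_chr_alg[OF assms(1,4)] assms)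
  then show ?thesis
    unfolding omega_half_def tr_alg_def theta_alg_def var_theta_def
    by (intro smooth_on_add smooth_on_diff smooth_on_mult smooth_on_sum smooth_on_const J \<nu> assms)
qed

lemma smooth_on_omega_alg:
  assumes "\<And>a b. smooth_on S (\<lambda>p. I p a b)" "\<And>a b c. smooth_on S (\<lambda>p. B p a b c)"
    "\<And>a b. smooth_on S (\<lambda>p. h p a b)" "\<And>a b c. smooth_on S (\<lambda>p. k p a b c)"
    "\<And>a b. smooth_on S (\<lambda>p. H p a b)" "\<And>a b c. smooth_on S (\<lambda>p. K p a b c)"
  shows "smooth_on S (\<lambda>p. omega_alg (I p) (B p) (h p) (k p) (H p) (K p) m)"
  unfolding omega_alg_def by (intro smooth_on_diff smooth_on_omega_half assms)

section \<open>The leading order at the horizon\<close>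

text \<open>On the horizon the jets have only t and \<rho> components: cross derivatives carry a
  factor \<rho> in \<open>rescaled_jet\<close>, the cross block does not depend on t, and the mixed
  components vanish. \<open>block2\<close> in contrast leaves the cross block free; of a variation
  only its trace enters.\<close>

definition planar3 :: "('m coord \<Rightarrow> 'm coord \<Rightarrow> 'm coord \<Rightarrow> real) \<Rightarrow> bool" where
  "planar3 B \<longleftrightarrow> (\<forall>i a b. B (Cross i) a b = 0 \<and> B a (Cross i) b = 0 \<and> B a b (Cross i) = 0)"

definition block2 :: "('m coord \<Rightarrow> 'm coord \<Rightarrow> real) \<Rightarrow> bool" where
  "block2 I \<longleftrightarrow> (\<forall>i. I Time (Cross i) = 0 \<and> I Radial (Cross i) = 0 \<and> I (Cross i) Time = 0 \<and> I (Cross i) Radial = 0)"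

lemma planar3D: "planar3 B \<Longrightarrow> B (Cross i) a b = 0 \<and> B a (Cross i) b = 0 \<and> B a b (Cross i) = 0"
  by (simp add: planar3_def)

lemma block2D: "block2 I \<Longrightarrow> I Time (Cross i) = 0 \<and> I Radial (Cross i) = 0 \<and> I (Cross i) Time = 0 \<and> I (Cross i) Radial = 0"
  by (simp add: block2_def)

lemma planar3I:
  assumes "\<And>i a b. B (Cross i) a b = 0" "\<And>i a b. B a (Cross i) b = 0" "\<And>i a b. B a b (Cross i) = 0"
  shows "planar3 B"
  using assms by (simp add: planar3_def)

lemma planar3_chr:
  assumes "block2 I" "planar3 B" shows "planar3 (chr_alg I B)"
proof (rule planar3I)
  fix i a b
  show "chr_alg I B (Cross i) a b = 0"
    by (simp add: chr_alg_def sum_coord planar3D[OF assms(2)] block2D[OF assms(1)])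
qed (simp_all add: chr_alg_def planar3D[OF assms(2)])

lemma chr_planar:
  assumes "block2 I" "planar3 B" "a = Time \<or> a = Radial"
  shows "chr_alg I B a b c = (1 / 2) * (I a Time * (B b Time c + B c Time b - B Time b c)
    + I a Radial * (B b Radial c + B c Radial b - B Radial b c))"
  using assms(3) by (auto simp: chr_alg_def sum_coord planar3D[OF assms(2)] block2D[OF assms(1)])

lemma planar3_nab:
  assumes "planar3 \<Gamma>" "block2 h" "planar3 k" shows "planar3 (nab_alg \<Gamma> h k)"
proof (rule planar3I)
  fix i a b
  show "nab_alg \<Gamma> h k (Cross i) a b = 0"
    by (simp add: nab_alg_def planar3D[OF assms(1)] planar3D[OF assms(3)])
  show "nab_alg \<Gamma> h k a (Cross i) b = 0" "nab_alg \<Gamma> h k a b (Cross i) = 0"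
    by (cases b; simp add: nab_alg_def sum_coord planar3D[OF assms(1)] planar3D[OF assms(3)] block2D[OF assms(2)])+
qed

lemma nab_planar:
  assumes "planar3 \<Gamma>"
  shows "nab_alg \<Gamma> h k c a b = k c a b - (\<Gamma> Time c a * h Time b + \<Gamma> Time c b * h a Time
     + \<Gamma> Radial c a * h Radial b + \<Gamma> Radial c b * h a Radial)"
  by (simp add: nab_alg_def sum_coord planar3D[OF assms])

lemma planar3_var_nab:
  assumes "planar3 \<Gamma>" "block2 h" shows "planar3 (var_nab \<Gamma> h)"
  using planar3_nab[OF assms, of "\<lambda>_ _ _. 0"] by (simp add: planar3_def nab_alg_def var_nab_def)

lemma var_nab_planar:
  assumes "planar3 \<Gamma>"
  shows "var_nab \<Gamma> h c a b = - (\<Gamma> Time c a * h Time b + \<Gamma> Time c b * h a Time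
     + \<Gamma> Radial c a * h Radial b + \<Gamma> Radial c b * h a Radial)"
  by (simp add: var_nab_def sum_coord planar3D[OF assms])

lemma block2_var_inv:
  assumes "block2 I" "block2 h" shows "block2 (var_inv I h)"
  by (simp add: block2_def var_inv_def sum_coord block2D[OF assms(1)] block2D[OF assms(2)])

lemma var_inv_planar:
  assumes "block2 I" "block2 h" "a = Time \<or> a = Radial" "b = Time \<or> b = Radial"
  shows "var_inv I h a b = - (I a Time * h Time Time * I Time b + I a Time * h Time Radial * I Radial b
     + I a Radial * h Radial Time * I Time b + I a Radial * h Radial Radial * I Radial b)"
  using assms(3,4) by (auto simp: var_inv_def sum_coord block2D[OF assms(1)] block2D[OF assms(2)])

text \<open>In the plane, \<open>I\<^sup>m\<^sup>a I\<^sup>b\<^sup>c - I\<^sup>a\<^sup>b I\<^sup>m\<^sup>c\<close> is antisymmetric in \<open>a, c\<close>.\<close>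

lemma theta_planar:
  assumes "planar3 \<nu>" "I Time Radial = I Radial Time"
  shows "theta_alg I \<nu> Time = (I Time Time * I Radial Radial - I Time Radial * I Time Radial)
       * (\<nu> Radial Time Radial - \<nu> Time Radial Radial)"
    "theta_alg I \<nu> Radial = (I Time Time * I Radial Radial - I Time Radial * I Time Radial)
       * (\<nu> Time Radial Time - \<nu> Radial Time Time)"
  by (simp_all add: theta_alg_def sum_coord planar3D[OF assms(1)] assms(2) algebra_simps)

lemma var_theta_planar:
  assumes "planar3 \<nu>" "planar3 \<nu>'" "I Time Radial = I Radial Time" "J Time Radial = J Radial Time"
  shows "var_theta I J \<nu> \<nu>' Time =
      (J Time Time * I Radial Radial + I Time Time * J Radial Radial - 2 * (I Time Radial * J Time Radial))
         * (\<nu> Radial Time Radial - \<nu> Time Radial Radial)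
      + (I Time Time * I Radial Radial - I Time Radial * I Time Radial)
         * (\<nu>' Radial Time Radial - \<nu>' Time Radial Radial)"
    "var_theta I J \<nu> \<nu>' Radial =
      (J Time Time * I Radial Radial + I Time Time * J Radial Radial - 2 * (I Time Radial * J Time Radial))
         * (\<nu> Time Radial Time - \<nu> Radial Time Time)
      + (I Time Time * I Radial Radial - I Time Radial * I Time Radial)
         * (\<nu>' Time Radial Time - \<nu>' Radial Time Time)"
  by (simp_all add: var_theta_def sum_coord planar3D[OF assms(1)] planar3D[OF assms(2)] assms(3,4) algebra_simps)

text \<open>The frame components, at one point of the horizon, of E ((d\<rho> + c \<rho> dt)^2 - q
  \<rho>^2 dt^2) with \<partial>_t E = 2 c E. I is the inverse and B the
  \<open>rescaled_jet\<close>, whose radial part only counts the t-indices.\<close>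

locale horizon_jet =
  fixes E c q :: real and I :: "('m::finite) coord \<Rightarrow> 'm coord \<Rightarrow> real"
    and B :: "'m coord \<Rightarrow> 'm coord \<Rightarrow> 'm coord \<Rightarrow> real"
  assumes E0: "E \<noteq> 0" and q0: "q \<noteq> 0"
    and I: "I Time Time = - 1 / (E * q)" "I Time Radial = c / (E * q)" "I Radial Time = c / (E * q)"
      "I Radial Radial = (q - c\<^sup>2) / (E * q)" "block2 I"
    and B: "planar3 B" "B Time Time Time = 2 * c * E * (c\<^sup>2 - q)" "B Time Time Radial = 2 * c\<^sup>2 * E"
      "B Time Radial Time = 2 * c\<^sup>2 * E" "B Time Radial Radial = 2 * c * E"
      "B Radial Time Time = 2 * E * (c\<^sup>2 - q)" "B Radial Time Radial = c * E"
      "B Radial Radial Time = c * E" "B Radial Radial Radial = 0"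
begin

text \<open>The variation of the model with \<delta>(ln E) / 2 = s, \<delta>c = c G + J and
  \<delta>q = 2 q G. Since ln E / 2 = e + t c, the t-derivative of s is \<delta>c, and this fixes
  the part of k along t. The cross block is only required to be traceless.\<close>

definition variation_jet where
  "variation_jet s G J h k \<longleftrightarrow> block2 h \<and> planar3 k \<and> (\<Sum>i\<in>UNIV. \<Sum>j\<in>UNIV. I (Cross i) (Cross j) * h (Cross i) (Cross j)) = 0 \<and>
     h Time Time = E * (2 * (s + G) * (c\<^sup>2 - q) + 2 * J * c) \<and>
     h Time Radial = E * (2 * s * c + G * c + J) \<and> h Radial Time = E * (2 * s * c + G * c + J) \<and>
     h Radial Radial = 2 * s * E \<and>
     k Time Time Time = 2 * (c * G + J) * E * (c\<^sup>2 - q) + 2 * c * h Time Time \<and>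
     k Time Time Radial = 2 * (c * G + J) * E * c + 2 * c * h Time Radial \<and>
     k Time Radial Time = 2 * (c * G + J) * E * c + 2 * c * h Time Radial \<and>
     k Time Radial Radial = 2 * (c * G + J) * E + 2 * c * h Radial Radial \<and>
     k Radial Time Time = 2 * h Time Time \<and> k Radial Time Radial = h Time Radial \<and>
     k Radial Radial Time = h Time Radial \<and> k Radial Radial Radial = 0"

text \<open>For c = 0 these are the Christoffel symbols of Rindler space in the rescaled frame. The
  conformal factor E drops out.\<close>

lemma chr_horizon:
  "chr_alg I B Time Time Time = 2 * c" "chr_alg I B Radial Time Time = q - c\<^sup>2"
  "chr_alg I B Time Time Radial = 1" "chr_alg I B Time Radial Time = 1"
  "chr_alg I B Radial Time Radial = 0" "chr_alg I B Radial Radial Time = 0"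
  "chr_alg I B Time Radial Radial = 0" "chr_alg I B Radial Radial Radial = 0"
  using E0 q0 by (auto simp: chr_planar[OF I(5) B(1)] I B field_simps power2_eq_square)

context
  fixes s G J :: real and h :: "'m coord \<Rightarrow> 'm coord \<Rightarrow> real"
    and k :: "'m coord \<Rightarrow> 'm coord \<Rightarrow> 'm coord \<Rightarrow> real"
  assumes v: "variation_jet s G J h k"
begin

lemma variation_block: "block2 h" "planar3 k"
  using v by (auto simp: variation_jet_def)

lemma variation_sym: "h Radial Time = h Time Radial" "k Time Radial Time = k Time Time Radial"
  using v by (auto simp: variation_jet_def)

lemma variation_values:
  "h Time Time = E * (2 * (s + G) * (c\<^sup>2 - q) + 2 * J * c)"
  "h Time Radial = E * (2 * s * c + G * c + J)" "h Radial Radial = 2 * s * E"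
  "k Time Time Time = 2 * (c * G + J) * E * (c\<^sup>2 - q) + 2 * c * (E * (2 * (s + G) * (c\<^sup>2 - q) + 2 * J * c))"
  "k Time Time Radial = 2 * (c * G + J) * E * c + 2 * c * (E * (2 * s * c + G * c + J))"
  "k Time Radial Radial = 2 * (c * G + J) * E + 2 * c * (2 * s * E)"
  "k Radial Time Time = 2 * (E * (2 * (s + G) * (c\<^sup>2 - q) + 2 * J * c))"
  "k Radial Time Radial = E * (2 * s * c + G * c + J)"
  "k Radial Radial Time = E * (2 * s * c + G * c + J)" "k Radial Radial Radial = 0"
  using v by (auto simp: variation_jet_def)

lemma nab_horizon:
  "nab_alg (chr_alg I B) h k Radial Time Radial = 0"
  "nab_alg (chr_alg I B) h k Time Radial Radial = 0"
  "nab_alg (chr_alg I B) h k Radial Time Time = 0"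
  "nab_alg (chr_alg I B) h k Time Radial Time = 2 * E * q * G"
  by (simp_all add: nab_planar[OF planar3_chr[OF I(5) B(1)]] chr_horizon variation_sym variation_values
      algebra_simps power2_eq_square)

lemma var_inv_horizon:
  "var_inv I h Time Time = - (h Time Time - 2 * c * h Time Radial + c\<^sup>2 * h Radial Radial) / (E * q)\<^sup>2"
  "var_inv I h Time Radial = (c * h Time Time + (q - 2 * c\<^sup>2) * h Time Radial - c * (q - c\<^sup>2) * h Radial Radial) / (E * q)\<^sup>2"
  "var_inv I h Radial Time = (c * h Time Time + (q - 2 * c\<^sup>2) * h Time Radial - c * (q - c\<^sup>2) * h Radial Radial) / (E * q)\<^sup>2"
  "var_inv I h Radial Radial = - (c\<^sup>2 * h Time Time + 2 * c * (q - c\<^sup>2) * h Time Radial + (q - c\<^sup>2)\<^sup>2 * h Radial Radial) / (E * q)\<^sup>2"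
  using E0 q0 by (simp_all add: var_inv_planar[OF I(5) variation_block(1)] I variation_sym field_simps power2_eq_square)

lemma var_inv_horizon':
  "var_inv I h Time Time = (2 * s * q - 2 * J * c - 2 * G * (c\<^sup>2 - q) + 2 * c * (G * c + J)) / (E * q\<^sup>2)"
  "var_inv I h Time Radial = (c * (2 * G * (c\<^sup>2 - q) + 2 * J * c) + (q - 2 * c\<^sup>2) * (G * c + J) - 2 * s * c * q) / (E * q\<^sup>2)"
  "var_inv I h Radial Time = (c * (2 * G * (c\<^sup>2 - q) + 2 * J * c) + (q - 2 * c\<^sup>2) * (G * c + J) - 2 * s * c * q) / (E * q\<^sup>2)"
  "var_inv I h Radial Radial = - (c\<^sup>2 * (2 * G * (c\<^sup>2 - q) + 2 * J * c) + 2 * c * (q - c\<^sup>2) * (G * c + J) + 2 * s * q * (q - c\<^sup>2)) / (E * q\<^sup>2)"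
  using E0 q0 unfolding var_inv_horizon variation_values
  by (simp_all add: field_simps power2_eq_square)

lemma planar3_var_chr: "planar3 (var_chr I B h k)"
  using planar3_chr[OF block2_var_inv[OF I(5) variation_block(1)] B(1)] planar3_chr[OF I(5) variation_block(2)]
  by (simp add: planar3_def var_chr_def)

lemma var_chr_horizon:
  "var_chr I B h k Time Time Time = 2 * J + 2 * c * G"
  "var_chr I B h k Radial Time Time = 2 * G * (q - c\<^sup>2) - 2 * c * J"
  "var_chr I B h k Time Time Radial = 0" "var_chr I B h k Time Radial Time = 0"
  "var_chr I B h k Radial Time Radial = 0" "var_chr I B h k Radial Radial Time = 0"
  "var_chr I B h k Time Radial Radial = 0" "var_chr I B h k Radial Radial Radial = 0"
  using E0 q0
  by (simp_all add: var_chr_def chr_planar[OF I(5) variation_block(2)]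
      chr_planar[OF block2_var_inv[OF I(5) variation_block(1)] B(1)] var_inv_horizon' I(1-4) B
      variation_sym variation_values)
    (simp_all add: field_simps power2_eq_square)

lemma tr_horizon: "tr_alg I h = 4 * s + 2 * G"
proof -
  have "tr_alg I h = I Time Time * h Time Time + 2 * (I Time Radial * h Time Radial) + I Radial Radial * h Radial Radial"
    using v unfolding variation_jet_def
    by (simp add: tr_alg_def sum_coord block2D[OF I(5)] sum.distrib I(2,3))
  also have "\<dots> = 4 * s + 2 * G"
    using E0 q0 by (simp add: I variation_values field_simps power2_eq_square)
  finally show ?thesis .
qed

text \<open>The variation of the planar determinant of I, which is - det I times the planar trace of
  h. With det I = - 1 / (E^2 q) and a traceless cross part, it is the trace of
  \<open>tr_horizon\<close> over E^2 q.\<close>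

lemma var_det_horizon:
  "var_inv I h Time Time * I Radial Radial + I Time Time * var_inv I h Radial Radial
     - 2 * (I Time Radial * var_inv I h Time Radial) = (4 * s + 2 * G) / (E\<^sup>2 * q)"
  using E0 q0 by (simp add: I var_inv_horizon' field_simps power2_eq_square)

end

text \<open>By \<open>theta_planar\<close> only four components of the covariant derivative of h'
  enter, and \<open>nab_horizon\<close> leaves a single one nonzero. The radial component that
  remains is symmetric under exchange of the two variations, so the antisymmetrized current
  vanishes.\<close>

lemma omega_half_values:
  assumes 1: "variation_jet s G J h k" and 2: "variation_jet s' G' J' h' k'"
  shows "omega_half I B h k h' k' Time = 0"
    "omega_half I B h k h' k' Radial
       = (4 * q * (s * G' + G * s') + 2 * q * G * G' + 2 * (c * G + J) * (c * G' + J')) / (E * q)"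
proof -
  note \<nu> = planar3_nab[OF planar3_chr[OF I(5) B(1)] variation_block[OF 2]]
  note \<Gamma>' = planar3_var_chr[OF 1]
  note \<nu>' = planar3_var_nab[OF \<Gamma>' variation_block(1)[OF 2]]
  have s: "I Time Radial = I Radial Time" "var_inv I h Time Radial = var_inv I h Radial Time"
    by (simp_all add: I var_inv_horizon'[OF 1])
  have d: "I Time Time * I Radial Radial - I Time Radial * I Time Radial = - 1 / (E\<^sup>2 * q)"
    using E0 q0 by (simp add: I field_simps power2_eq_square)
  have n: "var_nab (var_chr I B h k) h' Radial Time Radial = 0"
    "var_nab (var_chr I B h k) h' Time Radial Radial = 0"
    "var_nab (var_chr I B h k) h' Radial Time Time = 0"
    "var_nab (var_chr I B h k) h' Time Radial Time
       = - ((2 * J + 2 * c * G) * h' Time Radial + (2 * G * (q - c\<^sup>2) - 2 * c * J) * h' Radial Radial)"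
    by (simp_all add: var_nab_planar[OF \<Gamma>'] var_chr_horizon[OF 1] variation_sym[OF 2])
  note e = omega_half_def theta_planar[OF \<nu> s(1)] var_theta_planar[OF \<nu> \<nu>' s] d n nab_horizon[OF 2]
    tr_horizon[OF 1] var_det_horizon[OF 1]
  show "omega_half I B h k h' k' Time = 0"
    unfolding e by simp
  show "omega_half I B h k h' k' Radial
       = (4 * q * (s * G' + G * s') + 2 * q * G * G' + 2 * (c * G + J) * (c * G' + J')) / (E * q)"
    unfolding e variation_values[OF 2] using E0 q0 by (simp add: field_simps power2_eq_square)
qed

lemma omega_alg_horizon:
  assumes "variation_jet s G J h k" "variation_jet s' G' J' h' k'"
  shows "omega_alg I B h k h' k' Time = 0" "omega_alg I B h k h' k' Radial = 0"
  unfolding omega_alg_def omega_half_values[OF assms] omega_half_values[OF assms(2,1)]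
  by (simp_all add: algebra_simps)

end

section \<open>Rescaled tensors\<close>

text \<open>
  The hatted components are those in the frame \<open>\<rho>\<^sup>-\<^sup>1 \<partial>\<^sub>t, \<partial>\<^sub>\<rho>, \<partial>\<^sub>M\<close>, in which the metric is smooth and
  nondegenerate up to \<open>\<rho> = 0\<close>; \<open>rescaled_jet\<close> is the derivative along \<open>\<rho>\<close> times this frame.
\<close>

definition lam :: "real \<Rightarrow> 'm coord \<Rightarrow> real" where "lam r c = (if c = Time then r else 1)"

text \<open>The exponent of r in \<open>lam r c\<close>. Applying \<rho> \<partial>_\<rho> to the
  weights of a tensor component produces the term \<open>wt a + wt b\<close> of
  \<open>rescaled_jet\<close>.\<close>

definition wt :: "'m coord \<Rightarrow> real" where "wt c = (if c = Time then 1 else 0)"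

definition rescaled_jet :: "(real ^ ('m::finite) coord) set \<Rightarrow> (real ^ 'm coord \<Rightarrow> real ^ 'm coord ^ 'm coord)
    \<Rightarrow> real ^ 'm coord \<Rightarrow> 'm coord \<Rightarrow> 'm coord \<Rightarrow> 'm coord \<Rightarrow> real" where
  "rescaled_jet N f p c a b =
     (if c = Time then 1 else p $ Radial) * pd N c (\<lambda>q. f q $ a $ b) p
     + (if c = Radial then (wt a + wt b) * f p $ a $ b else 0)"

definition rescales where
  "rescales N f fh \<longleftrightarrow> (\<forall>p\<in>N. 0 < p $ Radial \<longrightarrow>
     (\<forall>a b. f p $ a $ b = lam (p $ Radial) a * lam (p $ Radial) b * fh p $ a $ b))"
  for fh :: "real ^ ('m::finite) coord \<Rightarrow> real ^ 'm coord ^ 'm coord"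

lemma rescalesD:
  "rescales N f fh \<Longrightarrow> p \<in> N \<Longrightarrow> 0 < p $ Radial \<Longrightarrow> f p $ a $ b = lam (p $ Radial) a * lam (p $ Radial) b * fh p $ a $ b"
  by (simp add: rescales_def)

lemma det_rescaled:
  fixes A B :: "real ^ ('m::finite) coord ^ 'm coord"
  assumes "\<And>a b. A $ a $ b = lam r a * lam r b * B $ a $ b"
  shows "det A = r\<^sup>2 * det B"
proof -
  define L :: "real ^ 'm coord ^ 'm coord" where "L = (\<chi> a b. if a = b then lam r a else 0)"
  have "det L = (\<Prod>a\<in>(UNIV :: 'm coord set). lam r a)"
    by (subst det_diagonal) (auto simp: L_def)
  also have "\<dots> = r" by (simp add: lam_def)
  finally have "det L = r" .
  moreover have "A = L ** B ** L"
    by (simp add: vec_eq_iff matrix_mult_entry L_def assms if_distrib if_distribR mult_ac cong: if_cong)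
  ultimately show ?thesis by (simp add: det_mul power2_eq_square)
qed

lemma inv_rescaled:
  fixes A B :: "real ^ ('m::finite) coord ^ 'm coord"
  assumes "\<And>a b. A $ a $ b = lam r a * lam r b * B $ a $ b" "r \<noteq> 0" "det B \<noteq> 0"
  shows "matrix_inv A $ a $ b = matrix_inv B $ a $ b / (lam r a * lam r b)"
proof -
  have l: "lam r c \<noteq> 0" for c :: "'m coord" using assms(2) by (simp add: lam_def)
  have "A ** (\<chi> a b. matrix_inv B $ a $ b / (lam r a * lam r b)) = mat 1"
  proof (simp only: vec_eq_iff, intro allI)
    fix i j
    have "(A ** (\<chi> a b. matrix_inv B $ a $ b / (lam r a * lam r b))) $ i $ j
      = (\<Sum>k\<in>UNIV. lam r i / lam r j * (B $ i $ k * matrix_inv B $ k $ j))"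
      unfolding matrix_mult_entry by (intro sum.cong refl) (use l in \<open>simp add: assms(1) field_simps\<close>)
    also have "\<dots> = lam r i / lam r j * (B ** matrix_inv B) $ i $ j"
      by (simp add: matrix_mult_entry sum_distrib_left)
    also have "\<dots> = mat 1 $ i $ j" using l by (simp add: matrix_inv_inverse[OF assms(3)] mat_def)
    finally show "(A ** (\<chi> a b. matrix_inv B $ a $ b / (lam r a * lam r b))) $ i $ j = mat 1 $ i $ j" .
  qed
  from matrix_inv_unique(1)[OF this] show ?thesis by simp
qed

context collar_domain
begin

lemma smooth_on_lam: "smooth_on N (\<lambda>q. lam (q $ Radial) a)"
  by (cases "a = Time") (auto simp: lam_def intro: smooth_on_component smooth_on_const)

lemma pd_lam: "p \<in> N \<Longrightarrow> pd N c (\<lambda>q. lam (q $ Radial) a) p = (if c = Radial then wt a else 0)"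
  by (cases "a = Time") (auto simp: lam_def wt_def pd_coord[OF fat_N] pd_const[OF fat_N])

lemma jet_rescaled:
  assumes "rescales N f fh" "smooth_tensor N fh" "p \<in> N" "0 < p $ Radial"
  shows "jet N f p c a b = lam (p $ Radial) a * lam (p $ Radial) b * lam (p $ Radial) c / p $ Radial * rescaled_jet N fh p c a b"
proof -
  note s = smooth_tensorD[OF assms(2), of a b]
  let ?l = "\<lambda>a q. lam (q $ Radial) a"
  have "jet N f p c a b = pd N c (\<lambda>q. ?l a q * (?l b q * fh q $ a $ b)) p"
    unfolding jet_def
    by (rule pd_cong_interior[OF _ _ assms(3,4)])
      (auto intro!: smooth_on_mult smooth_on_lam s simp: rescalesD[OF assms(1)])
  also have "\<dots> = ?l a p * (?l b p * pd N c (\<lambda>q. fh q $ a $ b) p + (if c = Radial then wt b else 0) * fh p $ a $ b)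
      + (if c = Radial then wt a else 0) * (?l b p * fh p $ a $ b)"
    by (simp add: pd_mult[OF fat_N assms(3)] smooth_on_mult smooth_on_lam s pd_lam[OF assms(3)])
  also have "\<dots> = ?l a p * ?l b p * ?l c p / p $ Radial * rescaled_jet N fh p c a b"
    using assms(4) by (simp add: rescaled_jet_def lam_def wt_def field_simps)
  finally show ?thesis .
qed

lemma smooth_rescaled_jet:
  assumes "smooth_tensor N fh" shows "smooth_on N (\<lambda>p. rescaled_jet N fh p c a b)"
proof -
  have "smooth_on N (\<lambda>p. if c = Time then 1 else p $ Radial)"
    "smooth_on N (\<lambda>p. if c = Radial then (wt a + wt b) * fh p $ a $ b else 0)"
    by (cases "c = Time"; simp add: smooth_on_const smooth_on_component)
      (cases "c = Radial"; simp add: smooth_on_const smooth_on_mult smooth_tensorD[OF assms])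
  then show ?thesis unfolding rescaled_jet_def
    by (intro smooth_on_add smooth_on_mult pd_smooth[OF fat_N] smooth_tensorD[OF assms])
qed

lemma pd_Time_eq:
  assumes "smooth_on N f" "x \<in> U" "\<And>s. f (point s 0 x) = \<phi> s" "(\<phi> has_real_derivative d) (at t)"
  shows "pd N Time f (point t 0 x) = d"
proof -
  have "(\<lambda>s. f (point s 0 x)) = \<phi>" by (rule ext) (rule assms(3))
  then show ?thesis using DERIV_unique[OF pd_Time_boundary[OF assms(1,2), of t]] assms(4) by simp
qed

section \<open>The symplectic current in the rescaled frame\<close>

definition rescaled_omega where
  "rescaled_omega Gn gh h1 h2 p m = sqrt (- det (gh p)) / (16 * pi * Gn) *
     omega_alg (\<lambda>a b. ginv gh p $ a $ b) (rescaled_jet N gh p) (\<lambda>a b. h1 p $ a $ b) (rescaled_jet N h1 p)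
       (\<lambda>a b. h2 p $ a $ b) (rescaled_jet N h2 p) m"

text \<open>The density contributes sqrt (- det g) = \<rho> sqrt (- det gh), which cancels the 1 /
  \<rho> of the derivative; only the weight of the upper index is left.\<close>

lemma omega_rescaled:
  assumes g: "smooth_tensor N g" "smooth_tensor N gh" "rescales N g gh"
    and h1: "smooth_tensor N h1" "smooth_tensor N hh1" "rescales N h1 hh1" "\<And>a b. h1 p $ a $ b = h1 p $ b $ a"
    and h2: "smooth_tensor N h2" "smooth_tensor N hh2" "rescales N h2 hh2" "\<And>a b. h2 p $ a $ b = h2 p $ b $ a"
    and p: "p \<in> N" "0 < p $ Radial" "det (gh p) < 0"
  shows "omega Gn N g h1 h2 p $ m = rescaled_omega Gn gh hh1 hh2 p m / lam (p $ Radial) m"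
proof -
  let ?r = "p $ Radial"
  have d: "det (g p) = ?r\<^sup>2 * det (gh p)" by (rule det_rescaled) (rule rescalesD[OF g(3) p(1,2)])
  then have neg: "det (g p) < 0" using p by (simp add: mult_pos_neg)
  have sq: "sqrt (- det (g p)) = ?r * sqrt (- det (gh p))"
  proof -
    have "- det (g p) = ?r\<^sup>2 * (- det (gh p))" unfolding d by simp
    then show ?thesis by (simp only: real_sqrt_mult real_sqrt_abs abs_of_pos[OF p(2)])
  qed
  interpret diagonal_rescaling "lam ?r" ?r
    using p by unfold_locales (auto simp: lam_def)
  have I: "ginv g p $ a $ b = ginv gh p $ a $ b / (lam ?r a * lam ?r b)" for a b
    by (rule inv_rescaled) (use p in \<open>auto intro: rescalesD[OF g(3)]\<close>)
  show ?thesis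
    unfolding omega_eq_alg[OF fat_N p(1) g(1) h1(1) h2(1) neg h1(4) h2(4)] sq
      omega_alg_scale[where I'="\<lambda>a b. ginv gh p $ a $ b", OF I jet_rescaled[OF g(3,2) p(1,2)]
        rescalesD[OF h1(3) p(1,2)] jet_rescaled[OF h1(3,2) p(1,2)]
        rescalesD[OF h2(3) p(1,2)] jet_rescaled[OF h2(3,2) p(1,2)]]
    using p(2) by (simp add: rescaled_omega_def)
qed

lemma smooth_rescaled_omega:
  assumes "smooth_tensor N gh" "smooth_tensor N h1" "smooth_tensor N h2" "D \<subseteq> N" "\<And>p. p \<in> D \<Longrightarrow> det (gh p) < 0"
  shows "smooth_on D (\<lambda>p. rescaled_omega Gn gh h1 h2 p m)"
proof -
  have t: "smooth_on D (\<lambda>p. f p $ a $ b)" and j: "smooth_on D (\<lambda>p. rescaled_jet N f p c a b)"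
    if "smooth_tensor N f" for f a b c
    using smooth_on_subset[OF smooth_tensorD[OF that] assms(4)]
      smooth_on_subset[OF smooth_rescaled_jet[OF that] assms(4)] by auto
  have "smooth_on D (\<lambda>p. sqrt (- det (gh p)))"
    by (intro smooth_on_sqrt smooth_on_minus smooth_on_det t[OF assms(1)]) (use assms(5) in force)
  moreover have I: "smooth_on D (\<lambda>p. ginv gh p $ a $ b)" for a b
    by (intro smooth_on_matrix_inv t[OF assms(1)]) (use assms(5) in force)
  ultimately show ?thesis
    unfolding rescaled_omega_def divide_inverse
    by (intro smooth_on_mult smooth_on_const smooth_on_omega_alg I t j assms(1-3))
qed

subsection \<open>Lie derivatives\<close>

text \<open>The asymptotic conditions of the algebra as conditions on the radial 1-jet at \<rho> =
  0; \<open>adapted_iff\<close> is the equivalence. Smoothness of the coefficients and the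
  divergence condition on K are stated separately.\<close>

definition adapted where
  "adapted V F G H J K \<longleftrightarrow> (\<forall>c. smooth_on N (\<lambda>p. V p $ c)) \<and> (\<forall>t. \<forall>x\<in>U.
     V (point t 0 x) $ Time = F x + t * G x \<and> V (point t 0 x) $ Radial = 0 \<and>
     (\<forall>i. V (point t 0 x) $ Cross i = K x $ i) \<and>
     pd N Radial (\<lambda>p. V p $ Time) (point t 0 x) = 0 \<and>
     pd N Radial (\<lambda>p. V p $ Radial) (point t 0 x) = H x + t * J x \<and>
     (\<forall>i. pd N Radial (\<lambda>p. V p $ Cross i) (point t 0 x) = 0))"

lemma adaptedD:
  assumes "adapted V F G H J K"
  shows "smooth_on N (\<lambda>p. V p $ c)"
    "x \<in> U \<Longrightarrow> V (point t 0 x) $ Time = F x + t * G x" "x \<in> U \<Longrightarrow> V (point t 0 x) $ Radial = 0"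
    "x \<in> U \<Longrightarrow> V (point t 0 x) $ Cross i = K x $ i"
    "x \<in> U \<Longrightarrow> pd N Radial (\<lambda>p. V p $ Time) (point t 0 x) = 0"
    "x \<in> U \<Longrightarrow> pd N Radial (\<lambda>p. V p $ Radial) (point t 0 x) = H x + t * J x"
    "x \<in> U \<Longrightarrow> pd N Radial (\<lambda>p. V p $ Cross i) (point t 0 x) = 0"
  using assms by (auto simp: adapted_def)

lemma adapted_pd:
  assumes V: "adapted V F G H J K" and x: "x \<in> U"
  shows "pd N Time (\<lambda>p. V p $ Time) (point t 0 x) = G x"
    "a \<noteq> Radial \<Longrightarrow> pd N a (\<lambda>p. V p $ Radial) (point t 0 x) = 0"
    "pd N Time (\<lambda>p. V p $ Cross i) (point t 0 x) = 0"
    "pd N (Cross j) (\<lambda>p. V p $ Cross i) (point t 0 x) = pd U j (\<lambda>y. K y $ i) x"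
proof -
  show "pd N Time (\<lambda>p. V p $ Time) (point t 0 x) = G x"
    by (rule pd_Time_eq[where \<phi>="\<lambda>s. F x + s * G x", OF adaptedD(1)[OF V] x])
      (auto intro!: derivative_eq_intros simp: adaptedD[OF V] x)
  show "a \<noteq> Radial \<Longrightarrow> pd N a (\<lambda>p. V p $ Radial) (point t 0 x) = 0"
    by (rule pd_tangent_zero[OF adaptedD(1)[OF V] adaptedD(3)[OF V] _ x])
  show "pd N Time (\<lambda>p. V p $ Cross i) (point t 0 x) = 0"
    by (rule pd_Time_eq[where \<phi>="\<lambda>s. K x $ i", OF adaptedD(1)[OF V] x]) (auto simp: adaptedD[OF V] x)
  have "smooth_on U (\<lambda>y. V (point t 0 y) $ Cross i)"
    by (rule smooth_on_compose[OF smooth_on_point adaptedD(1)[OF V] boundary_in])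
  then show "pd N (Cross j) (\<lambda>p. V p $ Cross i) (point t 0 x) = pd U j (\<lambda>y. K y $ i) x"
    unfolding pd_Cross_boundary[OF adaptedD(1)[OF V] x]
    by (intro pd_cong[OF open_fat[OF open_U] x, symmetric]) (auto simp: adaptedD[OF V])
qed

text \<open>The gradient of V in the rescaled frame, in the sense of \<open>field_grad_eq\<close>.
  Its components \<partial>_t V^c / \<rho> are smooth because on the horizon V^\<rho> vanishes and
  V^M does not depend on t.\<close>

definition field_grad where
  "field_grad V c a p = (if c = Time then (if a = Time then 1 else p $ Radial) * pd N a (\<lambda>q. V q $ Time) p
     else if a = Time then rho_quot N (pd N Time (\<lambda>q. V q $ c)) p else pd N a (\<lambda>q. V q $ c) p)"

lemma adapted_pd_Time_zero:
  "adapted V F G H J K \<Longrightarrow> c \<noteq> Time \<Longrightarrow> x \<in> U \<Longrightarrow> pd N Time (\<lambda>q. V q $ c) (point t 0 x) = 0"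
  by (cases c) (auto simp: adapted_pd)

lemma smooth_field_grad:
  assumes "adapted V F G H J K" shows "smooth_on N (field_grad V c a)"
proof -
  have 1: "smooth_on N (pd N a (\<lambda>q. V q $ c))" for a c
    by (rule pd_smooth[OF fat_N adaptedD(1)[OF assms]])
  have 2: "smooth_on N (rho_quot N (pd N Time (\<lambda>q. V q $ c)))" if "c \<noteq> Time"
    by (rule smooth_on_rho_quot[where f="pd N Time (\<lambda>q. V q $ c)", OF 1 adapted_pd_Time_zero[OF assms that]])
  have "smooth_on N (\<lambda>p. if c = Time then (if a = Time then 1 else p $ Radial) * pd N a (\<lambda>q. V q $ Time) p
     else if a = Time then rho_quot N (pd N Time (\<lambda>q. V q $ c)) p else pd N a (\<lambda>q. V q $ c) p)"
    using 1[of a] 2 by (cases "c = Time"; cases "a = Time") (auto intro!: smooth_on_mult smooth_on_const smooth_on_component)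
  then show ?thesis unfolding field_grad_def[abs_def] .
qed

lemma field_grad_eq:
  assumes "adapted V F G H J K" "p \<in> N" "0 < p $ Radial"
  shows "lam (p $ Radial) c * pd N a (\<lambda>q. V q $ c) p = lam (p $ Radial) a * field_grad V c a p"
  using rho_quot_mult[where f="pd N Time (\<lambda>q. V q $ c)", OF adapted_pd_Time_zero[OF assms(1)] assms(2)] by (auto simp: field_grad_def lam_def)

lemma field_grad_boundary:
  assumes V: "adapted V F G H J K" and x: "x \<in> U"
  shows "field_grad V Time Time (point t 0 x) = G x" "a \<noteq> Time \<Longrightarrow> field_grad V Time a (point t 0 x) = 0"
    "field_grad V Radial Time (point t 0 x) = J x" "field_grad V Radial Radial (point t 0 x) = H x + t * J x"
    "field_grad V Radial (Cross i) (point t 0 x) = 0"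
    "field_grad V (Cross i) Time (point t 0 x) = 0" "field_grad V (Cross i) Radial (point t 0 x) = 0"
    "field_grad V (Cross i) (Cross j) (point t 0 x) = pd U j (\<lambda>y. K y $ i) x"
proof -
  note s = pd_smooth[OF fat_N adaptedD(1)[OF V]]
  \<comment> \<open>On the horizon the quotient is \<partial>_\<rho> \<partial>_t V^c; in the other
    order it is the t-derivative of a radial derivative that \<open>adapted\<close> prescribes. This
    is how J enters.\<close>
  have r: "rho_quot N (pd N Time (\<lambda>q. V q $ c)) (point t 0 x)
      = pd N Time (pd N Radial (\<lambda>q. V q $ c)) (point t 0 x)" for c
    unfolding rho_quot_boundary by (rule pd_symmetric[OF fat_N boundary_in[OF x] adaptedD(1)[OF V]])
  show "field_grad V Radial Time (point t 0 x) = J x"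
    unfolding field_grad_def using r[of Radial]
    by (simp, intro pd_Time_eq[where \<phi>="\<lambda>s. H x + s * J x", OF s x])
      (auto intro!: derivative_eq_intros simp: adaptedD[OF V] x)
  show "field_grad V (Cross i) Time (point t 0 x) = 0"
    unfolding field_grad_def using r[of "Cross i"]
    by (simp, intro pd_Time_eq[where \<phi>="\<lambda>s. 0", OF s x]) (auto simp: adaptedD[OF V] x)
qed (auto simp: field_grad_def adapted_pd[OF V x] adaptedD[OF V] x)

text \<open>The middle term is the derivative of the weights along V: V^\<rho> / \<rho> times the
  number of t-indices.\<close>

definition rescaled_lie where
  "rescaled_lie V gh p = (\<chi> a b. (\<Sum>c\<in>UNIV. V p $ c * pd N c (\<lambda>q. gh q $ a $ b) p)
     + (wt a + wt b) * rho_quot N (\<lambda>q. V q $ Radial) p * gh p $ a $ b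
     + (\<Sum>c\<in>UNIV. gh p $ c $ b * field_grad V c a p + gh p $ a $ c * field_grad V c b p))"

lemma smooth_lie_derivative:
  assumes "smooth_tensor N g" "\<And>c. smooth_on N (\<lambda>p. V p $ c)"
  shows "smooth_tensor N (lie_derivative N V g)"
  unfolding smooth_tensor_def lie_derivative_def
  by (auto intro!: smooth_on_sum smooth_on_add smooth_on_mult pd_smooth[OF fat_N] smooth_tensorD[OF assms(1)] assms(2))

lemma smooth_rescaled_lie:
  assumes "smooth_tensor N gh" "adapted V F G H J K"
  shows "smooth_tensor N (rescaled_lie V gh)"
  unfolding smooth_tensor_def rescaled_lie_def
  by (auto intro!: smooth_on_sum smooth_on_add smooth_on_mult pd_smooth[OF fat_N] smooth_tensorD[OF assms(1)]
      smooth_field_grad[OF assms(2)] adaptedD(1)[OF assms(2)] smooth_on_const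
      smooth_on_rho_quot[OF adaptedD(1,3)[OF assms(2)]])

lemma lie_rescaled:
  assumes g: "rescales N g gh" "smooth_tensor N gh" and V: "adapted V F G H J K"
  shows "rescales N (lie_derivative N V g) (rescaled_lie V gh)"
  unfolding rescales_def
proof (intro ballI impI allI)
  fix p a b assume p: "p \<in> N" "0 < p $ Radial"
  let ?l = "lam (p $ Radial)"
  have V\<rho>: "V p $ Radial = p $ Radial * rho_quot N (\<lambda>q. V q $ Radial) p"
    by (rule rho_quot_mult[where f="\<lambda>q. V q $ Radial", OF adaptedD(3)[OF V] p(1)])
  have "(\<Sum>c\<in>UNIV. V p $ c * jet N g p c a b)
    = ?l a * ?l b * ((\<Sum>c\<in>UNIV. V p $ c * pd N c (\<lambda>q. gh q $ a $ b) p)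
     + (wt a + wt b) * rho_quot N (\<lambda>q. V q $ Radial) p * gh p $ a $ b)"
    unfolding jet_rescaled[OF g p] using p(2)
    by (simp add: sum_coord rescaled_jet_def lam_def V\<rho> field_simps sum_distrib_left)
  moreover have "g p $ c $ b * pd N a (\<lambda>q. V q $ c) p = ?l a * ?l b * (gh p $ c $ b * field_grad V c a p)" for c
    using field_grad_eq[OF V p, of c a] unfolding rescalesD[OF g(1) p] by (simp add: mult_ac)
  moreover have "g p $ a $ c * pd N b (\<lambda>q. V q $ c) p = ?l a * ?l b * (gh p $ a $ c * field_grad V c b p)" for c
    using field_grad_eq[OF V p, of c b] unfolding rescalesD[OF g(1) p] by (simp add: mult_ac)
  ultimately show "lie_derivative N V g p $ a $ b = ?l a * ?l b * rescaled_lie V gh p $ a $ b"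
    by (simp add: lie_derivative_def rescaled_lie_def jet_def sum.distrib distrib_left sum_distrib_left add.assoc)
qed

lemma lie_symmetric:
  assumes "\<And>q a b. q \<in> N \<Longrightarrow> g q $ a $ b = g q $ b $ a" "smooth_tensor N g" "p \<in> N"
  shows "lie_derivative N V g p $ a $ b = lie_derivative N V g p $ b $ a"
proof -
  have "pd N c (\<lambda>q. g q $ a $ b) p = pd N c (\<lambda>q. g q $ b $ a) p" for c
    by (rule pd_cong[OF fat_N assms(3) smooth_tensorD[OF assms(2)] assms(1)])
  then show ?thesis unfolding lie_derivative_def
    by (auto intro!: sum.cong simp: assms(1)[OF assms(3), of _ b] assms(1)[OF assms(3), of _ a])
qed

end

section \<open>Metrics with a horizon\<close>

lemma pd_directional:
  assumes "open U" "x \<in> U" "(f has_derivative D) (at x)"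
  shows "(\<Sum>i\<in>UNIV. v $ i * pd U i f x) = D v"
proof -
  have "pd U i f x = D (axis i 1)" for i
    using pdI[OF open_fat[OF assms(1)] assms(2), of f D] assms(3) by (simp add: has_derivative_at_withinI)
  then show ?thesis
    using linear_expansion[OF has_derivative_linear[OF assms(3)], of v] by simp
qed

lemma pd_has_derivative_at:
  assumes "open U" "x \<in> U" "smooth_on U f"
  shows "(f has_derivative (\<lambda>v. \<Sum>i\<in>UNIV. v $ i * pd U i f x)) (at x)"
  using pd_has_derivative[OF assms(3,2)] by (simp only: at_within_open[OF assms(2,1)])

text \<open>The expression is \<open>2 d\<close> times the divergence of \<open>K\<close> with respect to the volume density \<open>\<bar>d\<bar>\<^sup>1\<^sup>/\<^sup>2\<close>.\<close>

definition divfree :: "(real ^ 'm) set \<Rightarrow> (real ^ 'm \<Rightarrow> real) \<Rightarrow> (real ^ 'm \<Rightarrow> real ^ ('m::finite)) \<Rightarrow> bool" where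
  "divfree U d K \<longleftrightarrow> (\<forall>x\<in>U. (\<Sum>i\<in>UNIV. K x $ i * pd U i d x)
     + 2 * d x * (\<Sum>i\<in>UNIV. pd U i (\<lambda>y. K y $ i) x) = 0)"

text \<open>The trace of the Lie derivative of a metric is twice the divergence: the first sum gives
  K applied to ln det \<gamma>, and each of the other two gives \<partial>_i K^i.\<close>

lemma trace_lie_metric:
  fixes \<gamma> :: "real ^ 'm \<Rightarrow> real ^ 'm ^ ('m::finite)"
  assumes U: "open U" "x \<in> U" and \<gamma>: "\<And>a b. smooth_on U (\<lambda>y. \<gamma> y $ a $ b)"
    "\<And>y a b. y \<in> U \<Longrightarrow> \<gamma> y $ a $ b = \<gamma> y $ b $ a" "det (\<gamma> x) \<noteq> 0"
    and K: "divfree U (\<lambda>y. det (\<gamma> y)) K"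
  shows "(\<Sum>i\<in>UNIV. \<Sum>j\<in>UNIV. matrix_inv (\<gamma> x) $ i $ j * ((\<Sum>l\<in>UNIV. K x $ l * pd U l (\<lambda>y. \<gamma> y $ i $ j) x)
     + (\<Sum>l\<in>UNIV. \<gamma> x $ l $ j * pd U i (\<lambda>y. K y $ l) x + \<gamma> x $ i $ l * pd U j (\<lambda>y. K y $ l) x))) = 0"
proof -
  let ?I = "matrix_inv (\<gamma> x)"
  note f = open_fat[OF U(1)]
  have "(\<Sum>i\<in>UNIV. \<Sum>j\<in>UNIV. ?I $ i $ j * (\<Sum>l\<in>UNIV. K x $ l * pd U l (\<lambda>y. \<gamma> y $ i $ j) x))
    = (\<Sum>l\<in>UNIV. K x $ l * (\<Sum>i\<in>UNIV. \<Sum>j\<in>UNIV. ?I $ i $ j * pd U l (\<lambda>y. \<gamma> y $ i $ j) x))"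
    unfolding sum_distrib_left
    by (subst (3) sum.swap, subst (2) sum.swap) (auto intro!: sum.cong simp: mult_ac)
  also have "\<dots> = (\<Sum>l\<in>UNIV. K x $ l * (pd U l (\<lambda>y. det (\<gamma> y)) x / det (\<gamma> x)))"
  proof (intro sum.cong refl arg_cong2[where f="(*)"])
    fix l
    have "pd U l (\<lambda>y. \<gamma> y $ j $ i) x = pd U l (\<lambda>y. \<gamma> y $ i $ j) x" for i j
      by (rule pd_cong[OF f U(2) \<gamma>(1,2)])
    then show "(\<Sum>i\<in>UNIV. \<Sum>j\<in>UNIV. ?I $ i $ j * pd U l (\<lambda>y. \<gamma> y $ i $ j) x)
        = pd U l (\<lambda>y. det (\<gamma> y)) x / det (\<gamma> x)"
      using \<gamma>(3) by (simp add: pd_det[OF f U(2) \<gamma>(1,3)])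
  qed
  finally have 1: "(\<Sum>i\<in>UNIV. \<Sum>j\<in>UNIV. ?I $ i $ j * (\<Sum>l\<in>UNIV. K x $ l * pd U l (\<lambda>y. \<gamma> y $ i $ j) x))
    = (\<Sum>l\<in>UNIV. K x $ l * pd U l (\<lambda>y. det (\<gamma> y)) x) / det (\<gamma> x)"
    by (simp add: sum_divide_distrib)
  have g1: "(\<Sum>j\<in>UNIV. ?I $ i $ j * \<gamma> x $ l $ j) = (if i = l then 1 else 0)" for i l
  proof -
    have "(?I ** \<gamma> x) $ i $ l = mat 1 $ i $ l" by (simp only: matrix_inv_inverse(2)[OF \<gamma>(3)])
    then show ?thesis unfolding matrix_mult_entry mat_def by (simp add: \<gamma>(2)[OF U(2), of l])
  qed
  have g2: "(\<Sum>i\<in>UNIV. ?I $ i $ j * \<gamma> x $ i $ l) = (if j = l then 1 else 0)" for j l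
  proof -
    have "(\<gamma> x ** ?I) $ l $ j = mat 1 $ l $ j" by (simp only: matrix_inv_inverse(1)[OF \<gamma>(3)])
    then show ?thesis unfolding matrix_mult_entry mat_def by (simp add: \<gamma>(2)[OF U(2), of l] mult.commute eq_commute)
  qed
  have 2: "(\<Sum>i\<in>UNIV. \<Sum>j\<in>UNIV. ?I $ i $ j * (\<Sum>l\<in>UNIV. \<gamma> x $ l $ j * pd U i (\<lambda>y. K y $ l) x))
     = (\<Sum>i\<in>UNIV. pd U i (\<lambda>y. K y $ i) x)"
  proof (intro sum.cong refl)
    fix i
    have "(\<Sum>j\<in>UNIV. ?I $ i $ j * (\<Sum>l\<in>UNIV. \<gamma> x $ l $ j * pd U i (\<lambda>y. K y $ l) x))
      = (\<Sum>l\<in>UNIV. (\<Sum>j\<in>UNIV. ?I $ i $ j * \<gamma> x $ l $ j) * pd U i (\<lambda>y. K y $ l) x)"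
      unfolding sum_distrib_left sum_distrib_right by (subst sum.swap) (simp add: mult.assoc)
    then show "(\<Sum>j\<in>UNIV. ?I $ i $ j * (\<Sum>l\<in>UNIV. \<gamma> x $ l $ j * pd U i (\<lambda>y. K y $ l) x)) = pd U i (\<lambda>y. K y $ i) x"
      by (simp add: g1 if_distrib if_distribR cong: if_cong)
  qed
  have 3: "(\<Sum>i\<in>UNIV. \<Sum>j\<in>UNIV. ?I $ i $ j * (\<Sum>l\<in>UNIV. \<gamma> x $ i $ l * pd U j (\<lambda>y. K y $ l) x))
     = (\<Sum>j\<in>UNIV. pd U j (\<lambda>y. K y $ j) x)"
  proof (subst sum.swap, intro sum.cong refl)
    fix j
    have "(\<Sum>i\<in>UNIV. ?I $ i $ j * (\<Sum>l\<in>UNIV. \<gamma> x $ i $ l * pd U j (\<lambda>y. K y $ l) x))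
      = (\<Sum>l\<in>UNIV. (\<Sum>i\<in>UNIV. ?I $ i $ j * \<gamma> x $ i $ l) * pd U j (\<lambda>y. K y $ l) x)"
      unfolding sum_distrib_left sum_distrib_right by (subst sum.swap) (simp add: mult.assoc)
    then show "(\<Sum>i\<in>UNIV. ?I $ i $ j * (\<Sum>l\<in>UNIV. \<gamma> x $ i $ l * pd U j (\<lambda>y. K y $ l) x)) = pd U j (\<lambda>y. K y $ j) x"
      by (simp add: g2 if_distrib if_distribR cong: if_cong)
  qed
  show ?thesis
    unfolding distrib_left sum.distrib 1 2 3
    using K \<gamma>(3) U(2) by (simp add: divfree_def field_simps)
qed

text \<open>The metrics to which the planar model applies: gbar, with e = c = 0 and q = \<kappa>^2,
  and its pullbacks. The determinant of gh is controlled on the horizon only;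
  \<open>collar_nondegenerate\<close> extends this to a smaller collar.\<close>

locale horizon_metric = collar_domain U N
  for U :: "(real ^ ('m::finite)) set" and N :: "(real ^ 'm coord) set" +
  fixes g gh :: "real ^ 'm coord \<Rightarrow> real ^ 'm coord ^ 'm coord"
    and e c q :: "real ^ 'm \<Rightarrow> real" and \<gamma> :: "real ^ 'm \<Rightarrow> real ^ 'm ^ 'm"
  assumes g: "smooth_tensor N g" and gh: "smooth_tensor N gh" and g_gh: "rescales N g gh"
    and g_sym: "\<And>p a b. p \<in> N \<Longrightarrow> g p $ a $ b = g p $ b $ a"
    and gh_sym: "\<And>p a b. p \<in> N \<Longrightarrow> gh p $ a $ b = gh p $ b $ a"
    and smooth_ecq: "smooth_on U e" "smooth_on U c" "smooth_on U q"
    and q_pos: "\<And>x. x \<in> U \<Longrightarrow> 0 < q x"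
    and boundary_det: "\<And>t x. x \<in> U \<Longrightarrow> det (gh (point t 0 x)) < 0"
    and boundary:
      "\<And>t x. x \<in> U \<Longrightarrow> gh (point t 0 x) $ Radial $ Radial = exp (2 * (e x + t * c x))"
      "\<And>t x. x \<in> U \<Longrightarrow> gh (point t 0 x) $ Time $ Radial = exp (2 * (e x + t * c x)) * c x"
      "\<And>t x. x \<in> U \<Longrightarrow> gh (point t 0 x) $ Time $ Time = exp (2 * (e x + t * c x)) * ((c x)\<^sup>2 - q x)"
      "\<And>t x i. x \<in> U \<Longrightarrow> gh (point t 0 x) $ Time $ Cross i = 0"
      "\<And>t x i. x \<in> U \<Longrightarrow> gh (point t 0 x) $ Radial $ Cross i = 0"
      "\<And>t x i j. x \<in> U \<Longrightarrow> gh (point t 0 x) $ Cross i $ Cross j = \<gamma> x $ i $ j"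
begin

lemma boundary':
  assumes "x \<in> U"
  shows "gh (point t 0 x) $ Radial $ Time = exp (2 * (e x + t * c x)) * c x"
    "gh (point t 0 x) $ Cross i $ Time = 0" "gh (point t 0 x) $ Cross i $ Radial = 0"
  using gh_sym[OF boundary_in[OF assms, of t]] boundary[OF assms] by metis+

lemma smooth_\<gamma>: "smooth_on U (\<lambda>y. \<gamma> y $ i $ j)"
  by (rule smooth_on_cong[OF boundary(6)[where t=0]])
    (auto intro: smooth_on_compose[OF smooth_on_point smooth_tensorD[OF gh] boundary_in])

lemma sym_\<gamma>: "x \<in> U \<Longrightarrow> \<gamma> x $ i $ j = \<gamma> x $ j $ i"
  using gh_sym[OF boundary_in, of x 0 "Cross i" "Cross j"] by (simp add: boundary)

text \<open>A null vector of \<gamma>, extended by zero, would be a null vector of gh on the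
  horizon, where the cross block decouples.\<close>

lemma det_\<gamma>: assumes "x \<in> U" shows "det (\<gamma> x) \<noteq> 0"
proof -
  have "v = 0" if v: "\<gamma> x *v v = 0" for v
  proof -
    define w :: "real ^ 'm coord" where "w = point 0 0 v"
    have "gh (point 0 0 x) *v w = 0"
    proof (simp only: vec_eq_iff, rule allI)
      fix a
      show "(gh (point 0 0 x) *v w) $ a = 0 $ a"
      proof (cases a)
        case (Cross i)
        have "(\<Sum>j\<in>UNIV. \<gamma> x $ i $ j * v $ j) = 0"
          using v by (simp add: vec_eq_iff matrix_vector_mult_def)
        then show ?thesis using Cross
          by (simp add: matrix_vector_mult_def sum_coord w_def boundary[OF assms])
      qed (simp_all add: matrix_vector_mult_def sum_coord w_def boundary[OF assms])
    qed
    moreover have "det (gh (point 0 0 x)) \<noteq> 0" using boundary_det[OF assms, of 0] by simp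
    then have "\<forall>w. gh (point 0 0 x) *v w = 0 \<longrightarrow> w = 0"
      unfolding invertible_det_nz[symmetric] invertible_left_inverse matrix_left_invertible_ker .
    ultimately have "w = 0" by blast
    then have "w $ Cross i = 0" for i by simp
    then show "v = 0" by (simp add: w_def vec_eq_iff)
  qed
  then show ?thesis
    unfolding invertible_det_nz[symmetric] invertible_left_inverse matrix_left_invertible_ker by blast
qed

lemma inv_boundary:
  assumes x: "x \<in> U"
  shows "ginv gh (point t 0 x) $ a $ b = (case a of
      Time \<Rightarrow> (case b of Time \<Rightarrow> - 1 / (exp (2 * (e x + t * c x)) * q x)
        | Radial \<Rightarrow> c x / (exp (2 * (e x + t * c x)) * q x) | Cross j \<Rightarrow> 0)
    | Radial \<Rightarrow> (case b of Time \<Rightarrow> c x / (exp (2 * (e x + t * c x)) * q x)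
        | Radial \<Rightarrow> (q x - (c x)\<^sup>2) / (exp (2 * (e x + t * c x)) * q x) | Cross j \<Rightarrow> 0)
    | Cross i \<Rightarrow> (case b of Cross j \<Rightarrow> matrix_inv (\<gamma> x) $ i $ j | _ \<Rightarrow> 0))"
    (is "_ = ?B a b")
proof -
  have q: "q x \<noteq> 0" using q_pos[OF x] by simp
  have "gh (point t 0 x) ** (\<chi> a b. ?B a b) = mat 1"
  proof (simp only: vec_eq_iff, intro allI)
    fix a b
    have "(\<Sum>k\<in>UNIV. \<gamma> x $ i $ k * matrix_inv (\<gamma> x) $ k $ j) = mat 1 $ i $ j" for i j
      using matrix_inv_inverse(1)[OF det_\<gamma>[OF x]] by (metis matrix_mult_entry)
    then show "(gh (point t 0 x) ** (\<chi> a b. ?B a b)) $ a $ b = mat 1 $ a $ b"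
      using q by (cases a; cases b)
        (simp_all add: matrix_mult_entry sum_coord boundary[OF x] boundary'[OF x] mat_def
          add_divide_distrib[symmetric], simp_all add: field_simps power2_eq_square)
  qed
  from matrix_inv_unique(1)[OF this] show ?thesis by simp
qed

lemma jet_horizon:
  assumes x: "x \<in> U"
  shows "horizon_jet (exp (2 * (e x + t * c x))) (c x) (q x)
    (\<lambda>a b. ginv gh (point t 0 x) $ a $ b) (rescaled_jet N gh (point t 0 x))"
proof
  note P = boundary_in[OF x, of t]
  note s = smooth_tensorD[OF gh]
  have z: "pd N Time (\<lambda>p. gh p $ a $ b) (point t 0 x) = 0" if "\<And>s. gh (point s 0 x) $ a $ b = k" for a b k
    using pd_Time_eq[OF s x that] by simp
  have d: "pd N Time (\<lambda>p. gh p $ a $ b) (point t 0 x) = 2 * c x * exp (2 * (e x + t * c x)) * k"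
    if "\<And>s. gh (point s 0 x) $ a $ b = exp (2 * (e x + s * c x)) * k" for a b k
    by (rule pd_Time_eq[OF s x that]) (auto intro!: derivative_eq_intros)
  show "planar3 (rescaled_jet N gh (point t 0 x))"
  proof (rule planar3I)
    fix i a b
    show "rescaled_jet N gh (point t 0 x) (Cross i) a b = 0" by (simp add: rescaled_jet_def)
    show "rescaled_jet N gh (point t 0 x) a (Cross i) b = 0"
      by (cases b; simp add: rescaled_jet_def wt_def boundary[OF x] boundary'[OF x]; (rule impI, rule z, simp add: boundary[OF x] boundary'[OF x]))
    show "rescaled_jet N gh (point t 0 x) a b (Cross i) = 0"
      by (cases b; simp add: rescaled_jet_def wt_def boundary[OF x] boundary'[OF x]; (rule impI, rule z, simp add: boundary[OF x] boundary'[OF x]))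
  qed
  show "block2 (\<lambda>a b. ginv gh (point t 0 x) $ a $ b)" by (simp add: block2_def inv_boundary[OF x])
  have "pd N Time (\<lambda>p. gh p $ Radial $ Radial) (point t 0 x) = 2 * c x * exp (2 * (e x + t * c x)) * 1"
    by (rule d) (simp add: boundary[OF x])
  then show "rescaled_jet N gh (point t 0 x) Time Radial Radial = 2 * c x * exp (2 * (e x + t * c x))"
    by (simp add: rescaled_jet_def)
  have "pd N Time (\<lambda>p. gh p $ Time $ Time) (point t 0 x) = 2 * c x * exp (2 * (e x + t * c x)) * ((c x)\<^sup>2 - q x)"
    by (rule d) (simp add: boundary[OF x])
  then show "rescaled_jet N gh (point t 0 x) Time Time Time = 2 * c x * exp (2 * (e x + t * c x)) * ((c x)\<^sup>2 - q x)"
    by (simp add: rescaled_jet_def)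
  have "pd N Time (\<lambda>p. gh p $ Time $ Radial) (point t 0 x) = 2 * c x * exp (2 * (e x + t * c x)) * c x"
    by (rule d) (simp add: boundary[OF x])
  then show "rescaled_jet N gh (point t 0 x) Time Time Radial = 2 * (c x)\<^sup>2 * exp (2 * (e x + t * c x))"
    by (simp add: rescaled_jet_def power2_eq_square)
  have "pd N Time (\<lambda>p. gh p $ Radial $ Time) (point t 0 x) = 2 * c x * exp (2 * (e x + t * c x)) * c x"
    by (rule d) (simp add: boundary'[OF x])
  then show "rescaled_jet N gh (point t 0 x) Time Radial Time = 2 * (c x)\<^sup>2 * exp (2 * (e x + t * c x))"
    by (simp add: rescaled_jet_def power2_eq_square)
qed (use q_pos[OF x] in \<open>auto simp: inv_boundary[OF x] rescaled_jet_def wt_def boundary[OF x] boundary'[OF x]\<close>)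

text \<open>
  Relative to a metric with constant \<open>e\<close>, \<open>c\<close>, \<open>q\<close>, the tangential part \<open>K\<close> of the field only shifts the
  parameters \<open>s\<close>, \<open>G\<close>, \<open>J\<close> of the variation.
\<close>

definition dir where "dir K f x = (\<Sum>i\<in>UNIV. K x $ i * pd U i f x)"

lemma lie_boundary:
  assumes V: "adapted V F G H J K" and x: "x \<in> U"
  defines "G' \<equiv> G x + dir K q x / (2 * q x)"
    and "J' \<equiv> J x + dir K c x - c x * dir K q x / (2 * q x)"
    and "s \<equiv> \<lambda>t. c x * (F x + t * G x) + H x + t * J x + dir K e x + t * dir K c x"
  shows "rescaled_lie V gh (point t 0 x) $ Time $ Time
      = exp (2 * (e x + t * c x)) * (2 * (s t + G') * ((c x)\<^sup>2 - q x) + 2 * J' * c x)"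
    "rescaled_lie V gh (point t 0 x) $ Time $ Radial = exp (2 * (e x + t * c x)) * (2 * s t * c x + G' * c x + J')"
    "rescaled_lie V gh (point t 0 x) $ Radial $ Time = exp (2 * (e x + t * c x)) * (2 * s t * c x + G' * c x + J')"
    "rescaled_lie V gh (point t 0 x) $ Radial $ Radial = 2 * s t * exp (2 * (e x + t * c x))"
    "rescaled_lie V gh (point t 0 x) $ Time $ Cross i = 0" "rescaled_lie V gh (point t 0 x) $ Cross i $ Time = 0"
    "rescaled_lie V gh (point t 0 x) $ Radial $ Cross i = 0" "rescaled_lie V gh (point t 0 x) $ Cross i $ Radial = 0"
    "rescaled_lie V gh (point t 0 x) $ Cross i $ Cross j
       = (\<Sum>l\<in>UNIV. K x $ l * pd U l (\<lambda>y. \<gamma> y $ i $ j) x)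
     + (\<Sum>l\<in>UNIV. \<gamma> x $ l $ j * pd U i (\<lambda>y. K y $ l) x + \<gamma> x $ i $ l * pd U j (\<lambda>y. K y $ l) x)"
proof -
  interpret hj: horizon_jet "exp (2 * (e x + t * c x))" "c x" "q x"
    "\<lambda>a b. ginv gh (point t 0 x) $ a $ b" "rescaled_jet N gh (point t 0 x)"
    by (rule jet_horizon[OF x])
  note sm = smooth_tensorD[OF gh]
  have T: "pd N Time (\<lambda>p. gh p $ a $ b) (point t 0 x) = rescaled_jet N gh (point t 0 x) Time a b" for a b
    by (simp add: rescaled_jet_def)
  have C0: "pd N (Cross l) (\<lambda>p. gh p $ a $ b) (point t 0 x) = 0"
    if "\<And>t x. x \<in> U \<Longrightarrow> gh (point t 0 x) $ a $ b = 0" for l a b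
    by (rule pd_tangent_zero[OF sm that _ x]) auto
  have Cg: "pd N (Cross l) (\<lambda>p. gh p $ Cross i $ Cross j) (point t 0 x) = pd U l (\<lambda>y. \<gamma> y $ i $ j) x" for l i j
    unfolding pd_Cross_boundary[OF sm x]
    by (rule pd_cong[OF open_fat[OF open_U] x smooth_\<gamma>]) (simp add: boundary)
  \<comment> \<open>The tangential part of the Lie derivative is a directional derivative of the
    boundary value, so the product and chain rules can be applied to whole expressions in e, c and
    q.\<close>
  have CC: "(\<Sum>l\<in>UNIV. K x $ l * pd N (Cross l) (\<lambda>p. gh p $ a $ b) (point t 0 x)) = d (K x)"
    if "\<And>y. y \<in> U \<Longrightarrow> gh (point t 0 y) $ a $ b = \<phi> y" "(\<phi> has_derivative d) (at x)" for a b \<phi> d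
  proof -
    have "((\<lambda>y. gh (point t 0 y) $ a $ b) has_derivative d) (at x)"
      using that(2) by (rule has_derivative_transform_within_open[OF _ open_U x]) (simp add: that(1))
    from pd_directional[OF open_U x this] show ?thesis
      by (simp add: pd_Cross_boundary[OF sm x])
  qed
  note de = pd_has_derivative_at[OF open_U x smooth_ecq(1)]
  note dc = pd_has_derivative_at[OF open_U x smooth_ecq(2)]
  note dq = pd_has_derivative_at[OF open_U x smooth_ecq(3)]
  let ?E = "exp (2 * (e x + t * c x))"
  have dE: "((\<lambda>y. exp (2 * (e y + t * c y))) has_derivative
      (\<lambda>v. ?E * (2 * ((\<Sum>i\<in>UNIV. v $ i * pd U i e x) + t * (\<Sum>i\<in>UNIV. v $ i * pd U i c x))))) (at x)"
    by (rule has_derivative_eq_rhs, rule has_derivative_exp, (rule has_derivative_mult_right has_derivative_add de dc)+)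
      (simp add: mult_ac)
  have Crr: "(\<Sum>l\<in>UNIV. K x $ l * pd N (Cross l) (\<lambda>p. gh p $ Radial $ Radial) (point t 0 x))
      = ?E * (2 * (dir K e x + t * dir K c x))"
    unfolding dir_def by (rule CC[OF boundary(1) dE])
  have Ctr: "(\<Sum>l\<in>UNIV. K x $ l * pd N (Cross l) (\<lambda>p. gh p $ Time $ Radial) (point t 0 x))
      = ?E * dir K c x + ?E * (2 * (dir K e x + t * dir K c x)) * c x"
    unfolding dir_def by (rule CC[OF boundary(2) has_derivative_mult[OF dE dc]])
  have Crt: "(\<Sum>l\<in>UNIV. K x $ l * pd N (Cross l) (\<lambda>p. gh p $ Radial $ Time) (point t 0 x))
      = ?E * dir K c x + ?E * (2 * (dir K e x + t * dir K c x)) * c x"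
    unfolding dir_def by (rule CC[OF boundary'(1) has_derivative_mult[OF dE dc]])
  have "((\<lambda>y. (c y)\<^sup>2 - q y) has_derivative (\<lambda>v. 2 * c x * (\<Sum>i\<in>UNIV. v $ i * pd U i c x) - (\<Sum>i\<in>UNIV. v $ i * pd U i q x))) (at x)"
    using has_derivative_diff[OF has_derivative_power[OF dc, of 2] dq] by (simp add: mult_ac)
  from CC[OF boundary(3) has_derivative_mult[OF dE this]]
  have Ctt: "(\<Sum>l\<in>UNIV. K x $ l * pd N (Cross l) (\<lambda>p. gh p $ Time $ Time) (point t 0 x))
      = ?E * (2 * c x * dir K c x - dir K q x) + ?E * (2 * (dir K e x + t * dir K c x)) * ((c x)\<^sup>2 - q x)"
    unfolding dir_def .
  have q: "q x \<noteq> 0" using q_pos[OF x] by simp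
  note S = rescaled_lie_def sum_coord rho_quot_boundary adaptedD[OF V] adapted_pd[OF V x] x wt_def
    field_grad_boundary[OF V x] boundary[OF x] boundary'[OF x] T hj.B planar3D[OF hj.B(1)]
  show "rescaled_lie V gh (point t 0 x) $ Radial $ Radial = 2 * s t * ?E"
    by (simp add: S Crr s_def) (simp add: algebra_simps)
  show "rescaled_lie V gh (point t 0 x) $ Time $ Radial = ?E * (2 * s t * c x + G' * c x + J')"
    using q by (simp add: S Ctr s_def G'_def J'_def) (simp add: field_simps power2_eq_square)
  show "rescaled_lie V gh (point t 0 x) $ Radial $ Time = ?E * (2 * s t * c x + G' * c x + J')"
    using q by (simp add: S Crt s_def G'_def J'_def) (simp add: field_simps power2_eq_square)
  show "rescaled_lie V gh (point t 0 x) $ Time $ Time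
      = ?E * (2 * (s t + G') * ((c x)\<^sup>2 - q x) + 2 * J' * c x)"
    using q by (simp add: S Ctt s_def G'_def J'_def) (simp add: field_simps power2_eq_square)
  show "rescaled_lie V gh (point t 0 x) $ Time $ Cross i = 0" "rescaled_lie V gh (point t 0 x) $ Cross i $ Time = 0"
    "rescaled_lie V gh (point t 0 x) $ Radial $ Cross i = 0" "rescaled_lie V gh (point t 0 x) $ Cross i $ Radial = 0"
    by (simp_all add: S C0[OF boundary(4)] C0[OF boundary(5)] C0[OF boundary'(2)] C0[OF boundary'(3)])
  show "rescaled_lie V gh (point t 0 x) $ Cross i $ Cross j
       = (\<Sum>l\<in>UNIV. K x $ l * pd U l (\<lambda>y. \<gamma> y $ i $ j) x)
     + (\<Sum>l\<in>UNIV. \<gamma> x $ l $ j * pd U i (\<lambda>y. K y $ l) x + \<gamma> x $ i $ l * pd U j (\<lambda>y. K y $ l) x)"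
    by (simp add: S Cg)
qed

lemma variation_horizon:
  assumes V: "adapted V F G H J K" and x: "x \<in> U" and K: "divfree U (\<lambda>y. det (\<gamma> y)) K"
  shows "horizon_jet.variation_jet (exp (2 * (e x + t * c x))) (c x) (q x)
    (\<lambda>a b. ginv gh (point t 0 x) $ a $ b)
    (c x * (F x + t * G x) + H x + t * J x + dir K e x + t * dir K c x)
    (G x + dir K q x / (2 * q x)) (J x + dir K c x - c x * dir K q x / (2 * q x))
    (\<lambda>a b. rescaled_lie V gh (point t 0 x) $ a $ b)
    (rescaled_jet N (rescaled_lie V gh) (point t 0 x))"
proof -
  interpret hj: horizon_jet "exp (2 * (e x + t * c x))" "c x" "q x"
    "\<lambda>a b. ginv gh (point t 0 x) $ a $ b" "rescaled_jet N gh (point t 0 x)"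
    by (rule jet_horizon[OF x])
  define G' where "G' = G x + dir K q x / (2 * q x)"
  define J' where "J' = J x + dir K c x - c x * dir K q x / (2 * q x)"
  define s where "s = (\<lambda>t. c x * (F x + t * G x) + H x + t * J x + dir K e x + t * dir K c x)"
  have s: "c x * (F x + t * G x) + H x + t * J x + dir K e x + t * dir K c x = s t" for t
    by (simp add: s_def)
  note lb = lie_boundary[OF V x, folded G'_def J'_def, unfolded s]
  note sm = smooth_tensorD[OF smooth_rescaled_lie[OF gh V]]
  let ?h = "rescaled_lie V gh" and ?E = "\<lambda>t. exp (2 * (e x + t * c x))"
  have q: "q x \<noteq> 0" using q_pos[OF x] by simp
  \<comment> \<open>The t-derivative of s is the variation of c, as \<open>variation_jet\<close>
    demands; the corrections by the derivative of q in G' and J' cancel in c G' + J'.\<close>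
  have ds: "(s has_real_derivative (c x * G' + J')) (at t)"
    unfolding s_def G'_def J'_def using q by (auto intro!: derivative_eq_intros simp: field_simps)
  have dE: "(?E has_real_derivative 2 * c x * ?E t) (at t)" by (auto intro!: derivative_eq_intros)
  have z: "pd N Time (\<lambda>p. ?h p $ a $ b) (point t 0 x) = 0" if "\<And>s. ?h (point s 0 x) $ a $ b = k" for a b k
    using pd_Time_eq[OF sm x that] by simp
  have tt: "pd N Time (\<lambda>p. ?h p $ Time $ Time) (point t 0 x)
    = ?E t * (2 * (c x * G' + J') * ((c x)\<^sup>2 - q x)) + 2 * c x * ?E t * (2 * (s t + G') * ((c x)\<^sup>2 - q x) + 2 * J' * c x)"
    by (rule pd_Time_eq[OF sm x lb(1)]) (rule DERIV_cong[OF DERIV_mult[OF dE]],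
      auto intro!: derivative_eq_intros ds)
  have tr: "pd N Time (\<lambda>p. ?h p $ Time $ Radial) (point t 0 x)
    = ?E t * (2 * (c x * G' + J') * c x) + 2 * c x * ?E t * (2 * s t * c x + G' * c x + J')"
    by (rule pd_Time_eq[OF sm x lb(2)]) (rule DERIV_cong[OF DERIV_mult[OF dE]],
      auto intro!: derivative_eq_intros ds)
  have rt: "pd N Time (\<lambda>p. ?h p $ Radial $ Time) (point t 0 x)
    = ?E t * (2 * (c x * G' + J') * c x) + 2 * c x * ?E t * (2 * s t * c x + G' * c x + J')"
    by (rule pd_Time_eq[OF sm x lb(3)]) (rule DERIV_cong[OF DERIV_mult[OF dE]],
      auto intro!: derivative_eq_intros ds)
  have rr: "pd N Time (\<lambda>p. ?h p $ Radial $ Radial) (point t 0 x) = 2 * (c x * G' + J') * ?E t + 2 * s t * (2 * c x * ?E t)"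
    by (rule pd_Time_eq[OF sm x lb(4)]) (rule DERIV_cong[OF DERIV_mult[OF DERIV_cmult[OF ds] dE]], simp)
  have "(\<Sum>i\<in>UNIV. \<Sum>j\<in>UNIV. ginv gh (point t 0 x) $ Cross i $ Cross j * ?h (point t 0 x) $ Cross i $ Cross j) = 0"
    unfolding lb(9) using trace_lie_metric[OF open_U x smooth_\<gamma> sym_\<gamma> det_\<gamma>[OF x] K] by (simp add: inv_boundary[OF x])
  moreover have "planar3 (rescaled_jet N ?h (point t 0 x))"
  proof (rule planar3I)
    fix i a b
    show "rescaled_jet N ?h (point t 0 x) (Cross i) a b = 0" by (simp add: rescaled_jet_def)
    show "rescaled_jet N ?h (point t 0 x) a (Cross i) b = 0"
      by (cases b; simp add: rescaled_jet_def wt_def lb; (rule impI, rule z, rule lb))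
    show "rescaled_jet N ?h (point t 0 x) a b (Cross i) = 0"
      by (cases b; simp add: rescaled_jet_def wt_def lb; (rule impI, rule z, rule lb))
  qed
  moreover have "block2 (\<lambda>a b. ?h (point t 0 x) $ a $ b)" by (simp add: block2_def lb)
  ultimately have "hj.variation_jet (s t) G' J' (\<lambda>a b. ?h (point t 0 x) $ a $ b) (rescaled_jet N ?h (point t 0 x))"
    unfolding hj.variation_jet_def
    by (simp add: lb(1-4) rescaled_jet_def wt_def tt tr rt rr algebra_simps)
  then show ?thesis unfolding s[symmetric] G'_def J'_def .
qed

lemma rescaled_omega_boundary:
  assumes "adapted V F G H J K" "divfree U (\<lambda>y. det (\<gamma> y)) K" "adapted V' F' G' H' J' K'" "divfree U (\<lambda>y. det (\<gamma> y)) K'"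
    and x: "x \<in> U"
  shows "rescaled_omega Gn gh (rescaled_lie V gh) (rescaled_lie V' gh) (point t 0 x) Time = 0"
    "rescaled_omega Gn gh (rescaled_lie V gh) (rescaled_lie V' gh) (point t 0 x) Radial = 0"
proof -
  interpret hj: horizon_jet "exp (2 * (e x + t * c x))" "c x" "q x"
    "\<lambda>a b. ginv gh (point t 0 x) $ a $ b" "rescaled_jet N gh (point t 0 x)"
    by (rule jet_horizon[OF x])
  note v = variation_horizon[OF assms(1) x assms(2)] variation_horizon[OF assms(3) x assms(4)]
  show "rescaled_omega Gn gh (rescaled_lie V gh) (rescaled_lie V' gh) (point t 0 x) Time = 0"
    "rescaled_omega Gn gh (rescaled_lie V gh) (rescaled_lie V' gh) (point t 0 x) Radial = 0"
    unfolding rescaled_omega_def hj.omega_alg_horizon[OF v] by simp_all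
qed

lemma omega_lie_rescaled:
  assumes V: "adapted V F G H J K" and V': "adapted V' F' G' H' J' K'"
    and p: "p \<in> N" "0 < p $ Radial" "det (gh p) < 0"
  shows "omega Gn N g (lie_derivative N V g) (lie_derivative N V' g) p $ m
    = rescaled_omega Gn gh (rescaled_lie V gh) (rescaled_lie V' gh) p m / lam (p $ Radial) m"
  by (rule omega_rescaled[OF g gh g_gh
        smooth_lie_derivative[OF g adaptedD(1)[OF V]] smooth_rescaled_lie[OF gh V] lie_rescaled[OF g_gh gh V]
        lie_symmetric[OF g_sym g p(1)]
        smooth_lie_derivative[OF g adaptedD(1)[OF V']] smooth_rescaled_lie[OF gh V'] lie_rescaled[OF g_gh gh V']
        lie_symmetric[OF g_sym g p(1)] p])

text \<open>Dividing by \<open>lam\<close> costs a power of \<rho> in the t component only. Its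
  frame component vanishes on the horizon, so the quotient is still smooth; the same vanishing gives
  the radial component its factor \<rho>.\<close>

lemma omega_order:
  fixes Gn :: real
  assumes V: "adapted V F G H J K" "divfree U (\<lambda>y. det (\<gamma> y)) K"
    and V': "adapted V' F' G' H' J' K'" "divfree U (\<lambda>y. det (\<gamma> y)) K'"
    and d: "\<And>p. p \<in> N \<Longrightarrow> det (gh p) < 0"
  defines "\<omega> \<equiv> omega Gn N g (lie_derivative N V g) (lie_derivative N V' g)"
  shows "rho_order N 0 (\<lambda>p. \<omega> p $ Time)" "rho_order N 1 (\<lambda>p. \<omega> p $ Radial)" "rho_order N 0 (\<lambda>p. \<omega> p $ Cross i)"
proof -
  let ?\<Omega> = "\<lambda>m p. rescaled_omega Gn gh (rescaled_lie V gh) (rescaled_lie V' gh) p m"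
  note eq = omega_lie_rescaled[where Gn=Gn, OF V(1) V'(1) _ _ d, folded \<omega>_def]
  have s: "smooth_on N (?\<Omega> m)" for m
    by (rule smooth_rescaled_omega[OF gh smooth_rescaled_lie[OF gh V(1)] smooth_rescaled_lie[OF gh V'(1)] subset_refl d])
  note b = rescaled_omega_boundary[OF V V']
  show "rho_order N 1 (\<lambda>p. \<omega> p $ Radial)"
  proof (rule rho_order_cong[OF rho_order_1I[OF s]])
    show "?\<Omega> Radial (point t 0 x) = 0" if "x \<in> U" for t x by (rule b(2)[OF that])
    show "\<omega> p $ Radial = ?\<Omega> Radial p" if "p \<in> N" "0 < p $ Radial" for p
      using eq[OF that(1,2,1)] by (simp add: lam_def)
  qed
  show "rho_order N 0 (\<lambda>p. \<omega> p $ Cross i)"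
    unfolding rho_order_def by (intro exI[of _ "?\<Omega> (Cross i)"] conjI s) (auto simp: eq lam_def)
  show "rho_order N 0 (\<lambda>p. \<omega> p $ Time)"
    unfolding rho_order_def
    using rho_quot_mult[where f="?\<Omega> Time", OF b(1)]
    by (intro exI[of _ "rho_quot N (?\<Omega> Time)"] conjI smooth_on_rho_quot[OF s b(1)]) (auto simp: eq lam_def)
qed

text \<open>det gh is continuous and negative on the horizon, hence negative on a smaller collar.
  For limits as \<rho> -> 0 this is enough, and it is the form available for a pulled-back
  metric.\<close>

lemma collar_nondegenerate: "collar U {p\<in>N. det (gh p) < 0}"
proof -
  have "continuous_on N (\<lambda>p. det (gh p))"
    by (intro smooth_on_continuous smooth_on_det smooth_tensorD[OF gh])
  then obtain A where A: "open A" "A \<inter> N = (\<lambda>p. det (gh p)) -` {..<0} \<inter> N"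
    unfolding continuous_on_open_invariant by (meson open_lessThan)
  obtain W where W: "open W" "N = W \<inter> {p. 0 \<le> p $ Radial \<and> cross p \<in> U}"
    using collar unfolding collar_def by auto
  have "{p\<in>N. det (gh p) < 0} = (A \<inter> W) \<inter> {p. 0 \<le> p $ Radial \<and> cross p \<in> U}"
    using A(2) W(2) by auto
  moreover have "p \<in> N \<and> det (gh p) < 0" if "p $ Radial = 0" "cross p \<in> U" for p
    using boundary_in[OF that(2), of "p $ Time"] boundary_det[OF that(2), of "p $ Time"] point_eq[of p] that(1) by simp
  ultimately show ?thesis
    unfolding collar_def using A(1) W(1) by blast
qed

lemma omega_boundary_limit:
  fixes Gn :: real
  assumes V: "adapted V F G H J K" "divfree U (\<lambda>y. det (\<gamma> y)) K"
    and V': "adapted V' F' G' H' J' K'" "divfree U (\<lambda>y. det (\<gamma> y)) K'"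
    and X: "adapted X F1 G1 H1 J1 K1" and x: "x \<in> U"
  defines "\<omega> \<equiv> omega Gn N g (lie_derivative N V g) (lie_derivative N V' g)"
  shows "((\<lambda>r. X (point t r x) $ Time * \<omega> (point t r x) $ Radial - X (point t r x) $ Radial * \<omega> (point t r x) $ Time)
     \<longlongrightarrow> 0) (at_right 0)"
proof -
  define D where "D = {p\<in>N. det (gh p) < 0}"
  interpret D: collar_domain U D
    using open_U collar_nondegenerate by unfold_locales (auto simp: D_def)
  let ?\<Omega> = "\<lambda>m p. rescaled_omega Gn gh (rescaled_lie V gh) (rescaled_lie V' gh) p m"
  have s: "smooth_on D (?\<Omega> m)" for m
    by (rule smooth_rescaled_omega[OF gh smooth_rescaled_lie[OF gh V(1)] smooth_rescaled_lie[OF gh V'(1)]]) (auto simp: D_def)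
  note b = rescaled_omega_boundary[OF V V' x]
  \<comment> \<open>X^\<rho> supplies the factor \<rho> that cancels the 1 / \<rho> of \<omega>^t,
    so the whole expression extends smoothly to the horizon, with value 0 there.\<close>
  let ?f = "\<lambda>p. X p $ Time * ?\<Omega> Radial p - rho_quot N (\<lambda>q. X q $ Radial) p * ?\<Omega> Time p"
  have "smooth_on D ?f"
    by (intro smooth_on_diff smooth_on_mult s smooth_on_subset[OF adaptedD(1)[OF X]]
        smooth_on_subset[OF smooth_on_rho_quot[OF adaptedD(1,3)[OF X]]]) (auto simp: D_def)
  from D.tendsto_boundary[OF this x, of t]
  have "((\<lambda>r. ?f (point t r x)) \<longlongrightarrow> 0) (at_right 0)" by (simp add: b)
  moreover have "\<forall>\<^sub>F r in at_right 0. ?f (point t r x)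
     = X (point t r x) $ Time * \<omega> (point t r x) $ Radial - X (point t r x) $ Radial * \<omega> (point t r x) $ Time"
    using D.eventually_in[OF x, of t]
  proof eventually_elim
    case (elim r)
    then have p: "point t r x \<in> N" "0 < point t r x $ Radial" "det (gh (point t r x)) < 0" by (auto simp: D_def)
    show ?case
      using rho_quot_mult[where f="\<lambda>q. X q $ Radial", OF adaptedD(3)[OF X] p(1)] p(2)
      by (simp add: \<omega>_def omega_lie_rescaled[OF V(1) V'(1) p] lam_def)
  qed
  ultimately show ?thesis by (rule Lim_transform_eventually)
qed

end

section \<open>The symmetry algebra\<close>

lemma matrix_inv_symmetric:
  fixes A :: "real ^ 'n ^ 'n"
  assumes "\<And>a b. A $ a $ b = A $ b $ a" "det A \<noteq> 0"
  shows "matrix_inv A $ a $ b = matrix_inv A $ b $ a"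
proof -
  have A: "transpose A = A" using assms(1) by (simp add: transpose_def vec_eq_iff)
  have "A ** transpose (matrix_inv A) = transpose (matrix_inv A ** A)"
    by (simp add: matrix_transpose_mul A)
  also have "\<dots> = mat 1" by (simp add: matrix_inv_inverse[OF assms(2)] transpose_mat)
  finally have "matrix_inv A = transpose (matrix_inv A)" by (rule matrix_inv_unique)
  then show ?thesis by (simp add: transpose_def vec_eq_iff)
qed

text \<open>In the trace of the Christoffel symbol two of the three derivative terms cancel, and the
  third is half the derivative of ln det \<gamma>. The factor 2 det \<gamma> avoids square roots and
  quotients and yields the expression in \<open>divfree\<close>.\<close>

lemma divergence_density:
  fixes \<gamma> :: "real ^ 'm \<Rightarrow> real ^ 'm ^ ('m::finite)"
  assumes U: "open U" "x \<in> U" and \<gamma>: "\<And>a b. smooth_on U (\<lambda>y. \<gamma> y $ a $ b)"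
    "\<And>y a b. y \<in> U \<Longrightarrow> \<gamma> y $ a $ b = \<gamma> y $ b $ a" "det (\<gamma> x) \<noteq> 0"
  shows "2 * det (\<gamma> x) * (\<Sum>i\<in>UNIV. nabla_vec U \<gamma> i K i x)
    = (\<Sum>i\<in>UNIV. K x $ i * pd U i (\<lambda>y. det (\<gamma> y)) x) + 2 * det (\<gamma> x) * (\<Sum>i\<in>UNIV. pd U i (\<lambda>y. K y $ i) x)"
proof -
  let ?I = "matrix_inv (\<gamma> x)"
  note f = open_fat[OF U(1)]
  have I: "?I $ a $ b = ?I $ b $ a" for a b by (rule matrix_inv_symmetric[OF \<gamma>(2)[OF U(2)] \<gamma>(3)])
  have s: "pd U l (\<lambda>y. \<gamma> y $ j $ i) x = pd U l (\<lambda>y. \<gamma> y $ i $ j) x" for i j l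
    by (rule pd_cong[OF f U(2) \<gamma>(1,2)])
  have chr: "2 * (\<Sum>i\<in>UNIV. christoffel U \<gamma> i i c x) = pd U c (\<lambda>y. det (\<gamma> y)) x / det (\<gamma> x)" for c
  proof -
    have "(\<Sum>i\<in>UNIV. \<Sum>e\<in>UNIV. ?I $ i $ e * pd U i (\<lambda>q. \<gamma> q $ e $ c) x)
        = (\<Sum>i\<in>UNIV. \<Sum>e\<in>UNIV. ?I $ i $ e * pd U e (\<lambda>q. \<gamma> q $ i $ c) x)"
      by (subst sum.swap) (simp add: I)
    then have "2 * (\<Sum>i\<in>UNIV. christoffel U \<gamma> i i c x) = (\<Sum>i\<in>UNIV. \<Sum>e\<in>UNIV. ?I $ i $ e * pd U c (\<lambda>q. \<gamma> q $ e $ i) x)"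
      by (simp add: christoffel_def sum_distrib_left[symmetric] distrib_left right_diff_distrib sum.distrib sum_subtractf)
        (simp add: sum_divide_distrib[symmetric])
    then show ?thesis using \<gamma>(3) by (simp add: pd_det[OF f U(2) \<gamma>(1,3)])
  qed
  have "(\<Sum>i\<in>UNIV. nabla_vec U \<gamma> i K i x) = (\<Sum>i\<in>UNIV. pd U i (\<lambda>y. K y $ i) x)
      + (\<Sum>c\<in>UNIV. (\<Sum>i\<in>UNIV. christoffel U \<gamma> i i c x) * K x $ c)"
    unfolding nabla_vec_def sum.distrib sum_distrib_right by (subst (2) sum.swap) simp
  moreover have "2 * det (\<gamma> x) * (\<Sum>c\<in>UNIV. (\<Sum>i\<in>UNIV. christoffel U \<gamma> i i c x) * K x $ c)
      = (\<Sum>c\<in>UNIV. K x $ c * pd U c (\<lambda>y. det (\<gamma> y)) x)"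
    unfolding sum_distrib_left
  proof (intro sum.cong refl)
    fix c
    have "2 * det (\<gamma> x) * ((\<Sum>i\<in>UNIV. christoffel U \<gamma> i i c x) * K x $ c)
       = det (\<gamma> x) * (2 * (\<Sum>i\<in>UNIV. christoffel U \<gamma> i i c x)) * K x $ c" by simp
    then show "2 * det (\<gamma> x) * ((\<Sum>i\<in>UNIV. christoffel U \<gamma> i i c x) * K x $ c)
       = K x $ c * pd U c (\<lambda>y. det (\<gamma> y)) x" unfolding chr using \<gamma>(3) by simp
  qed
  ultimately show ?thesis by (simp add: distrib_left)
qed

text \<open>The identity div [K, L] = K(div L) - L(div K), for the divergence with respect to a
  density whose square is |d|.\<close>

lemma divfree_bracket:
  fixes K L :: "real ^ 'm \<Rightarrow> real ^ ('m::finite)"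
  assumes U: "open U" and d: "smooth_on U d" "\<And>x. x \<in> U \<Longrightarrow> d x \<noteq> 0"
    and K: "\<And>i. smooth_on U (\<lambda>x. K x $ i)" "divfree U d K" and L: "\<And>i. smooth_on U (\<lambda>x. L x $ i)" "divfree U d L"
  shows "divfree U d (\<lambda>x. \<chi> i. \<Sum>j\<in>UNIV. K x $ j * pd U j (\<lambda>y. L y $ i) x - L x $ j * pd U j (\<lambda>y. K y $ i) x)"
proof -
  note f = open_fat[OF U]
  \<comment> \<open>u = ln |d|, written with a square so that both signs of d are covered; being
    divergence free becomes \<partial>_i K^i = - K(u) / 2.\<close>
  define u where "u x = ln ((d x)\<^sup>2) / 2" for x
  have u: "smooth_on U u"
    unfolding u_def[abs_def] divide_inverse
    by (intro smooth_on_mult smooth_on_ln smooth_on_power d smooth_on_const) (simp add: d(2))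
  have du: "pd U i d x = d x * pd U i u x" if x: "x \<in> U" for i x
  proof -
    have "(d has_derivative (\<lambda>v. \<Sum>i\<in>UNIV. v $ i * pd U i d x)) (at x within U)" by (rule pd_has_derivative[OF d(1) x])
    moreover have "0 < d x * d x" using d(2)[OF x] by (auto simp: zero_less_mult_iff)
    ultimately have "(u has_derivative (\<lambda>v. (\<Sum>i\<in>UNIV. v $ i * pd U i d x) / d x)) (at x within U)"
      unfolding u_def[abs_def] using d(2)[OF x]
      by (auto intro!: derivative_eq_intros simp: field_simps power2_eq_square)
    from pdI[OF f x this, of i] show ?thesis using d(2)[OF x]
      by (simp add: axis_def if_distrib if_distribR cong: if_cong)
  qed
  have div: "(\<Sum>i\<in>UNIV. pd U i (\<lambda>y. M y $ i) x) = - 1 / 2 * (\<Sum>i\<in>UNIV. M x $ i * pd U i u x)"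
    if "divfree U d M" "x \<in> U" for M :: "real ^ 'm \<Rightarrow> real ^ 'm" and x
  proof -
    have "d x * ((\<Sum>i\<in>UNIV. M x $ i * pd U i u x) + 2 * (\<Sum>i\<in>UNIV. pd U i (\<lambda>y. M y $ i) x)) = 0"
      using that by (simp add: divfree_def du sum_distrib_left distrib_left mult_ac)
    then show ?thesis using d(2)[OF that(2)] by simp
  qed
  \<comment> \<open>The first and the last sum are symmetric in K and L up to relabelling and cancel
    in the commutator; the middle ones combine to - [K, L](u) / 2.\<close>
  have half: "(\<Sum>i\<in>UNIV. pd U i (\<lambda>y. \<Sum>j\<in>UNIV. K y $ j * pd U j (\<lambda>y. L y $ i) y) x)
      = (\<Sum>i\<in>UNIV. \<Sum>j\<in>UNIV. pd U i (\<lambda>y. K y $ j) x * pd U j (\<lambda>y. L y $ i) x)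
        - 1 / 2 * (\<Sum>i\<in>UNIV. \<Sum>j\<in>UNIV. K x $ j * pd U j (\<lambda>y. L y $ i) x * pd U i u x)
        - 1 / 2 * (\<Sum>i\<in>UNIV. \<Sum>j\<in>UNIV. K x $ j * L x $ i * pd U j (pd U i u) x)"
    if K: "\<And>i. smooth_on U (\<lambda>x. K x $ i)" and L: "\<And>i. smooth_on U (\<lambda>x. L x $ i)" "divfree U d L" and x: "x \<in> U"
    for K L :: "real ^ 'm \<Rightarrow> real ^ 'm" and x
  proof -
    note sL = pd_smooth[OF f L(1)]
    have "(\<Sum>i\<in>UNIV. pd U i (\<lambda>y. \<Sum>j\<in>UNIV. K y $ j * pd U j (\<lambda>y. L y $ i) y) x)
      = (\<Sum>i\<in>UNIV. \<Sum>j\<in>UNIV. K x $ j * pd U j (pd U i (\<lambda>y. L y $ i)) x + pd U i (\<lambda>y. K y $ j) x * pd U j (\<lambda>y. L y $ i) x)"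
      by (simp add: pd_sum[OF f x] smooth_on_mult K sL pd_mult[OF f x] pd_symmetric[OF f x L(1)])
    also have "\<dots> = (\<Sum>j\<in>UNIV. K x $ j * (\<Sum>i\<in>UNIV. pd U j (pd U i (\<lambda>y. L y $ i)) x))
        + (\<Sum>i\<in>UNIV. \<Sum>j\<in>UNIV. pd U i (\<lambda>y. K y $ j) x * pd U j (\<lambda>y. L y $ i) x)"
      unfolding sum.distrib sum_distrib_left by (subst sum.swap) simp
    finally have A: "(\<Sum>i\<in>UNIV. pd U i (\<lambda>y. \<Sum>j\<in>UNIV. K y $ j * pd U j (\<lambda>y. L y $ i) y) x)
      = (\<Sum>j\<in>UNIV. K x $ j * (\<Sum>i\<in>UNIV. pd U j (pd U i (\<lambda>y. L y $ i)) x))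
        + (\<Sum>i\<in>UNIV. \<Sum>j\<in>UNIV. pd U i (\<lambda>y. K y $ j) x * pd U j (\<lambda>y. L y $ i) x)" .
    have B: "(\<Sum>i\<in>UNIV. pd U j (pd U i (\<lambda>y. L y $ i)) x)
       = - 1 / 2 * (\<Sum>i\<in>UNIV. L x $ i * pd U j (pd U i u) x + pd U j (\<lambda>y. L y $ i) x * pd U i u x)" for j
    proof -
      have "(\<Sum>i\<in>UNIV. pd U j (pd U i (\<lambda>y. L y $ i)) x) = pd U j (\<lambda>x. \<Sum>i\<in>UNIV. pd U i (\<lambda>y. L y $ i) x) x"
        by (simp add: pd_sum[OF f x] sL)
      also have "\<dots> = pd U j (\<lambda>x. - 1 / 2 * (\<Sum>i\<in>UNIV. L x $ i * pd U i u x)) x"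
      proof (rule pd_cong[OF f x])
        show "smooth_on U (\<lambda>x. - 1 / 2 * (\<Sum>i\<in>UNIV. L x $ i * pd U i u x))"
          by (intro smooth_on_mult smooth_on_const smooth_on_sum L(1) pd_smooth[OF f u])
      qed (rule div[OF L(2)])
      also have "\<dots> = - 1 / 2 * (\<Sum>i\<in>UNIV. L x $ i * pd U j (pd U i u) x + pd U j (\<lambda>y. L y $ i) x * pd U i u x)"
        by (subst pd_mult[OF f x smooth_on_const])
          (auto intro!: smooth_on_sum smooth_on_mult L(1) pd_smooth[OF f u]
            simp: pd_const[OF f x] pd_sum[OF f x] pd_mult[OF f x] smooth_on_mult L(1) pd_smooth[OF f u])
      finally show ?thesis .
    qed
    have C: "(\<Sum>j\<in>UNIV. K x $ j * (- 1 / 2 * (\<Sum>i\<in>UNIV. L x $ i * pd U j (pd U i u) x + pd U j (\<lambda>y. L y $ i) x * pd U i u x)))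
      = - 1 / 2 * (\<Sum>i\<in>UNIV. \<Sum>j\<in>UNIV. K x $ j * pd U j (\<lambda>y. L y $ i) x * pd U i u x)
        - 1 / 2 * (\<Sum>i\<in>UNIV. \<Sum>j\<in>UNIV. K x $ j * L x $ i * pd U j (pd U i u) x)"
      unfolding sum_distrib_left
      by (subst sum.swap) (simp only: sum_subtractf[symmetric], intro sum.cong refl, simp add: algebra_simps)
    show ?thesis unfolding A B C by simp
  qed
  let ?M = "\<lambda>x. \<chi> i. \<Sum>j\<in>UNIV. K x $ j * pd U j (\<lambda>y. L y $ i) x - L x $ j * pd U j (\<lambda>y. K y $ i) x"
  show ?thesis unfolding divfree_def
  proof
    fix x assume x: "x \<in> U"
    have sw: "(\<Sum>i\<in>UNIV. \<Sum>j\<in>UNIV. pd U i (\<lambda>y. L y $ j) x * pd U j (\<lambda>y. K y $ i) x)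
       = (\<Sum>i\<in>UNIV. \<Sum>j\<in>UNIV. pd U i (\<lambda>y. K y $ j) x * pd U j (\<lambda>y. L y $ i) x)"
      by (subst sum.swap) (simp add: mult.commute)
    have sw2: "(\<Sum>i\<in>UNIV. \<Sum>j\<in>UNIV. L x $ j * K x $ i * pd U j (pd U i u) x)
       = (\<Sum>i\<in>UNIV. \<Sum>j\<in>UNIV. K x $ j * L x $ i * pd U j (pd U i u) x)"
      by (subst sum.swap) (simp add: mult.commute pd_symmetric[OF f x u])
    have "(\<Sum>i\<in>UNIV. pd U i (\<lambda>y. ?M y $ i) x)
      = (\<Sum>i\<in>UNIV. pd U i (\<lambda>y. \<Sum>j\<in>UNIV. K y $ j * pd U j (\<lambda>y. L y $ i) y) x)
      - (\<Sum>i\<in>UNIV. pd U i (\<lambda>y. \<Sum>j\<in>UNIV. L y $ j * pd U j (\<lambda>y. K y $ i) y) x)"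
      by (simp add: sum_subtractf pd_diff[OF f x] smooth_on_sum smooth_on_mult K(1) L(1) pd_smooth[OF f])
    also have "\<dots> = - 1 / 2 * (\<Sum>i\<in>UNIV. ?M x $ i * pd U i u x)"
      unfolding half[OF K(1) L x] half[OF L(1) K x] sw sw2
      by (simp add: sum_subtractf left_diff_distrib sum_distrib_right diff_divide_distrib)
    finally have m: "(\<Sum>i\<in>UNIV. pd U i (\<lambda>y. ?M y $ i) x) = - 1 / 2 * (\<Sum>i\<in>UNIV. ?M x $ i * pd U i u x)" .
    have e: "(\<Sum>i\<in>UNIV. ?M x $ i * pd U i d x) = d x * (\<Sum>i\<in>UNIV. ?M x $ i * pd U i u x)"
      unfolding sum_distrib_left by (intro sum.cong refl) (simp only: du[OF x] mult.left_commute)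
    have "d x * B + 2 * d x * (- 1 / 2 * B) = 0" for B by simp
    then show "(\<Sum>i\<in>UNIV. ?M x $ i * pd U i d x) + 2 * d x * (\<Sum>i\<in>UNIV. pd U i (\<lambda>y. ?M y $ i) x) = 0"
      unfolding e m .
  qed
qed

context collar_domain
begin

lemma smooth_on_cross_N: "smooth_on U f \<Longrightarrow> smooth_on N (\<lambda>p. f (cross p))"
  by (rule smooth_on_cross[OF _ N_D(2)])

lemma pd_cross:
  assumes "smooth_on U f" "p \<in> N"
  shows "pd N Radial (\<lambda>p. f (cross p)) p = 0"
proof -
  have "pd N Radial (\<lambda>p. f (cross p)) p = (\<Sum>c\<in>UNIV. pd U c f (cross p) * pd N Radial (\<lambda>q. cross q $ c) p)"
    by (rule pd_chain_gen[OF fat_N assms(2,1) N_D(2) smooth_on_linear[OF bounded_linear_cross]])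
  then show ?thesis by (simp add: pd_coord[OF fat_N assms(2)])
qed

lemma adapted_iff:
  assumes F: "smooth_on U F" "smooth_on U G" "smooth_on U H" "smooth_on U J" "\<And>i. smooth_on U (\<lambda>x. K x $ i)"
  shows "adapted V F G H J K \<longleftrightarrow> (\<forall>c. smooth_on N (\<lambda>p. V p $ c)) \<and>
     rho_order N 2 (\<lambda>p. V p $ Time - (F (cross p) + p $ Time * G (cross p))) \<and>
     rho_order N 2 (\<lambda>p. V p $ Radial - p $ Radial * (H (cross p) + p $ Time * J (cross p))) \<and>
     (\<forall>i. rho_order N 2 (\<lambda>p. V p $ Cross i - K (cross p) $ i))"
proof -
  note sc = smooth_on_cross_N
  have sT: "smooth_on N (\<lambda>p. F (cross p) + p $ Time * G (cross p))"
    by (intro smooth_on_add smooth_on_mult smooth_on_component sc F)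
  have sR': "smooth_on N (\<lambda>p. H (cross p) + p $ Time * J (cross p))"
    by (intro smooth_on_add smooth_on_mult smooth_on_component sc F)
  then have sR: "smooth_on N (\<lambda>p. p $ Radial * (H (cross p) + p $ Time * J (cross p)))"
    by (intro smooth_on_mult smooth_on_component)
  have sC: "smooth_on N (\<lambda>p. K (cross p) $ i)" for i
    by (rule sc[OF F(5)])
  have pT: "pd N Radial (\<lambda>p. F (cross p) + p $ Time * G (cross p)) (point t 0 x) = 0" if x: "x \<in> U" for t x
    by (simp add: pd_add[OF fat_N boundary_in[OF x]] pd_mult[OF fat_N boundary_in[OF x]] smooth_on_mult smooth_on_component
        sc F pd_cross[OF _ boundary_in[OF x]] pd_coord[OF fat_N boundary_in[OF x]])
  have pR: "pd N Radial (\<lambda>p. p $ Radial * (H (cross p) + p $ Time * J (cross p))) (point t 0 x) = H x + t * J x"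
    if x: "x \<in> U" for t x
    by (simp add: pd_Radial_product_boundary[OF sR' x])
  have pC: "pd N Radial (\<lambda>p. K (cross p) $ i) (point t 0 x) = 0" if x: "x \<in> U" for t x i
    by (rule pd_cross[OF F(5) boundary_in[OF x]])
  show ?thesis
  proof
    assume V: "adapted V F G H J K"
    note b = adaptedD[OF V]
    note pd = pd_diff[OF fat_N boundary_in b(1)]
    show "(\<forall>c. smooth_on N (\<lambda>p. V p $ c)) \<and>
       rho_order N 2 (\<lambda>p. V p $ Time - (F (cross p) + p $ Time * G (cross p))) \<and>
       rho_order N 2 (\<lambda>p. V p $ Radial - p $ Radial * (H (cross p) + p $ Time * J (cross p))) \<and>
       (\<forall>i. rho_order N 2 (\<lambda>p. V p $ Cross i - K (cross p) $ i))"
      by (intro conjI allI rho_order_2I smooth_on_diff b(1) sT sR sC)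
        (simp_all add: b pd[OF _ sT] pd[OF _ sR] pd[OF _ sC] pT pR pC)
  next
    assume a: "(\<forall>c. smooth_on N (\<lambda>p. V p $ c)) \<and>
       rho_order N 2 (\<lambda>p. V p $ Time - (F (cross p) + p $ Time * G (cross p))) \<and>
       rho_order N 2 (\<lambda>p. V p $ Radial - p $ Radial * (H (cross p) + p $ Time * J (cross p))) \<and>
       (\<forall>i. rho_order N 2 (\<lambda>p. V p $ Cross i - K (cross p) $ i))"
    then have sV: "smooth_on N (\<lambda>p. V p $ c)" for c by blast
    have r: "rho_order N 2 (\<lambda>p. V p $ Time - (F (cross p) + p $ Time * G (cross p)))"
      "rho_order N 2 (\<lambda>p. V p $ Radial - p $ Radial * (H (cross p) + p $ Time * J (cross p)))"
      "rho_order N 2 (\<lambda>p. V p $ Cross i - K (cross p) $ i)" for i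
      using a by blast+
    show "adapted V F G H J K" unfolding adapted_def
      by (intro conjI allI ballI sV)
        (simp_all add: rho_order_2D[OF r(1) sV sT] rho_order_2D[OF r(2) sV sR] rho_order_2D[OF r(3) sV sC] pT pR pC)
  qed
qed

lemma adapted_tangential:
  assumes W: "adapted W F G H J K" and s: "smooth_on U F" "smooth_on U G" "smooth_on U H" "smooth_on U J"
    and x: "x \<in> U"
  shows "pd N (Cross i) (\<lambda>p. W p $ Time) (point t 0 x) = pd U i F x + t * pd U i G x"
    "pd N Time (pd N Radial (\<lambda>p. W p $ Radial)) (point t 0 x) = J x"
    "pd N (Cross i) (pd N Radial (\<lambda>p. W p $ Radial)) (point t 0 x) = pd U i H x + t * pd U i J x"
    "a \<noteq> Radial \<Longrightarrow> pd N a (pd N Radial (\<lambda>p. W p $ Time)) (point t 0 x) = 0"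
    "a \<noteq> Radial \<Longrightarrow> pd N a (pd N Radial (\<lambda>p. W p $ Cross i)) (point t 0 x) = 0"
proof -
  note b = adaptedD[OF W] and f = open_fat[OF open_U]
  note sp = pd_smooth[OF fat_N b(1)]
  have lin: "pd U i (\<lambda>y. P y + t * Q y) x = pd U i P x + t * pd U i Q x"
    if "smooth_on U P" "smooth_on U Q" for P Q
    by (simp add: pd_add[OF f x] pd_mult[OF f x] pd_const[OF f x] smooth_on_mult smooth_on_const that)
  have sl: "smooth_on U (\<lambda>y. P y + t * Q y)" if "smooth_on U P" "smooth_on U Q" for P Q
    by (intro smooth_on_add smooth_on_mult smooth_on_const that)
  show "pd N (Cross i) (\<lambda>p. W p $ Time) (point t 0 x) = pd U i F x + t * pd U i G x"
    unfolding pd_Cross_boundary[OF b(1) x] lin[OF s(1,2), symmetric]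
    by (rule pd_cong[OF f x sl[OF s(1,2)]]) (simp add: b)
  show "pd N (Cross i) (pd N Radial (\<lambda>p. W p $ Radial)) (point t 0 x) = pd U i H x + t * pd U i J x"
    unfolding pd_Cross_boundary[OF sp x] lin[OF s(3,4), symmetric]
    by (rule pd_cong[OF f x sl[OF s(3,4)]]) (simp add: b)
  show "pd N Time (pd N Radial (\<lambda>p. W p $ Radial)) (point t 0 x) = J x"
    by (rule pd_Time_eq[where \<phi>="\<lambda>s. H x + s * J x", OF sp x]) (auto intro!: derivative_eq_intros simp: b x)
  show "a \<noteq> Radial \<Longrightarrow> pd N a (pd N Radial (\<lambda>p. W p $ Time)) (point t 0 x) = 0"
    by (rule pd_tangent_zero[OF sp _ _ x]) (simp add: b)
  show "a \<noteq> Radial \<Longrightarrow> pd N a (pd N Radial (\<lambda>p. W p $ Cross i)) (point t 0 x) = 0"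
    by (rule pd_tangent_zero[OF sp _ _ x]) (simp add: b)
qed

text \<open>The terms t G G' of the t component and the products (H + t J) (H' + t J') of the radial
  derivatives cancel by antisymmetry, so the result is again affine in t, with the coefficients
  listed.\<close>

lemma adapted_commutator:
  assumes V: "adapted V F G H J K" and sV: "smooth_on U F" "smooth_on U G" "smooth_on U H" "smooth_on U J"
    and W: "adapted W F' G' H' J' K'" and sW: "smooth_on U F'" "smooth_on U G'" "smooth_on U H'" "smooth_on U J'"
  shows "adapted (commutator N V W)
    (\<lambda>x. F x * G' x - F' x * G x + (\<Sum>i\<in>UNIV. K x $ i * pd U i F' x - K' x $ i * pd U i F x))
    (\<lambda>x. \<Sum>i\<in>UNIV. K x $ i * pd U i G' x - K' x $ i * pd U i G x)
    (\<lambda>x. F x * J' x - F' x * J x + (\<Sum>i\<in>UNIV. K x $ i * pd U i H' x - K' x $ i * pd U i H x))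
    (\<lambda>x. G x * J' x - G' x * J x + (\<Sum>i\<in>UNIV. K x $ i * pd U i J' x - K' x $ i * pd U i J x))
    (\<lambda>x. \<chi> i. \<Sum>j\<in>UNIV. K x $ j * pd U j (\<lambda>y. K' y $ i) x - K' x $ j * pd U j (\<lambda>y. K y $ i) x)"
proof -
  note bV = adaptedD[OF V] and bW = adaptedD[OF W]
  note s = bV(1) bW(1) pd_smooth[OF fat_N bV(1)] pd_smooth[OF fat_N bW(1)]
  have c: "commutator N V W p $ a = (\<Sum>b\<in>UNIV. V p $ b * pd N b (\<lambda>q. W q $ a) p - W p $ b * pd N b (\<lambda>q. V q $ a) p)" for p a
    by (simp add: commutator_def)
  have r: "pd N Radial (\<lambda>p. commutator N V W p $ a) (point t 0 x)
    = (\<Sum>b\<in>UNIV. V (point t 0 x) $ b * pd N b (pd N Radial (\<lambda>q. W q $ a)) (point t 0 x)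
        + pd N Radial (\<lambda>q. V q $ b) (point t 0 x) * pd N b (\<lambda>q. W q $ a) (point t 0 x)
        - (W (point t 0 x) $ b * pd N b (pd N Radial (\<lambda>q. V q $ a)) (point t 0 x)
        + pd N Radial (\<lambda>q. W q $ b) (point t 0 x) * pd N b (\<lambda>q. V q $ a) (point t 0 x)))"
    if x: "x \<in> U" for a t x
    unfolding c using boundary_in[OF x, of t]
    by (simp add: pd_sum[OF fat_N] pd_diff[OF fat_N] pd_mult[OF fat_N] smooth_on_diff smooth_on_mult s
        pd_symmetric[OF fat_N _ bV(1)] pd_symmetric[OF fat_N _ bW(1)])
  have "smooth_on N (\<lambda>p. commutator N V W p $ a)" for a
    unfolding c by (intro smooth_on_sum smooth_on_diff smooth_on_mult s)
  then show ?thesis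
    unfolding adapted_def
    by (intro conjI allI ballI)
      (simp_all add: r c[of "point _ 0 _"] sum_coord bV bW adapted_pd[OF V] adapted_pd[OF W]
        adapted_tangential[OF V sV] adapted_tangential[OF W sW]
        algebra_simps sum.distrib sum_subtractf sum_distrib_left)
qed

end

lemma near_horizon_fields_iff:
  assumes "collar_domain U N" and \<gamma>: "\<And>a b. smooth_on U (\<lambda>y. \<gamma> y $ a $ b)"
    "\<And>y a b. y \<in> U \<Longrightarrow> \<gamma> y $ a $ b = \<gamma> y $ b $ a" "\<And>x. x \<in> U \<Longrightarrow> det (\<gamma> x) \<noteq> 0"
  shows "V \<in> near_horizon_fields U N \<gamma> \<longleftrightarrow> (\<exists>F G H J K. smooth_on U F \<and> smooth_on U G \<and> smooth_on U H \<and> smooth_on U J \<and>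
     (\<forall>i. smooth_on U (\<lambda>x. K x $ i)) \<and> divfree U (\<lambda>y. det (\<gamma> y)) K \<and> collar_domain.adapted U N V F G H J K)"
proof -
  interpret collar_domain U N by fact
  have d: "(\<forall>x\<in>U. (\<Sum>i\<in>UNIV. nabla_vec U \<gamma> i K i x) = 0) \<longleftrightarrow> divfree U (\<lambda>y. det (\<gamma> y)) K" for K
    unfolding divfree_def using divergence_density[OF open_U _ \<gamma>, of _ K] \<gamma>(3)
    by (metis (no_types, lifting) mult_eq_0_iff zero_neq_numeral)
  have k: "smooth_on U K \<longleftrightarrow> (\<forall>i. smooth_on U (\<lambda>x. K x $ i))" for K :: "real ^ 'a \<Rightarrow> real ^ 'a"
    using smooth_on_vec smooth_on_vec_nth by blast
  have v: "smooth_on N V \<longleftrightarrow> (\<forall>i. smooth_on N (\<lambda>x. V x $ i))"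
    using smooth_on_vec smooth_on_vec_nth by blast
  have eq: "(smooth_on U F \<and> smooth_on U G \<and> smooth_on U H \<and> smooth_on U J \<and> (\<forall>i. smooth_on U (\<lambda>x. K x $ i)) \<and>
       divfree U (\<lambda>y. det (\<gamma> y)) K \<and>
       rho_order N 2 (\<lambda>p. V p $ Time - (F (cross p) + p $ Time * G (cross p))) \<and>
       rho_order N 2 (\<lambda>p. V p $ Radial - p $ Radial * (H (cross p) + p $ Time * J (cross p))) \<and>
       (\<forall>i. rho_order N 2 (\<lambda>p. V p $ Cross i - K (cross p) $ i)) \<and> (\<forall>i. smooth_on N (\<lambda>x. V x $ i)))
    \<longleftrightarrow> (smooth_on U F \<and> smooth_on U G \<and> smooth_on U H \<and> smooth_on U J \<and> (\<forall>i. smooth_on U (\<lambda>x. K x $ i)) \<and>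
       divfree U (\<lambda>y. det (\<gamma> y)) K \<and> adapted V F G H J K)" for F G H J K
    using adapted_iff[of F G H J K V] by blast
  show ?thesis
    unfolding near_horizon_fields_def mem_Collect_eq d k v
    unfolding eq[symmetric]
  proof (intro iffI; elim conjE exE)
    fix F G H J K
    assume "\<forall>i. smooth_on N (\<lambda>x. V x $ i)" "smooth_on U F" "smooth_on U G" "smooth_on U H" "smooth_on U J"
      "\<forall>i. smooth_on U (\<lambda>x. K x $ i)" "divfree U (\<lambda>y. det (\<gamma> y)) K"
      "rho_order N 2 (\<lambda>p. V p $ Time - (F (cross p) + p $ Time * G (cross p)))"
      "rho_order N 2 (\<lambda>p. V p $ Radial - p $ Radial * (H (cross p) + p $ Time * J (cross p)))"
      "\<forall>i. rho_order N 2 (\<lambda>p. V p $ Cross i - K (cross p) $ i)"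
    then show "\<exists>F G H J K. smooth_on U F \<and> smooth_on U G \<and> smooth_on U H \<and> smooth_on U J \<and> (\<forall>i. smooth_on U (\<lambda>x. K x $ i)) \<and>
       divfree U (\<lambda>y. det (\<gamma> y)) K \<and>
       rho_order N 2 (\<lambda>p. V p $ Time - (F (cross p) + p $ Time * G (cross p))) \<and>
       rho_order N 2 (\<lambda>p. V p $ Radial - p $ Radial * (H (cross p) + p $ Time * J (cross p))) \<and>
       (\<forall>i. rho_order N 2 (\<lambda>p. V p $ Cross i - K (cross p) $ i)) \<and> (\<forall>i. smooth_on N (\<lambda>x. V x $ i))"
      by (intro exI[of _ F] exI[of _ G] exI[of _ H] exI[of _ J] exI[of _ K] conjI)
  next
    fix F G H J K
    assume "\<forall>i. smooth_on N (\<lambda>x. V x $ i)" "smooth_on U F" "smooth_on U G" "smooth_on U H" "smooth_on U J"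
      "\<forall>i. smooth_on U (\<lambda>x. K x $ i)" "divfree U (\<lambda>y. det (\<gamma> y)) K"
      "rho_order N 2 (\<lambda>p. V p $ Time - (F (cross p) + p $ Time * G (cross p)))"
      "rho_order N 2 (\<lambda>p. V p $ Radial - p $ Radial * (H (cross p) + p $ Time * J (cross p)))"
      "\<forall>i. rho_order N 2 (\<lambda>p. V p $ Cross i - K (cross p) $ i)"
    then show "(\<forall>i. smooth_on N (\<lambda>x. V x $ i)) \<and> (\<exists>F G H J K. smooth_on U F \<and> smooth_on U G \<and> smooth_on U H \<and> smooth_on U J \<and>
       (\<forall>i. smooth_on U (\<lambda>x. K x $ i)) \<and> divfree U (\<lambda>y. det (\<gamma> y)) K \<and>
       rho_order N 2 (\<lambda>p. V p $ Time - (F (cross p) + p $ Time * G (cross p))) \<and>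
       rho_order N 2 (\<lambda>p. V p $ Radial - p $ Radial * (H (cross p) + p $ Time * J (cross p))) \<and>
       (\<forall>i. rho_order N 2 (\<lambda>p. V p $ Cross i - K (cross p) $ i)))"
      by (intro exI[of _ F] exI[of _ G] exI[of _ H] exI[of _ J] exI[of _ K] conjI)
  qed
qed

section \<open>Flows of symmetries\<close>

text \<open>Gronwall's argument: exp (- 2 C s) |y|^2 does not increase.\<close>

lemma linear_ode_zero:
  fixes y :: "real \<Rightarrow> 'a::real_inner"
  assumes y: "\<And>s. s \<in> {0..1} \<Longrightarrow> (y has_vector_derivative y' s) (at s within {0..1})"
    and C: "\<And>s. s \<in> {0..1} \<Longrightarrow> norm (y' s) \<le> C * norm (y s)" and "y 0 = 0" and s: "s \<in> {0..1}"
  shows "y s = 0"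
proof -
  define z where "z s = exp (- 2 * C * s) * (y s \<bullet> y s)" for s
  have dz: "(z has_real_derivative exp (- 2 * C * s) * (2 * (y s \<bullet> y' s) - 2 * C * (y s \<bullet> y s))) (at s within {0..1})"
    if "s \<in> {0..1}" for s
  proof -
    have "((\<lambda>s. y s \<bullet> y s) has_vector_derivative y s \<bullet> y' s + y' s \<bullet> y s) (at s within {0..1})"
      by (rule bounded_bilinear.has_vector_derivative[OF bounded_bilinear_inner y[OF that] y[OF that]])
    then have d: "((\<lambda>s. y s \<bullet> y s) has_real_derivative 2 * (y s \<bullet> y' s)) (at s within {0..1})"
      by (simp add: has_real_derivative_iff_has_vector_derivative inner_commute)
    have e: "((\<lambda>s. exp (- 2 * C * s)) has_real_derivative - 2 * C * exp (- 2 * C * s)) (at s within {0..1})"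
      by (auto intro!: derivative_eq_intros)
    have "z = (\<lambda>s. exp (- 2 * C * s) * (y s \<bullet> y s))" by (simp add: z_def fun_eq_iff)
    then show ?thesis using DERIV_mult[OF e d] by (simp add: algebra_simps)
  qed
  have "z s \<le> z 0"
  proof (rule DERIV_nonpos_imp_decreasing_open[where a=0 and b=s and f=z])
    show "0 \<le> s" using s by simp
    show "continuous_on {0..s} z"
      using dz s by (intro continuous_on_subset[OF DERIV_continuous_on[of "{0..1}"]]) auto
    fix u assume u: "0 < u" "u < s"
    then have u1: "u \<in> {0<..<1}" using s by auto
    have "at u within {0..1} = at u" using u1 by (intro at_within_interior) auto
    moreover have "y u \<bullet> y' u \<le> C * (y u \<bullet> y u)"
    proof -
      have "y u \<bullet> y' u \<le> norm (y u) * norm (y' u)" by (rule norm_cauchy_schwarz)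
      also have "\<dots> \<le> norm (y u) * (C * norm (y u))" using C[of u] u1 by (intro mult_left_mono) auto
      finally show ?thesis by (simp add: dot_square_norm power2_eq_square mult_ac)
    qed
    then have "exp (- 2 * C * u) * (2 * (y u \<bullet> y' u) - 2 * C * (y u \<bullet> y u)) \<le> 0"
      by (intro mult_nonneg_nonpos) auto
    ultimately show "\<exists>d. (z has_real_derivative d) (at u) \<and> d \<le> 0" using dz[of u] u1 by fastforce
  qed
  then have "y s \<bullet> y s \<le> 0" using assms(3) by (simp add: z_def mult_le_0_iff)
  then have "y s \<bullet> y s = 0" using inner_ge_zero[of "y s"] by linarith
  then show ?thesis by simp
qed

lemma scalar_ode_exp:
  fixes y :: "real \<Rightarrow> real"
  assumes y: "\<And>s. s \<in> {0..1} \<Longrightarrow> (y has_real_derivative a s * y s) (at s within {0..1})"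
    and a: "continuous_on {0..1} a" and s: "s \<in> {0..1}"
  shows "y s = y 0 * exp (integral {0..s} a)"
proof -
  let ?A = "\<lambda>s. integral {0..s} a"
  have A: "(?A has_real_derivative a s) (at s within {0..1})" if "s \<in> {0..1}" for s
    by (rule integral_has_real_derivative[OF a that])
  have "((\<lambda>s. y s * exp (- ?A s)) has_real_derivative 0) (at s within {0..1})" if "s \<in> {0..1}" for s
    by (rule DERIV_cong[OF DERIV_mult[OF y[OF that]]], rule derivative_eq_intros,
        rule DERIV_minus[OF A[OF that]], rule refl) simp
  then have "((\<lambda>s. y s * exp (- ?A s)) has_derivative (\<lambda>h. 0)) (at s within {0..1})" if "s \<in> {0..1}" for s
    using that unfolding has_field_derivative_def by (metis (no_types, lifting) ext mult_zero_left)
  from has_derivative_zero_unique[OF convex_real_interval(5) this _ s, of 0]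
  have "y s * exp (- ?A s) = y 0" by simp
  then show ?thesis by (simp add: exp_minus field_simps)
qed

text \<open>What a generated diffeomorphism looks like at the horizon, in a form closed under
  composition. The determinant is squared because d will be det \<gamma>, the square of the volume
  density. Smoothness of e, b and c is recovered from \<phi> in \<open>smooth_ebc\<close>.\<close>

definition horizon_map where
  "horizon_map U W N d \<phi> \<longleftrightarrow> (\<forall>c. smooth_on W (\<lambda>q. \<phi> q $ c)) \<and> (\<forall>p\<in>W. \<phi> p \<in> N) \<and>
    (\<exists>a b k e c. \<forall>t. \<forall>x\<in>U. \<phi> (point t 0 x) = point (a x + t * b x) 0 (k x) \<and> b x \<noteq> 0 \<and>
      pd W Radial (\<lambda>q. \<phi> q $ Radial) (point t 0 x) = exp (e x + t * c x) \<and>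
      (\<forall>i. pd W Radial (\<lambda>q. \<phi> q $ Cross i) (point t 0 x) = 0) \<and>
      (det (\<chi> i j. pd W (Cross j) (\<lambda>q. \<phi> q $ Cross i) (point t 0 x)))\<^sup>2 * d (k x) = d x)"
  for \<phi> :: "real ^ ('m::finite) coord \<Rightarrow> real ^ 'm coord" and d :: "real ^ 'm \<Rightarrow> real"

lemma horizon_mapE:
  assumes "horizon_map U W N d \<phi>"
  obtains a b k e c where "\<And>t x. x \<in> U \<Longrightarrow> \<phi> (point t 0 x) = point (a x + t * b x) 0 (k x)"
    "\<And>x. x \<in> U \<Longrightarrow> b x \<noteq> 0"
    "\<And>t x. x \<in> U \<Longrightarrow> pd W Radial (\<lambda>q. \<phi> q $ Radial) (point t 0 x) = exp (e x + t * c x)"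
    "\<And>t x i. x \<in> U \<Longrightarrow> pd W Radial (\<lambda>q. \<phi> q $ Cross i) (point t 0 x) = 0"
    "\<And>t x. x \<in> U \<Longrightarrow> (det (\<chi> i j. pd W (Cross j) (\<lambda>q. \<phi> q $ Cross i) (point t 0 x)))\<^sup>2 * d (k x) = d x"
proof -
  from assms obtain a b k e c where *: "\<forall>t. \<forall>x\<in>U. \<phi> (point t 0 x) = point (a x + t * b x) 0 (k x) \<and> b x \<noteq> 0 \<and>
      pd W Radial (\<lambda>q. \<phi> q $ Radial) (point t 0 x) = exp (e x + t * c x) \<and>
      (\<forall>i. pd W Radial (\<lambda>q. \<phi> q $ Cross i) (point t 0 x) = 0) \<and>
      (det (\<chi> i j. pd W (Cross j) (\<lambda>q. \<phi> q $ Cross i) (point t 0 x)))\<^sup>2 * d (k x) = d x"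
    unfolding horizon_map_def by (elim conjE exE) (rule that)
  show thesis by (rule that[where a=a and b=b and k=k and e=e and c=c]) (simp_all add: *)
qed

lemma horizon_map_id:
  assumes "collar_domain U W" "W \<subseteq> N"
  shows "horizon_map U W N d id"
proof -
  interpret collar_domain U W by fact
  have "(\<chi> i j. pd W (Cross j) (\<lambda>q. q $ Cross i) (point t 0 x)) = mat 1" if "x \<in> U" for t x
    by (simp add: vec_eq_iff pd_coord[OF fat_N boundary_in[OF that]] mat_def)
  then show ?thesis
    unfolding horizon_map_def using assms(2)
    apply (intro conjI allI ballI)
      apply (simp add: smooth_on_component)
     apply auto[1]
    apply (rule exI[of _ "\<lambda>_. 0"], rule exI[of _ "\<lambda>_. 1"], rule exI[of _ "\<lambda>x. x"], rule exI[of _ "\<lambda>_. 0"], rule exI[of _ "\<lambda>_. 0"])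
    apply (simp add: pd_coord[OF fat_N boundary_in])
    done
qed

lemma horizon_map_comp:
  assumes "collar_domain U W" "collar_domain U W'"
    and \<phi>: "horizon_map U W W' d \<phi>" and \<phi>': "horizon_map U W' N d \<phi>'"
  shows "horizon_map U W N d (\<phi>' \<circ> \<phi>)"
proof -
  interpret W: collar_domain U W by fact
  interpret W': collar_domain U W' by fact
  have s: "smooth_on W (\<lambda>q. \<phi> q $ c)" "smooth_on W' (\<lambda>q. \<phi>' q $ c)" for c
    using \<phi> \<phi>' by (auto simp: horizon_map_def)
  have s\<phi>: "smooth_on W \<phi>" by (rule smooth_on_vec[OF s(1)])
  have m: "p \<in> W \<Longrightarrow> \<phi> p \<in> W'" "p \<in> W' \<Longrightarrow> \<phi>' p \<in> N" for p
    using \<phi> \<phi>' by (auto simp: horizon_map_def)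
  obtain a b k e c where 1: "\<And>t x. x \<in> U \<Longrightarrow> \<phi> (point t 0 x) = point (a x + t * b x) 0 (k x)"
    "\<And>x. x \<in> U \<Longrightarrow> b x \<noteq> 0"
    "\<And>t x. x \<in> U \<Longrightarrow> pd W Radial (\<lambda>q. \<phi> q $ Radial) (point t 0 x) = exp (e x + t * c x)"
    "\<And>t x i. x \<in> U \<Longrightarrow> pd W Radial (\<lambda>q. \<phi> q $ Cross i) (point t 0 x) = 0"
    "\<And>t x. x \<in> U \<Longrightarrow> (det (\<chi> i j. pd W (Cross j) (\<lambda>q. \<phi> q $ Cross i) (point t 0 x)))\<^sup>2 * d (k x) = d x"
    by (rule horizon_mapE[OF \<phi>]) (rule that; simp)
  obtain a' b' k' e' c' where 2: "\<And>t x. x \<in> U \<Longrightarrow> \<phi>' (point t 0 x) = point (a' x + t * b' x) 0 (k' x)"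
    "\<And>x. x \<in> U \<Longrightarrow> b' x \<noteq> 0"
    "\<And>t x. x \<in> U \<Longrightarrow> pd W' Radial (\<lambda>q. \<phi>' q $ Radial) (point t 0 x) = exp (e' x + t * c' x)"
    "\<And>t x i. x \<in> U \<Longrightarrow> pd W' Radial (\<lambda>q. \<phi>' q $ Cross i) (point t 0 x) = 0"
    "\<And>t x. x \<in> U \<Longrightarrow> (det (\<chi> i j. pd W' (Cross j) (\<lambda>q. \<phi>' q $ Cross i) (point t 0 x)))\<^sup>2 * d (k' x) = d x"
    by (rule horizon_mapE[OF \<phi>']) (rule that; simp)
  have kU: "k x \<in> U" if "x \<in> U" for x
    using W'.N_D(2)[OF m(1)[OF W.boundary_in[OF that, of 0]]] by (simp add: 1(1)[OF that])
  have ch: "pd W i (\<lambda>q. \<phi>' (\<phi> q) $ j) p = (\<Sum>l\<in>UNIV. pd W' l (\<lambda>q. \<phi>' q $ j) (\<phi> p) * pd W i (\<lambda>q. \<phi> q $ l) p)"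
    if "p \<in> W" for i j p
    by (rule pd_chain_gen[OF W.fat_N that s(2) m(1) s\<phi>])
  have tC: "pd W' Time (\<lambda>q. \<phi>' q $ Cross i) (point t 0 x) = 0" if "x \<in> U" for i t x
    by (rule W'.pd_Time_eq[where \<phi>="\<lambda>s. k' x $ i", OF s(2) that]) (simp_all add: 2(1)[OF that])
  have tR: "pd W' l (\<lambda>q. \<phi>' q $ Radial) (point t 0 x) = 0" if "x \<in> U" "l \<noteq> Radial" for l t x
    by (rule W'.pd_tangent_zero[OF s(2) _ that(2,1)]) (simp add: 2(1))
  have "(\<chi> i j. pd W (Cross j) (\<lambda>q. \<phi>' (\<phi> q) $ Cross i) (point t 0 x))
     = (\<chi> i j. pd W' (Cross j) (\<lambda>q. \<phi>' q $ Cross i) (point (a x + t * b x) 0 (k x)))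
      ** (\<chi> i j. pd W (Cross j) (\<lambda>q. \<phi> q $ Cross i) (point t 0 x))" if x: "x \<in> U" for t x
    by (simp add: vec_eq_iff matrix_mult_entry ch[OF W.boundary_in[OF x]] sum_coord 1(1)[OF x] tC[OF kU[OF x]] 2(4)[OF kU[OF x]])
  then have dm: "det (\<chi> i j. pd W (Cross j) (\<lambda>q. \<phi>' (\<phi> q) $ Cross i) (point t 0 x))
     = det (\<chi> i j. pd W' (Cross j) (\<lambda>q. \<phi>' q $ Cross i) (point (a x + t * b x) 0 (k x)))
      * det (\<chi> i j. pd W (Cross j) (\<lambda>q. \<phi> q $ Cross i) (point t 0 x))" if "x \<in> U" for t x
    using that by (simp add: det_mul)
  have D: "(det (\<chi> i j. pd W (Cross j) (\<lambda>q. \<phi>' (\<phi> q) $ Cross i) (point t 0 x)))\<^sup>2 * d (k' (k x)) = d x"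
    if "x \<in> U" for t x
  proof -
    have "(B * A)\<^sup>2 * D = A\<^sup>2 * (B\<^sup>2 * D)" for A B D :: real by (simp add: power_mult_distrib)
    then show ?thesis
      using 1(5)[OF that, of t] 2(5)[OF kU[OF that], of "a x + t * b x"]
      by (simp only: dm[OF that])
  qed
  \<comment> \<open>The new coefficients come from substituting t' = a + t b into a' + t' b' and
    into the exponent e' + t' c', to which e + t c is added by the chain rule.\<close>
  have "\<phi>' (\<phi> (point t 0 x)) = point ((a' (k x) + a x * b' (k x)) + t * (b x * b' (k x))) 0 (k' (k x)) \<and>
      b x * b' (k x) \<noteq> 0 \<and>
      pd W Radial (\<lambda>q. \<phi>' (\<phi> q) $ Radial) (point t 0 x)
        = exp ((e' (k x) + a x * c' (k x) + e x) + t * (b x * c' (k x) + c x)) \<and>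
      (\<forall>i. pd W Radial (\<lambda>q. \<phi>' (\<phi> q) $ Cross i) (point t 0 x) = 0) \<and>
      (det (\<chi> i j. pd W (Cross j) (\<lambda>q. \<phi>' (\<phi> q) $ Cross i) (point t 0 x)))\<^sup>2 * d (k' (k x)) = d x"
    if x: "x \<in> U" for t x
    using 1(2)[OF x] 2(2)[OF kU[OF x]]
    by (intro conjI allI D[OF x])
      (simp_all add: ch[OF W.boundary_in[OF x]] sum_coord 1(1-4)[OF x] 2(1-4)[OF kU[OF x]] tC[OF kU[OF x]] tR[OF kU[OF x]]
        exp_add[symmetric] algebra_simps)
  moreover have "smooth_on W (\<lambda>q. \<phi>' (\<phi> q) $ c)" for c
    by (rule smooth_on_compose[OF s\<phi> s(2) m(1)])
  ultimately show ?thesis unfolding horizon_map_def comp_apply using m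
    apply (intro conjI allI ballI)
      apply blast
     apply blast
    apply (rule exI[of _ "\<lambda>x. a' (k x) + a x * b' (k x)"], rule exI[of _ "\<lambda>x. b x * b' (k x)"],
      rule exI[of _ "\<lambda>x. k' (k x)"], rule exI[of _ "\<lambda>x. e' (k x) + a x * c' (k x) + e x"],
      rule exI[of _ "\<lambda>x. b x * c' (k x) + c x"])
    apply blast
    done
qed

locale smooth_flow = collar_domain U N + W: collar_domain U W
  for U :: "(real ^ ('m::finite)) set" and N W :: "(real ^ 'm coord) set" +
  fixes V :: "real ^ 'm coord \<Rightarrow> real ^ 'm coord" and \<Phi> :: "real \<Rightarrow> real ^ 'm coord \<Rightarrow> real ^ 'm coord"
    and F G H J :: "real ^ 'm \<Rightarrow> real" and K :: "real ^ 'm \<Rightarrow> real ^ 'm" and d :: "real ^ 'm \<Rightarrow> real"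
  assumes smooth_flow: "smooth_on ({0..1} \<times> W) (\<lambda>(s, p). \<Phi> s p)"
    and flow_0: "\<And>p. p \<in> W \<Longrightarrow> \<Phi> 0 p = p"
    and flow_in: "\<And>p s. p \<in> W \<Longrightarrow> s \<in> {0..1} \<Longrightarrow> \<Phi> s p \<in> N"
    and flow: "\<And>p s. p \<in> W \<Longrightarrow> s \<in> {0..1} \<Longrightarrow> ((\<lambda>r. \<Phi> r p) has_vector_derivative V (\<Phi> s p)) (at s within {0..1})"
    and V: "adapted V F G H J K"
    and smooth_coeffs: "smooth_on U F" "smooth_on U G" "smooth_on U H" "smooth_on U J" "\<And>i. smooth_on U (\<lambda>x. K x $ i)"
    and smooth_d: "smooth_on U d" and K_divfree: "divfree U d K"
begin

abbreviation "S \<equiv> {0..1::real} \<times> W"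

section \<open>Joint derivatives of the flow in flow time and space\<close>

lemma fat_S: "fat S" by (intro fat_Times fat_unit_interval W.fat_N)

lemma smooth_component: "smooth_on S (\<lambda>z. \<Phi> (fst z) (snd z) $ c)"
  using smooth_on_vec_nth[OF smooth_flow] by (simp add: split_def)

lemma smooth_slice:
  assumes "smooth_on S h" "s \<in> {0..1}" shows "smooth_on W (\<lambda>q. h (s, q))"
proof (rule smooth_on_compose[OF _ assms(1)])
  have "bounded_linear (\<lambda>q :: real ^ 'm coord. (0::real, q))"
    by (intro bounded_linear_Pair bounded_linear_zero bounded_linear_ident)
  then show "smooth_on W (\<lambda>q. (s, q))"
    using smooth_on_add[OF smooth_on_const[of W "(s, 0)"] smooth_on_linear] by fastforce
qed (use assms(2) in auto)

lemma slice_derivative: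
  assumes h: "smooth_on S (h :: _ \<Rightarrow> real)" and s: "s \<in> {0..1}" and p: "p \<in> W"
  shows "frechet_derivative h (at (s, p) within S) (0, axis i 1) = pd W i (\<lambda>q. h (s, q)) p"
proof -
  have sp: "(s, p) \<in> S" using s p by auto
  have "((\<lambda>q. (s, q)) has_derivative (\<lambda>v. (0, v))) (at p within W)"
    by (auto intro!: derivative_eq_intros)
  moreover have "(h has_derivative frechet_derivative h (at (s, p) within S)) (at (s, p) within (\<lambda>q. (s, q)) ` W)"
    by (rule has_derivative_subset[OF smooth_on_has_derivative[OF h sp]]) (use s in auto)
  ultimately have "((\<lambda>q. h (s, q)) has_derivative (\<lambda>v. frechet_derivative h (at (s, p) within S) (0, v))) (at p within W)"
    by (rule has_derivative_in_compose)
  from pdI[OF W.fat_N p this] show ?thesis by simp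
qed

lemma curve_derivative:
  assumes h: "smooth_on S (h :: _ \<Rightarrow> real)" and s: "s \<in> {0..1}" and p: "p \<in> W"
  shows "((\<lambda>r. h (r, p)) has_real_derivative frechet_derivative h (at (s, p) within S) (1, 0)) (at s within {0..1})"
proof -
  have sp: "(s, p) \<in> S" using s p by auto
  note d = smooth_on_has_derivative[OF h sp]
  have l: "linear (frechet_derivative h (at (s, p) within S))" using d by (rule has_derivative_linear)
  have "((\<lambda>r. (r, p)) has_derivative (\<lambda>v. (v, 0))) (at s within {0..1})"
    by (auto intro!: derivative_eq_intros)
  moreover have "(h has_derivative frechet_derivative h (at (s, p) within S)) (at (s, p) within (\<lambda>r. (r, p)) ` {0..1})"
    by (rule has_derivative_subset[OF d]) (use p in auto)
  ultimately have "((\<lambda>r. h (r, p)) has_derivative (\<lambda>v. frechet_derivative h (at (s, p) within S) (v, 0))) (at s within {0..1})"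
    by (rule has_derivative_in_compose)
  moreover have "(\<lambda>v. frechet_derivative h (at (s, p) within S) (v, 0)) = (*) (frechet_derivative h (at (s, p) within S) (1, 0))"
  proof (rule ext)
    fix v :: real
    show "frechet_derivative h (at (s, p) within S) (v, 0) = frechet_derivative h (at (s, p) within S) (1, 0) * v"
      using linear_scale[OF l, of v "(1, 0)"]
      by (simp only: scaleR_Pair real_scaleR_def mult_1_right mult_1_left scaleR_zero_right mult.commute)
  qed
  ultimately show ?thesis unfolding has_field_derivative_def by (simp only:)
qed

lemma flow_component:
  assumes "p \<in> W" "s \<in> {0..1}"
  shows "((\<lambda>r. \<Phi> r p $ c) has_real_derivative V (\<Phi> s p) $ c) (at s within {0..1})"
  using bounded_linear.has_vector_derivative[OF bounded_linear_vec_nth flow[OF assms]]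
  by (simp add: has_real_derivative_iff_has_vector_derivative)

text \<open>Identifies the partial derivative of the jointly smooth \<Phi> with the right-hand side
  of the flow equation; at the ends of the time interval this rests on uniqueness of derivatives
  within the fat set [0, 1].\<close>

lemma time_derivative:
  assumes "p \<in> W" "s \<in> {0..1}"
  shows "frechet_derivative (\<lambda>z. \<Phi> (fst z) (snd z) $ c) (at (s, p) within S) (1, 0) = V (\<Phi> s p) $ c"
proof -
  have 1: "((\<lambda>r. \<Phi> r p $ c) has_derivative (*) (frechet_derivative (\<lambda>z. \<Phi> (fst z) (snd z) $ c) (at (s, p) within S) (1, 0))) (at s within {0..1})"
    using curve_derivative[OF smooth_component assms(2,1), of c] by (simp add: has_field_derivative_def)
  have 2: "((\<lambda>r. \<Phi> r p $ c) has_derivative (*) (V (\<Phi> s p) $ c)) (at s within {0..1})"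
    using flow_component[OF assms, of c] by (simp add: has_field_derivative_def)
  have "(*) (frechet_derivative (\<lambda>z. \<Phi> (fst z) (snd z) $ c) (at (s, p) within S) (1, 0)) = (*) (V (\<Phi> s p) $ c)"
    by (rule trans[OF fat_frechet[OF fat_unit_interval assms(2) 1, symmetric] fat_frechet[OF fat_unit_interval assms(2) 2]])
  from fun_cong[OF this, of 1] show ?thesis by simp
qed

lemma smooth_flow_slice: "s \<in> {0..1} \<Longrightarrow> smooth_on W (\<lambda>q. \<Phi> s q $ c)"
  using smooth_slice[OF smooth_component] by simp

text \<open>The derivatives in \<open>s\<close> and in space commute.\<close>

lemma variational:
  assumes p: "p \<in> W" and s: "s \<in> {0..1}"
  shows "((\<lambda>r. pd W i (\<lambda>q. \<Phi> r q $ c) p) has_real_derivative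
    (\<Sum>b\<in>UNIV. pd N b (\<lambda>q. V q $ c) (\<Phi> s p) * pd W i (\<lambda>q. \<Phi> s q $ b) p)) (at s within {0..1})"
proof -
  let ?f = "\<lambda>z. \<Phi> (fst z) (snd z) $ c"
  have sd: "smooth_on S (\<lambda>z. frechet_derivative ?f (at z within S) v)" for v
    by (rule smooth_on_frechet[OF fat_S smooth_component])
  have sp: "(s, p) \<in> S" using s p by auto
  have "((\<lambda>r. frechet_derivative ?f (at (r, p) within S) (0, axis i 1)) has_real_derivative
     frechet_derivative (\<lambda>z. frechet_derivative ?f (at z within S) (0, axis i 1)) (at (s, p) within S) (1, 0)) (at s within {0..1})"
    by (rule curve_derivative[OF sd s p])
  also have "frechet_derivative (\<lambda>z. frechet_derivative ?f (at z within S) (0, axis i 1)) (at (s, p) within S) (1, 0)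
     = frechet_derivative (\<lambda>z. frechet_derivative ?f (at z within S) (1, 0)) (at (s, p) within S) (0, axis i 1)"
    by (rule smooth_on_symmetric[OF fat_S smooth_component sp])
  also have "\<dots> = pd W i (\<lambda>q. frechet_derivative ?f (at (s, q) within S) (1, 0)) p"
    by (rule slice_derivative[OF sd s p])
  also have "\<dots> = pd W i (\<lambda>q. V (\<Phi> s q) $ c) p"
    by (rule pd_cong[OF W.fat_N p smooth_on_compose[OF smooth_on_vec[OF smooth_flow_slice[OF s]] adaptedD(1)[OF V] flow_in]])
      (use s in \<open>auto simp: time_derivative\<close>)
  also have "\<dots> = (\<Sum>b\<in>UNIV. pd N b (\<lambda>q. V q $ c) (\<Phi> s p) * pd W i (\<lambda>q. \<Phi> s q $ b) p)"
    by (rule pd_chain_gen[OF W.fat_N p adaptedD(1)[OF V] flow_in[OF _ s] smooth_on_vec[OF smooth_flow_slice[OF s]]])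
  finally have *: "((\<lambda>r. frechet_derivative ?f (at (r, p) within S) (0, axis i 1)) has_real_derivative
    (\<Sum>b\<in>UNIV. pd N b (\<lambda>q. V q $ c) (\<Phi> s p) * pd W i (\<lambda>q. \<Phi> s q $ b) p)) (at s within {0..1})" .
  show ?thesis
    using * by (rule has_field_derivative_transform_within[where d=1])
      (use s p in \<open>auto simp: slice_derivative[OF smooth_component]\<close>)
qed

lemma continuous_along:
  assumes "p \<in> W" "continuous_on N f"
  shows "continuous_on {0..1} (\<lambda>s. f (\<Phi> s p))"
proof (rule continuous_on_compose2[OF assms(2)])
  show "continuous_on {0..1} (\<lambda>s. \<Phi> s p)"
    using flow[OF assms(1)] by (intro continuous_on_vector_derivative)
qed (use flow_in[OF assms(1)] in auto)

lemma continuous_bounded: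
  assumes "continuous_on {0..1::real} (f :: _ \<Rightarrow> real)"
  obtains C where "\<And>s. s \<in> {0..1} \<Longrightarrow> \<bar>f s\<bar> \<le> C"
proof -
  obtain C where "\<forall>z\<in>f ` {0..1}. norm z \<le> C"
    using compact_imp_bounded[OF compact_continuous_image[OF assms compact_Icc]] unfolding bounded_iff by blast
  then show thesis by (intro that[of C]) auto
qed

text \<open>V^\<rho> is \<rho> times a smooth function, so along an integral curve \<rho> solves a
  homogeneous linear equation and stays 0: the horizon is invariant.\<close>

lemma flow_boundary_Radial:
  assumes x: "x \<in> U" and s: "s \<in> {0..1}"
  shows "\<Phi> s (point t 0 x) $ Radial = 0"
proof -
  note p = W.boundary_in[OF x, of t]
  let ?r = "rho_quot N (\<lambda>q. V q $ Radial)"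
  have "continuous_on N ?r"
    by (rule smooth_on_continuous[OF smooth_on_rho_quot[OF adaptedD(1,3)[OF V]]])
  then obtain C where C: "\<And>s. s \<in> {0..1} \<Longrightarrow> \<bar>?r (\<Phi> s (point t 0 x))\<bar> \<le> C"
    using continuous_bounded[OF continuous_along[OF p]] by blast
  have "((\<lambda>s. \<Phi> s (point t 0 x) $ Radial) has_vector_derivative V (\<Phi> s (point t 0 x)) $ Radial) (at s within {0..1})"
    if "s \<in> {0..1}" for s
    using flow_component[OF p that] by (simp add: has_real_derivative_iff_has_vector_derivative)
  then show ?thesis
  proof (rule linear_ode_zero[where C=C and y="\<lambda>s. \<Phi> s (point t 0 x) $ Radial", OF _ _ _ s])
    fix s :: real assume s: "s \<in> {0..1}"
    have "V (\<Phi> s (point t 0 x)) $ Radial = \<Phi> s (point t 0 x) $ Radial * ?r (\<Phi> s (point t 0 x))"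
      by (rule rho_quot_mult[where f="\<lambda>q. V q $ Radial", OF adaptedD(3)[OF V] flow_in[OF p s]])
    then show "norm (V (\<Phi> s (point t 0 x)) $ Radial) \<le> C * norm (\<Phi> s (point t 0 x) $ Radial)"
      using mult_right_mono[OF C[OF s], of "\<bar>\<Phi> s (point t 0 x) $ Radial\<bar>"] by (simp add: abs_mult mult.commute)
  next
    show "\<Phi> 0 (point t 0 x) $ Radial = 0" by (subst flow_0[OF p]) simp
  qed
qed

lemma flow_boundary:
  assumes x: "x \<in> U" and s: "s \<in> {0..1}"
  shows "\<Phi> s (point t 0 x) = point (\<Phi> s (point t 0 x) $ Time) 0 (cross (\<Phi> s (point t 0 x)))"
    "cross (\<Phi> s (point t 0 x)) \<in> U"
  using flow_boundary_Radial[OF assms, of t] point_eq[of "\<Phi> s (point t 0 x)"] N_D(2)[OF flow_in[OF W.boundary_in[OF x] s]] by auto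

lemma field_derivatives:
  fixes t :: real
  assumes x: "x \<in> U" and s: "s \<in> {0..1}"
  defines "y \<equiv> cross (\<Phi> s (point t 0 x))"
  shows "pd N Time (\<lambda>q. V q $ Time) (\<Phi> s (point t 0 x)) = G y"
    "pd N Radial (\<lambda>q. V q $ Time) (\<Phi> s (point t 0 x)) = 0"
    "a \<noteq> Radial \<Longrightarrow> pd N a (\<lambda>q. V q $ Radial) (\<Phi> s (point t 0 x)) = 0"
    "pd N Radial (\<lambda>q. V q $ Radial) (\<Phi> s (point t 0 x)) = H y + \<Phi> s (point t 0 x) $ Time * J y"
    "pd N Time (\<lambda>q. V q $ Cross i) (\<Phi> s (point t 0 x)) = 0"
    "pd N Radial (\<lambda>q. V q $ Cross i) (\<Phi> s (point t 0 x)) = 0"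
    "pd N (Cross j) (\<lambda>q. V q $ Cross i) (\<Phi> s (point t 0 x)) = pd U j (\<lambda>z. K z $ i) y"
    "V (\<Phi> s (point t 0 x)) $ Cross i = K y $ i"
proof -
  define T where "T = \<Phi> s (point t 0 x) $ Time"
  have e: "\<Phi> s (point t 0 x) = point T 0 y" unfolding T_def y_def by (rule flow_boundary(1)[OF x s])
  have y: "y \<in> U" unfolding y_def by (rule flow_boundary(2)[OF x s])
  show "pd N Time (\<lambda>q. V q $ Time) (\<Phi> s (point t 0 x)) = G y"
    "pd N Radial (\<lambda>q. V q $ Time) (\<Phi> s (point t 0 x)) = 0"
    "a \<noteq> Radial \<Longrightarrow> pd N a (\<lambda>q. V q $ Radial) (\<Phi> s (point t 0 x)) = 0"
    "pd N Radial (\<lambda>q. V q $ Radial) (\<Phi> s (point t 0 x)) = H y + \<Phi> s (point t 0 x) $ Time * J y"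
    "pd N Time (\<lambda>q. V q $ Cross i) (\<Phi> s (point t 0 x)) = 0"
    "pd N Radial (\<lambda>q. V q $ Cross i) (\<Phi> s (point t 0 x)) = 0"
    "pd N (Cross j) (\<lambda>q. V q $ Cross i) (\<Phi> s (point t 0 x)) = pd U j (\<lambda>z. K z $ i) y"
    "V (\<Phi> s (point t 0 x)) $ Cross i = K y $ i"
    unfolding e by (simp_all add: adapted_pd[OF V y] adaptedD(2-)[OF V] y)
qed

lemma continuous_cross:
  assumes "x \<in> U" "smooth_on U f"
  shows "continuous_on {0..1} (\<lambda>s. f (cross (\<Phi> s (point t 0 x))))"
  by (rule continuous_along[OF W.boundary_in[OF assms(1)] smooth_on_continuous[OF smooth_on_cross_N[OF assms(2)]]])

text \<open>On the horizon \<partial>_t V^M and \<partial>_\<rho> V^M vanish, so the t- or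
  \<rho>-derivatives of the cross components solve a homogeneous linear system with matrix
  \<partial>_j K^i and start at 0.\<close>

lemma pd_flow_Cross_zero:
  assumes x: "x \<in> U" and s: "s \<in> {0..1}" and i: "i = Time \<or> i = Radial"
  shows "pd W i (\<lambda>q. \<Phi> s q $ Cross k) (point t 0 x) = 0"
proof -
  note p = W.boundary_in[OF x, of t]
  let ?M = "\<lambda>s k j. pd U j (\<lambda>z. K z $ k) (cross (\<Phi> s (point t 0 x)))"
  let ?y = "\<lambda>s. \<chi> k. pd W i (\<lambda>q. \<Phi> s q $ Cross k) (point t 0 x)"
  let ?y' = "\<lambda>s. \<chi> k. \<Sum>j\<in>UNIV. ?M s k j * ?y s $ j"
  have "continuous_on {0..1} (\<lambda>s. \<Sum>k\<in>UNIV. \<Sum>j\<in>UNIV. \<bar>?M s k j\<bar>)"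
    by (intro continuous_on_sum continuous_on_rabs continuous_cross[OF x] pd_smooth open_fat open_U smooth_coeffs)
  then obtain C where C: "\<And>s. s \<in> {0..1} \<Longrightarrow> \<bar>\<Sum>k\<in>UNIV. \<Sum>j\<in>UNIV. \<bar>?M s k j\<bar>\<bar> \<le> C"
    using continuous_bounded by blast
  have "(?y has_vector_derivative ?y' s) (at s within {0..1})" if s: "s \<in> {0..1}" for s
    by (rule has_vector_derivative_vec, simp, rule DERIV_cong[OF variational[OF p s]])
      (simp add: sum_coord field_derivatives[OF x s])
  then have "?y s = 0"
  proof (rule linear_ode_zero[where C=C, OF _ _ _ s])
    fix s :: real assume s: "s \<in> {0..1}"
    have "norm (?y' s) \<le> (\<Sum>k\<in>UNIV. \<bar>?y' s $ k\<bar>)" by (rule norm_le_l1_cart)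
    also have "\<dots> \<le> (\<Sum>k\<in>UNIV. \<Sum>j\<in>UNIV. \<bar>?M s k j\<bar> * norm (?y s))"
    proof (rule sum_mono)
      fix k
      have "\<bar>?y' s $ k\<bar> \<le> (\<Sum>j\<in>UNIV. \<bar>?M s k j * ?y s $ j\<bar>)" by simp
      also have "\<dots> \<le> (\<Sum>j\<in>UNIV. \<bar>?M s k j\<bar> * norm (?y s))"
        by (intro sum_mono) (auto simp: abs_mult intro!: mult_left_mono component_le_norm_cart[of "?y s", simplified])
      finally show "\<bar>?y' s $ k\<bar> \<le> (\<Sum>j\<in>UNIV. \<bar>?M s k j\<bar> * norm (?y s))" .
    qed
    also have "\<dots> = (\<Sum>k\<in>UNIV. \<Sum>j\<in>UNIV. \<bar>?M s k j\<bar>) * norm (?y s)" by (simp only: sum_distrib_right)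
    also have "\<dots> \<le> C * norm (?y s)" using C[OF s] by (intro mult_right_mono) auto
    finally show "norm (?y' s) \<le> C * norm (?y s)" .
  next
    have "pd W i (\<lambda>q. \<Phi> 0 q $ Cross k) (point t 0 x) = pd W i (\<lambda>q. q $ Cross k) (point t 0 x)" for k
      by (rule pd_cong[OF W.fat_N p smooth_on_component]) (simp add: flow_0)
    then show "?y 0 = 0" using i by (auto simp: vec_eq_iff pd_coord[OF W.fat_N p])
  qed
  then show ?thesis by (simp add: vec_eq_iff)
qed

lemma pd_flow_Time:
  assumes x: "x \<in> U" and s: "s \<in> {0..1}"
  shows "pd W Time (\<lambda>q. \<Phi> s q $ Time) (point t 0 x) = exp (integral {0..s} (\<lambda>s. G (cross (\<Phi> s (point t 0 x)))))"
proof -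
  note p = W.boundary_in[OF x, of t]
  have "pd W Time (\<lambda>q. \<Phi> s q $ Time) (point t 0 x)
    = pd W Time (\<lambda>q. \<Phi> 0 q $ Time) (point t 0 x) * exp (integral {0..s} (\<lambda>s. G (cross (\<Phi> s (point t 0 x)))))"
  proof (rule scalar_ode_exp[OF _ continuous_cross[OF x smooth_coeffs(2)] s])
    fix s :: real assume s: "s \<in> {0..1}"
    show "((\<lambda>s. pd W Time (\<lambda>q. \<Phi> s q $ Time) (point t 0 x)) has_real_derivative
       G (cross (\<Phi> s (point t 0 x))) * pd W Time (\<lambda>q. \<Phi> s q $ Time) (point t 0 x)) (at s within {0..1})"
      by (rule DERIV_cong[OF variational[OF p s]])
        (simp add: sum_coord field_derivatives[OF x s] pd_flow_Cross_zero[OF x s])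
  qed
  moreover have "pd W Time (\<lambda>q. \<Phi> 0 q $ Time) (point t 0 x) = pd W Time (\<lambda>q. q $ Time) (point t 0 x)"
    by (rule pd_cong[OF W.fat_N p smooth_on_component]) (simp add: flow_0)
  ultimately show ?thesis by (simp add: pd_coord[OF W.fat_N p])
qed

lemma pd_flow_Radial:
  assumes x: "x \<in> U" and s: "s \<in> {0..1}"
  shows "pd W Radial (\<lambda>q. \<Phi> s q $ Radial) (point t 0 x)
    = exp (integral {0..s} (\<lambda>s. H (cross (\<Phi> s (point t 0 x))) + \<Phi> s (point t 0 x) $ Time * J (cross (\<Phi> s (point t 0 x)))))"
proof -
  note p = W.boundary_in[OF x, of t]
  let ?a = "\<lambda>s. H (cross (\<Phi> s (point t 0 x))) + \<Phi> s (point t 0 x) $ Time * J (cross (\<Phi> s (point t 0 x)))"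
  have "pd W Radial (\<lambda>q. \<Phi> s q $ Radial) (point t 0 x)
    = pd W Radial (\<lambda>q. \<Phi> 0 q $ Radial) (point t 0 x) * exp (integral {0..s} ?a)"
  proof (rule scalar_ode_exp[OF _ _ s])
    show "continuous_on {0..1} ?a"
      by (intro continuous_on_add continuous_on_mult continuous_cross[OF x] smooth_coeffs
          continuous_along[OF p] continuous_intros)
    fix s :: real assume s: "s \<in> {0..1}"
    show "((\<lambda>s. pd W Radial (\<lambda>q. \<Phi> s q $ Radial) (point t 0 x)) has_real_derivative
       ?a s * pd W Radial (\<lambda>q. \<Phi> s q $ Radial) (point t 0 x)) (at s within {0..1})"
      by (rule DERIV_cong[OF variational[OF p s]])
        (simp add: sum_coord field_derivatives[OF x s])
  qed
  moreover have "pd W Radial (\<lambda>q. \<Phi> 0 q $ Radial) (point t 0 x) = pd W Radial (\<lambda>q. q $ Radial) (point t 0 x)"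
    by (rule pd_cong[OF W.fat_N p smooth_on_component]) (simp add: flow_0)
  ultimately show ?thesis by (simp add: pd_coord[OF W.fat_N p])
qed

lemma flow_cross_constant:
  assumes x: "x \<in> U" and s: "s \<in> {0..1}"
  shows "cross (\<Phi> s (point t 0 x)) = cross (\<Phi> s (point 0 0 x))"
proof (simp add: vec_eq_iff, rule allI)
  fix k
  have "((\<lambda>t. \<Phi> s (point t 0 x) $ Cross k) has_real_derivative 0) (at t)" for t
    using W.pd_Time_boundary[OF smooth_flow_slice[OF s] x, of "Cross k" t] pd_flow_Cross_zero[OF x s, of Time k t] by simp
  then show "\<Phi> s (point t 0 x) $ Cross k = \<Phi> s (point 0 0 x) $ Cross k"
    using DERIV_isconst_all by blast
qed

definition "rate s x = exp (integral {0..s} (\<lambda>s. G (cross (\<Phi> s (point 0 0 x)))))"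

text \<open>The t-derivative of the flow is the exponential of G integrated along the projected
  trajectory in the cross-section. That trajectory does not depend on t, hence neither does the
  derivative.\<close>

lemma flow_Time_affine:
  assumes x: "x \<in> U" and s: "s \<in> {0..1}"
  shows "\<Phi> s (point t 0 x) $ Time = \<Phi> s (point 0 0 x) $ Time + t * rate s x"
proof -
  have eq: "integral {0..s} (\<lambda>s. G (cross (\<Phi> s (point t 0 x)))) = integral {0..s} (\<lambda>s. G (cross (\<Phi> s (point 0 0 x))))" for t
    by (rule integral_cong) (use s flow_cross_constant[OF x, of _ t] in auto)
  have r: "pd W Time (\<lambda>q. \<Phi> s q $ Time) (point t 0 x) = rate s x" for t
    unfolding pd_flow_Time[OF x s] rate_def by (rule arg_cong[where f=exp]) (rule eq)
  have "((\<lambda>t. \<Phi> s (point t 0 x) $ Time - t * rate s x) has_real_derivative 0) (at t)" for t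
    using DERIV_diff[OF W.pd_Time_boundary[OF smooth_flow_slice[OF s] x, of Time t] DERIV_cmult_right[OF DERIV_ident, of "rate s x"]]
    by (simp add: r)
  then have "\<Phi> s (point t 0 x) $ Time - t * rate s x = \<Phi> s (point 0 0 x) $ Time - 0 * rate s x"
    using DERIV_isconst_all by blast
  then show ?thesis by simp
qed

text \<open>The radial rate along the flow is H + T J, where T is affine in the initial t. Its
  integral is therefore affine in t, and the two coefficients are the e and c of
  \<open>horizon_map\<close>.\<close>

lemma pd_flow_Radial_exp:
  assumes x: "x \<in> U"
  shows "pd W Radial (\<lambda>q. \<Phi> 1 q $ Radial) (point t 0 x)
    = exp (integral {0..1} (\<lambda>s. H (cross (\<Phi> s (point 0 0 x))) + \<Phi> s (point 0 0 x) $ Time * J (cross (\<Phi> s (point 0 0 x))))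
       + t * integral {0..1} (\<lambda>s. rate s x * J (cross (\<Phi> s (point 0 0 x)))))"
proof -
  note p = W.boundary_in[OF x, of 0]
  let ?a = "\<lambda>s. H (cross (\<Phi> s (point 0 0 x))) + \<Phi> s (point 0 0 x) $ Time * J (cross (\<Phi> s (point 0 0 x)))"
  let ?b = "\<lambda>s. rate s x * J (cross (\<Phi> s (point 0 0 x)))"
  have "continuous_on {0..1} (\<lambda>s. integral {0..s} (\<lambda>s. G (cross (\<Phi> s (point 0 0 x)))))"
    by (intro indefinite_integral_continuous_1 integrable_continuous_real continuous_cross[OF x] smooth_coeffs)
  then have "continuous_on {0..1} ?b" unfolding rate_def
    by (intro continuous_on_mult continuous_on_exp continuous_cross[OF x] smooth_coeffs)
  moreover have "continuous_on {0..1} ?a"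
    by (intro continuous_on_add continuous_on_mult continuous_cross[OF x] smooth_coeffs continuous_along[OF p] continuous_intros)
  ultimately have "integral {0..1} (\<lambda>s. ?a s + t * ?b s) = integral {0..1} ?a + t * integral {0..1} ?b"
    by (subst integral_add) (auto intro!: integrable_continuous_real integrable_on_mult_right)
  moreover have "integral {0..1} (\<lambda>s. H (cross (\<Phi> s (point t 0 x))) + \<Phi> s (point t 0 x) $ Time * J (cross (\<Phi> s (point t 0 x))))
     = integral {0..1} (\<lambda>s. ?a s + t * ?b s)"
    by (rule integral_cong) (simp add: flow_cross_constant[OF x, of _ t] flow_Time_affine[OF x, of _ t] algebra_simps)
  ultimately show ?thesis using pd_flow_Radial[OF x, of 1 t] by simp
qed

text \<open>Liouville's theorem: a divergence-free flow preserves volume.\<close>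

lemma flow_volume:
  assumes x: "x \<in> U"
  shows "(det (\<chi> i j. pd W (Cross j) (\<lambda>q. \<Phi> 1 q $ Cross i) (point t 0 x)))\<^sup>2 * d (cross (\<Phi> 1 (point t 0 x))) = d x"
proof -
  note p = W.boundary_in[OF x, of t]
  let ?X = "\<lambda>s. cross (\<Phi> s (point t 0 x))"
  let ?Y = "\<lambda>s. \<chi> i j. pd W (Cross j) (\<lambda>q. \<Phi> s q $ Cross i) (point t 0 x)"
  let ?M = "\<lambda>s. \<chi> i j. pd U j (\<lambda>z. K z $ i) (?X s)"
  \<comment> \<open>The s-derivative of this quantity is (det Y)^2 times the expression in
    \<open>divfree\<close> for K at the moving point: the square accounts for its factor 2.\<close>
  let ?w = "\<lambda>s. (det (?Y s))\<^sup>2 * d (?X s)"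
  have w: "(?w has_derivative (\<lambda>h. 0)) (at s within {0..1})" if s: "s \<in> {0..1}" for s
  proof -
    have y: "?X s \<in> U" by (rule flow_boundary(2)[OF x s])
    have "((\<lambda>s. ?Y s $ i $ j) has_real_derivative (?M s ** ?Y s) $ i $ j) (at s within {0..1})" for i j
      by (simp, rule DERIV_cong[OF variational[OF p s]])
        (simp add: sum_coord field_derivatives[OF x s] matrix_mult_entry)
    then have "((\<lambda>s. ?Y s $ i $ j) has_derivative (\<lambda>v. (v *\<^sub>R (?M s ** ?Y s)) $ i $ j)) (at s within {0..1})" for i j
      unfolding has_field_derivative_def by (rule has_derivative_eq_rhs) (simp add: fun_eq_iff)
    then have "((\<lambda>s. det (?Y s)) has_derivative (\<lambda>v. det_deriv (?Y s) (v *\<^sub>R (?M s ** ?Y s)))) (at s within {0..1})"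
      by (rule det_has_derivative)
    moreover have "det_deriv (?Y s) (v *\<^sub>R (?M s ** ?Y s)) = trace (?M s) * det (?Y s) * v" for v
    proof -
      have "v *\<^sub>R (?M s ** ?Y s) = (v *\<^sub>R ?M s) ** ?Y s"
        by (simp add: vec_eq_iff matrix_mult_entry sum_distrib_left mult.assoc)
      then show ?thesis by (simp add: det_deriv_mult trace_def sum_distrib_left[symmetric])
    qed
    ultimately have dd: "((\<lambda>s. det (?Y s)) has_real_derivative trace (?M s) * det (?Y s)) (at s within {0..1})"
      unfolding has_field_derivative_def by simp
    have "((\<lambda>s. ?X s) has_vector_derivative K (?X s)) (at s within {0..1})"
      by (rule has_vector_derivative_vec, simp, rule DERIV_cong[OF flow_component[OF p s]])
        (rule field_derivatives(8)[OF x s])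
    then have X: "((\<lambda>s. ?X s) has_derivative (\<lambda>h. h *\<^sub>R K (?X s))) (at s within {0..1})"
      by (simp add: has_vector_derivative_def)
    have "(d has_derivative (\<lambda>v. \<Sum>i\<in>UNIV. v $ i * pd U i d (?X s))) (at (?X s) within ?X ` {0..1})"
      using pd_has_derivative_at[OF open_U y smooth_d] by (rule has_derivative_at_withinI)
    from has_derivative_in_compose[OF X this]
    have "((\<lambda>s. d (?X s)) has_real_derivative (\<Sum>i\<in>UNIV. K (?X s) $ i * pd U i d (?X s))) (at s within {0..1})"
      unfolding has_field_derivative_def
      by (rule has_derivative_eq_rhs) (simp add: fun_eq_iff sum_distrib_left mult_ac)
    from DERIV_mult[OF DERIV_power[OF dd, of 2] this]
    have "(?w has_real_derivative (det (?Y s))\<^sup>2 * ((\<Sum>i\<in>UNIV. K (?X s) $ i * pd U i d (?X s)) + 2 * d (?X s) * trace (?M s))) (at s within {0..1})"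
      by (rule DERIV_cong) (simp add: power2_eq_square algebra_simps)
    moreover have "(\<Sum>i\<in>UNIV. K (?X s) $ i * pd U i d (?X s)) + 2 * d (?X s) * trace (?M s) = 0"
      using K_divfree y by (simp add: divfree_def trace_def)
    moreover have "(*) (0::real) = (\<lambda>h. 0)" by (simp add: fun_eq_iff)
    ultimately show ?thesis unfolding has_field_derivative_def by (simp only: mult_zero_right)
  qed
  have "?w 1 = ?w 0"
    by (rule has_derivative_zero_unique[OF convex_real_interval(5) w, symmetric]) auto
  moreover have "pd W (Cross j) (\<lambda>q. \<Phi> 0 q $ Cross i) (point t 0 x) = mat 1 $ i $ j" for i j
    by (subst pd_cong[OF W.fat_N p smooth_on_component[of _ "Cross i"]])
      (auto simp: flow_0 pd_coord[OF W.fat_N p] mat_def)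
  then have "?Y 0 = mat 1" by (simp add: vec_eq_iff)
  ultimately show ?thesis by (simp add: flow_0[OF p])
qed

lemma horizon_map_flow:
  assumes "\<And>p. p \<in> W \<Longrightarrow> \<Phi> 1 p = \<phi> p" "\<And>p. p \<in> W \<Longrightarrow> \<phi> p \<in> W'"
  shows "horizon_map U W W' d \<phi>"
proof -
  have o: "(1::real) \<in> {0..1}" by simp
  have pc: "pd W i (\<lambda>q. \<phi> q $ c) p = pd W i (\<lambda>q. \<Phi> 1 q $ c) p" if "p \<in> W" for i c p
    by (rule pd_cong[OF W.fat_N that smooth_flow_slice[OF o]]) (simp add: assms(1))
  have "smooth_on W (\<lambda>q. \<phi> q $ c)" for c
    by (rule smooth_on_cong[OF _ smooth_flow_slice[OF o]]) (simp add: assms(1))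
  moreover have "\<phi> (point t 0 x) = point (\<Phi> 1 (point 0 0 x) $ Time + t * rate 1 x) 0 (cross (\<Phi> 1 (point 0 0 x)))"
    if x: "x \<in> U" for t x
    using flow_boundary(1)[OF x o, of t] flow_Time_affine[OF x o, of t] flow_cross_constant[OF x o, of t]
      assms(1)[OF W.boundary_in[OF x, of t]] by simp
  moreover have "(det (\<chi> i j. pd W (Cross j) (\<lambda>q. \<phi> q $ Cross i) (point t 0 x)))\<^sup>2 * d (cross (\<Phi> 1 (point 0 0 x))) = d x"
    if x: "x \<in> U" for t x
    using flow_volume[OF x, of t] flow_cross_constant[OF x o, of t] by (simp add: pc[OF W.boundary_in[OF x]])
  ultimately show ?thesis
    unfolding horizon_map_def
    apply (intro conjI allI ballI assms(2))
      apply blast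
     apply assumption
    apply (rule exI[of _ "\<lambda>x. \<Phi> 1 (point 0 0 x) $ Time"], rule exI[of _ "rate 1"],
      rule exI[of _ "\<lambda>x. cross (\<Phi> 1 (point 0 0 x))"],
      rule exI[of _ "\<lambda>x. integral {0..1} (\<lambda>s. H (cross (\<Phi> s (point 0 0 x))) + \<Phi> s (point 0 0 x) $ Time * J (cross (\<Phi> s (point 0 0 x))))"],
      rule exI[of _ "\<lambda>x. integral {0..1} (\<lambda>s. rate s x * J (cross (\<Phi> s (point 0 0 x))))"])
    apply (auto simp: pc[OF W.boundary_in] pd_flow_Radial_exp pd_flow_Cross_zero[OF _ o] rate_def)
    done
qed

end

section \<open>Pulling back horizon metrics\<close>

lemma pd_subset:
  assumes "fat W" "W \<subseteq> N" "smooth_on N f" "p \<in> W"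
  shows "pd W i f p = pd N i f p"
proof -
  have "(f has_derivative (\<lambda>v. \<Sum>i\<in>UNIV. v $ i * pd N i f p)) (at p within W)"
    using pd_has_derivative[OF assms(3), of p] assms(2,4) by (blast intro: has_derivative_subset)
  from pdI[OF assms(1,4) this] show ?thesis
    by (simp add: axis_def if_distrib if_distribR cong: if_cong)
qed

lemma adapted_subset:
  assumes "collar_domain U N" "collar_domain U W" "W \<subseteq> N" "collar_domain.adapted U N V F G H J K"
  shows "collar_domain.adapted U W V F G H J K"
proof -
  interpret collar_domain U N by fact
  interpret W: collar_domain U W by fact
  note a = adaptedD[OF assms(4)]
  show ?thesis unfolding W.adapted_def
    using smooth_on_subset[OF a(1) assms(3)] pd_subset[OF W.fat_N assms(3) a(1) W.boundary_in] a
    by simp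
qed

lemma divfree_cong:
  assumes "open U" "smooth_on U d" "\<And>x. x \<in> U \<Longrightarrow> d' x = d x" "divfree U d K"
  shows "divfree U d' K"
  using assms(3,4) pd_cong[OF open_fat[OF assms(1)] _ assms(2,3)] by (simp add: divfree_def)

context collar_domain
begin

text \<open>The relation persists at \<rho> = 0, so it can be evaluated at \<phi> p without asking
  whether \<phi> p lies on the horizon.\<close>

lemma rescales_all:
  assumes "rescales N g gh" "smooth_tensor N g" "smooth_tensor N gh" "p \<in> N"
  shows "g p $ a $ b = lam (p $ Radial) a * lam (p $ Radial) b * gh p $ a $ b"
proof -
  have "g p $ a $ b - lam (p $ Radial) a * lam (p $ Radial) b * gh p $ a $ b = 0"
    by (rule zero_boundary[OF _ _ assms(4)])
      (auto intro!: smooth_on_diff smooth_on_mult smooth_on_lam smooth_tensorD[OF assms(2)] smooth_tensorD[OF assms(3)]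
        simp: rescalesD[OF assms(1)])
  then show ?thesis by simp
qed

end

text \<open>Only the model with e = c = 0 and constant q is pulled back; here e and c belong to the
  map. Compositions are handled on the level of maps by \<open>horizon_map_comp\<close>, so a single
  pullback suffices.\<close>

locale horizon_pullback = horizon_metric U N g gh "\<lambda>_. 0" "\<lambda>_. 0" "\<lambda>_. k2" \<gamma> + W: collar_domain U W
  for U :: "(real ^ ('m::finite)) set" and N g gh k2 \<gamma> and W :: "(real ^ 'm coord) set" +
  fixes \<phi> :: "real ^ 'm coord \<Rightarrow> real ^ 'm coord"
    and a b :: "real ^ 'm \<Rightarrow> real" and k :: "real ^ 'm \<Rightarrow> real ^ 'm" and e c :: "real ^ 'm \<Rightarrow> real"
  assumes smooth_\<phi>: "\<And>i. smooth_on W (\<lambda>q. \<phi> q $ i)" and \<phi>_in: "\<And>p. p \<in> W \<Longrightarrow> \<phi> p \<in> N"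
    and \<phi>_boundary: "\<And>t x. x \<in> U \<Longrightarrow> \<phi> (point t 0 x) = point (a x + t * b x) 0 (k x)"
    and b0: "\<And>x. x \<in> U \<Longrightarrow> b x \<noteq> 0"
    and \<phi>_Radial: "\<And>t x. x \<in> U \<Longrightarrow> pd W Radial (\<lambda>q. \<phi> q $ Radial) (point t 0 x) = exp (e x + t * c x)"
    and \<phi>_Cross: "\<And>t x i. x \<in> U \<Longrightarrow> pd W Radial (\<lambda>q. \<phi> q $ Cross i) (point t 0 x) = 0"
    and \<phi>_volume: "\<And>t x. x \<in> U \<Longrightarrow>
      (det (\<chi> i j. pd W (Cross j) (\<lambda>q. \<phi> q $ Cross i) (point t 0 x)))\<^sup>2 * det (\<gamma> (k x)) = det (\<gamma> x)"
begin

lemma k_in: "x \<in> U \<Longrightarrow> k x \<in> U"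
  using N_D(2)[OF \<phi>_in[OF W.boundary_in, of x 0]] by (simp add: \<phi>_boundary)

lemma smooth_pd_\<phi>: "smooth_on W (pd W i (\<lambda>q. \<phi> q $ j))"
  by (rule pd_smooth[OF W.fat_N smooth_\<phi>])

lemma \<phi>_Radial_zero: "x \<in> U \<Longrightarrow> \<phi> (point t 0 x) $ Radial = 0"
  by (simp add: \<phi>_boundary)

lemma pd_\<phi>_boundary:
  assumes x: "x \<in> U"
  shows "pd W Time (\<lambda>q. \<phi> q $ Time) (point t 0 x) = b x"
    "l \<noteq> Radial \<Longrightarrow> pd W l (\<lambda>q. \<phi> q $ Radial) (point t 0 x) = 0"
    "pd W Time (\<lambda>q. \<phi> q $ Cross i) (point t 0 x) = 0"
    "pd W (Cross j) (\<lambda>q. \<phi> q $ Cross i) (point t 0 x) = pd W (Cross j) (\<lambda>q. \<phi> q $ Cross i) (point 0 0 x)"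
proof -
  show "pd W Time (\<lambda>q. \<phi> q $ Time) (point t 0 x) = b x"
    by (rule W.pd_Time_eq[where \<phi>="\<lambda>s. a x + s * b x", OF smooth_\<phi> x])
      (auto intro!: derivative_eq_intros simp: \<phi>_boundary[OF x])
  show "l \<noteq> Radial \<Longrightarrow> pd W l (\<lambda>q. \<phi> q $ Radial) (point t 0 x) = 0"
    by (rule W.pd_tangent_zero[OF smooth_\<phi> \<phi>_Radial_zero _ x])
  show "pd W Time (\<lambda>q. \<phi> q $ Cross i) (point t 0 x) = 0"
    by (rule W.pd_Time_eq[where \<phi>="\<lambda>s. k x $ i", OF smooth_\<phi> x]) (auto simp: \<phi>_boundary[OF x])
  show "pd W (Cross j) (\<lambda>q. \<phi> q $ Cross i) (point t 0 x) = pd W (Cross j) (\<lambda>q. \<phi> q $ Cross i) (point 0 0 x)"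
    unfolding W.pd_Cross_boundary[OF smooth_\<phi> x]
    by (rule pd_cong[OF open_fat[OF open_U] x smooth_on_compose[OF smooth_on_point smooth_\<phi> W.boundary_in]])
      (simp_all add: \<phi>_boundary)
qed

text \<open>The Jacobian between the rescaled frames at p and at \<phi> p, in the sense of
  \<open>jac_eq\<close>. The quotients by \<rho> are smooth because \<phi> preserves the horizon and
  its cross components do not depend on t there.\<close>

definition jac where
  "jac i j p = (if i = Time then (if j = Time then rho_quot W (\<lambda>q. \<phi> q $ Radial) p else \<phi> p $ Radial)
       * pd W j (\<lambda>q. \<phi> q $ Time) p
     else if j = Time then rho_quot W (pd W Time (\<lambda>q. \<phi> q $ i)) p else pd W j (\<lambda>q. \<phi> q $ i) p)"

lemma pd_Time_zero: "i \<noteq> Time \<Longrightarrow> x \<in> U \<Longrightarrow> pd W Time (\<lambda>q. \<phi> q $ i) (point t 0 x) = 0"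
  by (cases i) (auto simp: pd_\<phi>_boundary)

lemma smooth_jac: "smooth_on W (jac i j)"
proof -
  have r: "smooth_on W (rho_quot W (\<lambda>q. \<phi> q $ Radial))"
    by (rule W.smooth_on_rho_quot[OF smooth_\<phi> \<phi>_Radial_zero])
  have 2: "smooth_on W (rho_quot W (pd W Time (\<lambda>q. \<phi> q $ i)))" if "i \<noteq> Time"
    by (rule W.smooth_on_rho_quot[OF smooth_pd_\<phi> pd_Time_zero[OF that]])
  have "smooth_on W (\<lambda>p. if i = Time then (if j = Time then rho_quot W (\<lambda>q. \<phi> q $ Radial) p else \<phi> p $ Radial)
       * pd W j (\<lambda>q. \<phi> q $ Time) p
     else if j = Time then rho_quot W (pd W Time (\<lambda>q. \<phi> q $ i)) p else pd W j (\<lambda>q. \<phi> q $ i) p)"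
    using r 2 smooth_\<phi>[of Radial] smooth_pd_\<phi> by (cases "i = Time"; cases "j = Time") (auto intro!: smooth_on_mult)
  then show ?thesis unfolding jac_def[abs_def] .
qed

lemma jac_eq:
  assumes "p \<in> W"
  shows "lam (\<phi> p $ Radial) i * pd W j (\<lambda>q. \<phi> q $ i) p = lam (p $ Radial) j * jac i j p"
  using W.rho_quot_mult[where f="\<lambda>q. \<phi> q $ Radial", OF \<phi>_Radial_zero assms]
    W.rho_quot_mult[where f="pd W Time (\<lambda>q. \<phi> q $ i)", OF pd_Time_zero assms]
  by (auto simp: jac_def lam_def)

lemma jac_boundary:
  assumes x: "x \<in> U"
  shows "jac Time Time (point t 0 x) = exp (e x + t * c x) * b x"
    "j \<noteq> Time \<Longrightarrow> jac Time j (point t 0 x) = 0"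
    "jac Radial Time (point t 0 x) = exp (e x + t * c x) * c x"
    "jac Radial Radial (point t 0 x) = exp (e x + t * c x)"
    "jac Radial (Cross i) (point t 0 x) = 0"
    "jac (Cross i) Time (point t 0 x) = 0" "jac (Cross i) Radial (point t 0 x) = 0"
    "jac (Cross i) (Cross l) (point t 0 x) = pd W (Cross l) (\<lambda>q. \<phi> q $ Cross i) (point 0 0 x)"
proof -
  have r: "rho_quot W (pd W Time (\<lambda>q. \<phi> q $ i)) (point t 0 x) = pd W Time (pd W Radial (\<lambda>q. \<phi> q $ i)) (point t 0 x)" for i
    unfolding W.rho_quot_boundary by (rule pd_symmetric[OF W.fat_N W.boundary_in[OF x] smooth_\<phi>])
  \<comment> \<open>The t-dependence of the radial stretching creates the off-diagonal entry, and
    with it the t \<rho> component of the pulled-back metric.\<close>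
  have "pd W Time (pd W Radial (\<lambda>q. \<phi> q $ Radial)) (point t 0 x) = exp (e x + t * c x) * c x"
    by (rule W.pd_Time_eq[where \<phi>="\<lambda>s. exp (e x + s * c x)", OF smooth_pd_\<phi> x])
      (auto intro!: derivative_eq_intros simp: \<phi>_Radial[OF x])
  then show "jac Radial Time (point t 0 x) = exp (e x + t * c x) * c x" by (simp add: jac_def r)
  have "pd W Time (pd W Radial (\<lambda>q. \<phi> q $ Cross i)) (point t 0 x) = 0"
    by (rule W.pd_Time_eq[where \<phi>="\<lambda>s. 0", OF smooth_pd_\<phi> x]) (auto simp: \<phi>_Cross[OF x])
  then show "jac (Cross i) Time (point t 0 x) = 0" by (simp add: jac_def r)
  show "jac (Cross i) (Cross l) (point t 0 x) = pd W (Cross l) (\<lambda>q. \<phi> q $ Cross i) (point 0 0 x)"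
    unfolding jac_def using pd_\<phi>_boundary(4)[OF x, of l i t] by simp
qed (auto simp: jac_def W.rho_quot_boundary \<phi>_Radial[OF x] \<phi>_Radial_zero[OF x] pd_\<phi>_boundary(1-3)[OF x] \<phi>_Cross[OF x])

definition "pull_gh p = (\<chi> i j. \<Sum>l\<in>UNIV. \<Sum>m\<in>UNIV. jac l i p * jac m j p * gh (\<phi> p) $ l $ m)"

definition "pull_\<gamma> x = (\<chi> i j. \<Sum>l\<in>UNIV. \<Sum>m\<in>UNIV. pd W (Cross i) (\<lambda>q. \<phi> q $ Cross l) (point 0 0 x)
   * pd W (Cross j) (\<lambda>q. \<phi> q $ Cross m) (point 0 0 x) * \<gamma> (k x) $ l $ m)"

lemma pull_gh_matrix: "pull_gh p = transpose (\<chi> i j. jac i j p) ** gh (\<phi> p) ** (\<chi> i j. jac i j p)"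
  by (simp add: vec_eq_iff pull_gh_def matrix_mult_entry transpose_def sum_distrib_right)
    (subst sum.swap, simp add: mult_ac)

lemma pull_\<gamma>_matrix: "pull_\<gamma> x = transpose (\<chi> i j. pd W (Cross j) (\<lambda>q. \<phi> q $ Cross i) (point 0 0 x)) ** \<gamma> (k x)
   ** (\<chi> i j. pd W (Cross j) (\<lambda>q. \<phi> q $ Cross i) (point 0 0 x))"
  by (simp add: vec_eq_iff pull_\<gamma>_def matrix_mult_entry transpose_def sum_distrib_right)
    (subst sum.swap, simp add: mult_ac)

text \<open>Keeps the algebra usable after the pullback: \<open>divfree\<close> sees \<gamma> only
  through its determinant, so the same K are divergence free for the pulled-back cross
  metric.\<close>

lemma det_pull_\<gamma>: "x \<in> U \<Longrightarrow> det (pull_\<gamma> x) = det (\<gamma> x)"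
  unfolding pull_\<gamma>_matrix det_mul det_transpose
  using \<phi>_volume[of x 0] by (simp add: power2_eq_square mult_ac)

lemma det_pull_gh_boundary:
  assumes x: "x \<in> U" shows "det (pull_gh (point t 0 x)) < 0"
proof -
  let ?Q = "\<chi> i j. jac i j (point t 0 x)"
  let ?K = "\<chi> i j. pd W (Cross j) (\<lambda>q. \<phi> q $ Cross i) (point 0 0 x)"
  have "det ?K \<noteq> 0" using \<phi>_volume[OF x, of 0] det_\<gamma>[OF x] by auto
  then have K: "\<forall>v. ?K *v v = 0 \<longrightarrow> v = 0"
    unfolding invertible_det_nz[symmetric] invertible_left_inverse matrix_left_invertible_ker .
  have "v = 0" if v: "?Q *v v = 0" for v
  proof -
    have c: "(\<Sum>j\<in>UNIV. jac i j (point t 0 x) * v $ j) = 0" for i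
      using v by (simp add: vec_eq_iff matrix_vector_mult_def)
    have T: "v $ Time = 0" using c[of Time] b0[OF x] by (simp add: sum_coord jac_boundary[OF x])
    have R: "v $ Radial = 0" using c[of Radial] T by (simp add: sum_coord jac_boundary[OF x])
    have "?K *v cross v = 0"
      using c[of "Cross _"] T R by (simp add: vec_eq_iff matrix_vector_mult_def sum_coord jac_boundary[OF x])
    then have "cross v = 0" using K by blast
    then have "v $ Cross i = 0" for i by (metis point_simps(5) zero_index)
    with T R show "v = 0" by (simp add: vec_eq_iff all_coord)
  qed
  then have "det ?Q \<noteq> 0"
    unfolding invertible_det_nz[symmetric] invertible_left_inverse matrix_left_invertible_ker by blast
  moreover have "det (gh (\<phi> (point t 0 x))) < 0"
    unfolding \<phi>_boundary[OF x] by (rule boundary_det[OF k_in[OF x]])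
  moreover have "det (pull_gh (point t 0 x)) = (det ?Q)\<^sup>2 * det (gh (\<phi> (point t 0 x)))"
    unfolding pull_gh_matrix det_mul det_transpose by (simp add: power2_eq_square)
  ultimately show ?thesis by (simp add: mult_pos_neg)
qed

lemma smooth_comp: "smooth_on N f \<Longrightarrow> smooth_on W (\<lambda>p. f (\<phi> p))"
  by (rule smooth_on_compose[OF smooth_on_vec[OF smooth_\<phi>] _ \<phi>_in])

lemma smooth_pull:
  "smooth_tensor W (pullback W \<phi> g)" "smooth_tensor W pull_gh"
  unfolding smooth_tensor_def pullback_def pull_gh_def
  by (auto intro!: smooth_on_sum smooth_on_mult smooth_pd_\<phi> smooth_jac smooth_comp smooth_tensorD[OF g] smooth_tensorD[OF gh])

lemma pull_rescales: "rescales W (pullback W \<phi> g) pull_gh"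
  unfolding rescales_def
proof (intro ballI impI allI)
  fix p i j assume p: "p \<in> W"
  let ?l = "lam (\<phi> p $ Radial)"
  have "pd W i (\<lambda>q. \<phi> q $ l) p * pd W j (\<lambda>q. \<phi> q $ m) p * g (\<phi> p) $ l $ m
     = (?l l * pd W i (\<lambda>q. \<phi> q $ l) p) * (?l m * pd W j (\<lambda>q. \<phi> q $ m) p) * gh (\<phi> p) $ l $ m" for l m
    by (simp add: rescales_all[OF g_gh g gh \<phi>_in[OF p]] mult_ac)
  then show "pullback W \<phi> g p $ i $ j = lam (p $ Radial) i * lam (p $ Radial) j * pull_gh p $ i $ j"
    unfolding pullback_def pull_gh_def jac_eq[OF p] by (simp add: sum_distrib_left mult_ac)
qed

lemma pull_symmetric:
  assumes "p \<in> W"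
  shows "pullback W \<phi> g p $ i $ j = pullback W \<phi> g p $ j $ i" "pull_gh p $ i $ j = pull_gh p $ j $ i"
proof -
  note s = g_sym[OF \<phi>_in[OF assms]] gh_sym[OF \<phi>_in[OF assms]]
  show "pullback W \<phi> g p $ i $ j = pullback W \<phi> g p $ j $ i"
    unfolding pullback_def
    by (simp, subst sum.swap, intro sum.cong refl) (subst s(1), simp add: mult_ac)
  show "pull_gh p $ i $ j = pull_gh p $ j $ i"
    unfolding pull_gh_def
    by (simp, subst sum.swap, intro sum.cong refl) (subst s(2), simp add: mult_ac)
qed

lemma smooth_restrict: "smooth_on W f \<Longrightarrow> smooth_on U (\<lambda>x. f (point 0 0 x))"
  by (rule smooth_on_compose[OF smooth_on_point _ W.boundary_in])

text \<open>\<open>horizon_map\<close> yields e, b and c as mere functions. At t = 0 they are read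
  off smooth data: e is the logarithm of the radial stretching, b the stretching of t, and c a
  quotient of two entries of \<open>jac\<close>.\<close>

lemma smooth_ebc: "smooth_on U e" "smooth_on U b" "smooth_on U c"
proof -
  have "smooth_on U (\<lambda>x. ln (pd W Radial (\<lambda>q. \<phi> q $ Radial) (point 0 0 x)))"
    by (intro smooth_on_ln smooth_restrict smooth_pd_\<phi>) (simp add: \<phi>_Radial)
  then show "smooth_on U e" by (rule smooth_on_cong[rotated]) (simp add: \<phi>_Radial)
  show "smooth_on U b" by (rule smooth_on_cong[OF _ smooth_restrict[OF smooth_pd_\<phi>[of Time Time]]]) (simp add: pd_\<phi>_boundary(1))
  have "smooth_on U (\<lambda>x. jac Radial Time (point 0 0 x) / jac Radial Radial (point 0 0 x))"
    by (intro smooth_on_divide smooth_restrict smooth_jac) (simp add: jac_boundary)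
  then show "smooth_on U c" by (rule smooth_on_cong[rotated]) (simp add: jac_boundary)
qed

lemma horizon_metric_pullback:
  "horizon_metric U W (pullback W \<phi> g) pull_gh e c (\<lambda>x. k2 * (b x)\<^sup>2) pull_\<gamma>"
proof
  have k2: "0 < k2" if "x \<in> U" for x using q_pos[OF that] .
  have EE: "exp (e x + t * c x) * exp (e x + t * c x) = exp (2 * (e x + t * c x))" for x t
    by (simp add: exp_add[symmetric])
  fix x :: "real ^ 'm" and t :: real assume x: "x \<in> U"
  define P where "P = exp (e x + t * c x)"
  note S = pull_gh_def sum_coord jac_boundary[OF x, where t=t, folded P_def] \<phi>_boundary[OF x] boundary[OF k_in[OF x]] boundary'[OF k_in[OF x]]
  show "0 < k2 * (b x)\<^sup>2" using k2[OF x] b0[OF x] by simp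
  show "det (pull_gh (point t 0 x)) < 0" by (rule det_pull_gh_boundary[OF x])
  show "pull_gh (point t 0 x) $ Radial $ Radial = exp (2 * (e x + t * c x))"
    unfolding EE[symmetric] P_def[symmetric] by (simp add: S)
  show "pull_gh (point t 0 x) $ Time $ Radial = exp (2 * (e x + t * c x)) * c x"
    unfolding EE[symmetric] P_def[symmetric] by (simp add: S)
  show "pull_gh (point t 0 x) $ Time $ Time = exp (2 * (e x + t * c x)) * ((c x)\<^sup>2 - k2 * (b x)\<^sup>2)"
    unfolding EE[symmetric] P_def[symmetric] by (simp add: S algebra_simps power2_eq_square)
  show "pull_gh (point t 0 x) $ Time $ Cross i = 0" "pull_gh (point t 0 x) $ Radial $ Cross i = 0" for i
    by (simp_all add: S)
  show "pull_gh (point t 0 x) $ Cross i $ Cross j = pull_\<gamma> x $ i $ j" for i j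
    by (simp add: S pull_\<gamma>_def)
qed (intro smooth_pull pull_rescales pull_symmetric smooth_ebc smooth_on_mult smooth_on_const smooth_on_power; assumption)+

end

section \<open>The near-horizon metric\<close>

lemma lorentzian_symmetric_det:
  fixes A :: "real ^ ('m::finite) coord ^ 'm coord"
  assumes "lorentzian A"
  shows "A $ a $ b = A $ b $ a" "det A < 0"
proof -
  let ?E = "(\<chi> a b. if a = b then (if a = Time then -1 else 1) else 0) :: real ^ 'm coord ^ 'm coord"
  obtain P :: "real ^ 'm coord ^ 'm coord" where P: "invertible P" "transpose P ** A ** P = ?E"
    using assms unfolding lorentzian_def by blast
  have dP: "det P \<noteq> 0" using P(1) by (simp add: invertible_det_nz)
  have "det ?E = (\<Prod>a\<in>(UNIV :: 'm coord set). if a = Time then -1 else 1)"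
    by (subst det_diagonal) auto
  also have "\<dots> = -1" by simp
  finally have "(det P)\<^sup>2 * det A = -1"
    unfolding P(2)[symmetric] det_mul det_transpose by (simp add: power2_eq_square mult_ac)
  then show "det A < 0" using dP by (smt (verit) mult_nonneg_nonneg zero_le_power2)
  define B where "B = matrix_inv P"
  have B: "P ** B = mat 1" unfolding B_def by (rule matrix_inv_inverse[OF dP])
  then have B': "transpose B ** transpose P = mat 1" by (metis matrix_transpose_mul transpose_mat)
  have "transpose B ** ?E ** B = transpose B ** transpose P ** A ** (P ** B)"
    unfolding P(2)[symmetric] by (simp only: matrix_mul_assoc)
  then have A: "A = transpose B ** ?E ** B" by (simp add: B B')
  have "transpose ?E = ?E" by (simp add: transpose_def vec_eq_iff)
  then have "transpose A = A" by (subst (1 2) A) (simp add: matrix_transpose_mul matrix_mul_assoc)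
  then have "transpose A $ b $ a = A $ b $ a" by simp
  then show "A $ a $ b = A $ b $ a" by (simp add: transpose_def)
qed

lemma positive_definite_props:
  fixes A :: "real ^ 'm ^ ('m::finite)"
  assumes "positive_definite A"
  shows "A $ a $ b = A $ b $ a" "A *v v = 0 \<Longrightarrow> v = 0" "det A \<noteq> 0"
proof -
  have "transpose A = A" using assms by (simp add: positive_definite_def)
  then have "transpose A $ b $ a = A $ b $ a" by simp
  then show "A $ a $ b = A $ b $ a" by (simp add: transpose_def)
  have k: "A *v v = 0 \<Longrightarrow> v = 0" for v using assms unfolding positive_definite_def by fastforce
  then show "A *v v = 0 \<Longrightarrow> v = 0" .
  show "det A \<noteq> 0"
    unfolding invertible_det_nz[symmetric] invertible_left_inverse matrix_left_invertible_ker using k by blast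
qed

lemma rho_order_mono:
  assumes "rho_order N k f" "j \<le> k"
  shows "rho_order N j f"
proof -
  obtain h where h: "smooth_on N h" "\<forall>p\<in>N. 0 < p $ Radial \<longrightarrow> f p = p $ Radial ^ k * h p"
    using assms(1) unfolding rho_order_def by blast
  have "x ^ k = x ^ j * x ^ (k - j)" for x :: real using assms(2) by (simp flip: power_add)
  then show ?thesis unfolding rho_order_def using h
    by (intro exI[of _ "\<lambda>p. p $ Radial ^ (k - j) * h p"])
      (auto intro!: smooth_on_mult smooth_on_power smooth_on_component simp: mult.assoc)
qed

locale near_horizon = collar_domain U N
  for U :: "(real ^ ('m::finite)) set" and N :: "(real ^ 'm coord) set" +
  fixes \<psi> :: 'm and \<kappa> :: real and ft :: "real ^ 'm \<Rightarrow> real ^ 'm" and fpp :: "real ^ 'm \<Rightarrow> real"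
    and \<Omega> :: "real ^ 'm \<Rightarrow> real ^ 'm ^ 'm" and gbar :: "real ^ 'm coord \<Rightarrow> real ^ 'm coord ^ 'm coord"
  assumes \<kappa>: "\<kappa> \<noteq> 0" and smooth_gbar: "smooth_on N gbar"
    and lorentz: "\<And>p. p \<in> N \<Longrightarrow> 0 < p $ Radial \<Longrightarrow> lorentzian (gbar p)"
    and form: "near_horizon_form \<psi> U N \<kappa> ft fpp \<Omega> gbar"
begin

lemma smooth_gbar_entry: "smooth_on N (\<lambda>p. gbar p $ i $ j)"
  by (rule smooth_on_vec_nth[OF smooth_on_vec_nth[OF smooth_gbar]])

lemma gbar_sym: assumes "p \<in> N" shows "gbar p $ i $ j = gbar p $ j $ i"
proof -
  have "gbar p $ i $ j - gbar p $ j $ i = 0"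
    by (rule zero_boundary[OF _ _ assms])
      (auto intro!: smooth_on_diff smooth_gbar_entry simp: lorentzian_symmetric_det(1)[OF lorentz])
  then show ?thesis by simp
qed

lemma boundary_order:
  assumes "rho_order N l (\<lambda>p. gbar p $ i $ j - f p)" "2 \<le> l" "smooth_on N f" "x \<in> U"
  shows "gbar (point t 0 x) $ i $ j = f (point t 0 x)"
    "pd N Radial (\<lambda>p. gbar p $ i $ j) (point t 0 x) = pd N Radial f (point t 0 x)"
  using rho_order_2D[OF rho_order_mono[OF assms(1,2)] smooth_gbar_entry assms(3,4)] by auto

lemma boundary_order_zero:
  assumes "rho_order N l (\<lambda>p. gbar p $ i $ j)" "2 \<le> l" "x \<in> U"
  shows "gbar (point t 0 x) $ i $ j = 0" "pd N Radial (\<lambda>p. gbar p $ i $ j) (point t 0 x) = 0"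
  using boundary_order[of l i j "\<lambda>_. 0" x t] assms
  by (auto simp: smooth_on_const pd_const[OF fat_N boundary_in])

lemma form': "rho_order N 4 (\<lambda>p. gbar p $ Time $ Time - (- \<kappa>\<^sup>2 * (p $ Radial)\<^sup>2))"
  "rho_order N 4 (\<lambda>p. gbar p $ Time $ Radial)"
  "rho_order N 4 (\<lambda>p. gbar p $ Time $ Cross i - ft (cross p) $ i * (p $ Radial)\<^sup>2)"
  "rho_order N 2 (\<lambda>p. gbar p $ Radial $ Radial - 1)"
  "rho_order N 3 (\<lambda>p. gbar p $ Radial $ Cross i)"
  "smooth_on U (\<lambda>x. ft x $ i)"
  "x \<in> U \<Longrightarrow> positive_definite (cross_metric \<psi> fpp \<Omega> x)"
  using form rho_order_mono[of N 4 _ 3] unfolding near_horizon_form_def by (cases "i = \<psi>"; simp)+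

lemma smooth_cross_metric: "smooth_on U (\<lambda>x. cross_metric \<psi> fpp \<Omega> x $ i $ j)"
  using form unfolding near_horizon_form_def cross_metric_def
  by (cases "i = \<psi>"; cases "j = \<psi>") (simp_all add: smooth_on_const)

lemma gbar_Cross: "rho_order N 2 (\<lambda>p. gbar p $ Cross i $ Cross j - cross_metric \<psi> fpp \<Omega> (cross p) $ i $ j)"
proof -
  have *: "rho_order N 2 (\<lambda>p. gbar p $ Cross \<psi> $ Cross \<psi> - fpp (cross p))"
    "\<And>A. A \<noteq> \<psi> \<Longrightarrow> rho_order N 2 (\<lambda>p. gbar p $ Cross \<psi> $ Cross A)"
    "\<And>A B. A \<noteq> \<psi> \<Longrightarrow> B \<noteq> \<psi> \<Longrightarrow> rho_order N 2 (\<lambda>p. gbar p $ Cross A $ Cross B - \<Omega> (cross p) $ A $ B)"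
    using form unfolding near_horizon_form_def by auto
  have "rho_order N 2 (\<lambda>p. gbar p $ Cross A $ Cross \<psi>)" if "A \<noteq> \<psi>" for A
    by (rule rho_order_cong[OF *(2)[OF that]]) (rule gbar_sym)
  then show ?thesis using * unfolding cross_metric_def by (cases "i = \<psi>"; cases "j = \<psi>") simp_all
qed

lemma pd_rho_square:
  assumes "smooth_on N f" "x \<in> U"
  shows "pd N Radial (\<lambda>p. f p * (p $ Radial)\<^sup>2) (point t 0 x) = 0"
proof -
  have "pd N Radial (\<lambda>p. p $ Radial * (p $ Radial * f p)) (point t 0 x) = 0"
    by (subst pd_Radial_product_boundary) (auto intro!: smooth_on_mult smooth_on_component assms)
  then show ?thesis by (simp add: power2_eq_square mult_ac)
qed

lemma gbar_Time_boundary: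
  assumes "x \<in> U"
  shows "gbar (point t 0 x) $ Time $ j = 0" "pd N Radial (\<lambda>p. gbar p $ Time $ j) (point t 0 x) = 0"
proof -
  have sT: "smooth_on N (\<lambda>p. - \<kappa>\<^sup>2 * (p $ Radial)\<^sup>2)"
    by (intro smooth_on_mult smooth_on_const smooth_on_power smooth_on_component)
  have sC: "smooth_on N (\<lambda>p. ft (cross p) $ i * (p $ Radial)\<^sup>2)" for i
    by (intro smooth_on_mult smooth_on_power smooth_on_component smooth_on_cross_N[OF form'(6)])
  have "gbar (point t 0 x) $ Time $ j = 0 \<and> pd N Radial (\<lambda>p. gbar p $ Time $ j) (point t 0 x) = 0"
  proof (cases j)
    case Time
    then show ?thesis using boundary_order[OF form'(1) _ sT assms, of t] pd_rho_square[OF smooth_on_const assms, of "- \<kappa>\<^sup>2" t] by simp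
  next
    case Radial
    then show ?thesis using boundary_order_zero[OF form'(2) _ assms, of t] by simp
  next
    case (Cross i)
    then show ?thesis using boundary_order[OF form'(3)[of i] _ sC assms, of t]
        pd_rho_square[OF smooth_on_cross_N[OF form'(6)[of i]] assms, of t] by simp
  qed
  then show "gbar (point t 0 x) $ Time $ j = 0" "pd N Radial (\<lambda>p. gbar p $ Time $ j) (point t 0 x) = 0" by auto
qed

text \<open>g_tt vanishes to second order on the horizon and is divided by \<rho> twice, the other t
  components once. Row and column are built from the same entries, so most of the symmetry holds by
  construction.\<close>

definition "ghbar p = (\<chi> i j. if i = Time \<and> j = Time then rho_quot N (rho_quot N (\<lambda>p. gbar p $ Time $ Time)) p
   else if i = Time then rho_quot N (\<lambda>p. gbar p $ Time $ j) p
   else if j = Time then rho_quot N (\<lambda>p. gbar p $ Time $ i) p else gbar p $ i $ j)"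

lemma rho_quot_gbar:
  "smooth_on N (rho_quot N (\<lambda>p. gbar p $ Time $ j))"
  "x \<in> U \<Longrightarrow> rho_quot N (\<lambda>p. gbar p $ Time $ j) (point t 0 x) = 0"
  by (rule smooth_on_rho_quot[OF smooth_gbar_entry gbar_Time_boundary(1)]) (simp_all add: rho_quot_boundary gbar_Time_boundary)

lemma smooth_ghbar: "smooth_tensor N ghbar"
proof -
  have "smooth_on N (rho_quot N (rho_quot N (\<lambda>p. gbar p $ Time $ Time)))"
    by (rule smooth_on_rho_quot[OF rho_quot_gbar])
  then show ?thesis
    unfolding smooth_tensor_def
  proof (intro allI)
    fix i j
    show "smooth_on N (\<lambda>q. ghbar q $ i $ j)"
      using \<open>smooth_on N (rho_quot N (rho_quot N _))\<close> rho_quot_gbar(1) smooth_gbar_entry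
      unfolding ghbar_def by (cases "i = Time"; cases "j = Time") simp_all
  qed
qed

lemma ghbar_rescales: "rescales N gbar ghbar"
  unfolding rescales_def
proof (intro ballI impI allI)
  fix p i j assume p: "p \<in> N"
  note m = rho_quot_mult[where f="\<lambda>p. gbar p $ Time $ l" for l, OF gbar_Time_boundary(1) p]
  have "gbar p $ Time $ Time = p $ Radial * (p $ Radial * ghbar p $ Time $ Time)"
    using m[of Time] rho_quot_mult[where f="rho_quot N (\<lambda>p. gbar p $ Time $ Time)", OF rho_quot_gbar(2) p]
    by (simp add: ghbar_def)
  then show "gbar p $ i $ j = lam (p $ Radial) i * lam (p $ Radial) j * ghbar p $ i $ j"
    using m[of i] m[of j] gbar_sym[OF p, of i Time] by (auto simp: ghbar_def lam_def)
qed

text \<open>The first quotient is - \<kappa>^2 \<rho> up to order \<rho>^3; its radial derivative on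
  the horizon is the value of the second quotient.\<close>

lemma ghbar_Time_Time: assumes "x \<in> U" shows "ghbar (point t 0 x) $ Time $ Time = - \<kappa>\<^sup>2"
proof -
  let ?r = "rho_quot N (\<lambda>p. gbar p $ Time $ Time)"
  have sl: "smooth_on N (\<lambda>p. - \<kappa>\<^sup>2 * p $ Radial)" by (intro smooth_on_mult smooth_on_const smooth_on_component)
  obtain h where h: "smooth_on N h" "\<forall>p\<in>N. 0 < p $ Radial \<longrightarrow> gbar p $ Time $ Time - (- \<kappa>\<^sup>2 * (p $ Radial)\<^sup>2) = (p $ Radial)^4 * h p"
    using form'(1) unfolding rho_order_def by blast
  have "rho_order N 2 (\<lambda>p. ?r p - (- \<kappa>\<^sup>2 * p $ Radial))"
    unfolding rho_order_def
  proof (intro exI[of _ "\<lambda>p. p $ Radial * h p"] conjI ballI impI smooth_on_mult smooth_on_component h(1))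
    fix p assume p: "p \<in> N" "0 < p $ Radial"
    have "gbar p $ Time $ Time = - \<kappa>\<^sup>2 * (p $ Radial)\<^sup>2 + (p $ Radial)^4 * h p" using h(2) p by (simp add: algebra_simps)
    then show "?r p - (- \<kappa>\<^sup>2 * p $ Radial) = (p $ Radial)\<^sup>2 * (p $ Radial * h p)"
      using p by (simp add: rho_quot_def field_simps power2_eq_square power4_eq_xxxx)
  qed
  from rho_order_2D(2)[OF this rho_quot_gbar(1) sl assms, of t]
  show ?thesis
    using pd_mult[OF fat_N boundary_in[OF assms] smooth_on_const smooth_on_component, of Radial "- \<kappa>\<^sup>2" Radial t]
    by (simp add: ghbar_def rho_quot_boundary pd_coord[OF fat_N boundary_in[OF assms]] pd_const[OF fat_N boundary_in[OF assms]])
qed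

lemma ghbar_boundary:
  assumes x: "x \<in> U"
  shows "ghbar (point t 0 x) $ Time $ Radial = 0" "ghbar (point t 0 x) $ Radial $ Time = 0"
    "ghbar (point t 0 x) $ Time $ Cross i = 0" "ghbar (point t 0 x) $ Cross i $ Time = 0"
    "ghbar (point t 0 x) $ Radial $ Radial = 1"
    "ghbar (point t 0 x) $ Radial $ Cross i = 0" "ghbar (point t 0 x) $ Cross i $ Radial = 0"
    "ghbar (point t 0 x) $ Cross i $ Cross j = cross_metric \<psi> fpp \<Omega> x $ i $ j"
proof -
  have 1: "gbar (point t 0 x) $ Radial $ Radial = 1"
    by (rule boundary_order(1)[OF form'(4) _ smooth_on_const x]) simp
  have 2: "gbar (point t 0 x) $ Radial $ Cross i = 0"
    by (rule boundary_order_zero(1)[OF form'(5) _ x]) simp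
  have 3: "gbar (point t 0 x) $ Cross i $ Cross j = cross_metric \<psi> fpp \<Omega> x $ i $ j"
    using boundary_order(1)[OF gbar_Cross[of i j] _ smooth_on_cross_N[OF smooth_cross_metric] x, of t] by simp
  show "ghbar (point t 0 x) $ Cross i $ Radial = 0"
    using 2 gbar_sym[OF boundary_in[OF x], of t "Cross i" Radial] by (simp add: ghbar_def)
qed (simp_all add: ghbar_def rho_quot_gbar(2)[OF x] boundary_order(1)[OF form'(4) _ smooth_on_const x]
    boundary_order_zero(1)[OF form'(5) _ x] boundary_order(1)[OF gbar_Cross _ smooth_on_cross_N[OF smooth_cross_metric] x])

text \<open>For \<rho> > 0 the sign is that of a Lorentzian metric. On the horizon the limit gives
  only a weak inequality, and the block form, with \<kappa> nonzero and a positive definite cross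
  metric, excludes 0.\<close>

lemma ghbar_det: assumes "p \<in> N" shows "det (ghbar p) < 0"
proof (cases "p $ Radial = 0")
  case False
  then have p: "0 < p $ Radial" using N_D(1)[OF assms] by simp
  have "det (gbar p) = (p $ Radial)\<^sup>2 * det (ghbar p)"
    by (rule det_rescaled) (rule rescalesD[OF ghbar_rescales assms p])
  moreover have "det (gbar p) < 0" by (rule lorentzian_symmetric_det(2)[OF lorentz[OF assms p]])
  ultimately show ?thesis using p by (simp add: mult_less_0_iff)
next
  case True
  define t x where "t = p $ Time" and "x = cross p"
  have x: "x \<in> U" unfolding x_def by (rule N_D(2)[OF assms])
  have p: "p = point t 0 x" using point_eq[of p] True by (simp add: t_def x_def)
  have "((\<lambda>r. det (ghbar (point t r x))) \<longlongrightarrow> det (ghbar (point t 0 x))) (at_right 0)"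
    by (rule tendsto_boundary[OF smooth_on_det[OF smooth_tensorD[OF smooth_ghbar]] x])
  moreover have "\<forall>\<^sub>F r in at_right 0. det (ghbar (point t r x)) \<le> 0"
    using eventually_in[OF x, of t]
  proof eventually_elim
    case (elim r)
    have "det (gbar (point t r x)) = r\<^sup>2 * det (ghbar (point t r x))"
      by (rule det_rescaled) (use rescalesD[OF ghbar_rescales, of "point t r x"] elim in simp)
    moreover have "det (gbar (point t r x)) < 0"
      by (rule lorentzian_symmetric_det(2)[OF lorentz]) (use elim in auto)
    ultimately show ?case using elim by (simp add: mult_less_0_iff)
  qed
  ultimately have "det (ghbar (point t 0 x)) \<le> 0"
    by (rule tendsto_upperbound) simp
  moreover have "det (ghbar (point t 0 x)) \<noteq> 0"
  proof -
    have "v = 0" if v: "ghbar (point t 0 x) *v v = 0" for v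
    proof -
      have c: "(\<Sum>j\<in>UNIV. ghbar (point t 0 x) $ i $ j * v $ j) = 0" for i
        using v by (simp add: vec_eq_iff matrix_vector_mult_def)
      have T: "v $ Time = 0" using c[of Time] \<kappa> by (simp add: sum_coord ghbar_boundary[OF x] ghbar_Time_Time[OF x])
      have R: "v $ Radial = 0" using c[of Radial] by (simp add: sum_coord ghbar_boundary[OF x])
      have "cross_metric \<psi> fpp \<Omega> x *v cross v = 0"
        using c[of "Cross _"] by (simp add: vec_eq_iff matrix_vector_mult_def sum_coord ghbar_boundary[OF x])
      then have "cross v = 0" by (rule positive_definite_props(2)[OF form'(7)[OF x]])
      then have "v $ Cross i = 0" for i by (metis point_simps(5) zero_index)
      with T R show "v = 0" by (simp add: vec_eq_iff all_coord)
    qed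
    then show ?thesis
      unfolding invertible_det_nz[symmetric] invertible_left_inverse matrix_left_invertible_ker by blast
  qed
  ultimately show ?thesis using p by simp
qed

sublocale hm: horizon_metric U N gbar ghbar "\<lambda>_. 0" "\<lambda>_. 0" "\<lambda>_. \<kappa>\<^sup>2" "cross_metric \<psi> fpp \<Omega>"
proof
  show "smooth_tensor N gbar" unfolding smooth_tensor_def using smooth_gbar_entry by blast
  show "ghbar p $ i $ j = ghbar p $ j $ i" if "p \<in> N" for p i j
    using gbar_sym[OF that, of i j] by (auto simp: ghbar_def)
  show "0 < \<kappa>\<^sup>2" using \<kappa> by simp
qed (simp_all add: smooth_ghbar ghbar_rescales gbar_sym smooth_on_const ghbar_det boundary_in ghbar_boundary ghbar_Time_Time)

lemma smooth_det_cross: "smooth_on U (\<lambda>x. det (cross_metric \<psi> fpp \<Omega> x))"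
  by (rule smooth_on_det[OF smooth_cross_metric])

end

section \<open>Charges\<close>

definition con_alg where
  "con_alg I \<nu> c a b = (\<Sum>d\<in>UNIV. \<Sum>e\<in>UNIV. I a d * I b e * \<nu> c d e)"
  for I :: "'n::finite \<Rightarrow> 'n \<Rightarrow> real" and \<nu> :: "'n \<Rightarrow> 'n \<Rightarrow> 'n \<Rightarrow> real"

text \<open>\<open>n a b\<close> is \<open>\<nabla>\<^sub>a \<xi>\<^sup>b\<close>, \<open>\<nu> c a b\<close> is \<open>\<nabla>\<^sub>c h\<^sub>a\<^sub>b\<close>, and \<open>\<tau> c\<close> is the derivative of the trace of \<open>h\<close>.\<close>

definition charge_alg where
  "charge_alg A I h n \<nu> \<xi> \<tau> m k =
     - (1 / 2) * tr_alg I h * (\<Sum>c\<in>UNIV. I m c * n c k)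
     + (\<Sum>a\<in>UNIV. (\<Sum>c\<in>UNIV. \<Sum>d\<in>UNIV. I a c * I m d * h c d) * n a k)
     - (\<Sum>a\<in>UNIV. (\<Sum>c\<in>UNIV. I m c * con_alg I \<nu> c k a) * (\<Sum>b\<in>UNIV. A a b * \<xi> b))
     + \<xi> m * (\<Sum>a\<in>UNIV. con_alg I \<nu> a k a)
     - \<xi> m * (\<Sum>c\<in>UNIV. I k c * \<tau> c)"
  for I :: "'n::finite \<Rightarrow> 'n \<Rightarrow> real" and \<nu> :: "'n \<Rightarrow> 'n \<Rightarrow> 'n \<Rightarrow> real"

lemma charge_density_alg:
  "charge_density Gn S g h \<xi> p $ m $ k = sqrt (- det (g p)) / (8 * pi * Gn) *
    ((\<lambda>f. f m k - f k m) (charge_alg (\<lambda>a b. g p $ a $ b) (\<lambda>a b. ginv g p $ a $ b) (\<lambda>a b. h p $ a $ b)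
      (\<lambda>a b. nabla_vec S g a \<xi> b p)
      (nab_alg (chr_alg (\<lambda>a b. ginv g p $ a $ b) (jet S g p)) (\<lambda>a b. h p $ a $ b) (jet S h p))
      (\<lambda>a. \<xi> p $ a) (\<lambda>c. pd S c (trace_with g h) p)) / 2)"
  unfolding charge_density_def antisym_part_def charge_alg_def
  by (simp add: trace_with_def[of g h p] tr_alg_def nabla_con_def con_alg_def nabla_cov_alg)

context diagonal_rescaling
begin

lemma con_scale:
  assumes "\<And>a b. I a b = I' a b / (l a * l b)" "\<And>c a b. \<nu> c a b = l a * l b * l c / r * \<nu>' c a b"
  shows "con_alg I \<nu> c a b = l c / (r * l a * l b) * con_alg I' \<nu>' c a b"
  unfolding con_alg_def sum_distrib_left
  by (intro sum.cong refl) (use l0 r0 in \<open>simp add: assms field_simps\<close>)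

text \<open>The field carries an extra factor r, which compensates the 1 / r of the one derivative
  in every summand; what remains is the weight of the two upper indices.\<close>

lemma charge_scale:
  assumes A: "\<And>a b. A a b = l a * l b * A' a b" and I: "\<And>a b. I a b = I' a b / (l a * l b)"
    and h: "\<And>a b. h a b = l a * l b * h' a b" and n: "\<And>a b. n a b = l a / l b * n' a b"
    and \<nu>: "\<And>c a b. \<nu> c a b = l a * l b * l c / r * \<nu>' c a b"
    and \<xi>: "\<And>a. \<xi> a = r * \<xi>' a / l a" and \<tau>: "\<And>a. \<tau> a = l a / r * \<tau>' a"
  shows "charge_alg A I h n \<nu> \<xi> \<tau> m k = charge_alg A' I' h' n' \<nu>' \<xi>' \<tau>' m k / (l m * l k)"
proof -
  have 1: "(\<Sum>c\<in>UNIV. I m c * n c k) = (\<Sum>c\<in>UNIV. I' m c * n' c k) / (l m * l k)"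
    unfolding sum_divide_distrib by (intro sum.cong refl) (use l0 r0 in \<open>simp add: I n field_simps\<close>)
  have 2: "(\<Sum>a\<in>UNIV. (\<Sum>c\<in>UNIV. \<Sum>d\<in>UNIV. I a c * I m d * h c d) * n a k)
     = (\<Sum>a\<in>UNIV. (\<Sum>c\<in>UNIV. \<Sum>d\<in>UNIV. I' a c * I' m d * h' c d) * n' a k) / (l m * l k)"
    unfolding sum_divide_distrib sum_distrib_right
    by (intro sum.cong refl) (use l0 r0 in \<open>simp add: I h n field_simps\<close>)
  have 3: "(\<Sum>a\<in>UNIV. (\<Sum>c\<in>UNIV. I m c * con_alg I \<nu> c k a) * (\<Sum>b\<in>UNIV. A a b * \<xi> b))
     = (\<Sum>a\<in>UNIV. (\<Sum>c\<in>UNIV. I' m c * con_alg I' \<nu>' c k a) * (\<Sum>b\<in>UNIV. A' a b * \<xi>' b)) / (l m * l k)"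
    unfolding sum_divide_distrib sum_product con_scale[OF I \<nu>]
    by (intro sum.cong refl) (use l0 r0 in \<open>simp add: I A \<xi> field_simps\<close>)
  have 4: "\<xi> m * (\<Sum>a\<in>UNIV. con_alg I \<nu> a k a) = \<xi>' m * (\<Sum>a\<in>UNIV. con_alg I' \<nu>' a k a) / (l m * l k)"
    unfolding sum_divide_distrib sum_distrib_left con_scale[OF I \<nu>]
    by (intro sum.cong refl) (use l0 r0 in \<open>simp add: \<xi> field_simps\<close>)
  have 5: "\<xi> m * (\<Sum>c\<in>UNIV. I k c * \<tau> c) = \<xi>' m * (\<Sum>c\<in>UNIV. I' k c * \<tau>' c) / (l m * l k)"
    unfolding sum_divide_distrib sum_distrib_left
    by (intro sum.cong refl) (use l0 r0 in \<open>simp add: I \<tau> \<xi> field_simps\<close>)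
  show ?thesis
    unfolding charge_alg_def 1 2 3 4 5 tr_scale[OF I h]
    by (simp add: add_divide_distrib diff_divide_distrib)
qed

end

context horizon_metric
begin

text \<open>Components along \<rho> times the frame, that is along \<partial>_t, \<rho>
  \<partial>_\<rho> and \<rho> \<partial>_M. Smoothness thus asks X to vanish on the horizon in all
  directions but t, which is ensured below by taking X without cross components.\<close>

definition rescaled_field where
  "rescaled_field X p a = (if a = Time then X p $ Time else rho_quot N (\<lambda>q. X q $ a) p)"

definition rescaled_nabla where
  "rescaled_nabla X p a b = field_grad X b a p
     + (\<Sum>c\<in>UNIV. chr_alg (\<lambda>a b. ginv gh p $ a $ b) (rescaled_jet N gh p) b a c * rescaled_field X p c)"

definition rescaled_trace where
  "rescaled_trace V p = tr_alg (\<lambda>a b. ginv gh p $ a $ b) (\<lambda>a b. rescaled_lie V gh p $ a $ b)"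

definition rescaled_charge where
  "rescaled_charge V X p m k = charge_alg (\<lambda>a b. gh p $ a $ b) (\<lambda>a b. ginv gh p $ a $ b) (\<lambda>a b. rescaled_lie V gh p $ a $ b)
     (rescaled_nabla X p)
     (nab_alg (chr_alg (\<lambda>a b. ginv gh p $ a $ b) (rescaled_jet N gh p)) (\<lambda>a b. rescaled_lie V gh p $ a $ b)
        (rescaled_jet N (rescaled_lie V gh) p))
     (rescaled_field X p) (\<lambda>c. (if c = Time then 1 else p $ Radial) * pd N c (rescaled_trace V) p) m k"

context
  fixes X V :: "real ^ 'm coord \<Rightarrow> real ^ 'm coord" and F G H J K F' G' H' J' K'
  assumes V: "adapted V F G H J K" and X: "adapted X F' G' H' J' K'"
    and X_Cross: "\<And>p i. X p $ Cross i = 0"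
    and nondegenerate: "\<And>p. p \<in> N \<Longrightarrow> det (gh p) < 0"
begin

lemma nondegenerate': "p \<in> N \<Longrightarrow> det (gh p) \<noteq> 0"
  using nondegenerate by force

lemma X_boundary_zero: "a \<noteq> Time \<Longrightarrow> x \<in> U \<Longrightarrow> X (point t 0 x) $ a = 0"
  by (cases a) (auto simp: adaptedD(3)[OF X] X_Cross)

lemma smooth_inv: "smooth_on N (\<lambda>p. ginv gh p $ a $ b)"
  by (intro smooth_on_matrix_inv smooth_tensorD[OF gh] nondegenerate')

lemma smooth_rescaled_field: "smooth_on N (\<lambda>p. rescaled_field X p a)"
  unfolding rescaled_field_def
  using adaptedD(1)[OF X, of Time] smooth_on_rho_quot[OF adaptedD(1)[OF X] X_boundary_zero, of a]
  by (cases "a = Time") auto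

lemma smooth_rescaled_trace: "smooth_on N (rescaled_trace V)"
  unfolding rescaled_trace_def[abs_def] tr_alg_def
  by (intro smooth_on_sum smooth_on_mult smooth_inv smooth_tensorD[OF smooth_rescaled_lie[OF gh V]])

lemma smooth_rescaled_charge: "smooth_on N (\<lambda>p. rescaled_charge V X p m k)"
proof -
  note h = smooth_tensorD[OF smooth_rescaled_lie[OF gh V]]
  note \<Gamma> = smooth_on_chr_alg[OF smooth_inv smooth_rescaled_jet[OF gh]]
  note \<nu> = smooth_on_nab_alg[OF \<Gamma> h smooth_rescaled_jet[OF smooth_rescaled_lie[OF gh V]]]
  have n: "smooth_on N (\<lambda>p. rescaled_nabla X p a b)" for a b
    unfolding rescaled_nabla_def
    by (intro smooth_on_add smooth_on_sum smooth_on_mult smooth_rescaled_field \<Gamma> smooth_field_grad[OF X])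
  have \<tau>: "smooth_on N (\<lambda>p. (if c = Time then 1 else p $ Radial) * pd N c (rescaled_trace V) p)" for c
    by (cases "c = Time") (auto intro!: smooth_on_mult smooth_on_component smooth_on_const pd_smooth[OF fat_N smooth_rescaled_trace])
  show ?thesis
    unfolding rescaled_charge_def charge_alg_def con_alg_def tr_alg_def
    by (intro smooth_on_diff smooth_on_add smooth_on_sum smooth_on_mult smooth_on_const smooth_inv h n \<nu> \<tau>
        smooth_rescaled_field smooth_tensorD[OF gh])
qed

text \<open>For the pair t, \<rho> the trailing factor \<rho> / (\<rho> 1) is 1, so the charge
  density has a finite limit, given by \<open>rescaled_charge\<close> on the horizon.\<close>

lemma charge_rescaled:
  assumes p: "p \<in> N" "0 < p $ Radial"
  shows "charge_density Gn N g (lie_derivative N V g) X p $ m $ k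
    = sqrt (- det (gh p)) / (8 * pi * Gn) * ((rescaled_charge V X p m k - rescaled_charge V X p k m) / 2)
       * p $ Radial / (lam (p $ Radial) m * lam (p $ Radial) k)"
proof -
  let ?r = "p $ Radial" and ?l = "lam (p $ Radial)"
  have d: "- det (g p) = ?r\<^sup>2 * (- det (gh p))"
    using det_rescaled[OF rescalesD[OF g_gh p]] by simp
  then have sq: "sqrt (- det (g p)) = ?r * sqrt (- det (gh p))"
    by (simp only: real_sqrt_mult real_sqrt_abs abs_of_pos[OF p(2)])
  have l: "?l c \<noteq> 0" for c :: "'m coord" using p by (simp add: lam_def)
  interpret diagonal_rescaling ?l ?r
    using p by unfold_locales (auto simp: lam_def)
  have I: "ginv g p $ a $ b = ginv gh p $ a $ b / (?l a * ?l b)" for a b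
    by (rule inv_rescaled) (use p nondegenerate'[OF p(1)] in \<open>auto intro: rescalesD[OF g_gh]\<close>)
  note h = lie_rescaled[OF g_gh gh V]
  note \<nu> = nab_scale[OF chr_scale[OF I jet_rescaled[OF g_gh gh p]] rescalesD[OF h p]
      jet_rescaled[OF h smooth_rescaled_lie[OF gh V] p]]
  have \<xi>: "X p $ a = ?r * rescaled_field X p a / ?l a" for a
  proof (cases "a = Time")
    case False
    then show ?thesis
      using rho_quot_mult[where f="\<lambda>q. X q $ a", OF X_boundary_zero p(1)] by (simp add: rescaled_field_def lam_def)
  qed (use p in \<open>simp add: rescaled_field_def lam_def\<close>)
  have n: "nabla_vec N g a X b p = ?l a / ?l b * rescaled_nabla X p a b" for a b
  proof -
    have "pd N a (\<lambda>q. X q $ b) p = ?l a / ?l b * field_grad X b a p"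
      using field_grad_eq[OF X p, of b a] l[of b] by (simp add: field_simps)
    moreover have "(\<Sum>c\<in>UNIV. christoffel N g b a c p * X p $ c) = ?l a / ?l b *
       (\<Sum>c\<in>UNIV. chr_alg (\<lambda>a b. ginv gh p $ a $ b) (rescaled_jet N gh p) b a c * rescaled_field X p c)"
      unfolding sum_distrib_left christoffel_alg chr_scale[OF I jet_rescaled[OF g_gh gh p]] \<xi>
      by (intro sum.cong refl) (use l p(2) in \<open>simp add: field_simps\<close>)
    ultimately show ?thesis by (simp add: nabla_vec_def rescaled_nabla_def distrib_left)
  qed
  have tr: "trace_with g (lie_derivative N V g) q = rescaled_trace V q" if q: "q \<in> N" "0 < q $ Radial" for q
  proof -
    interpret diagonal_rescaling "lam (q $ Radial)" "q $ Radial"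
      using q by unfold_locales (auto simp: lam_def)
    have "tr_alg (\<lambda>a b. ginv g q $ a $ b) (\<lambda>a b. lie_derivative N V g q $ a $ b) = rescaled_trace V q"
      unfolding rescaled_trace_def
      by (rule tr_scale[OF inv_rescaled rescalesD[OF h q]])
        (use q nondegenerate'[OF q(1)] in \<open>auto intro: rescalesD[OF g_gh]\<close>)
    then show ?thesis by (simp add: trace_with_def tr_alg_def)
  qed
  have \<tau>: "pd N c (trace_with g (lie_derivative N V g)) p
     = ?l c / ?r * ((if c = Time then 1 else ?r) * pd N c (rescaled_trace V) p)" for c
    using p(2) by (simp add: pd_cong_interior[OF smooth_rescaled_trace tr p] lam_def)
  show ?thesis
    unfolding charge_density_alg sq
      charge_scale[OF rescalesD[OF g_gh p] I rescalesD[OF h p] n \<nu> \<xi> \<tau>, folded rescaled_charge_def]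
    using l[of m] l[of k] by (simp add: field_simps)
qed

end

end

context near_horizon
begin

section \<open>Two fields with a nonzero bracket of charges\<close>

definition "xi_field \<beta> p = axis Time (p $ Time * \<beta> (cross p))"
definition "eta_field p = axis Radial (p $ Time * p $ Radial)"

lemma adapted_xi:
  assumes "smooth_on U \<beta>"
  shows "adapted (xi_field \<beta>) (\<lambda>_. 0) \<beta> (\<lambda>_. 0) (\<lambda>_. 0) (\<lambda>_. 0)"
proof -
  have "smooth_on N (\<lambda>p. xi_field \<beta> p $ i)" for i
    by (cases "i = Time") (auto simp: xi_field_def axis_def intro!: smooth_on_mult smooth_on_component smooth_on_cross_N assms smooth_on_const)
  moreover have "pd N Radial (\<lambda>p. p $ Time * \<beta> (cross p)) (point t 0 x) = 0" if "x \<in> U" for t x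
    by (simp add: pd_mult[OF fat_N boundary_in[OF that]] smooth_on_component smooth_on_cross_N[OF assms]
      pd_cross[OF assms boundary_in[OF that]] pd_coord[OF fat_N boundary_in[OF that]])
  ultimately show ?thesis
    unfolding adapted_def by (auto simp: xi_field_def axis_def pd_const[OF fat_N boundary_in])
qed

lemma adapted_eta: "adapted eta_field (\<lambda>_. 0) (\<lambda>_. 0) (\<lambda>_. 0) (\<lambda>_. 1) (\<lambda>_. 0)"
proof -
  have "smooth_on N (\<lambda>p. eta_field p $ i)" for i
    by (cases "i = Radial") (auto simp: eta_field_def axis_def intro!: smooth_on_mult smooth_on_component smooth_on_const)
  moreover have "pd N Radial (\<lambda>p. p $ Time * p $ Radial) (point t 0 x) = t" if "x \<in> U" for t x
    by (simp add: pd_mult[OF fat_N boundary_in[OF that]] smooth_on_component pd_coord[OF fat_N boundary_in[OF that]])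
  ultimately show ?thesis
    unfolding adapted_def by (auto simp: eta_field_def axis_def pd_const[OF fat_N boundary_in])
qed

text \<open>The terms in t^2 cancel between the first two summands of \<open>charge_alg\<close>, and
  the other three summands vanish here. The survivor is the product of the t \<rho> component of the
  variation, which is J = 1 for \<eta>, with \<nabla>_t \<xi>^t = \<beta>, and - 1 / \<kappa>^2 from
  the inverse metric. Hence both fields are linear in t.\<close>

lemma rescaled_charge_boundary:
  assumes \<beta>: "smooth_on U \<beta>" and x: "x \<in> U"
  shows "hm.rescaled_charge eta_field (xi_field \<beta>) (point t 0 x) Time Radial = 0"
    "hm.rescaled_charge eta_field (xi_field \<beta>) (point t 0 x) Radial Time = - \<beta> x / \<kappa>\<^sup>2"
proof -
  note V = adapted_eta and X = adapted_xi[OF \<beta>]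
  let ?P = "point t 0 x"
  interpret hj: horizon_jet "exp (2 * (0 + t * 0))" 0 "\<kappa>\<^sup>2" "\<lambda>a b. ginv ghbar ?P $ a $ b" "rescaled_jet N ghbar ?P"
    by (rule hm.jet_horizon[OF x])
  have K0: "divfree U d (\<lambda>_. 0)" for d
    by (simp add: divfree_def pd_const[OF open_fat[OF open_U]])
  have v: "hj.variation_jet s 0 1 (\<lambda>a b. rescaled_lie eta_field ghbar (point s 0 x) $ a $ b)
      (rescaled_jet N (rescaled_lie eta_field ghbar) (point s 0 x))" if "s = t" for s
    using hm.variation_horizon[OF V x K0, of t] that by (simp add: hm.dir_def)
  note v = v[OF refl]
  have tr: "hm.rescaled_trace eta_field (point s 0 x) = 4 * s" for s
  proof -
    interpret hs: horizon_jet "exp (2 * (0 + s * 0))" 0 "\<kappa>\<^sup>2" "\<lambda>a b. ginv ghbar (point s 0 x) $ a $ b" "rescaled_jet N ghbar (point s 0 x)"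
      by (rule hm.jet_horizon[OF x])
    have "hs.variation_jet s 0 1 (\<lambda>a b. rescaled_lie eta_field ghbar (point s 0 x) $ a $ b)
      (rescaled_jet N (rescaled_lie eta_field ghbar) (point s 0 x))"
      using hm.variation_horizon[OF V x K0, of s] by (simp add: hm.dir_def)
    from hs.tr_horizon[OF this] show ?thesis by (simp add: hm.rescaled_trace_def)
  qed
  have C: "xi_field \<beta> p $ Cross i = 0" for p i by (simp add: xi_field_def axis_def)
  have dtr: "pd N Time (hm.rescaled_trace eta_field) ?P = 4"
    by (rule pd_Time_eq[where \<phi>="\<lambda>s. 4 * s", OF hm.smooth_rescaled_trace[OF V X C ghbar_det] x tr])
      (auto intro!: derivative_eq_intros)
  have trt: "tr_alg (\<lambda>a b. ginv ghbar ?P $ a $ b) (\<lambda>a b. rescaled_lie eta_field ghbar ?P $ a $ b) = 4 * t"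
    using tr[of t] by (simp add: hm.rescaled_trace_def)
  have \<xi>: "hm.rescaled_field (xi_field \<beta>) ?P Time = t * \<beta> x" "hm.rescaled_field (xi_field \<beta>) ?P Radial = 0"
    "hm.rescaled_field (xi_field \<beta>) ?P (Cross i) = 0" for i
    by (simp_all add: hm.rescaled_field_def rho_quot_boundary adaptedD[OF X] x)
  note \<Gamma> = planar3_chr[OF hj.I(5) hj.B(1)]
  have n: "hm.rescaled_nabla (xi_field \<beta>) ?P Time Time = \<beta> x"
    "hm.rescaled_nabla (xi_field \<beta>) ?P Time Radial = \<kappa>\<^sup>2 * (t * \<beta> x)"
    "hm.rescaled_nabla (xi_field \<beta>) ?P Radial Time = t * \<beta> x"
    "hm.rescaled_nabla (xi_field \<beta>) ?P Radial Radial = 0"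
    using hj.chr_horizon
    by (simp_all add: hm.rescaled_nabla_def sum_coord \<xi> field_grad_boundary[OF X x])
  let ?\<nu> = "nab_alg (chr_alg (\<lambda>a b. ginv ghbar ?P $ a $ b) (rescaled_jet N ghbar ?P)) (\<lambda>a b. rescaled_lie eta_field ghbar ?P $ a $ b)
        (rescaled_jet N (rescaled_lie eta_field ghbar) ?P)"
  have \<nu>p: "planar3 ?\<nu>" by (rule planar3_nab[OF \<Gamma> hj.variation_block[OF v]])
  have \<nu>: "?\<nu> Time Radial Time = 0" "?\<nu> Radial Time Time = 0" "?\<nu> Radial Radial Radial = 0"
    using hj.nab_horizon[OF v] hj.chr_horizon hj.variation_values[OF v] by (simp_all add: nab_planar[OF \<Gamma>])
  have h: "rescaled_lie eta_field ghbar ?P $ Time $ Time = - 2 * t * \<kappa>\<^sup>2" "rescaled_lie eta_field ghbar ?P $ Time $ Radial = 1"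
    "rescaled_lie eta_field ghbar ?P $ Radial $ Time = 1" "rescaled_lie eta_field ghbar ?P $ Radial $ Radial = 2 * t"
    using hj.variation_values(1-3)[OF v] hj.variation_sym(1)[OF v] by simp_all
  have I: "ginv ghbar ?P $ Time $ Time = - 1 / \<kappa>\<^sup>2" "ginv ghbar ?P $ Time $ Radial = 0"
    "ginv ghbar ?P $ Radial $ Time = 0" "ginv ghbar ?P $ Radial $ Radial = 1"
    using hj.I(1-4) \<kappa> by simp_all
  note S = hm.rescaled_charge_def charge_alg_def con_alg_def sum_coord trt \<xi> n \<nu> h I dtr
    planar3D[OF \<nu>p] block2D[OF hj.I(5)] block2D[OF hj.variation_block(1)[OF v]]
    ghbar_boundary[OF x] ghbar_Time_Time[OF x]
  show "hm.rescaled_charge eta_field (xi_field \<beta>) ?P Time Radial = 0"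
    using \<kappa> by (simp add: S power2_eq_square)
  show "hm.rescaled_charge eta_field (xi_field \<beta>) ?P Radial Time = - \<beta> x / \<kappa>\<^sup>2"
    using \<kappa> by (simp add: S)
qed

lemma charge_limit:
  assumes \<beta>: "smooth_on U \<beta>" and x: "x \<in> U"
  shows "((\<lambda>r. (1 / 2) * (charge_density Gn N gbar (lie_derivative N eta_field gbar) (xi_field \<beta>) (point t r x) $ Time $ Radial
     - charge_density Gn N gbar (lie_derivative N eta_field gbar) (xi_field \<beta>) (point t r x) $ Radial $ Time))
    \<longlongrightarrow> sqrt (- det (ghbar (point 0 0 x))) / (8 * pi * Gn) * (\<beta> x / (2 * \<kappa>\<^sup>2))) (at_right 0)"
proof -
  note V = adapted_eta and X = adapted_xi[OF \<beta>]
  have C: "xi_field \<beta> p $ Cross i = 0" for p i by (simp add: xi_field_def axis_def)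
  let ?c = "hm.rescaled_charge eta_field (xi_field \<beta>)"
  let ?f = "\<lambda>p. sqrt (- det (ghbar p)) / (8 * pi * Gn) * ((?c p Time Radial - ?c p Radial Time) / 2)"
  have "smooth_on N ?f"
    unfolding divide_inverse
    by (intro smooth_on_mult smooth_on_const smooth_on_diff hm.smooth_rescaled_charge[OF V X C ghbar_det]
        smooth_on_sqrt smooth_on_minus smooth_on_det smooth_tensorD[OF smooth_ghbar]) (use ghbar_det in force)
  from tendsto_boundary[OF this x, of t]
  have L: "((\<lambda>r. ?f (point t r x)) \<longlongrightarrow> ?f (point t 0 x)) (at_right 0)" .
  \<comment> \<open>The horizon value of the rescaled metric is independent of t, so one choice of
    \<beta> serves all times.\<close>
  have "ghbar (point t 0 x) = ghbar (point 0 0 x)"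
    by (simp add: vec_eq_iff all_coord ghbar_boundary[OF x] ghbar_Time_Time[OF x])
  then have v: "?f (point t 0 x) = sqrt (- det (ghbar (point 0 0 x))) / (8 * pi * Gn) * (\<beta> x / (2 * \<kappa>\<^sup>2))"
    by (simp add: rescaled_charge_boundary[OF \<beta> x])
  have "\<forall>\<^sub>F r in at_right 0. ?f (point t r x) =
     (1 / 2) * (charge_density Gn N gbar (lie_derivative N eta_field gbar) (xi_field \<beta>) (point t r x) $ Time $ Radial
     - charge_density Gn N gbar (lie_derivative N eta_field gbar) (xi_field \<beta>) (point t r x) $ Radial $ Time)"
    using eventually_in[OF x, of t]
  proof eventually_elim
    case (elim r)
    then have p: "point t r x \<in> N" "0 < point t r x $ Radial" by auto
    have c: "charge_density Gn N gbar (lie_derivative N eta_field gbar) (xi_field \<beta>) (point t r x) $ m $ k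
      = sqrt (- det (ghbar (point t r x))) / (8 * pi * Gn) * ((?c (point t r x) m k - ?c (point t r x) k m) / 2)
       * point t r x $ Radial / (lam (point t r x $ Radial) m * lam (point t r x $ Radial) k)" for m k
      by (rule hm.charge_rescaled[OF V X C _ p]) (rule ghbar_det)
    have r: "y * r / (lam r Time * lam r Radial) = y" "y * r / (lam r Radial * lam r Time) = y" for y
      using elim by (simp_all add: lam_def)
    show ?case unfolding c point_simps r by (simp add: algebra_simps diff_divide_distrib)
  qed
  from Lim_transform_eventually[OF L this] show ?thesis unfolding v .
qed

end

section \<open>A positive integrable density on the cross-section\<close>

lemma integrable_inverse_quadratic: "integrable lborel (\<lambda>x::real. 1 / (1 + x\<^sup>2))"
proof -
  have "set_integrable lborel (einterval (-\<infinity>) \<infinity>) (\<lambda>x::real. 1 / (1 + x\<^sup>2))"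
  proof (rule interval_integral_FTC_nonneg(1)[where F=arctan and A="- pi / 2" and B="pi / 2"])
    show "(arctan has_real_derivative 1 / (1 + x\<^sup>2)) (at x)" for x
      using DERIV_arctan[of x] by (simp add: inverse_eq_divide)
    show "isCont (\<lambda>x. 1 / (1 + x\<^sup>2)) x" for x :: real
      by (intro continuous_intros) (simp add: add_nonneg_eq_0_iff)
    show "((arctan \<circ> real_of_ereal) \<longlongrightarrow> - pi / 2) (at_right (-\<infinity>))"
      by (simp add: ereal_tendsto_simps) (use tendsto_arctan_at_bot in simp)
    show "((arctan \<circ> real_of_ereal) \<longlongrightarrow> pi / 2) (at_left \<infinity>)"
      by (simp add: ereal_tendsto_simps tendsto_arctan_at_top)
  qed (auto intro!: AE_I2)
  then show ?thesis by (simp add: set_integrable_def)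
qed

text \<open>Lebesgue measure is the image of the product measure indexed by \<open>Basis\<close>,
  and there the integrand is a product of functions of one variable each.\<close>

lemma integrable_prod_inverse_quadratic:
  "integrable lborel (\<lambda>x :: real ^ ('m::finite). \<Prod>i\<in>UNIV. 1 / (1 + (x $ i)\<^sup>2))"
proof -
  interpret product_sigma_finite "\<lambda>_ :: real ^ 'm. lborel :: real measure" by standard
  let ?g = "\<lambda>f :: (real ^ 'm) \<Rightarrow> real. \<Sum>b\<in>Basis. f b *\<^sub>R b"
  have m: "?g \<in> measurable (\<Pi>\<^sub>M b\<in>(Basis :: (real ^ 'm) set). lborel) borel"
    by measurable
  have c: "?g f $ i = f (axis i 1)" for f i
  proof -
    have "?g f $ i = ?g f \<bullet> axis i 1" by (simp add: inner_axis)
    also have "\<dots> = f (axis i 1)" by (subst inner_sum_left_Basis) auto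
    finally show ?thesis .
  qed
  have B: "(Basis :: (real ^ 'm) set) = range (\<lambda>i. axis i 1)" by (auto simp: Basis_vec_def)
  have "integrable (\<Pi>\<^sub>M b\<in>(Basis :: (real ^ 'm) set). lborel) (\<lambda>f. \<Prod>b\<in>Basis. 1 / (1 + (f b :: real)\<^sup>2))"
    using product_integrable_prod[of Basis "\<lambda>_ y. 1 / (1 + y\<^sup>2)"] integrable_inverse_quadratic by simp
  also have "(\<lambda>f. \<Prod>b\<in>(Basis :: (real ^ 'm) set). 1 / (1 + (f b)\<^sup>2)) = (\<lambda>f. \<Prod>i\<in>UNIV. 1 / (1 + (?g f $ i)\<^sup>2))"
    unfolding c unfolding B by (subst prod.reindex) (auto simp: inj_on_def axis_eq_axis)
  finally have i: "integrable (\<Pi>\<^sub>M b\<in>(Basis :: (real ^ 'm) set). lborel) (\<lambda>f. \<Prod>i\<in>UNIV. 1 / (1 + (?g f $ i)\<^sup>2))" .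
  have "continuous_on UNIV (\<lambda>x :: real ^ 'm. \<Prod>i\<in>UNIV. 1 / (1 + (x $ i)\<^sup>2))"
    by (intro continuous_intros) (auto simp: add_nonneg_eq_0_iff)
  then have meas: "(\<lambda>x :: real ^ 'm. \<Prod>i\<in>UNIV. 1 / (1 + (x $ i)\<^sup>2)) \<in> borel_measurable borel"
    by (rule borel_measurable_continuous_onI)
  show ?thesis
    by (subst lborel_eq) (rule integrable_distr_eq[OF m meas, THEN iffD2, OF i])
qed

text \<open>Positivity comes from a box inside U: a zero integral there would force the continuous
  nonnegative f to vanish.\<close>

lemma integral_prod_inverse_quadratic_pos:
  assumes "open U" "U \<noteq> {}" "0 < C"
  defines "f \<equiv> \<lambda>x :: real ^ ('m::finite). C * (\<Prod>i\<in>UNIV. 1 / (1 + (x $ i)\<^sup>2))"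
  shows "f absolutely_integrable_on U" "integral U f > 0"
proof -
  have pos: "0 < f x" for x
    unfolding f_def using assms(3) by (intro mult_pos_pos prod_pos) (auto simp: add_pos_nonneg)
  have "integrable lborel f"
    unfolding f_def by (intro integrable_mult_right integrable_prod_inverse_quadratic)
  then have "integrable lebesgue f" by (simp add: integrable_completion borel_measurable_integrable)
  then have "f absolutely_integrable_on UNIV" by (simp add: set_integrable_def)
  then show a: "f absolutely_integrable_on U"
    by (rule set_integrable_subset) (use assms(1) in auto)
  then have i: "f integrable_on U" by (rule set_lebesgue_integral_eq_integral)
  have c: "continuous_on UNIV f"
    unfolding f_def by (intro continuous_intros) (auto simp: add_nonneg_eq_0_iff)
  obtain x where x: "x \<in> U" using assms(2) by blast
  obtain a b where ab: "cbox a b \<subseteq> U" "x \<in> box a b"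
    by (rule open_contains_cbox[OF assms(1) x]) (rule that)
  have nonneg: "0 \<le> f y" for y using pos[of y] by simp
  have ic: "f integrable_on cbox a b" by (rule integrable_continuous[OF continuous_on_subset[OF c subset_UNIV]])
  have "integral (cbox a b) f \<noteq> 0"
  proof
    assume "integral (cbox a b) f = 0"
    then have hi: "(f has_integral 0) (cbox a b)" using integrable_integral[OF ic] by simp
    have "f x = 0"
      by (rule has_integral_0_cbox_imp_0[OF continuous_on_subset[OF c subset_UNIV] nonneg hi])
        (use ab(2) box_subset_cbox in blast)+
    with pos[of x] show False by simp
  qed
  moreover have "integral (cbox a b) f \<ge> 0" by (rule integral_nonneg[OF ic nonneg])
  ultimately have "integral (cbox a b) f > 0" by simp
  also have "integral (cbox a b) f \<le> integral U f"
    by (rule integral_subset_le[OF ab(1) ic i]) (simp add: nonneg)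
  finally show "integral U f > 0" .
qed

section \<open>The main theorem\<close>

context near_horizon
begin

abbreviation "\<gamma> \<equiv> cross_metric \<psi> fpp \<Omega>"

lemma fields_iff:
  "V \<in> near_horizon_fields U N \<gamma> \<longleftrightarrow> (\<exists>F G H J K. smooth_on U F \<and> smooth_on U G \<and> smooth_on U H \<and> smooth_on U J \<and>
     (\<forall>i. smooth_on U (\<lambda>x. K x $ i)) \<and> divfree U (\<lambda>y. det (\<gamma> y)) K \<and> adapted V F G H J K)"
  by (rule near_horizon_fields_iff[OF collar_domain_axioms smooth_cross_metric
        positive_definite_props(1)[OF form'(7)] positive_definite_props(3)[OF form'(7)]])

lemma fieldsE:
  assumes "V \<in> near_horizon_fields U N \<gamma>"
  obtains F G H J K where "adapted V F G H J K" "divfree U (\<lambda>y. det (\<gamma> y)) K"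
    "smooth_on U F" "smooth_on U G" "smooth_on U H" "smooth_on U J" "\<forall>i. smooth_on U (\<lambda>x. K x $ i)"
proof -
  from assms obtain F G H J K where "smooth_on U F \<and> smooth_on U G \<and> smooth_on U H \<and> smooth_on U J \<and>
     (\<forall>i. smooth_on U (\<lambda>x. K x $ i)) \<and> divfree U (\<lambda>y. det (\<gamma> y)) K \<and> adapted V F G H J K"
    unfolding fields_iff by (elim exE) (rule that)
  then show thesis by (intro that[of F G H J K]) auto
qed

lemma fieldsI:
  assumes "adapted V F G H J K" "divfree U (\<lambda>y. det (\<gamma> y)) K"
    "smooth_on U F" "smooth_on U G" "smooth_on U H" "smooth_on U J" "\<And>i. smooth_on U (\<lambda>x. K x $ i)"
  shows "V \<in> near_horizon_fields U N \<gamma>"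
  unfolding fields_iff using assms by blast

lemma commutator_closed:
  assumes "V \<in> near_horizon_fields U N \<gamma>" "W \<in> near_horizon_fields U N \<gamma>"
  shows "commutator N V W \<in> near_horizon_fields U N \<gamma>"
proof -
  obtain F G H J K where V: "adapted V F G H J K" "divfree U (\<lambda>y. det (\<gamma> y)) K"
    "smooth_on U F" "smooth_on U G" "smooth_on U H" "smooth_on U J" "\<forall>i. smooth_on U (\<lambda>x. K x $ i)"
    using assms(1) by (rule fieldsE)
  obtain F' G' H' J' K' where W: "adapted W F' G' H' J' K'" "divfree U (\<lambda>y. det (\<gamma> y)) K'"
    "smooth_on U F'" "smooth_on U G'" "smooth_on U H'" "smooth_on U J'" "\<forall>i. smooth_on U (\<lambda>x. K' x $ i)"
    using assms(2) by (rule fieldsE)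
  note V = V(1-6) V(7)[rule_format] and W = W(1-6) W(7)[rule_format]
  note pd = pd_smooth[OF open_fat[OF open_U]]
  have dir: "smooth_on U (\<lambda>x. \<Sum>i\<in>UNIV. K x $ i * pd U i f' x - K' x $ i * pd U i f x)"
    if "smooth_on U f" "smooth_on U f'" for f f'
    by (intro smooth_on_sum smooth_on_diff smooth_on_mult V(7) W(7) pd that)
  show ?thesis
    by (rule fieldsI[OF adapted_commutator[OF V(1,3-6) W(1,3-6)]
          divfree_bracket[OF open_U smooth_det_cross positive_definite_props(3)[OF form'(7)] V(7,2) W(7,2)]])
      (simp_all, (intro smooth_on_add smooth_on_diff smooth_on_mult smooth_on_sum dir V(3-7) W(3-7) pd)+)
qed

lemma omega_asymptotics:
  fixes Gn :: real
  assumes "\<xi> \<in> near_horizon_fields U N \<gamma>" "\<eta> \<in> near_horizon_fields U N \<gamma>"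
  defines "\<omega> \<equiv> omega Gn N gbar (lie_derivative N \<eta> gbar) (lie_derivative N \<xi> gbar)"
  shows "rho_order N 0 (\<lambda>p. \<omega> p $ Time)" "rho_order N 1 (\<lambda>p. \<omega> p $ Radial)" "rho_order N 0 (\<lambda>p. \<omega> p $ Cross i)"
proof -
  obtain F G H J K where X: "adapted \<xi> F G H J K" "divfree U (\<lambda>y. det (\<gamma> y)) K"
    using assms(1) by (rule fieldsE)
  obtain F' G' H' J' K' where E: "adapted \<eta> F' G' H' J' K'" "divfree U (\<lambda>y. det (\<gamma> y)) K'"
    using assms(2) by (rule fieldsE)
  show "rho_order N 0 (\<lambda>p. \<omega> p $ Time)" "rho_order N 1 (\<lambda>p. \<omega> p $ Radial)" "rho_order N 0 (\<lambda>p. \<omega> p $ Cross i)"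
    unfolding \<omega>_def by (rule hm.omega_order[OF E X ghbar_det], assumption)+
qed

text \<open>The induction composes maps and never iterates pullbacks of metrics; d = det \<gamma> of
  the original cross metric stays fixed throughout.\<close>

lemma horizon_map_generated:
  assumes "generated U N (near_horizon_fields U N \<gamma>) W W' \<phi>"
  shows "collar U W \<and> collar U W' \<and> W \<subseteq> N \<and> W' \<subseteq> N \<and> horizon_map U W W' (\<lambda>y. det (\<gamma> y)) \<phi>"
  using assms
proof induction
  case (1 W)
  then show ?case using horizon_map_id[of U W W] open_U by (simp add: collar_domain_def id_def)
next
  case (2 V W W' \<phi> W'' \<phi>')
  obtain F G H J K where V: "adapted V F G H J K" "divfree U (\<lambda>y. det (\<gamma> y)) K"
    "smooth_on U F" "smooth_on U G" "smooth_on U H" "smooth_on U J" "\<forall>i. smooth_on U (\<lambda>x. K x $ i)"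
    using 2(1) by (rule fieldsE)
  from 2(2) have c: "collar U W" "collar U W'" "W \<subseteq> N" "W' \<subseteq> N" "bij_betw \<phi> W W'"
    unfolding time_one_flow_def by auto
  from 2(2) obtain \<Phi> where \<Phi>: "smooth_on ({0..1} \<times> W) (\<lambda>(s, p). \<Phi> s p)"
    "\<forall>p\<in>W. \<Phi> 0 p = p \<and> \<Phi> 1 p = \<phi> p \<and> (\<forall>s\<in>{0..1}. \<Phi> s p \<in> N \<and>
            ((\<lambda>r. \<Phi> r p) has_vector_derivative V (\<Phi> s p)) (at s within {0..1}))"
    unfolding time_one_flow_def by auto
  interpret f: smooth_flow U N W V \<Phi> F G H J K "\<lambda>y. det (\<gamma> y)"
    by unfold_locales (use c \<Phi> V open_U smooth_det_cross in auto)
  have "horizon_map U W W' (\<lambda>y. det (\<gamma> y)) \<phi>"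
    by (rule f.horizon_map_flow) (use \<Phi>(2) c(5) in \<open>auto simp: bij_betw_def\<close>)
  moreover have "collar_domain U W" "collar_domain U W'" using open_U c by (auto simp: collar_domain_def)
  ultimately show ?case using horizon_map_comp[of U W W' "\<lambda>y. det (\<gamma> y)" \<phi> W'' \<phi>'] 2 c by (simp add: comp_def)
qed

lemma integrable_charges:
  assumes gen: "generated U N (near_horizon_fields U N \<gamma>) W W' \<phi>"
    and \<xi>: "\<xi> \<in> near_horizon_fields U N \<gamma>" and \<eta>: "\<eta> \<in> near_horizon_fields U N \<gamma>" and \<zeta>: "\<zeta> \<in> near_horizon_fields U N \<gamma>"
  defines "g \<equiv> pullback W \<phi> gbar"
  shows "has_boundary_integral U t (\<lambda>p. antisym_part (\<chi> \<mu> \<nu>. \<xi> p $ \<mu> *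
     omega Gn W g (lie_derivative W \<eta> g) (lie_derivative W \<zeta> g) p $ \<nu>)) 0"
proof -
  from horizon_map_generated[OF gen] have W: "collar_domain U W" "W \<subseteq> N" "W' \<subseteq> N"
    and m: "horizon_map U W W' (\<lambda>y. det (\<gamma> y)) \<phi>"
    using open_U by (auto simp: collar_domain_def)
  obtain a b k e c where *: "\<And>t x. x \<in> U \<Longrightarrow> \<phi> (point t 0 x) = point (a x + t * b x) 0 (k x)"
    "\<And>x. x \<in> U \<Longrightarrow> b x \<noteq> 0"
    "\<And>t x. x \<in> U \<Longrightarrow> pd W Radial (\<lambda>q. \<phi> q $ Radial) (point t 0 x) = exp (e x + t * c x)"
    "\<And>t x i. x \<in> U \<Longrightarrow> pd W Radial (\<lambda>q. \<phi> q $ Cross i) (point t 0 x) = 0"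
    "\<And>t x. x \<in> U \<Longrightarrow> (det (\<chi> i j. pd W (Cross j) (\<lambda>q. \<phi> q $ Cross i) (point t 0 x)))\<^sup>2 * det (\<gamma> (k x)) = det (\<gamma> x)"
    by (rule horizon_mapE[OF m]) (rule that; simp)
  interpret W: collar_domain U W by (rule W(1))
  interpret pb: horizon_pullback U N gbar ghbar "\<kappa>\<^sup>2" \<gamma> W \<phi> a b k e c
    by unfold_locales (use * m W(3) in \<open>auto simp: horizon_map_def\<close>)
  interpret pm: horizon_metric U W "pullback W \<phi> gbar" pb.pull_gh e c "\<lambda>x. \<kappa>\<^sup>2 * (b x)\<^sup>2" pb.pull_\<gamma>
    by (rule pb.horizon_metric_pullback)
  \<comment> \<open>The fields are those of the original algebra, restricted to W. Their divergence
    condition refers to \<gamma> and passes to the pulled-back cross metric because the determinants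
    agree.\<close>
  have field: "\<exists>F G H J K. W.adapted V F G H J K \<and> divfree U (\<lambda>y. det (pb.pull_\<gamma> y)) K"
    if "V \<in> near_horizon_fields U N \<gamma>" for V
  proof -
    obtain F G H J K where "adapted V F G H J K" "divfree U (\<lambda>y. det (\<gamma> y)) K"
      using \<open>V \<in> _\<close> by (rule fieldsE)
    then show ?thesis
      using adapted_subset[OF collar_domain_axioms W(1,2)] divfree_cong[OF open_U smooth_det_cross pb.det_pull_\<gamma>] by blast
  qed
  obtain F1 G1 H1 J1 K1 where 1: "W.adapted \<xi> F1 G1 H1 J1 K1" using field[OF \<xi>] by blast
  obtain F2 G2 H2 J2 K2 where 2: "W.adapted \<eta> F2 G2 H2 J2 K2" "divfree U (\<lambda>y. det (pb.pull_\<gamma> y)) K2"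
    using field[OF \<eta>] by blast
  obtain F3 G3 H3 J3 K3 where 3: "W.adapted \<zeta> F3 G3 H3 J3 K3" "divfree U (\<lambda>y. det (pb.pull_\<gamma> y)) K3"
    using field[OF \<zeta>] by blast
  let ?\<omega> = "omega Gn W g (lie_derivative W \<eta> g) (lie_derivative W \<zeta> g)"
  let ?B = "\<lambda>p. antisym_part (\<chi> \<mu> \<nu>. \<xi> p $ \<mu> * ?\<omega> p $ \<nu>)"
  have "((\<lambda>r. (1 / 2) * (?B (point t r x) $ Time $ Radial - ?B (point t r x) $ Radial $ Time)) \<longlongrightarrow> 0) (at_right 0)"
    if x: "x \<in> U" for x
  proof -
    have "((\<lambda>r. 1 / 2 * (\<xi> (point t r x) $ Time * ?\<omega> (point t r x) $ Radial - \<xi> (point t r x) $ Radial * ?\<omega> (point t r x) $ Time))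
      \<longlongrightarrow> 1 / 2 * 0) (at_right 0)"
      unfolding g_def by (intro tendsto_mult tendsto_const pm.omega_boundary_limit[OF 2 3 1 x])
    moreover have "1 / 2 * (?B p $ Time $ Radial - ?B p $ Radial $ Time)
       = 1 / 2 * (\<xi> p $ Time * ?\<omega> p $ Radial - \<xi> p $ Radial * ?\<omega> p $ Time)" for p
      by (simp add: antisym_part_def) (simp add: diff_divide_distrib)
    ultimately show ?thesis by (simp only: mult_zero_right)
  qed
  then show ?thesis
    unfolding has_boundary_integral_def by (intro exI[of _ "\<lambda>_. 0"]) auto
qed

lemma nontrivial_charge:
  assumes "U \<noteq> {}" "Gn > 0"
  shows "\<exists>\<xi>\<in>near_horizon_fields U N \<gamma>. \<exists>\<eta>\<in>near_horizon_fields U N \<gamma>. \<forall>t. \<exists>I. I \<noteq> 0 \<and>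
     has_boundary_integral U t (charge_density Gn N gbar (lie_derivative N \<eta> gbar) \<xi>) I"
proof -
  define \<delta> where "\<delta> x = sqrt (- det (ghbar (point 0 0 x)))" for x
  \<comment> \<open>U may have infinite volume. This product is smooth, positive and integrable over
    the whole space, hence over every open U.\<close>
  define f where "f x = (\<Prod>i\<in>UNIV. 1 / (1 + (x $ i)\<^sup>2))" for x :: "real ^ 'm"
  define \<beta> where "\<beta> x = f x / \<delta> x" for x
  have \<delta>0: "\<delta> x > 0" if "x \<in> U" for x
    using ghbar_det[OF boundary_in[OF that]] by (simp add: \<delta>_def)
  have "smooth_on U \<delta>"
    unfolding \<delta>_def
    by (intro smooth_on_sqrt smooth_on_minus smooth_on_compose[OF smooth_on_point smooth_on_det boundary_in]
        smooth_tensorD[OF smooth_ghbar]) (use ghbar_det boundary_in in force)+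
  moreover have "smooth_on U f"
    unfolding f_def
    by (intro smooth_on_prod smooth_on_divide smooth_on_const smooth_on_add smooth_on_power smooth_on_component)
      (simp add: add_nonneg_eq_0_iff)
  ultimately have \<beta>: "smooth_on U \<beta>"
    unfolding \<beta>_def by (intro smooth_on_divide) (use \<delta>0 in force)+
  have K0: "divfree U d (\<lambda>_. 0)" for d
    by (simp add: divfree_def pd_const[OF open_fat[OF open_U]])
  have \<xi>: "xi_field \<beta> \<in> near_horizon_fields U N \<gamma>"
    by (rule fieldsI[OF adapted_xi[OF \<beta>] K0]) (simp_all add: smooth_on_const \<beta>)
  have \<eta>: "eta_field \<in> near_horizon_fields U N \<gamma>"
    by (rule fieldsI[OF adapted_eta K0]) (simp_all add: smooth_on_const)
  \<comment> \<open>The factor 1 / (8 pi G) of the charge density times the 1 / (2 \<kappa>^2) of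
    \<open>charge_limit\<close>.\<close>
  define C where "C = 1 / (16 * pi * Gn * \<kappa>\<^sup>2)"
  have C: "C > 0" using assms(2) \<kappa> by (simp add: C_def)
  note int = integral_prod_inverse_quadratic_pos[OF open_U assms(1) C, folded f_def]
  have "has_boundary_integral U t (charge_density Gn N gbar (lie_derivative N eta_field gbar) (xi_field \<beta>))
      (integral U (\<lambda>x. C * f x))" for t
    unfolding has_boundary_integral_def
  proof (intro exI[of _ "\<lambda>x. C * f x"] conjI ballI int(1) refl)
    fix x assume x: "x \<in> U"
    have "\<delta> x / (8 * pi * Gn) * (\<beta> x / (2 * \<kappa>\<^sup>2)) = C * f x"
      using \<delta>0[OF x] by (simp add: \<beta>_def C_def)
    with charge_limit[OF \<beta> x, of Gn t]
    show "((\<lambda>\<rho>. (1 / 2) * (charge_density Gn N gbar (lie_derivative N eta_field gbar) (xi_field \<beta>) (point t \<rho> x) $ Time $ Radial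
       - charge_density Gn N gbar (lie_derivative N eta_field gbar) (xi_field \<beta>) (point t \<rho> x) $ Radial $ Time))
      \<longlongrightarrow> C * f x) (at_right 0)"
      by (simp only: \<delta>_def[symmetric])
  qed
  then show ?thesis using \<xi> \<eta> int(2) by (metis less_irrefl)
qed

end

theorem mainTheorem2:
  fixes gbar :: "real ^ 'm coord \<Rightarrow> real ^ ('m::finite) coord ^ 'm coord"
    and U :: "(real ^ 'm) set"
    and N :: "(real ^ 'm coord) set"
    and \<psi> :: 'm
    and ft :: "real ^ 'm \<Rightarrow> real ^ 'm"
    and fpp :: "real ^ 'm \<Rightarrow> real"
    and \<Omega> :: "real ^ 'm \<Rightarrow> real ^ 'm ^ 'm"
    and \<kappa> \<Lambda> Gn :: real
    and \<A> :: "(real ^ 'm coord \<Rightarrow> real ^ 'm coord) set"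
  assumes "open U" and "U \<noteq> {}" and "collar U N"
    and "Gn > 0" and "\<kappa> \<noteq> 0"
    and "smooth_on N gbar"
    and "\<forall>p\<in>N. p $ Radial > 0 \<longrightarrow> lorentzian (gbar p)"
    and "\<forall>p\<in>N. p $ Radial > 0 \<longrightarrow> einstein_tensor N gbar p + \<Lambda> *\<^sub>R gbar p = 0"
    and "near_horizon_form \<psi> U N \<kappa> ft fpp \<Omega> gbar"
    and "\<A> = near_horizon_fields U N (cross_metric \<psi> fpp \<Omega>)"
  shows "(\<forall>\<xi>\<in>\<A>. \<forall>\<eta>\<in>\<A>. commutator N \<xi> \<eta> \<in> \<A>)
    \<and> (\<forall>\<xi>\<in>\<A>. \<forall>\<eta>\<in>\<A>.
          let \<omega> = omega Gn N gbar (lie_derivative N \<eta> gbar) (lie_derivative N \<xi> gbar) in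
            rho_order N 0 (\<lambda>p. \<omega> p $ Time) \<and>
            rho_order N 1 (\<lambda>p. \<omega> p $ Radial) \<and>
            (\<forall>i. rho_order N 0 (\<lambda>p. \<omega> p $ Cross i)))
    \<and> (\<forall>W W' \<phi>. generated U N \<A> W W' \<phi> \<longrightarrow>
          (let g = pullback W \<phi> gbar in
            \<forall>\<xi>\<in>\<A>. \<forall>\<eta>\<in>\<A>. \<forall>\<zeta>\<in>\<A>. \<forall>t.
              has_boundary_integral U t
                (\<lambda>p. antisym_part (\<chi> \<mu> \<nu>. \<xi> p $ \<mu> *
                   omega Gn W g (lie_derivative W \<eta> g) (lie_derivative W \<zeta> g) p $ \<nu>)) 0))
    \<and> (\<exists>\<xi>\<in>\<A>. \<exists>\<eta>\<in>\<A>. \<forall>t. \<exists>I. I \<noteq> 0 \<and>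
          has_boundary_integral U t
            (charge_density Gn N gbar (lie_derivative N \<eta> gbar) \<xi>) I)"
proof -
  interpret near_horizon U N \<psi> \<kappa> ft fpp \<Omega> gbar
    by unfold_locales (use assms in auto)
  show ?thesis
    unfolding assms(10) Let_def
    by (intro conjI ballI allI impI;
        (rule commutator_closed omega_asymptotics integrable_charges; assumption
          | rule nontrivial_charge[OF assms(2,4)]))
qed

end
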